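(* Let $G$ be a uniformly ballistic network with controlled stationary measure and $\|P\|_{\mathrm{bub}}<\infty$, and let $\mathfrak F$ be the (oriented) wired uniform spanning forest of $G$, with $\mathfrak P(v)$ denoting the past of $v$ in $\mathfrak F$. Then there exist constants $0<a\le A<\infty$, depending only on $G$, such that for every vertex $v$ and every $R\ge1$, $$a\,q(v)^2R^{-1}\le\mathbb P\bigl(\mathrm{diam}_{\mathrm{ext}}(\mathfrak P(v))\ge R\bigr)\le A R^{-1}.$$
   Context: A network is a connected graph $G=(V,E)$ (loops and multiple edges allowed) together with conductances $c:E\to(0,\infty)$ such that the vertex conductance $c(v)$, the sum of $c(e)$ over edges $e$ incident to $v$, is finite for every $v\in V$. It has controlled stationary measure if there is a constant $M>0$ with $M^{-1}\le c(v)\le M$ for every $v\in V$. The random walk $X$ on $G$ at each step crosses an edge emanating from its current position chosen with probability proportional to its conductance; $\mathbf E_v$ is expectation for the walk started at $v$, $P$ is its Markov operator and $p_n(u,v)$ is the probability that the walk started at $u$ is at $v$ at time $n$. Set $\|P^n\|_{1\to\infty}=\sup_{u,v\in V}p_n(u,v)$ and $\|P\|_{\mathrm{bub}}=\sum_{n\ge0}(n+1)\|P^n\|_{1\to\infty}$. (If it is finite then $G$ is infinite and transient.) With $d$ the graph distance, $G$ is uniformly ballistic if there is a constant $C$ such that $\sup_{v\in V}\mathbf E_v[\sup\{n\ge0:d(v,X_n)\le r\}]\le Cr$ for every $r\ge1$. $q(v)$ is the probability that two independent random walks $X,Y$ started at $v$ never return to $v$ or intersect each other after time zero, i.e. that $\{X_i:i>0\}$,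 $\{Y_i:i>0\}$ and $\{v\}$ are mutually disjoint. Wired uniform spanning forest (WUSF): the uniform spanning tree of a finite network is the random spanning tree chosen with probability proportional to the product of the conductances of its edges. Let $(V_n)$ be an increasing sequence of finite sets with union $V$, and let $G_n^*$ be obtained from $G$ by contracting $V\setminus V_n$ to a single vertex $\partial_n$ and deleting the resulting self-loops at $\partial_n$. Orient the uniform spanning tree of $G_n^*$ towards $\partial_n$. For transient $G$, the oriented WUSF of $G$ is the weak limit of these random oriented trees (it exists and does not depend on the exhaustion); almost surely every vertex has exactly one outgoing edge in it. The past $\mathfrak P(v)$ of $v$ is the subgraph of $\mathfrak F$ induced by $v$ together with all vertices $u$ in the same tree as $v$ such that every edge of the path from $u$ to $v$ in $\mathfrak F$ is oriented in the direction of $v$. $\mathrm{diam}_{\mathrm{ext}}(K)$ is the supremal graph distance in $G$ between two vertices of $K$. *)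

theory Defs
  imports "HOL-Probability.Probability" "HOL-Library.Uprod"
begin

section \<open>Networks\<close>

text \<open>
  Undirected multigraphs: each edge carries an unordered pair of ends, so that loops
  (\<open>ends N e = Upair x x\<close>) and parallel edges are allowed.
\<close>

record ('v, 'e) network =
  verts :: "'v set"
  edges :: "'e set"
  ends :: "'e \<Rightarrow> 'v uprod"
  cond :: "'e \<Rightarrow> real"

definition incident :: "('v, 'e) network \<Rightarrow> 'v \<Rightarrow> 'e set" where
  "incident N x = {e \<in> edges N. x \<in> set_uprod (ends N e)}"

text \<open>A loop at \<open>x\<close> is counted once in the conductance of \<open>x\<close>.\<close>

definition vcond :: "('v, 'e) network \<Rightarrow> 'v \<Rightarrow> real" where
  "vcond N x = (\<Sum>\<^sub>\<infinity>e\<in>incident N x. cond N e)"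

text \<open>
  A walk is the list of its steps; a step \<open>(x, e)\<close> leaves the vertex \<open>x\<close> through the edge \<open>e\<close>.
  Pairs \<open>(x, e)\<close> also serve as oriented edges (\<open>e\<close> with tail \<open>x\<close>).
\<close>

fun is_walk :: "('v, 'e) network \<Rightarrow> 'v \<Rightarrow> ('v \<times> 'e) list \<Rightarrow> 'v \<Rightarrow> bool" where
  "is_walk N u [] v \<longleftrightarrow> u = v \<and> v \<in> verts N"
| "is_walk N u ((x, e) # p) v \<longleftrightarrow> x = u \<and> u \<in> verts N \<and> e \<in> edges N \<and>
     (\<exists>w. ends N e = Upair u w \<and> is_walk N w p v)"

definition is_path :: "('v, 'e) network \<Rightarrow> 'v \<Rightarrow> ('v \<times> 'e) list \<Rightarrow> 'v \<Rightarrow> bool" where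
  "is_path N u p v \<longleftrightarrow> is_walk N u p v \<and> distinct (map fst p @ [v])"

definition is_cycle :: "('v, 'e) network \<Rightarrow> 'v \<Rightarrow> ('v \<times> 'e) list \<Rightarrow> bool" where
  "is_cycle N u p \<longleftrightarrow> is_walk N u p u \<and> p \<noteq> [] \<and> distinct (map fst p) \<and> distinct (map snd p)"

definition connected_net :: "('v, 'e) network \<Rightarrow> bool" where
  "connected_net N \<longleftrightarrow> verts N \<noteq> {} \<and> (\<forall>u\<in>verts N. \<forall>v\<in>verts N. \<exists>p. is_walk N u p v)"

definition gdist :: "('v, 'e) network \<Rightarrow> 'v \<Rightarrow> 'v \<Rightarrow> nat" where
  "gdist N u v = (LEAST n. \<exists>p. is_walk N u p v \<and> length p = n)"

locale network =
  fixes G :: "('v, 'e) network"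
  assumes ends_verts: "e \<in> edges G \<Longrightarrow> set_uprod (ends G e) \<subseteq> verts G"
    and connected: "connected_net G"
    and cond_pos: "e \<in> edges G \<Longrightarrow> cond G e > 0"
    and vcond_finite: "x \<in> verts G \<Longrightarrow> cond G summable_on incident G x"

definition controlled_stationary_measure :: "('v, 'e) network \<Rightarrow> bool" where
  "controlled_stationary_measure G \<longleftrightarrow>
     (\<exists>M>0. \<forall>x\<in>verts G. inverse M \<le> vcond G x \<and> vcond G x \<le> M)"


section \<open>Random walk\<close>

definition trans_prob :: "('v, 'e) network \<Rightarrow> 'v \<Rightarrow> 'v \<Rightarrow> real" where
  "trans_prob G x y = (\<Sum>\<^sub>\<infinity>e\<in>{e \<in> edges G. ends G e = Upair x y}. cond G e) / vcond G x"

definition walk_kernel :: "('v, 'e) network \<Rightarrow> 'v \<Rightarrow> nat \<Rightarrow> (nat \<Rightarrow> 'v) \<Rightarrow> 'v measure" where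
  "walk_kernel G v n \<omega> =
     (if n = 0 then return (count_space (verts G)) v
      else point_measure (verts G) (\<lambda>y. ennreal (trans_prob G (\<omega> (n - 1)) y)))"

text \<open>
  The law of the trajectory \<open>\<omega> 0, \<omega> 1, \<dots>\<close> of the walk started at \<open>v\<close>, on the product
  sigma-algebra of \<open>verts G\<close>-valued sequences. It is the Ionescu-Tulcea measure, which the
  library provides as the projective limit of \<open>Ionescu_Tulcea.CI\<close>.
\<close>

definition random_walk :: "('v, 'e) network \<Rightarrow> 'v \<Rightarrow> (nat \<Rightarrow> 'v) measure" where
  "random_walk G v =
     projective_family.lim UNIV
       (Ionescu_Tulcea.CI (walk_kernel G v) (\<lambda>_. count_space (verts G)))
       (\<lambda>_. count_space (verts G))"

definition step_prob :: "('v, 'e) network \<Rightarrow> nat \<Rightarrow> 'v \<Rightarrow> 'v \<Rightarrow> real" where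
  "step_prob G n u v = \<P>(\<omega> in random_walk G u. \<omega> n = v)"

definition sup_norm_P :: "('v, 'e) network \<Rightarrow> nat \<Rightarrow> ennreal" where
  "sup_norm_P G n = (SUP u\<in>verts G. SUP v\<in>verts G. ennreal (step_prob G n u v))"

definition bubble_norm :: "('v, 'e) network \<Rightarrow> ennreal" where
  "bubble_norm G = (\<Sum>n. of_nat (n + 1) * sup_norm_P G n)"

text \<open>The inner supremum is the last visit time to the ball; it is \<open>\<infinity>\<close> if there is no last visit.\<close>

definition uniformly_ballistic :: "('v, 'e) network \<Rightarrow> bool" where
  "uniformly_ballistic G \<longleftrightarrow>
     (\<exists>C::real. \<forall>r::real. r \<ge> 1 \<longrightarrow>
       (SUP v\<in>verts G. \<integral>\<^sup>+\<omega>. (SUP n\<in>{n. real (gdist G v (\<omega> n)) \<le> r}. of_nat n) \<partial>random_walk G v)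
         \<le> ennreal (C * r))"

definition disjoint_prob :: "('v, 'e) network \<Rightarrow> 'v \<Rightarrow> real" where
  "disjoint_prob G v = \<P>((X, Y) in random_walk G v \<Otimes>\<^sub>M random_walk G v.
     X ` {0<..} \<inter> Y ` {0<..} = {} \<and> v \<notin> X ` {0<..} \<and> v \<notin> Y ` {0<..})"


section \<open>Uniform spanning trees\<close>

definition spanning_trees :: "('v, 'e) network \<Rightarrow> 'e set set" where
  "spanning_trees N = {T. T \<subseteq> edges N \<and> connected_net (N\<lparr>edges := T\<rparr>) \<and>
     (\<nexists>u p. is_cycle (N\<lparr>edges := T\<rparr>) u p)}"

definition tree_weight :: "('v, 'e) network \<Rightarrow> 'e set \<Rightarrow> real" where
  "tree_weight N T = (\<Prod>e\<in>T. cond N e)"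

text \<open>
  Meant for networks with finitely many vertices. Infinitely many edges are possible, since
  vertices of an infinite network may have infinite degree, hence the infinite sum in the
  normalisation.
\<close>

definition UST :: "('v, 'e) network \<Rightarrow> 'e set measure" where
  "UST N = point_measure (spanning_trees N)
     (\<lambda>T. ennreal (tree_weight N T / (\<Sum>\<^sub>\<infinity>T'\<in>spanning_trees N. tree_weight N T')))"

definition orient_towards :: "('v, 'e) network \<Rightarrow> 'v \<Rightarrow> 'e set \<Rightarrow> ('v \<times> 'e) set" where
  "orient_towards N r T = {(x, e). \<exists>p. is_path (N\<lparr>edges := T\<rparr>) x ((x, e) # p) r}"


section \<open>The oriented wired uniform spanning forest\<close>

text \<open>The vertices outside \<open>W\<close> are contracted to \<open>None\<close>.\<close>

definition wire :: "('v, 'e) network \<Rightarrow> 'v set \<Rightarrow> ('v option, 'e) network" where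
  "wire G W =
     (let ends' = (\<lambda>e. map_uprod (\<lambda>x. if x \<in> W then Some x else None) (ends G e)) in
      \<lparr>verts = insert None (Some ` W),
       edges = {e \<in> edges G. ends' e \<noteq> Upair None None},
       ends = ends',
       cond = cond G\<rparr>)"

definition exhaustion :: "('v, 'e) network \<Rightarrow> (nat \<Rightarrow> 'v set) \<Rightarrow> bool" where
  "exhaustion G V \<longleftrightarrow> incseq V \<and> (\<forall>n. finite (V n)) \<and> (\<Union>n. V n) = verts G"

text \<open>
  Random sets of oriented edges are encoded by their indicator functions in \<open>'v \<times> 'e \<Rightarrow> bool\<close>,
  with the product topology and the product sigma-algebra.
\<close>

abbreviation config_space :: "('v \<times> 'e \<Rightarrow> bool) measure" where
  "config_space \<equiv> PiM UNIV (\<lambda>_. count_space UNIV)"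

text \<open>
  No edge of a tree oriented towards \<open>None\<close> has tail \<open>None\<close>, so every oriented edge of the tree
  of \<open>wire G W\<close> corresponds to the oriented edge of \<open>G\<close> with the same tail.
\<close>

definition wired_UST :: "('v, 'e) network \<Rightarrow> 'v set \<Rightarrow> ('v \<times> 'e \<Rightarrow> bool) measure" where
  "wired_UST G W = distr (UST (wire G W)) config_space
     (\<lambda>T (x, e). (Some x, e) \<in> orient_towards (wire G W) None T)"

definition weak_limit :: "(nat \<Rightarrow> 'a::topological_space measure) \<Rightarrow> 'a measure \<Rightarrow> bool" where
  "weak_limit \<mu> M \<longleftrightarrow>
     (\<forall>f::'a \<Rightarrow> real. continuous_on UNIV f \<longrightarrow> bounded (range f) \<longrightarrow>
        (\<lambda>n. \<integral>x. f x \<partial>\<mu> n) \<longlonglongrightarrow> (\<integral>x. f x \<partial>M))"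

text \<open>
  \<open>M\<close> is the law of the oriented wired uniform spanning forest of the transient network \<open>G\<close>.
  The weak limit does not depend on the exhaustion, so one exhaustion suffices.
\<close>

definition oriented_WUSF :: "('v, 'e) network \<Rightarrow> ('v \<times> 'e \<Rightarrow> bool) measure \<Rightarrow> bool" where
  "oriented_WUSF G M \<longleftrightarrow> prob_space M \<and> sets M = sets config_space \<and>
     (\<exists>V. exhaustion G V \<and> weak_limit (\<lambda>n. wired_UST G (V n)) M)"

definition past_verts :: "('v, 'e) network \<Rightarrow> ('v \<times> 'e) set \<Rightarrow> 'v \<Rightarrow> 'v set" where
  "past_verts G F v = {u. \<exists>p. is_path G u p v \<and> set p \<subseteq> F}"

definition past :: "('v, 'e) network \<Rightarrow> ('v \<times> 'e) set \<Rightarrow> 'v \<Rightarrow> ('v, 'e) network" where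
  "past G F v = G\<lparr>verts := past_verts G F v,
     edges := {e \<in> edges G. e \<in> snd ` F \<and> set_uprod (ends G e) \<subseteq> past_verts G F v}\<rparr>"

definition diam_ext :: "('v, 'e) network \<Rightarrow> ('v, 'e) network \<Rightarrow> ereal" where
  "diam_ext G K = (SUP u\<in>verts K. SUP w\<in>verts K. ereal (real (gdist G u w)))"

end

theory Submission
  imports Defs
begin

text \<open>
  Everything is proved for finite networks with a root and passes to the weak limit through events
  that depend on finitely many oriented edges. A spanning tree oriented towards the root is a choice
  of an outgoing edge at every other vertex, and the path of a vertex to the root is its orbit under
  the successor function. Given this path, the rest of the tree is again a random forest, with the
  path added to the boundary; hence hitting probabilities of orbits are harmonic, and they are bounded
  by the Green function \<open>U\<close> of the infinite network. The bubble norm bounds \<open>\<Sum>y. (U x y)\<^sup>2\<close>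
  and ballisticity gives \<open>\<Sum>y | d x y \<le> r. U x y \<le> C * r\<close>, both uniformly in \<open>x\<close>.

  Upper bound. Contract the boundary of the domain to a point \<open>\<rho>\<close>. Moving the root of a random
  spanning tree along a random edge is a stationary chain, and during an excursion of the root from
  \<open>\<rho>\<close> it destroys a given path of the tree with at least the probability that a random walk started
  from the boundary hits this path. A typical path of length \<open>r\<close> has small energy, hence capacity of
  order \<open>r\<close>, so that boundary conductance divided by \<open>r\<close> excursions destroy it, while each excursion
  creates a path to a fixed boundary point \<open>v\<close> with probability at most the conductance of \<open>v\<close>
  divided by that of the boundary. If \<open>Q r\<close> is the largest probability, over all domains and all
  \<open>v\<close>, that the past of \<open>v\<close> reaches distance \<open>r\<close>, this gives \<open>Q (3 * r) \<le> C / r + Q r / 6\<close>, and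
  induction over the scales yields \<open>Q r = O(1 / r)\<close>.

  Lower bound. Count the vertices at distance between \<open>R\<close> and \<open>2 * R\<close> whose path reaches \<open>v\<close> inside
  the ball. Given the path of a neighbour of \<open>v\<close> to the root, the expected number is governed by a
  random walk from \<open>v\<close> that avoids this path, so the mean is at least of order \<open>q R\<close>; the second moment
  is \<open>O(R ^ 3)\<close>, and the second moment method gives the order \<open>q\<^sup>2 / R\<close>.
\<close>

section \<open>Random forests in finite networks\<close>

text \<open>What forces \<open>Q\<close> to range over all domains: once the path of
  \<open>w\<close> is revealed, the rest of the forest lives on a smaller domain in which
  \<open>w\<close> has become a boundary point, so a recursion for one fixed domain would not close.
  The term \<open>Q r / 6\<close> has two sources of size 1/12 each: paths of too large energy,
  controlled by Markov's inequality, and paths that survive all excursions, controlled by an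
  exponential. If \<open>Q r\<close> is at most \<open>Dc / r\<close>, this is
  \<open>Dc / (6 * r)\<close>; the excursions cost as much again, and 1/6 + 1/6 = 1/3 is exactly the
  ratio between the scales \<open>r\<close> and \<open>3 * r\<close>. An excursion may create many
  paths to \<open>v\<close> at once. Counting them all would be too expensive, so sums over paths
  are truncated at one until the last excursion. Degrees may be infinite, also through parallel
  edges. Successor functions therefore record vertices only; the edges are restored by summing over
  parallel ones, and events of the limit are approximated by finitely many paths through finitely
  many edges.\<close>

definition orb :: "('b \<Rightarrow> 'b) \<Rightarrow> 'b \<Rightarrow> 'b set" where
  "orb f u = range (\<lambda>n. (f ^^ n) u)"

lemma orb_self [simp]: "u \<in> orb f u"
  unfolding orb_def by (rule range_eqI[of _ _ 0]) simp

lemma orb_step: "y \<in> orb f u \<Longrightarrow> f y \<in> orb f u"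
proof -
  assume "y \<in> orb f u"
  then obtain n where "y = (f ^^ n) u" unfolding orb_def by auto
  then have "f y = (f ^^ Suc n) u" by simp
  then show ?thesis unfolding orb_def by (rule range_eqI)
qed

lemma orb_least:
  assumes "u \<in> S" "f ` S \<subseteq> S" shows "orb f u \<subseteq> S"
proof -
  have "(f ^^ n) u \<in> S" for n by (induction n) (use assms in auto)
  then show ?thesis unfolding orb_def by auto
qed

lemma orb_closed: "f ` orb f u \<subseteq> orb f u"
  using orb_step[of _ f u] by fast

lemma orb_trans: "y \<in> orb f u \<Longrightarrow> orb f y \<subseteq> orb f u"
  by (rule orb_least[OF _ orb_closed])

lemma orb_insert: "orb f u = insert u (orb f (f u))"
proof
  show "orb f u \<subseteq> insert u (orb f (f u))"
    by (rule orb_least) (auto intro: orb_step[of _ f "f u"])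
  show "insert u (orb f (f u)) \<subseteq> orb f u"
    using orb_trans[OF orb_step[OF orb_self[of u f]]] by auto
qed

lemma orb_image: "orb f (f u) = f ` orb f u"
proof
  show "orb f (f u) \<subseteq> f ` orb f u"
    by (rule orb_least) (auto intro!: imageI orb_step[of _ f u])
  show "f ` orb f u \<subseteq> orb f (f u)"
  proof
    fix y assume "y \<in> f ` orb f u"
    then obtain z where z: "z \<in> orb f u" "y = f z" by auto
    have "z = u \<or> z \<in> orb f (f u)" using z(1) orb_insert[of f u] by blast
    then show "y \<in> orb f (f u)" using z(2) by (auto intro: orb_step[of _ f "f u"])
  qed
qed

lemma orb_fix: "f u = u \<Longrightarrow> orb f u = {u}"
  using orb_least[of u "{u}" f] by auto

lemma orb_linear:
  assumes "y \<in> orb f u" "z \<in> orb f u" shows "z \<in> orb f y \<or> y \<in> orb f z"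
proof -
  obtain n m where nm: "y = (f ^^ n) u" "z = (f ^^ m) u" using assms unfolding orb_def by auto
  have *: "(f ^^ b) u \<in> orb f ((f ^^ a) u)" if "a \<le> b" for a b
  proof -
    have "(f ^^ b) u = (f ^^ (b - a)) ((f ^^ a) u)"
      using that by (metis add.commute funpow_add le_add_diff_inverse o_apply)
    then show ?thesis unfolding orb_def by auto
  qed
  show ?thesis using nm * by (cases "n \<le> m") auto
qed

text \<open>The case \<open>f y = y\<close> covers maps that stop where \<open>g\<close> goes on,
  such as a forest with an edge removed: stopping can only shorten the orbit.\<close>

lemma orb_mono:
  assumes "\<And>y. y \<in> orb f u \<Longrightarrow> f y = g y \<or> f y = y"
  shows "orb f u \<subseteq> orb g u"
proof -
  have "orb f u \<subseteq> orb f u \<inter> orb g u"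
  proof (rule orb_least)
    show "f ` (orb f u \<inter> orb g u) \<subseteq> orb f u \<inter> orb g u"
    proof
      fix y assume "y \<in> f ` (orb f u \<inter> orb g u)"
      then obtain z where z: "z \<in> orb f u" "z \<in> orb g u" "y = f z" by auto
      then show "y \<in> orb f u \<inter> orb g u" using assms[of z] orb_step[of z f u] orb_step[of z g u] by auto
    qed
  qed simp
  then show ?thesis by auto
qed

lemma orb_cong:
  assumes "\<And>y. y \<in> orb f u \<Longrightarrow> f y = g y"
  shows "orb f u = orb g u"
proof
  show *: "orb f u \<subseteq> orb g u" using assms by (intro orb_mono) auto
  have "g ` orb f u \<subseteq> orb f u" using assms orb_closed[of f u] by (auto simp: image_subset_iff)
  then show "orb g u \<subseteq> orb f u" by (intro orb_least) auto
qed

lemma orb_fix_unique: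
  assumes "a \<in> orb f u" "b \<in> orb f u" "f a = a" "f b = b" shows "a = b"
  using orb_linear[OF assms(1,2)] orb_fix[of f a] orb_fix[of f b] assms(3,4) by auto

text \<open>The assumption \<open>leaving\<close> is connectedness to \<open>\<rho>\<close> in the
  form in which it is used: every nonempty set without \<open>\<rho>\<close> has an edge of positive
  conductance out of it. It yields forests of positive weight and the maximum principle.\<close>

locale finite_net =
  fixes B :: "'b set" and C :: "'b \<Rightarrow> 'b \<Rightarrow> real" and \<rho> :: 'b
  assumes finB: "finite B" and rhoB: "\<rho> \<in> B"
    and C_nonneg: "C x y \<ge> 0" and C_sym: "C x y = C y x"
    and leaving: "S \<subseteq> B - {\<rho>} \<Longrightarrow> S \<noteq> {} \<Longrightarrow> \<exists>x\<in>S. \<exists>y\<in>B-S. C x y > 0"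
begin

text \<open>Elements of \<open>forests A\<close> are the successor functions of forests on \<open>A\<close> oriented towards the complement
  of \<open>A\<close>; the last condition says that there are no cycles.\<close>

definition forests :: "'b set \<Rightarrow> ('b \<Rightarrow> 'b) set" where
  "forests A = {f. (\<forall>x\<in>A. f x \<in> B) \<and> (\<forall>x. x \<notin> A \<longrightarrow> f x = x) \<and> (\<forall>S\<subseteq>A. f ` S \<subseteq> S \<longrightarrow> S = {})}"

definition wt :: "'b set \<Rightarrow> ('b \<Rightarrow> 'b) \<Rightarrow> real" where
  "wt A f = (\<Prod>x\<in>A. C x (f x))"

definition Z :: "'b set \<Rightarrow> real" where "Z A = (\<Sum>f\<in>forests A. wt A f)"

definition ex :: "'b set \<Rightarrow> (('b \<Rightarrow> 'b) \<Rightarrow> real) \<Rightarrow> real" where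
  "ex A X = (\<Sum>f\<in>forests A. wt A f * X f) / Z A"

definition pr :: "'b set \<Rightarrow> (('b \<Rightarrow> 'b) \<Rightarrow> bool) \<Rightarrow> real" where
  "pr A P = ex A (\<lambda>f. of_bool (P f))"

definition vertex_cond :: "'b \<Rightarrow> real" where "vertex_cond x = (\<Sum>y\<in>B. C x y)"

lemma forestsD:
  assumes "f \<in> forests A"
  shows "x \<in> A \<Longrightarrow> f x \<in> B" "x \<notin> A \<Longrightarrow> f x = x" "S \<subseteq> A \<Longrightarrow> f ` S \<subseteq> S \<Longrightarrow> S = {}"
  using assms unfolding forests_def by auto

lemma forest_orb_out:
  assumes "f \<in> forests A" "x \<notin> A" shows "orb f x = {x}"
  using orb_fix[of f x] forestsD(2)[OF assms] by simp

lemma finite_forests: assumes "A \<subseteq> B" shows "finite (forests A)"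
proof -
  have "inj_on (\<lambda>f. restrict f A) (forests A)"
  proof (rule inj_onI)
    fix f g assume *: "f \<in> forests A" "g \<in> forests A" "restrict f A = restrict g A"
    show "f = g"
    proof
      fix x show "f x = g x"
        using * forestsD(2)[of f A x] forestsD(2)[of g A x] by (cases "x \<in> A") (auto dest: fun_cong[of _ _ x])
    qed
  qed
  moreover have "(\<lambda>f. restrict f A) ` forests A \<subseteq> PiE A (\<lambda>_. B)"
    by (auto simp: forests_def)
  moreover have "finite (PiE A (\<lambda>_. B))" using assms finB finite_subset by (intro finite_PiE) blast+
  ultimately show ?thesis using finite_subset inj_on_finite by blast
qed

lemma wt_nonneg: "wt A f \<ge> 0" unfolding wt_def by (intro prod_nonneg) (simp add: C_nonneg)

text \<open>If \<open>k\<close> and \<open>y\<close> were distinct, every point of the orbit of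
  \<open>y\<close> would lead back to \<open>y\<close>, so the orbit would be a nonempty invariant
  subset of \<open>A\<close>, which a forest excludes.\<close>

lemma forest_acyclic:
  assumes f: "f \<in> forests A" and k: "k \<in> orb f y" and y: "y \<in> orb f k" shows "k = y"
proof (rule ccontr)
  assume ne: "k \<noteq> y"
  have "k \<in> orb f (f y)" using k ne orb_insert[of f y] by auto
  then have yy: "y \<in> orb f (f y)" using y orb_trans[of k f "f y"] by auto
  have yA: "y \<in> A"
    using k ne forestsD(2)[OF f, of y] orb_fix[of f y] by auto
  let ?S = "{z. y \<in> orb f z}"
  have "f ` ?S \<subseteq> ?S" using yy by (auto, metis insertE orb_insert)
  then have sub: "orb f y \<subseteq> ?S" by (intro orb_least) auto
  have "orb f y \<subseteq> A"
  proof
    fix z assume "z \<in> orb f y"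
    then have "y \<in> orb f z" using sub by auto
    then show "z \<in> A" using forestsD(2)[OF f, of z] orb_fix[of f z] yA by (cases "z \<in> A") auto
  qed
  then have "orb f y = {}" by (rule forestsD(3)[OF f]) (rule orb_closed)
  then show False using orb_self[of y f] by simp
qed

lemma forest_ne: "f \<in> forests A \<Longrightarrow> x \<in> A \<Longrightarrow> f x \<noteq> x"
  using forestsD(3)[of f A "{x}"] by auto

lemma forest_exit: assumes "f \<in> forests A" shows "\<exists>b\<in>orb f x. b \<notin> A"
  using forestsD(3)[OF assms _ orb_closed[of f x]] orb_self[of x f] by blast

lemma forest_exit_unique:
  assumes "f \<in> forests A" "a \<in> orb f x" "b \<in> orb f x" "a \<notin> A" "b \<notin> A" shows "a = b"
  using orb_fix_unique[OF assms(2,3)] forestsD(2)[OF assms(1)] assms(4,5) by auto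

lemma forest_orb_B: assumes "f \<in> forests A" "A \<subseteq> B" "x \<in> B" shows "orb f x \<subseteq> B"
proof (rule orb_least[OF assms(3)])
  show "f ` B \<subseteq> B" using forestsD(1,2)[OF assms(1)] by (metis image_subsetI)
qed

text \<open>Forests of weight zero are exempt, so that later comparisons may assume that a vertex
  and its successor are joined by an edge of positive conductance.\<close>

lemma ex_mono:
  assumes "A \<subseteq> B" "\<And>f. f \<in> forests A \<Longrightarrow> wt A f > 0 \<Longrightarrow> X f \<le> Y f" shows "ex A X \<le> ex A Y"
  unfolding ex_def
proof (rule divide_right_mono)
  show "(\<Sum>f\<in>forests A. wt A f * X f) \<le> (\<Sum>f\<in>forests A. wt A f * Y f)"
  proof (rule sum_mono)
    fix f assume "f \<in> forests A"
    then show "wt A f * X f \<le> wt A f * Y f"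
      using assms(2)[of f] wt_nonneg[of A f] by (cases "wt A f = 0") (auto intro: mult_left_mono)
  qed
  show "0 \<le> Z A" unfolding Z_def by (intro sum_nonneg) (simp add: wt_nonneg)
qed

lemma ex_cong:
  assumes "\<And>f. f \<in> forests A \<Longrightarrow> X f = Y f" shows "ex A X = ex A Y"
  unfolding ex_def using assms by (simp cong: sum.cong)

lemma ex_sum: "ex A (\<lambda>f. \<Sum>i\<in>I. X i f) = (\<Sum>i\<in>I. ex A (X i))"
proof -
  have "(\<Sum>f\<in>forests A. wt A f * (\<Sum>i\<in>I. X i f)) = (\<Sum>i\<in>I. \<Sum>f\<in>forests A. wt A f * X i f)"
    by (subst sum.swap) (simp add: sum_distrib_left)
  then show ?thesis unfolding ex_def by (simp add: sum_divide_distrib)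
qed

lemma ex_add: "ex A (\<lambda>f. X f + Y f) = ex A X + ex A Y"
  unfolding ex_def by (simp add: distrib_left sum.distrib add_divide_distrib)

lemma ex_diff: "ex A (\<lambda>f. X f - Y f) = ex A X - ex A Y"
  unfolding ex_def by (simp add: right_diff_distrib sum_subtractf diff_divide_distrib)

lemma ex_cmult: "ex A (\<lambda>f. a * X f) = a * ex A X"
proof -
  have "(\<Sum>f\<in>forests A. wt A f * (a * X f)) = a * (\<Sum>f\<in>forests A. wt A f * X f)"
    by (simp add: sum_distrib_left mult_ac)
  then show ?thesis unfolding ex_def by simp
qed

lemma ex_nonneg: "(\<And>f. f \<in> forests A \<Longrightarrow> X f \<ge> 0) \<Longrightarrow> ex A X \<ge> 0"
  unfolding ex_def Z_def by (intro divide_nonneg_nonneg sum_nonneg mult_nonneg_nonneg wt_nonneg) auto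

lemma Z_pos: assumes "A \<subseteq> B - {\<rho>}" shows "Z A > 0"
proof -
  have "finite A" using assms finB finite_subset by fast
  then have "\<exists>f\<in>forests A. wt A f > 0" using assms
  proof (induction "card A" arbitrary: A)
    case 0
    then have "A = {}" by simp
    then show ?case by (intro bexI[of _ id]) (auto simp: forests_def wt_def)
  next
    case (Suc n)
    then have "A \<noteq> {}" by auto
    \<comment> \<open>A vertex with an edge out of \<open>A\<close> can be attached last: since its
      successor lies outside \<open>A\<close>, no cycle passes through it.\<close>
    then obtain x y where xy: "x \<in> A" "y \<in> B - A" "C x y > 0" using leaving Suc.prems by blast
    have "n = card (A - {x})" using Suc.hyps(2) xy(1) Suc.prems(1) by simp
    then obtain f where f: "f \<in> forests (A - {x})" "wt (A - {x}) f > 0"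
      using Suc.hyps(1)[of "A - {x}"] Suc.prems by auto
    have "f(x := y) \<in> forests A" unfolding forests_def
    proof (intro CollectI conjI ballI allI impI)
      fix S assume S: "S \<subseteq> A" "f(x := y) ` S \<subseteq> S"
      then have "x \<notin> S" using xy by auto
      then have "f ` S \<subseteq> S" "S \<subseteq> A - {x}" using S by auto
      then show "S = {}" using forestsD(3)[OF f(1)] by blast
    qed (use f(1) xy in \<open>auto dest: forestsD\<close>)
    moreover have "wt A (f(x := y)) = C x y * wt (A - {x}) f"
      unfolding wt_def using Suc.prems(1) xy(1) by (simp add: prod.remove)
    ultimately show ?case using f(2) xy(3) by (intro bexI[of _ "f(x := y)"]) auto
  qed
  then show ?thesis unfolding Z_def
    using finite_forests[of A] assms wt_nonneg by (metis Diff_subset dual_order.trans sum_pos2)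
qed

lemma ex_const: "A \<subseteq> B - {\<rho>} \<Longrightarrow> ex A (\<lambda>_. a) = a"
  using Z_pos[of A] unfolding ex_def Z_def by (simp add: sum_distrib_right[symmetric])

lemma sum_wt: "A \<subseteq> B - {\<rho>} \<Longrightarrow> (\<Sum>f\<in>forests A. wt A f * X f) = ex A X * Z A"
  using Z_pos[of A] unfolding ex_def by simp

lemma pr_le1: "A \<subseteq> B - {\<rho>} \<Longrightarrow> pr A P \<le> 1"
  using ex_mono[of A "\<lambda>f. of_bool (P f)" "\<lambda>_. 1"] ex_const[of A 1] unfolding pr_def by auto

lemma pr_nonneg: "pr A P \<ge> 0" unfolding pr_def by (rule ex_nonneg) auto

lemma pr_mono:
  assumes "A \<subseteq> B" "\<And>f. f \<in> forests A \<Longrightarrow> wt A f > 0 \<Longrightarrow> P f \<Longrightarrow> Q f" shows "pr A P \<le> pr A Q"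
  unfolding pr_def by (rule ex_mono) (use assms in auto)

lemma pr_not: "A \<subseteq> B - {\<rho>} \<Longrightarrow> pr A (\<lambda>f. \<not> P f) = 1 - pr A P"
  unfolding pr_def of_bool_not_iff ex_diff by (simp add: ex_const)

section \<open>Revealing a path: the domain Markov property\<close>

lemma forests_restrict:
  assumes "f \<in> forests A"
  shows "(\<lambda>x. if x \<in> K then x else f x) \<in> forests (A - K)"
  unfolding forests_def
proof (intro CollectI conjI ballI allI impI)
  fix S assume S: "S \<subseteq> A - K" "(\<lambda>x. if x \<in> K then x else f x) ` S \<subseteq> S"
  then have "f ` S \<subseteq> S" by auto
  then show "S = {}" using forestsD(3)[OF assms] S by blast
qed (use assms in \<open>auto dest: forestsD\<close>)

lemma forests_join:
  assumes f: "f \<in> forests A" and f': "f' \<in> forests (A - orb f w)"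
  shows "(\<lambda>x. if x \<in> orb f w then f x else f' x) \<in> forests A" (is "?g \<in> _")
  unfolding forests_def
proof (intro CollectI conjI ballI allI impI)
  fix S assume S: "S \<subseteq> A" "?g ` S \<subseteq> S"
  have "f ` (S \<inter> orb f w) \<subseteq> S \<inter> orb f w" using S by (auto intro: orb_step[of _ f w])
  then have "S \<inter> orb f w = {}" using forestsD(3)[OF f, of "S \<inter> orb f w"] S by blast
  then have "S \<subseteq> A - orb f w" "f' ` S \<subseteq> S" using S by auto
  then show "S = {}" using forestsD(3)[OF f'] by blast
qed (use f f' in \<open>auto dest: forestsD\<close>)

text \<open>The next lemmas give the domain Markov property \<open>tower\<close>, which takes the place of Wilson's algorithm:
  given the path of \<open>w\<close>, the rest of the forest is a random forest on the complement of this path.\<close>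

lemma join_orbit:
  assumes f: "f \<in> forests A" and f': "f' \<in> forests (A - orb f y)"
    and b: "b \<in> orb f' w" "b \<notin> A - orb f y"
  shows "orb (\<lambda>x. if x \<in> orb f y then f x else f' x) w = orb f' w \<union> orb f b" (is "orb ?J w = _")
proof
  have out: "f' x = x" if "x \<in> orb f y \<or> x \<notin> A" for x using forestsD(2)[OF f', of x] that by auto
  have Jb: "orb f b = orb ?J b"
  proof (cases "b \<in> orb f y")
    case True
    then show ?thesis using orb_trans[OF True] by (intro orb_cong) auto
  next
    case False
    then have "b \<notin> A" using b by auto
    then have "f b = b" "f' b = b" using forestsD(2)[OF f] out by auto
    then show ?thesis using False orb_fix[of f b] orb_fix[of ?J b] by simp
  qed
  show "orb ?J w \<subseteq> orb f' w \<union> orb f b"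
  proof (rule orb_least)
    show "?J ` (orb f' w \<union> orb f b) \<subseteq> orb f' w \<union> orb f b"
    proof
      fix z assume "z \<in> ?J ` (orb f' w \<union> orb f b)"
      then obtain x where x: "z = ?J x" "x \<in> orb f' w \<union> orb f b" by (rule imageE)
      show "z \<in> orb f' w \<union> orb f b"
      proof (cases "x \<in> orb f b")
        case True
        then have "z \<in> orb ?J b" using x(1) Jb orb_step[of x ?J b] by (simp only:)
        then show ?thesis using Jb by auto
      next
        case False
        then have xw: "x \<in> orb f' w" "x \<noteq> b" using x(2) orb_self[of b f] by auto
        then have "x \<in> A - orb f y" using forest_exit_unique[OF f' xw(1) b(1)] b(2) by blast
        then have "z = f' x" using x by auto
        then show ?thesis using orb_step[OF xw(1)] by auto
      qed
    qed
  qed simp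
  have 1: "orb f' w \<subseteq> orb ?J w" by (rule orb_mono) (use out in auto)
  then have "orb ?J b \<subseteq> orb ?J w" using b(1) by (intro orb_trans) auto
  then show "orb f' w \<union> orb f b \<subseteq> orb ?J w" using 1 Jb by auto
qed

lemma tower:
  assumes A: "A \<subseteq> B - {\<rho>}"
  shows "ex A \<Theta> = ex A (\<lambda>f. ex (A - orb f w) (\<lambda>f'. \<Theta> (\<lambda>x. if x \<in> orb f w then f x else f' x)))"
proof -
  define J where "J f f' = (\<lambda>x. if x \<in> orb f w then f x else f' x)" for f f' :: "'b \<Rightarrow> 'b"
  define R where "R f = (\<lambda>x. if x \<in> orb f w then x else f x)" for f :: "'b \<Rightarrow> 'b"
  let ?Sig = "SIGMA f:forests A. forests (A - orb f w)"
  have fin: "finite (forests A)" "\<And>K. finite (forests (A - K))" using A by (auto intro!: finite_forests)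
  have finA: "finite A" using A finB finite_subset by fast
  have orbJ: "orb (J f f') w = orb f w" for f f' unfolding J_def by (rule orb_cong[symmetric]) auto
  have JR: "J (J f f') (R f) = f" for f f'
    unfolding orbJ J_def[of "J f f'"] by (auto simp: J_def R_def)
  have JS: "J f f' \<in> forests A" if "f \<in> forests A" "f' \<in> forests (A - orb f w)" for f f'
    unfolding J_def by (rule forests_join[OF that])
  have RS: "R f \<in> forests (A - orb f w)" if "f \<in> forests A" for f
    unfolding R_def by (rule forests_restrict[OF that])
  have RJ: "R (J f f') = f'" if "f \<in> forests A" "f' \<in> forests (A - orb f w)" for f f'
  proof
    fix x show "R (J f f') x = f' x"
      unfolding R_def orbJ using forestsD(2)[OF that(2), of x] by (auto simp: J_def)
  qed
  have wJ: "wt A (J f f') * wt (A - orb f w) (R f) = wt A f * wt (A - orb f w) f'" for f f'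
  proof -
    have split: "wt A h = wt (A \<inter> orb f w) h * wt (A - orb f w) h" for h
      unfolding wt_def using finA by (rule prod.Int_Diff)
    have "wt (A \<inter> orb f w) (J f f') = wt (A \<inter> orb f w) f" "wt (A - orb f w) (J f f') = wt (A - orb f w) f'"
      "wt (A - orb f w) (R f) = wt (A - orb f w) f"
      unfolding wt_def J_def R_def by (auto intro!: prod.cong)
    then show ?thesis unfolding split[of "J f f'"] split[of f] by simp
  qed
  have "(\<Sum>f\<in>forests A. wt A f * ex (A - orb f w) (\<lambda>f'. \<Theta> (J f f')))
     = (\<Sum>(f,f')\<in>?Sig. wt A f * wt (A - orb f w) f' * \<Theta> (J f f') / Z (A - orb f w))"
    unfolding ex_def using fin
    by (subst sum.Sigma[symmetric]) (auto simp: sum_distrib_left sum_divide_distrib mult.assoc)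
  also have "\<dots> = (\<Sum>(f,f')\<in>?Sig. wt A f * wt (A - orb f w) f' * \<Theta> f / Z (A - orb f w))"
  \<comment> \<open>The map exchanges the part of \<open>f\<close> off the path with the independent
    copy \<open>f'\<close>. It is an involution that keeps the path and, by \<open>wJ\<close>, the
    product of the weights, and its first component is the joined forest.\<close>
  proof (rule sum.reindex_bij_witness[of _ "\<lambda>(f,f'). (J f f', R f)" "\<lambda>(f,f'). (J f f', R f)"], goal_cases)
    case (1 a) then show ?case by (auto simp: JR RJ)
  next
    case (2 a) then show ?case
      using JS RS by (auto simp: orbJ)
  next
    case (3 a) then show ?case by (auto simp: JR RJ)
  next
    case (4 a) then show ?case
      using JS RS by (auto simp: orbJ)
  next
    case (5 a) then show ?case by (auto simp: orbJ wJ)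
  qed
  also have "\<dots> = (\<Sum>f\<in>forests A. \<Sum>f'\<in>forests (A - orb f w). wt A f * wt (A - orb f w) f' * \<Theta> f / Z (A - orb f w))"
    using fin by (subst sum.Sigma) auto
  also have "\<dots> = (\<Sum>f\<in>forests A. wt A f * \<Theta> f)"
  proof (rule sum.cong[OF refl])
    fix f
    have "(\<Sum>f'\<in>forests (A - orb f w). wt A f * wt (A - orb f w) f' * \<Theta> f / Z (A - orb f w))
       = wt A f * \<Theta> f * (\<Sum>f'\<in>forests (A - orb f w). wt (A - orb f w) f') / Z (A - orb f w)"
      by (simp add: sum_distrib_left sum_divide_distrib mult_ac)
    also have "\<dots> = wt A f * \<Theta> f" using Z_pos[of "A - orb f w"] A unfolding Z_def[symmetric] by (simp add: subset_iff)
    finally show "(\<Sum>f'\<in>forests (A - orb f w). wt A f * wt (A - orb f w) f' * \<Theta> f / Z (A - orb f w)) = wt A f * \<Theta> f" .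
  qed
  finally show ?thesis unfolding ex_def[of A] J_def by simp
qed

section \<open>Resampling one outgoing edge, and harmonicity\<close>

lemma forest_cut:
  assumes f: "f \<in> forests A" and w: "w \<in> A"
  shows "f(w := w) \<in> forests (A - {w})" "w \<notin> orb (f(w := w)) (f w)"
proof -
  have "(\<lambda>x. if x \<in> {w} then x else f x) = f(w := w)" by auto
  then show "f(w := w) \<in> forests (A - {w})" using forests_restrict[OF f, of "{w}"] by simp
  show "w \<notin> orb (f(w := w)) (f w)"
  proof
    assume "w \<in> orb (f(w := w)) (f w)"
    moreover have "orb (f(w := w)) (f w) \<subseteq> orb f (f w)" by (rule orb_mono) auto
    ultimately have "f w = w" using forest_acyclic[OF f, of "f w" w] orb_step[OF orb_self, of f w] by blast
    then show False using forest_ne[OF f w] by simp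
  qed
qed

lemma forest_glue:
  assumes f: "f \<in> forests (A - {w})" and w: "w \<in> A" and y: "y \<in> B" "w \<notin> orb f y"
  shows "f(w := y) \<in> forests A"
  unfolding forests_def
proof (intro CollectI conjI ballI allI impI)
  fix S assume S: "S \<subseteq> A" "f(w := y) ` S \<subseteq> S"
  have "w \<notin> S"
  proof
    assume wS: "w \<in> S"
    then have "y \<in> S" using S by auto
    moreover have "orb f y = orb (f(w := y)) y" by (rule orb_cong) (use y in auto)
    ultimately have "orb f y \<subseteq> S" using orb_least S by metis
    then have "orb f y \<subseteq> A - {w}" using S y by auto
    then have "orb f y = {}" by (rule forestsD(3)[OF f]) (rule orb_closed)
    then show False using orb_self[of y f] by simp
  qed
  then have "f ` S \<subseteq> S" "S \<subseteq> A - {w}" using S by auto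
  then show "S = {}" using forestsD(3)[OF f] by blast
qed (use f w y in \<open>auto dest: forestsD\<close>)

text \<open>Resampling the outgoing edge of \<open>w\<close> is what makes hitting probabilities harmonic.\<close>

lemma cut_sum:
  assumes A: "A \<subseteq> B" and w: "w \<in> A"
  shows "(\<Sum>f\<in>forests A. wt A f * \<Theta> f) =
    (\<Sum>y\<in>B. \<Sum>f\<in>forests (A - {w}). C w y * wt (A - {w}) f * (of_bool (w \<notin> orb f y) * \<Theta> (f(w := y))))"
proof -
  have fin: "finite A" "finite (forests A)" "finite (forests (A - {w}))"
    using A finB finite_subset[OF A finB] by (auto intro!: finite_forests)
  let ?T = "{(y, f). y \<in> B \<and> f \<in> forests (A - {w}) \<and> w \<notin> orb f y}"
  have "(\<Sum>f\<in>forests A. wt A f * \<Theta> f) = (\<Sum>(y,f)\<in>?T. C w y * wt (A - {w}) f * \<Theta> (f(w := y)))"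
  proof (rule sum.reindex_bij_witness[of _ "\<lambda>(y,f). f(w := y)" "\<lambda>f. (f w, f(w := w))"], goal_cases)
    case (3 b) then show ?case by (auto dest!: forestsD(2)[of _ "A - {w}" w] simp: fun_upd_idem)
  next
    case (5 f)
    have "wt A f = C w (f w) * wt (A - {w}) (f(w := w))"
      unfolding wt_def using fin w by (subst prod.remove[of A w]) auto
    then show ?case by simp
  qed (use forest_cut w forest_glue forestsD(1) in auto)
  also have "\<dots> = (\<Sum>(y,f)\<in>B \<times> forests (A - {w}). C w y * wt (A - {w}) f * (of_bool (w \<notin> orb f y) * \<Theta> (f(w := y))))"
    by (rule sum.mono_neutral_cong_left) (use fin finB in auto)
  finally show ?thesis by (simp add: sum.cartesian_product)
qed

lemma orb_upd_absorb:
  assumes "f w = w" "w \<notin> orb f y"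
  shows "orb (f(w := y)) z = (if w \<in> orb f z then orb f z \<union> orb f y else orb f z)"
proof -
  have y: "orb (f(w := y)) y = orb f y" by (rule orb_cong[symmetric]) (use assms in auto)
  show ?thesis
  proof (cases "w \<in> orb f z")
    case True
    have 1: "orb f z \<subseteq> orb (f(w := y)) z" by (rule orb_mono) (use assms in auto)
    then have "w \<in> orb (f(w := y)) z" using True by auto
    then have "y \<in> orb (f(w := y)) z" using orb_step[of w "f(w := y)" z] by simp
    then have 2: "orb f y \<subseteq> orb (f(w := y)) z" using orb_trans y by metis
    have "orb (f(w := y)) z \<subseteq> orb f z \<union> orb f y"
    proof (rule orb_least)
      show "f(w := y) ` (orb f z \<union> orb f y) \<subseteq> orb f z \<union> orb f y" using orb_step[of _ f] by auto
    qed simp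
    then show ?thesis using 1 2 True by auto
  next
    case False
    have "orb f z = orb (f(w := y)) z" by (rule orb_cong) (use False in auto)
    then show ?thesis using False by auto
  qed
qed

text \<open>Cut the edge of \<open>w\<close> and choose two independent edges out of
  \<open>w\<close>, to \<open>y\<close> and to \<open>z\<close>: the first is the edge of the
  forest, the second leads to the starting point on the right-hand side. Both sides become sums over
  the same triples, and their difference changes sign when \<open>y\<close> and \<open>z\<close> are
  exchanged.\<close>

lemma harmonic:
  assumes A: "A \<subseteq> B" and w: "w \<in> A" and b: "b \<notin> A"
  shows "vertex_cond w * pr A (\<lambda>f. b \<in> orb f w) = (\<Sum>z\<in>B. C w z * pr A (\<lambda>f. b \<in> orb f z))"
proof -
  let ?F = "forests (A - {w})" and ?W = "wt (A - {w})"
  have L: "(\<Sum>f\<in>forests A. wt A f * of_bool (b \<in> orb f w)) =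
     (\<Sum>y\<in>B. \<Sum>f\<in>?F. C w y * ?W f * (of_bool (w \<notin> orb f y) * of_bool (b \<in> orb f y)))"
    apply (subst cut_sum[OF A w])
  proof (rule sum.cong[OF refl], rule sum.cong[OF refl], goal_cases)
    case (1 y f)
    have "f w = w" using forestsD(2)[OF 1(2)] by auto
    then show ?case using orb_upd_absorb[of f w y w] orb_fix[of f w] b w by auto
  qed
  have R: "(\<Sum>f\<in>forests A. wt A f * of_bool (b \<in> orb f z)) =
     (\<Sum>y\<in>B. \<Sum>f\<in>?F. C w y * ?W f * (of_bool (w \<notin> orb f y) *
        (if w \<in> orb f z then of_bool (b \<in> orb f y) else of_bool (b \<in> orb f z))))" for z
    apply (subst cut_sum[OF A w])
  proof (rule sum.cong[OF refl], rule sum.cong[OF refl], goal_cases)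
    case (1 y f)
    have fw: "f w = w" using forestsD(2)[OF 1(2)] by auto
    have "b \<notin> orb f z" if "w \<in> orb f z"
      using forest_exit_unique[OF 1(2) that] b w by auto
    then show ?case
      using orb_upd_absorb[of f w y z, OF fw]
      by (cases "w \<in> orb f y"; cases "w \<in> orb f z") simp_all
  qed
  have "(\<Sum>z\<in>B. C w z * (\<Sum>f\<in>forests A. wt A f * of_bool (b \<in> orb f z)))
     - vertex_cond w * (\<Sum>f\<in>forests A. wt A f * of_bool (b \<in> orb f w)) =
     (\<Sum>z\<in>B. \<Sum>y\<in>B. \<Sum>f\<in>?F. C w z * C w y * ?W f * (of_bool (w \<notin> orb f y) * of_bool (w \<notin> orb f z) * 
        (of_bool (b \<in> orb f z) - of_bool (b \<in> orb f y))))"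
  proof -
    have "vertex_cond w * (\<Sum>f\<in>forests A. wt A f * of_bool (b \<in> orb f w)) =
      (\<Sum>z\<in>B. \<Sum>y\<in>B. \<Sum>f\<in>?F. C w z * (C w y * ?W f * (of_bool (w \<notin> orb f y) * of_bool (b \<in> orb f y))))"
      unfolding L vertex_cond_def sum_distrib_right by (simp only: sum_distrib_left)
    moreover have "(\<Sum>z\<in>B. C w z * (\<Sum>f\<in>forests A. wt A f * of_bool (b \<in> orb f z))) =
      (\<Sum>z\<in>B. \<Sum>y\<in>B. \<Sum>f\<in>?F. C w z * (C w y * ?W f * (of_bool (w \<notin> orb f y) *
        (if w \<in> orb f z then of_bool (b \<in> orb f y) else of_bool (b \<in> orb f z)))))"
      unfolding R by (simp only: sum_distrib_left)
    ultimately show ?thesis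
      apply (simp only: sum_subtractf[symmetric])
      apply (rule sum.cong[OF refl], rule sum.cong[OF refl], rule sum.cong[OF refl])
      by (simp add: algebra_simps)
  qed
  also have "\<dots> = 0" (is "?X = 0")
  proof -
    have "?X = (\<Sum>z\<in>B. \<Sum>y\<in>B. \<Sum>f\<in>?F. C w y * C w z * ?W f * (of_bool (w \<notin> orb f z) * of_bool (w \<notin> orb f y) * 
        (of_bool (b \<in> orb f y) - of_bool (b \<in> orb f z))))"
      by (rule sum.swap)
    also have "\<dots> = - ?X" unfolding sum_negf[symmetric] by (intro sum.cong refl) (auto simp: algebra_simps)
    finally show ?thesis by simp
  qed
  finally have "vertex_cond w * (\<Sum>f\<in>forests A. wt A f * of_bool (b \<in> orb f w))
     = (\<Sum>z\<in>B. C w z * (\<Sum>f\<in>forests A. wt A f * of_bool (b \<in> orb f z)))" by simp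
  then show ?thesis unfolding pr_def ex_def by (simp add: sum_divide_distrib[symmetric])
qed

section \<open>Maximum principle, Green function and exit probabilities\<close>

lemma max_principle:
  assumes A: "A \<subseteq> B - {\<rho>}"
    and sub: "\<And>x. x \<in> A \<Longrightarrow> vertex_cond x * D x \<le> (\<Sum>z\<in>B. C x z * D z)"
    and bd: "\<And>x. x \<in> B - A \<Longrightarrow> D x \<le> m" and m: "m \<ge> 0"
    and x: "x \<in> B" shows "D x \<le> m"
proof (rule ccontr)
  assume n: "\<not> D x \<le> m"
  have finA: "finite A" using A finB finite_subset by fast
  have xA: "x \<in> A" using n bd x by blast
  define M where "M = Max (D ` A)"
  have le: "D y \<le> M" if "y \<in> A" for y unfolding M_def using finA that by auto
  have M: "M > m" using le[OF xA] n by auto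
  \<comment> \<open>An edge that leaves the set where the maximum is attained leads to a strictly
    smaller value, which contradicts the mean value inequality at its inner end.\<close>
  let ?S = "{y\<in>A. D y = M}"
  have "M \<in> D ` A" unfolding M_def using finA xA by (intro Max_in) auto
  then have "?S \<noteq> {}" by auto
  then obtain y z where yz: "y \<in> ?S" "z \<in> B - ?S" "C y z > 0" using leaving[of ?S] A by blast
  have leB: "D u \<le> M" if "u \<in> B" for u using le bd that M by (cases "u \<in> A") force+
  have "D z < M" using yz leB[of z] bd[of z] M by (cases "z \<in> A") auto
  then have "0 < C y z * (M - D z)" using yz by auto
  also have "\<dots> \<le> (\<Sum>u\<in>B. C y u * (M - D u))"
    by (rule member_le_sum) (use yz finB leB C_nonneg in auto)
  also have "\<dots> = vertex_cond y * D y - (\<Sum>u\<in>B. C y u * D u)"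
    using yz unfolding vertex_cond_def by (simp add: right_diff_distrib sum_subtractf sum_distrib_right)
  also have "\<dots> \<le> 0" using sub[of y] yz by auto
  finally show False by simp
qed

text \<open>The Green function of the walk killed outside \<open>A\<close>, divided by the
  conductance of \<open>y\<close>, as a ratio of forest weights in the spirit of the matrix-tree
  theorem. In this form its sign is evident and no Laplacian has to be inverted;
  \<open>green_eq\<close> identifies it.\<close>

definition green :: "'b set \<Rightarrow> 'b \<Rightarrow> 'b \<Rightarrow> real" where
  "green A y x = (if x \<in> A then pr (A - {y}) (\<lambda>f. y \<in> orb f x) * Z (A - {y}) / Z A else 0)"

lemma green_nonneg: "A \<subseteq> B - {\<rho>} \<Longrightarrow> green A y x \<ge> 0"
  unfolding green_def Z_def
  by (auto intro!: divide_nonneg_nonneg mult_nonneg_nonneg pr_nonneg sum_nonneg wt_nonneg)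

lemma green_eq:
  assumes A: "A \<subseteq> B - {\<rho>}" and x: "x \<in> A" and y: "y \<in> A"
  shows "vertex_cond x * green A y x = (\<Sum>z\<in>B. C x z * green A y z) + of_bool (x = y)"
proof -
  let ?p = "\<lambda>z. pr (A - {y}) (\<lambda>f. y \<in> orb f z)"
  have Ay: "A - {y} \<subseteq> B - {\<rho>}" using A by auto
  have p0: "?p z = 0" if "z \<notin> A" for z
  proof -
    have "?p z = pr (A - {y}) (\<lambda>f. False)" unfolding pr_def
    proof (rule ex_cong)
      fix f assume "f \<in> forests (A - {y})"
      then have "orb f z = {z}" by (rule forest_orb_out) (use that in auto)
      then show "of_bool (y \<in> orb f z) = (of_bool False :: real)" using that y by auto
    qed
    then show ?thesis by (simp add: pr_def ex_def)
  qed
  have g: "green A y z = ?p z * Z (A - {y}) / Z A" for z unfolding green_def using p0 by auto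
  have sum: "(\<Sum>z\<in>B. C x z * green A y z) = (\<Sum>z\<in>B. C x z * ?p z) * Z (A - {y}) / Z A"
    unfolding g by (simp add: sum_distrib_right sum_divide_distrib mult.assoc)
  have gx: "vertex_cond x * green A y x = vertex_cond x * ?p x * Z (A - {y}) / Z A" unfolding g by simp
  have zpos: "Z A > 0" "Z (A - {y}) > 0" using Z_pos A Ay by auto
  show ?thesis
  proof (cases "x = y")
    case False
    then have "vertex_cond x * ?p x = (\<Sum>z\<in>B. C x z * ?p z)" using x A by (intro harmonic) auto
    then show ?thesis unfolding sum gx using False by simp
  next
    case True
    \<comment> \<open>At the pole, cutting the edge of \<open>y\<close> counts the forests on
      \<open>A\<close> by the possible successors of \<open>y\<close> whose path does not return to
      \<open>y\<close>. This fixes the normalisation.\<close>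
    have "Z A = (\<Sum>z\<in>B. C y z * (\<Sum>f\<in>forests (A - {y}). wt (A - {y}) f * of_bool (y \<notin> orb f z)))"
      using cut_sum[of A y "\<lambda>_. 1"] A y unfolding Z_def by (auto simp: sum_distrib_left mult.assoc)
    also have "\<dots> = (\<Sum>z\<in>B. C y z * ((1 - ?p z) * Z (A - {y})))"
      unfolding sum_wt[OF Ay] pr_def[symmetric] pr_not[OF Ay] ..
    also have "\<dots> = (vertex_cond y - (\<Sum>z\<in>B. C y z * ?p z)) * Z (A - {y})"
      unfolding vertex_cond_def by (simp add: algebra_simps sum_subtractf sum_distrib_left sum_distrib_right)
    finally have "Z A = (vertex_cond y - (\<Sum>z\<in>B. C y z * ?p z)) * Z (A - {y})" .
    moreover have "?p y = 1" using ex_const[OF Ay, of 1] by (simp add: pr_def)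
    ultimately have "vertex_cond y * ?p y * Z (A - {y}) = (\<Sum>z\<in>B. C y z * ?p z) * Z (A - {y}) + Z A"
      by (simp only: left_diff_distrib)
    then show ?thesis unfolding sum gx using True zpos by (simp add: add_divide_distrib)
  qed
qed

definition boundary_cond :: "'b set \<Rightarrow> 'b \<Rightarrow> real" where "boundary_cond A x = (\<Sum>b\<in>B-A. C b x)"

lemma boundary_cond_nonneg: "boundary_cond A x \<ge> 0" unfolding boundary_cond_def by (intro sum_nonneg) (simp add: C_nonneg)

text \<open>Summation by parts: by the symmetry of \<open>C\<close> the edges inside
  \<open>A\<close> cancel, and only those across its boundary remain.\<close>

lemma flux:
  assumes A: "A \<subseteq> B"
  shows "(\<Sum>x\<in>A. boundary_cond A x * u x) = (\<Sum>x\<in>A. vertex_cond x * u x - (\<Sum>z\<in>A. C x z * u z))"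
proof -
  have finA: "finite A" using A finB finite_subset by fast
  have "vertex_cond x = boundary_cond A x + (\<Sum>z\<in>A. C z x)" for x
  proof -
    have "vertex_cond x = (\<Sum>z\<in>A. C x z) + (\<Sum>z\<in>B-A. C x z)"
      unfolding vertex_cond_def using A finB by (subst add.commute) (rule sum.subset_diff)
    then show ?thesis unfolding boundary_cond_def by (simp add: C_sym[of x])
  qed
  then have "(\<Sum>x\<in>A. vertex_cond x * u x) = (\<Sum>x\<in>A. boundary_cond A x * u x) + (\<Sum>x\<in>A. \<Sum>z\<in>A. C z x * u x)"
    by (simp add: distrib_right sum.distrib sum_distrib_right)
  also have "(\<Sum>x\<in>A. \<Sum>z\<in>A. C z x * u x) = (\<Sum>x\<in>A. \<Sum>z\<in>A. C x z * u z)" by (rule sum.swap)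
  finally show ?thesis by (simp add: sum_subtractf)
qed

text \<open>By reversibility the sum is the probability that the walk from \<open>y\<close>
  eventually leaves \<open>A\<close>. Consequently the flux of a potential through the boundary
  equals the total mass of its charge.\<close>

lemma green_flux:
  assumes A: "A \<subseteq> B - {\<rho>}" and y: "y \<in> A"
  shows "(\<Sum>x\<in>A. boundary_cond A x * green A y x) = 1"
proof -
  have finA: "finite A" using A finB finite_subset by fast
  have "(\<Sum>z\<in>A. C x z * green A y z) = (\<Sum>z\<in>B. C x z * green A y z)" for x
    by (rule sum.mono_neutral_left) (use A finB in \<open>auto simp: green_def\<close>)
  then have "(\<Sum>x\<in>A. vertex_cond x * green A y x - (\<Sum>z\<in>A. C x z * green A y z)) = (\<Sum>x\<in>A. of_bool (x = y))"
    using green_eq[OF A _ y] by (intro sum.cong) auto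
  then show ?thesis using finA y A flux[of A "green A y"] by (auto simp: subset_Diff_insert)
qed

definition hit :: "'b set \<Rightarrow> 'b \<Rightarrow> 'b \<Rightarrow> real" where "hit A b x = pr A (\<lambda>f. b \<in> orb f x)"

lemma hit_boundary: assumes "A \<subseteq> B - {\<rho>}" "x \<notin> A" shows "hit A b x = of_bool (x = b)"
proof -
  have "hit A b x = ex A (\<lambda>_. of_bool (x = b))" unfolding hit_def pr_def
    by (rule ex_cong) (use forest_orb_out assms in auto)
  then show ?thesis using ex_const[OF assms(1)] by simp
qed

lemma hit_nonneg: "hit A b x \<ge> 0" unfolding hit_def by (rule pr_nonneg)

lemma hit_harmonic: "A \<subseteq> B \<Longrightarrow> x \<in> A \<Longrightarrow> b \<notin> A \<Longrightarrow> vertex_cond x * hit A b x = (\<Sum>z\<in>B. C x z * hit A b z)"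
  unfolding hit_def by (rule harmonic)

text \<open>By reversibility the sum is the conductance between \<open>b\<close> and
  \<open>A\<close>. Later it bounds the contribution of an excursion of the root to the creation of
  new paths that end at \<open>b\<close>.\<close>

lemma hit_flux:
  assumes A: "A \<subseteq> B - {\<rho>}" and b: "b \<in> B - A"
  shows "(\<Sum>x\<in>A. boundary_cond A x * hit A b x) \<le> vertex_cond b"
proof -
  have finA: "finite A" using A finB finite_subset by fast
  have AB: "A \<subseteq> B" using A by auto
  have "(\<Sum>z\<in>B. C x z * hit A b z) = (\<Sum>z\<in>A. C x z * hit A b z) + C x b" for x
  proof -
    have "(\<Sum>z\<in>B. C x z * hit A b z) = (\<Sum>z\<in>B-A. C x z * hit A b z) + (\<Sum>z\<in>A. C x z * hit A b z)"
      by (rule sum.subset_diff[OF AB finB])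
    also have "(\<Sum>z\<in>B-A. C x z * hit A b z) = (\<Sum>z\<in>B-A. if z = b then C x b else 0)"
      by (intro sum.cong refl) (auto simp: hit_boundary[OF A])
    finally show ?thesis using b finB by (simp add: sum.delta)
  qed
  then have "(\<Sum>x\<in>A. vertex_cond x * hit A b x - (\<Sum>z\<in>A. C x z * hit A b z)) = (\<Sum>x\<in>A. C x b)"
    using hit_harmonic[OF AB, of _ b] b by (intro sum.cong) auto
  then have "(\<Sum>x\<in>A. boundary_cond A x * hit A b x) = (\<Sum>x\<in>A. C x b)"
    using flux[OF AB, of "hit A b"] by simp
  also have "\<dots> = (\<Sum>x\<in>A. C b x)" by (simp add: C_sym[of b])
  also have "\<dots> \<le> vertex_cond b" unfolding vertex_cond_def by (rule sum_mono2) (use AB finB C_nonneg in auto)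
  finally show ?thesis .
qed

lemma hit_le_super:
  assumes A: "A \<subseteq> B - {\<rho>}" and b: "b \<in> B - A"
    and sup: "\<And>x. x \<in> A \<Longrightarrow> (\<Sum>z\<in>B. C x z * u z) \<le> vertex_cond x * u x"
    and u: "\<And>x. x \<in> B \<Longrightarrow> u x \<ge> 0" "u b \<ge> 1" and x: "x \<in> B"
  shows "hit A b x \<le> u x"
proof -
  define D where "D = (\<lambda>x. hit A b x - u x)"
  have AB: "A \<subseteq> B" using A by auto
  have 1: "vertex_cond y * D y \<le> (\<Sum>z\<in>B. C y z * D z)" if y: "y \<in> A" for y
  proof -
    have "(\<Sum>z\<in>B. C y z * D z) = vertex_cond y * hit A b y - (\<Sum>z\<in>B. C y z * u z)"
      unfolding D_def right_diff_distrib sum_subtractf using hit_harmonic[OF AB y, of b] b by simp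
    then show ?thesis using sup[OF y] by (simp add: D_def right_diff_distrib)
  qed
  have 2: "D y \<le> 0" if "y \<in> B - A" for y
    using hit_boundary[OF A, of y b] u that by (auto simp: D_def)
  have "D x \<le> 0" by (rule max_principle[OF A 1 2 _ x]) auto
  then show ?thesis by (simp add: D_def)
qed

text \<open>Reveal the path of \<open>y\<close> first. \<open>\<Psi>\<close> depends on this path
  only, and the path of \<open>w\<close> contains \<open>y\<close> only if it meets the revealed
  path exactly at \<open>y\<close>. For a fixed revealed path \<open>K\<close> this is an exit
  probability of \<open>A - K\<close>, and \<open>u\<close> bounds it uniformly in
  \<open>K\<close>.\<close>

lemma two_point:
  assumes A: "A \<subseteq> B - {\<rho>}" and w: "w \<in> A" and y: "y \<in> A"
    and u: "\<And>K. y \<in> K \<Longrightarrow> hit (A - K) y w \<le> u" and \<Psi>0: "\<And>f. \<Psi> f \<ge> 0"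
    and \<Psi>: "\<And>f g. f \<in> forests A \<Longrightarrow> g \<in> forests A \<Longrightarrow> (\<And>x. x \<in> orb f y \<Longrightarrow> f x = g x) \<Longrightarrow> \<Psi> f = \<Psi> g"
  shows "ex A (\<lambda>f. of_bool (y \<in> orb f w) * \<Psi> f) \<le> u * ex A \<Psi>"
proof -
  have "ex A (\<lambda>f. of_bool (y \<in> orb f w) * \<Psi> f) \<le> ex A (\<lambda>f. u * \<Psi> f)"
    unfolding tower[OF A, of "\<lambda>f. of_bool (y \<in> orb f w) * \<Psi> f" y]
  proof (rule ex_mono)
    fix f assume f: "f \<in> forests A"
    let ?J = "\<lambda>f' x. if x \<in> orb f y then f x else f' x"
    have "ex (A - orb f y) (\<lambda>f'. of_bool (y \<in> orb (?J f') w) * \<Psi> (?J f')) \<le>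
        ex (A - orb f y) (\<lambda>f'. \<Psi> f * of_bool (y \<in> orb f' w))"
    proof (rule ex_mono)
      fix f' assume f': "f' \<in> forests (A - orb f y)"
      have J: "?J f' \<in> forests A" by (rule forests_join[OF f f'])
      have 1: "\<Psi> (?J f') = \<Psi> f" by (rule \<Psi>[symmetric, OF f J]) auto
      have oy: "orb (?J f') y = orb f y" by (rule orb_cong[symmetric]) auto
      have "y \<in> orb f' w" if h: "y \<in> orb (?J f') w"
      proof -
        obtain b where b: "b \<in> orb f' w" "b \<notin> A - orb f y" using forest_exit[OF f', of w] by blast
        have "y \<in> orb f' w \<or> y \<in> orb f b" using join_orbit[OF f f' b] h by blast
        moreover have "b = y" if yb: "y \<in> orb f b"
        proof -
          have "b \<in> A" using forest_orb_out[OF f, of b] yb y by (cases "b \<in> A") auto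
          then show ?thesis using forest_acyclic[OF f _ yb] b(2) by blast
        qed
        ultimately show ?thesis using b by auto
      qed
      then show "of_bool (y \<in> orb (?J f') w) * \<Psi> (?J f') \<le> \<Psi> f * of_bool (y \<in> orb f' w)"
        using 1 \<Psi>0[of f] by auto
    qed (use A in auto)
    also have "\<dots> = \<Psi> f * hit (A - orb f y) y w" unfolding ex_cmult hit_def pr_def ..
    also have "\<dots> \<le> u * \<Psi> f" using mult_right_mono[OF u[of "orb f y"] \<Psi>0[of f]] by (simp add: mult.commute)
    finally show "ex (A - orb f y) (\<lambda>f'. of_bool (y \<in> orb (?J f') w) * \<Psi> (?J f')) \<le> u * \<Psi> f" .
  qed (use A in auto)
  then show ?thesis by (simp add: ex_cmult)
qed

end

lemma orb_upd: "x \<notin> orb f u \<Longrightarrow> orb (f(x := b)) u = orb f u"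
  by (rule orb_cong[symmetric]) auto

lemma orb_upd_iff: "x \<in> orb (f(x := b)) u \<longleftrightarrow> x \<in> orb f u"
  using orb_upd[of x f u b] orb_upd[of x "f(x := b)" u "f x"] by auto

text \<open>Jensen's inequality for the concave function \<open>min 1\<close>, without normalising
  the weights.\<close>

lemma sum_min_le:
  fixes a Y :: "'a \<Rightarrow> real"
  assumes "finite I" "\<And>i. i \<in> I \<Longrightarrow> a i \<ge> 0"
  shows "(\<Sum>i\<in>I. a i * min 1 (Y i)) \<le> min (\<Sum>i\<in>I. a i) (\<Sum>i\<in>I. a i * Y i)"
proof -
  have "(\<Sum>i\<in>I. a i * min 1 (Y i)) \<le> (\<Sum>i\<in>I. a i * 1)" "(\<Sum>i\<in>I. a i * min 1 (Y i)) \<le> (\<Sum>i\<in>I. a i * Y i)"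
    using assms by (intro sum_mono mult_left_mono; simp)+
  then show ?thesis by simp
qed

context finite_net begin

section \<open>The chain that moves the root\<close>

text \<open>The complement of \<open>A\<close> is collapsed to \<open>\<rho>\<close>, but an edge from \<open>\<rho>\<close> remembers its end point in \<open>A\<close> and
  an edge into \<open>\<rho>\<close> its end point outside \<open>A\<close>. Elements of \<open>rooted A x\<close> are spanning trees with root \<open>x\<close>;
  a state of the chain is such a tree together with an edge out of \<open>x\<close>, that is, a function with
  exactly one cycle, which runs through \<open>x\<close>. A step moves the root along this cycle. It changes
  neither the function nor its weight, so the weights are stationary.\<close>

definition collapse :: "'b set \<Rightarrow> 'b \<Rightarrow> 'b" where "collapse A b = (if b \<in> A then b else \<rho>)"
definition targets :: "'b set \<Rightarrow> 'b \<Rightarrow> 'b set" where "targets A x = (if x = \<rho> then A else B)"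
definition out_cond :: "'b set \<Rightarrow> 'b \<Rightarrow> 'b \<Rightarrow> real" where "out_cond A x b = (if x = \<rho> then boundary_cond A b else C x b)"

definition rooted :: "'b set \<Rightarrow> 'b \<Rightarrow> ('b \<Rightarrow> 'b) set" where
  "rooted A x = {h. (\<forall>z\<in>insert \<rho> A - {x}. h z \<in> targets A z) \<and> (\<forall>z. z \<notin> insert \<rho> A - {x} \<longrightarrow> h z = z) \<and>
     (\<forall>S\<subseteq>insert \<rho> A - {x}. (\<lambda>z. collapse A (h z)) ` S \<subseteq> S \<longrightarrow> S = {})}"

definition rooted_wt :: "'b set \<Rightarrow> 'b \<Rightarrow> ('b \<Rightarrow> 'b) \<Rightarrow> real" where
  "rooted_wt A x h = (\<Prod>z\<in>insert \<rho> A - {x}. out_cond A z (h z))"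

definition chain_states :: "'b set \<Rightarrow> (('b \<Rightarrow> 'b) \<times> 'b) set" where
  "chain_states A = {(g, x). x \<in> insert \<rho> A \<and> g x \<in> targets A x \<and> g(x := x) \<in> rooted A x}"

definition chain_wt :: "'b set \<Rightarrow> ('b \<Rightarrow> 'b) \<Rightarrow> real" where
  "chain_wt A g = (\<Prod>z\<in>insert \<rho> A. out_cond A z (g z))"

lemma rootedD:
  assumes "h \<in> rooted A x"
  shows "z \<in> insert \<rho> A \<Longrightarrow> z \<noteq> x \<Longrightarrow> h z \<in> targets A z" "z \<notin> insert \<rho> A \<or> z = x \<Longrightarrow> h z = z"
    "S \<subseteq> insert \<rho> A - {x} \<Longrightarrow> (\<lambda>z. collapse A (h z)) ` S \<subseteq> S \<Longrightarrow> S = {}"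
  using assms unfolding rooted_def by auto

lemma out_cond_nonneg: "out_cond A x b \<ge> 0" unfolding out_cond_def using C_nonneg boundary_cond_nonneg by auto

lemma rooted_wt_nonneg: "rooted_wt A x h \<ge> 0" unfolding rooted_wt_def by (intro prod_nonneg) (simp add: out_cond_nonneg)

lemma rooted_rho: assumes "A \<subseteq> B - {\<rho>}" shows "rooted A \<rho> = forests A"
proof -
  have r: "insert \<rho> A - {\<rho>} = A" using assms by auto
  have "(\<lambda>z. collapse A (h z)) ` S \<subseteq> S \<longleftrightarrow> h ` S \<subseteq> S" if "S \<subseteq> A" for S h
  proof -
    have "collapse A (h z) \<in> S \<longleftrightarrow> h z \<in> S" for z using that assms by (auto simp: collapse_def)
    then show ?thesis by (simp add: image_subset_iff)
  qed
  moreover have "(\<forall>z\<in>A. h z \<in> targets A z) \<longleftrightarrow> (\<forall>z\<in>A. h z \<in> B)" for h using assms by (auto simp: targets_def)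
  ultimately show ?thesis unfolding rooted_def forests_def r by auto
qed

lemma rooted_wt_rho: assumes "A \<subseteq> B - {\<rho>}" shows "rooted_wt A \<rho> h = wt A h"
proof -
  have r: "insert \<rho> A - {\<rho>} = A" using assms by auto
  show ?thesis unfolding rooted_wt_def wt_def r by (rule prod.cong) (use assms in \<open>auto simp: out_cond_def\<close>)
qed

lemma finite_rooted: assumes "A \<subseteq> B" shows "finite (rooted A x)"
proof -
  let ?I = "insert \<rho> A"
  have "inj_on (\<lambda>f. restrict f ?I) (rooted A x)"
  proof (rule inj_onI)
    fix f g assume *: "f \<in> rooted A x" "g \<in> rooted A x" "restrict f ?I = restrict g ?I"
    show "f = g"
    proof
      fix z show "f z = g z"
        using rootedD(2)[OF *(1), of z] rootedD(2)[OF *(2), of z] fun_cong[OF *(3), of z]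
        by (cases "z \<in> ?I") (auto simp del: insert_iff)
    qed
  qed
  moreover have "(\<lambda>f. restrict f ?I) ` rooted A x \<subseteq> PiE ?I (\<lambda>_. insert x B)"
  proof
    fix f' assume "f' \<in> (\<lambda>f. restrict f ?I) ` rooted A x"
    then obtain f where f: "f \<in> rooted A x" "f' = restrict f ?I" by auto
    have "f z \<in> insert x B" if "z \<in> ?I" for z
      using rootedD(1)[OF f(1) that] rootedD(2)[OF f(1), of z] assms
      by (cases "z = x") (auto simp: targets_def split: if_splits)
    then show "f' \<in> PiE ?I (\<lambda>_. insert x B)" unfolding f(2) by (simp add: PiE_def Pi_def)
  qed
  moreover have "finite (PiE ?I (\<lambda>_. insert x B))"
    using assms finB finite_subset[OF assms finB] by (intro finite_PiE) auto
  ultimately show ?thesis using finite_subset inj_on_finite by blast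
qed

text \<open>A state splits into its root, a tree with that root and the edge out of the root, and
  the weight factors accordingly. Both sides of the stationarity identity are read through this
  splitting.\<close>

lemma chain_states_sum:
  assumes A: "A \<subseteq> B"
  shows "(\<Sum>(g,x)\<in>chain_states A. chain_wt A g * F g x) =
    (\<Sum>x\<in>insert \<rho> A. \<Sum>h\<in>rooted A x. \<Sum>b\<in>targets A x. rooted_wt A x h * out_cond A x b * F (h(x := b)) x)"
    and "finite (chain_states A)"
proof -
  have finA: "finite A" "finite (targets A x)" for x
    using A finB finite_subset[OF A finB] by (auto simp: targets_def)
  let ?T = "SIGMA x:insert \<rho> A. SIGMA h:rooted A x. targets A x"
  have finT: "finite ?T" using finA finite_rooted[OF A] by (intro finite_SigmaI) auto
  have id: "h(x := x) = h" if "h \<in> rooted A x" for h x using rootedD(2)[OF that, of x] by auto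
  have bij: "bij_betw (\<lambda>(x,h,b). (h(x := b), x)) ?T (chain_states A)"
    by (rule bij_betw_byWitness[of _ "\<lambda>(g,x). (x, g(x := x), g x)"]) (auto simp: chain_states_def id)
  then show "finite (chain_states A)" using finT bij_betw_finite by blast
  have "(\<Sum>(g,x)\<in>chain_states A. chain_wt A g * F g x) = (\<Sum>(x,h,b)\<in>?T. chain_wt A (h(x := b)) * F (h(x := b)) x)"
    using sum.reindex_bij_betw[OF bij, of "\<lambda>(g,x). chain_wt A g * F g x"] by (simp add: case_prod_unfold)
  also have "\<dots> = (\<Sum>(x,h,b)\<in>?T. rooted_wt A x h * out_cond A x b * F (h(x := b)) x)"
  proof (rule sum.cong[OF refl])
    fix p assume "p \<in> ?T"
    then obtain x h b where p: "p = (x, h, b)" and x: "x \<in> insert \<rho> A" by (cases p) blast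
    have "chain_wt A (h(x := b)) = out_cond A x b * rooted_wt A x h"
      unfolding chain_wt_def rooted_wt_def using finA x by (subst prod.remove[of _ x]) auto
    then show "(case p of (x, h, b) \<Rightarrow> chain_wt A (h(x := b)) * F (h(x := b)) x) =
      (case p of (x, h, b) \<Rightarrow> rooted_wt A x h * out_cond A x b * F (h(x := b)) x)" unfolding p by simp
  qed
  also have "\<dots> = (\<Sum>x\<in>insert \<rho> A. \<Sum>(h,b)\<in>(SIGMA h:rooted A x. targets A x). rooted_wt A x h * out_cond A x b * F (h(x := b)) x)"
    by (rule sum.Sigma[symmetric]) (use finA finite_rooted[OF A] in auto)
  also have "\<dots> = (\<Sum>x\<in>insert \<rho> A. \<Sum>h\<in>rooted A x. \<Sum>b\<in>targets A x. rooted_wt A x h * out_cond A x b * F (h(x := b)) x)"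
    by (rule sum.cong[OF refl], rule sum.Sigma[symmetric]) (use finA finite_rooted[OF A] in auto)
  finally show "(\<Sum>(g,x)\<in>chain_states A. chain_wt A g * F g x) = \<dots>" .
qed

lemma chain_states_move:
  assumes "(g, x) \<in> chain_states A" shows "(g, collapse A (g x)) \<in> chain_states A"
proof -
  let ?y = "collapse A (g x)"
  have x: "x \<in> insert \<rho> A" "g x \<in> targets A x" and r: "g(x := x) \<in> rooted A x" using assms by (auto simp: chain_states_def)
  have y: "?y \<in> insert \<rho> A" by (auto simp: collapse_def)
  have targets: "g z \<in> targets A z" if "z \<in> insert \<rho> A" for z
    using rootedD(1)[OF r that] x(2) by (cases "z = x") simp_all
  have "g(?y := ?y) \<in> rooted A ?y" unfolding rooted_def
  proof (intro CollectI conjI ballI allI impI)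
    fix z assume z: "z \<notin> insert \<rho> A - {?y}"
    show "(g(?y := ?y)) z = z"
    proof (cases "z = ?y")
      case False
      then have "z \<notin> insert \<rho> A" using z by blast
      moreover from this have "z \<noteq> x" using x(1) by blast
      ultimately show ?thesis using rootedD(2)[OF r, of z] False by simp
    qed simp
  next
    fix S assume S: "S \<subseteq> insert \<rho> A - {?y}" "(\<lambda>z. collapse A ((g(?y := ?y)) z)) ` S \<subseteq> S"
    have c: "collapse A (g z) \<in> S" if "z \<in> S" for z
    proof -
      have "z \<noteq> ?y" using S that by auto
      moreover have "collapse A ((g(?y := ?y)) z) \<in> S" using S(2) that by blast
      ultimately show ?thesis by simp
    qed
    have "x \<notin> S" using c[of x] S(1) by auto
    then show "S = {}"
    proof (intro rootedD(3)[OF r])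
      assume xS: "x \<notin> S"
      show "S \<subseteq> insert \<rho> A - {x}" using xS S(1) by blast
      show "(\<lambda>z. collapse A ((g(x := x)) z)) ` S \<subseteq> S"
      proof (rule image_subsetI)
        fix z assume "z \<in> S"
        moreover from this have "z \<noteq> x" using xS by blast
        ultimately show "collapse A ((g(x := x)) z) \<in> S" using c by simp
      qed
    qed
  next
    fix z assume "z \<in> insert \<rho> A - {?y}"
    then show "(g(?y := ?y)) z \<in> targets A z" using targets[of z] by simp
  qed
  then show ?thesis using targets[OF y] y by (simp add: chain_states_def del: insert_iff)
qed

text \<open>All possible roots of \<open>g\<close> lie on its only cycle, since an orbit that misses
  the root would be a nonempty invariant set in a rooted tree. On a finite set that the successor
  map sends onto itself, this map is injective.\<close>

lemma chain_states_move_inj: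
  assumes A: "A \<subseteq> B" and "(g, x) \<in> chain_states A" "(g, x') \<in> chain_states A" "collapse A (g x) = collapse A (g x')"
  shows "x = x'"
proof -
  define s where "s = (\<lambda>z. collapse A (g z))"
  let ?O = "orb s (s x)"
  have sub: "?O \<subseteq> insert \<rho> A" by (rule orb_least) (auto simp: s_def collapse_def)
  have mem: "z \<in> ?O" if "(g, z) \<in> chain_states A" for z
  proof (rule ccontr)
    assume z: "z \<notin> ?O"
    have "?O = {}"
    proof (rule rootedD(3))
      show "g(z := z) \<in> rooted A z" using that by (simp add: chain_states_def)
      show "?O \<subseteq> insert \<rho> A - {z}" using sub z by blast
      show "(\<lambda>u. collapse A ((g(z := z)) u)) ` ?O \<subseteq> ?O"
      proof (rule image_subsetI)
        fix u assume u: "u \<in> ?O"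
        then have "u \<noteq> z" using z by auto
        then show "collapse A ((g(z := z)) u) \<in> ?O" using orb_step[OF u] by (simp add: s_def)
      qed
    qed
    then show False using orb_self[of "s x" s] by simp
  qed
  have "finite A" using A finB finite_subset by blast
  then have fin: "finite ?O" using sub finite_subset by blast
  have "insert (s x) (s ` ?O) = s ` ?O"
    by (rule insert_absorb, rule imageI, rule mem[OF assms(2)])
  moreover have "?O = insert (s x) (s ` ?O)"
    using orb_insert[of s "s x"] unfolding orb_image[of s "s x"] .
  ultimately have "card (s ` ?O) = card ?O" by (metis (no_types))
  then have "inj_on s ?O" by (rule eq_card_imp_inj_on[OF fin])
  moreover have "s x = s x'" using assms(4) by (simp add: s_def)
  ultimately show ?thesis using mem[OF assms(2)] mem[OF assms(3)] by (rule inj_onD)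
qed

lemma chain_stationary:
  assumes A: "A \<subseteq> B"
  shows "(\<Sum>(g,x)\<in>chain_states A. chain_wt A g * \<Phi> g (collapse A (g x))) = (\<Sum>(g,x)\<in>chain_states A. chain_wt A g * \<Phi> g x)"
proof -
  let ?T = "\<lambda>(g,x). (g, collapse A (g x))"
  have inj: "inj_on ?T (chain_states A)"
    by (rule inj_onI) (use chain_states_move_inj[OF A] in auto)
  have "?T ` chain_states A \<subseteq> chain_states A" using chain_states_move by auto
  then have "?T ` chain_states A = chain_states A" using endo_inj_surj[OF chain_states_sum(2)[OF A] _ inj] by blast
  then have "bij_betw ?T (chain_states A) (chain_states A)" using inj by (simp add: bij_betw_def)
  from sum.reindex_bij_betw[OF this, of "\<lambda>(g,x). chain_wt A g * \<Phi> g x"]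
  show ?thesis by (simp add: case_prod_unfold)
qed

section \<open>Excursions of the root from the collapsed boundary\<close>

definition boundary_total :: "'b set \<Rightarrow> real" where "boundary_total A = (\<Sum>b\<in>A. boundary_cond A b)"

lemma boundary_total_nonneg: "boundary_total A \<ge> 0" unfolding boundary_total_def by (intro sum_nonneg) (simp add: boundary_cond_nonneg)

text \<open>If \<open>\<Phi>\<close> ignores the edge out of the root and does not increase on
  average while the root walks inside \<open>A\<close>, then stationarity forces its mean not to
  decrease in the step that leaves \<open>\<rho>\<close>. In this way the two ends of an excursion
  are compared without introducing trajectories of the chain.\<close>

lemma excursion_step:
  assumes A: "A \<subseteq> B - {\<rho>}"
    and ind: "\<And>h x b. x \<in> insert \<rho> A \<Longrightarrow> h \<in> rooted A x \<Longrightarrow> \<Phi> (h(x := b)) x = \<Phi> h x"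
    and sub: "\<And>x h. x \<in> A \<Longrightarrow> h \<in> rooted A x \<Longrightarrow> (\<Sum>b\<in>B. C x b * \<Phi> (h(x := b)) (collapse A b)) \<le> vertex_cond x * \<Phi> h x"
  shows "boundary_total A * ex A (\<lambda>f. \<Phi> f \<rho>) \<le> ex A (\<lambda>f. \<Sum>b\<in>A. boundary_cond A b * \<Phi> (f(\<rho> := b)) b)"
proof -
  have AB: "A \<subseteq> B" and nr: "\<rho> \<notin> A" and finA: "finite A" using A finB finite_subset by auto
  define L where "L x = (\<Sum>h\<in>rooted A x. \<Sum>b\<in>targets A x. rooted_wt A x h * out_cond A x b * \<Phi> (h(x := b)) (collapse A b))" for x
  define R where "R x = (\<Sum>h\<in>rooted A x. \<Sum>b\<in>targets A x. rooted_wt A x h * out_cond A x b * \<Phi> (h(x := b)) x)" for x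
  have "(\<Sum>x\<in>insert \<rho> A. L x) = (\<Sum>x\<in>insert \<rho> A. R x)"
    using chain_stationary[OF AB, of \<Phi>] chain_states_sum(1)[OF AB, of "\<lambda>g x. \<Phi> g (collapse A (g x))"] chain_states_sum(1)[OF AB, of \<Phi>]
    unfolding L_def R_def by simp
  then have eq: "L \<rho> + sum L A = R \<rho> + sum R A" using nr finA by simp
  have "L x \<le> R x" if x: "x \<in> A" for x
  proof -
    have xr: "x \<noteq> \<rho>" using x nr by auto
    have "(\<Sum>b\<in>B. rooted_wt A x h * C x b * \<Phi> (h(x := b)) (collapse A b)) \<le> (\<Sum>b\<in>B. rooted_wt A x h * C x b * \<Phi> (h(x := b)) x)"
      if h: "h \<in> rooted A x" for h
    proof -
      have "(\<Sum>b\<in>B. rooted_wt A x h * C x b * \<Phi> (h(x := b)) (collapse A b)) = rooted_wt A x h * (\<Sum>b\<in>B. C x b * \<Phi> (h(x := b)) (collapse A b))"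
        by (simp add: sum_distrib_left mult.assoc)
      also have "\<dots> \<le> rooted_wt A x h * (vertex_cond x * \<Phi> h x)" by (intro mult_left_mono sub x h rooted_wt_nonneg)
      also have "\<dots> = (\<Sum>b\<in>B. rooted_wt A x h * C x b * \<Phi> h x)"
        by (simp add: vertex_cond_def sum_distrib_left sum_distrib_right mult.assoc)
      finally show ?thesis using ind[of x h] x h by simp
    qed
    then show ?thesis unfolding L_def R_def targets_def out_cond_def using xr by (simp add: sum_mono)
  qed
  then have "sum L A \<le> sum R A" by (rule sum_mono)
  then have le: "R \<rho> \<le> L \<rho>" using eq by simp
  have Rr: "R \<rho> = (\<Sum>f\<in>forests A. wt A f * (boundary_total A * \<Phi> f \<rho>))"
    unfolding R_def rooted_rho[OF A] rooted_wt_rho[OF A]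
  proof (rule sum.cong[OF refl])
    fix f assume f: "f \<in> forests A"
    then have "\<Phi> (f(\<rho> := b)) \<rho> = \<Phi> f \<rho>" for b using ind[of \<rho> f b] rooted_rho[OF A] by auto
    then show "(\<Sum>b\<in>targets A \<rho>. wt A f * out_cond A \<rho> b * \<Phi> (f(\<rho> := b)) \<rho>) = wt A f * (boundary_total A * \<Phi> f \<rho>)"
      by (simp add: targets_def out_cond_def boundary_total_def sum_distrib_left sum_distrib_right mult.assoc)
  qed
  have Lr: "L \<rho> = (\<Sum>f\<in>forests A. wt A f * (\<Sum>b\<in>A. boundary_cond A b * \<Phi> (f(\<rho> := b)) b))"
    unfolding L_def rooted_rho[OF A] rooted_wt_rho[OF A]
    by (intro sum.cong refl) (simp add: targets_def out_cond_def collapse_def sum_distrib_left mult.assoc)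
  have "R \<rho> / Z A \<le> L \<rho> / Z A" using le Z_pos[OF A] by (simp add: divide_right_mono)
  then show ?thesis unfolding Rr Lr ex_cmult[symmetric] unfolding ex_def .
qed

text \<open>When \<open>v\<close> lies outside \<open>A\<close>, it is the end of the path of
  \<open>u\<close>, so that \<open>w\<close> lies between \<open>u\<close> and
  \<open>v\<close>.\<close>

definition active :: "'b set \<Rightarrow> 'b \<Rightarrow> ('b \<Rightarrow> 'b \<Rightarrow> bool) \<Rightarrow> ('b \<Rightarrow> 'b) \<Rightarrow> 'b \<Rightarrow> bool" where
  "active A v Far f w \<longleftrightarrow> (\<exists>u\<in>A. Far u w \<and> w \<in> orb f u \<and> v \<in> orb f u)"

text \<open>This is \<open>active\<close> for a state of the chain with root \<open>x\<close>; the root must not have interrupted the path to \<open>v\<close>.\<close>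

definition active_off :: "'b set \<Rightarrow> 'b \<Rightarrow> ('b \<Rightarrow> 'b \<Rightarrow> bool) \<Rightarrow> 'b \<Rightarrow> ('b \<Rightarrow> 'b) \<Rightarrow> 'b \<Rightarrow> bool" where
  "active_off A v Far x h w \<longleftrightarrow> (\<exists>u\<in>A. Far u w \<and> w \<in> orb (h(\<rho> := \<rho>)) u \<and> v \<in> orb (h(\<rho> := \<rho>)) u \<and> x \<notin> orb (h(\<rho> := \<rho>)) u)"

text \<open>The root is not on the path in question, so the edge out of the root does not affect it.
  Setting the value at \<open>\<rho>\<close> to \<open>\<rho>\<close> stops all paths at the
  boundary.\<close>

lemma active_off_upd:
  shows "active_off A v Far x (h(x := b)) w \<longleftrightarrow> active_off A v Far x h w"
    and "active_off A v Far x h w \<Longrightarrow> orb ((h(x := b))(\<rho> := \<rho>)) w = orb (h(\<rho> := \<rho>)) w"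
proof -
  let ?f = "h(\<rho> := \<rho>)" and ?g = "(h(x := b))(\<rho> := \<rho>)"
  have *: "?g = ?f \<or> ?g = ?f(x := b)" by (cases "x = \<rho>") (auto simp: fun_upd_twist)
  have iff: "x \<in> orb ?g u \<longleftrightarrow> x \<in> orb ?f u" for u using * orb_upd_iff[of x ?f b u] by metis
  have eq: "orb ?g u = orb ?f u" if "x \<notin> orb ?f u" for u using * orb_upd[OF that, of b] by metis
  show "active_off A v Far x (h(x := b)) w \<longleftrightarrow> active_off A v Far x h w"
    unfolding active_off_def using iff eq by metis
  show "orb ?g w = orb ?f w" if ra: "active_off A v Far x h w"
  proof -
    obtain u where "w \<in> orb ?f u" "x \<notin> orb ?f u" using ra unfolding active_off_def by blast
    then have "x \<notin> orb ?f w" using orb_trans[of w ?f u] by auto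
    then show ?thesis by (rule eq)
  qed
qed

text \<open>When the root leaves \<open>x\<close>, the edge from \<open>x\<close> to
  \<open>b\<close> becomes part of the tree. A path to \<open>v\<close> through \<open>x\<close>
  would continue to \<open>b\<close>: if \<open>b\<close> is in \<open>A\<close>, the new root
  interrupts it there; if not, the path ends at \<open>b\<close>, which is not \<open>v\<close>.
  Hence a move creates active paths only when \<open>b\<close> is \<open>v\<close>.\<close>

lemma active_off_move:
  assumes A: "A \<subseteq> B - {\<rho>}" and v: "v \<notin> A" "v \<noteq> \<rho>" and x: "x \<in> A" and h: "h \<in> rooted A x" and b: "b \<noteq> v"
    and active: "active_off A v Far (collapse A b) (h(x := b)) w"
  shows "active_off A v Far x h w \<and> orb ((h(x := b))(\<rho> := \<rho>)) w = orb (h(\<rho> := \<rho>)) w"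
proof -
  let ?g = "(h(x := b))(\<rho> := \<rho>)"
  obtain u where u: "u \<in> A" "Far u w" "w \<in> orb ?g u" "v \<in> orb ?g u" "collapse A b \<notin> orb ?g u"
    using active unfolding active_off_def by blast
  have xr: "x \<noteq> \<rho>" using A x by auto
  have "x \<notin> orb ?g u"
  proof
    assume "x \<in> orb ?g u"
    then have bu: "b \<in> orb ?g u" using orb_step[of x ?g u] xr by simp
    have "b \<notin> A" using u(5) bu by (auto simp: collapse_def)
    then have "?g b = b" using rootedD(2)[OF h, of b] x by auto
    moreover have "?g v = v" using rootedD(2)[OF h, of v] v x by auto
    ultimately show False using orb_fix_unique[OF bu u(4)] b by simp
  qed
  then have "active_off A v Far x (h(x := b)) w" unfolding active_off_def using u by blast
  then show ?thesis using active_off_upd[where x=x and A=A and v=v and Far=Far and h=h and b=b and w=w] by auto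
qed

text \<open>One excursion costs at most the conductance of \<open>v\<close> for the paths that it
  creates, while each old path keeps the factor one minus the boundary average of
  \<open>\<phi>\<close>, where \<open>\<phi> K x\<close> is a subharmonic lower bound for the
  probability of hitting \<open>K\<close> from \<open>x\<close>. The weight \<open>s\<close> is
  arbitrary so that the estimate can be iterated.\<close>

lemma excursion_step_act:
  assumes A: "A \<subseteq> B - {\<rho>}" and v: "v \<in> B - A" "v \<noteq> \<rho>"
    and s: "\<And>K. 0 \<le> s K"
    and phi1: "\<And>K x. \<phi> K x \<le> (1::real)" and phi0: "\<And>K x. x \<notin> A \<Longrightarrow> \<phi> K x = 0"
    and phisub: "\<And>K x. x \<in> A \<Longrightarrow> x \<notin> K \<Longrightarrow> vertex_cond x * \<phi> K x \<le> (\<Sum>b\<in>B. C x b * \<phi> K b)"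
  shows "boundary_total A * ex A (\<lambda>f. min 1 (\<Sum>w\<in>S. of_bool (active A v Far f w) * s (orb f w))) \<le>
     vertex_cond v + boundary_total A * ex A (\<lambda>f. min 1 (\<Sum>w\<in>S. of_bool (active A v Far f w) * (s (orb f w) *
        (1 - (\<Sum>b\<in>A. boundary_cond A b * \<phi> (orb f w) b) / boundary_total A))))"
proof -
  have AB: "A \<subseteq> B" and nr: "\<rho> \<notin> A" and finA: "finite A" using A finB finite_subset by auto
  define Y where "Y x h b = (\<Sum>w\<in>S. of_bool (active_off A v Far x h w) * (s (orb (h(\<rho> := \<rho>)) w) * (1 - \<phi> (orb (h(\<rho> := \<rho>)) w) b)))" for x h b
  have Y0: "Y x h b \<ge> 0" for x h b unfolding Y_def
    by (intro sum_nonneg mult_nonneg_nonneg s) (auto simp: phi1)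
  \<comment> \<open>The first term pays for an excursion that ends through an edge to
    \<open>v\<close> and may create paths without control. The second counts the present paths, each
    discounted by the chance that the root, walking on from \<open>x\<close>, will hit it.\<close>
  define \<Phi> where "\<Phi> h x = (if x \<in> A then hit A v x else 0) + min 1 (Y x h x)" for h x
  have actr: "active_off A v Far \<rho> f w \<longleftrightarrow> active A v Far f w" "f(\<rho> := \<rho>) = f" if f: "f \<in> forests A" for f w
  proof -
    show ff: "f(\<rho> := \<rho>) = f" using forestsD(2)[OF f nr] by auto
    have "\<rho> \<notin> orb f u" if "v \<in> orb f u" for u
      using forest_exit_unique[OF f that, of \<rho>] v nr by auto
    then show "active_off A v Far \<rho> f w \<longleftrightarrow> active A v Far f w" unfolding active_off_def active_def ff by blast
  qed
  have step: "boundary_total A * ex A (\<lambda>f. \<Phi> f \<rho>) \<le> ex A (\<lambda>f. \<Sum>b\<in>A. boundary_cond A b * \<Phi> (f(\<rho> := b)) b)"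
  proof (rule excursion_step[OF A])
    fix h x b assume "x \<in> insert \<rho> A" "h \<in> rooted A x"
    have "Y x (h(x := b)) x = Y x h x" unfolding Y_def
      by (rule sum.cong[OF refl]) (use active_off_upd[where x=x and A=A and v=v and Far=Far and h=h and b=b] in auto)
    then show "\<Phi> (h(x := b)) x = \<Phi> h x" unfolding \<Phi>_def by simp
  next
    fix x h assume x: "x \<in> A" and h: "h \<in> rooted A x"
    have le: "\<Phi> (h(x := b)) (collapse A b) \<le> hit A v b + min 1 (Y x h b)" if bB: "b \<in> B" for b
    proof (cases "b = v")
      case True
      \<comment> \<open>The root leaves through an edge to \<open>v\<close>: the exit probability
        has grown to one and dominates the truncated sum.\<close>
      then have "collapse A b = \<rho>" "hit A v b = 1" using v hit_boundary[OF A, of b v] by (auto simp: collapse_def)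
      then show ?thesis using nr Y0[of x h b] unfolding \<Phi>_def by auto
    next
      case False
      have 1: "(if collapse A b \<in> A then hit A v (collapse A b) else 0) = hit A v b"
        using hit_boundary[OF A, of b v] False nr by (auto simp: collapse_def)
      have 2: "\<phi> K (collapse A b) = \<phi> K b" for K using phi0[of b K] phi0[OF nr, of K] by (auto simp: collapse_def)
      have "Y (collapse A b) (h(x := b)) (collapse A b) \<le> Y x h b" unfolding Y_def
      proof (rule sum_mono)
        fix w
        have v': "v \<notin> A" using v by auto
        show "of_bool (active_off A v Far (collapse A b) (h(x := b)) w) * (s (orb ((h(x := b))(\<rho> := \<rho>)) w) * (1 - \<phi> (orb ((h(x := b))(\<rho> := \<rho>)) w) (collapse A b)))
          \<le> of_bool (active_off A v Far x h w) * (s (orb (h(\<rho> := \<rho>)) w) * (1 - \<phi> (orb (h(\<rho> := \<rho>)) w) b))"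
        proof (cases "active_off A v Far (collapse A b) (h(x := b)) w")
          case True
          then show ?thesis using active_off_move[OF A v' v(2) x h False True] by (simp add: 2)
        next
          case False
          then show ?thesis using s[of "orb (h(\<rho> := \<rho>)) w"] phi1[of "orb (h(\<rho> := \<rho>)) w" b] by simp
        qed
      qed
      then show ?thesis unfolding \<Phi>_def 1 by simp
    qed
    have "(\<Sum>b\<in>B. C x b * \<Phi> (h(x := b)) (collapse A b)) \<le> (\<Sum>b\<in>B. C x b * (hit A v b + min 1 (Y x h b)))"
      by (intro sum_mono mult_left_mono le C_nonneg)
    also have "\<dots> = (\<Sum>b\<in>B. C x b * hit A v b) + (\<Sum>b\<in>B. C x b * min 1 (Y x h b))"
      by (simp add: distrib_left sum.distrib)
    also have "(\<Sum>b\<in>B. C x b * hit A v b) = vertex_cond x * hit A v x" using hit_harmonic[OF AB x, of v] v by simp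
    also have "(\<Sum>b\<in>B. C x b * min 1 (Y x h b)) \<le> min (vertex_cond x) (\<Sum>b\<in>B. C x b * Y x h b)"
      unfolding vertex_cond_def by (rule sum_min_le) (auto simp: finB C_nonneg)
    also have "(\<Sum>b\<in>B. C x b * Y x h b) \<le> vertex_cond x * Y x h x"
    proof -
      have "(\<Sum>b\<in>B. C x b * Y x h b) = (\<Sum>w\<in>S. of_bool (active_off A v Far x h w) * (s (orb (h(\<rho> := \<rho>)) w) * (\<Sum>b\<in>B. C x b * (1 - \<phi> (orb (h(\<rho> := \<rho>)) w) b))))"
        unfolding Y_def sum_distrib_left by (subst sum.swap) (simp add: mult_ac)
      also have "\<dots> \<le> (\<Sum>w\<in>S. of_bool (active_off A v Far x h w) * (s (orb (h(\<rho> := \<rho>)) w) * (vertex_cond x * (1 - \<phi> (orb (h(\<rho> := \<rho>)) w) x))))"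
      proof (rule sum_mono)
        fix w
        show "of_bool (active_off A v Far x h w) * (s (orb (h(\<rho> := \<rho>)) w) * (\<Sum>b\<in>B. C x b * (1 - \<phi> (orb (h(\<rho> := \<rho>)) w) b))) \<le>
          of_bool (active_off A v Far x h w) * (s (orb (h(\<rho> := \<rho>)) w) * (vertex_cond x * (1 - \<phi> (orb (h(\<rho> := \<rho>)) w) x)))"
        proof (cases "active_off A v Far x h w")
          case True
          then obtain u where "w \<in> orb (h(\<rho> := \<rho>)) u" "x \<notin> orb (h(\<rho> := \<rho>)) u" unfolding active_off_def by blast
          then have nx: "x \<notin> orb (h(\<rho> := \<rho>)) w" using orb_trans[of w "h(\<rho> := \<rho>)" u] by auto
          have "(\<Sum>b\<in>B. C x b * (1 - \<phi> (orb (h(\<rho> := \<rho>)) w) b)) = vertex_cond x - (\<Sum>b\<in>B. C x b * \<phi> (orb (h(\<rho> := \<rho>)) w) b)"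
            unfolding vertex_cond_def by (simp add: right_diff_distrib sum_subtractf)
          also have "\<dots> \<le> vertex_cond x * (1 - \<phi> (orb (h(\<rho> := \<rho>)) w) x)" using phisub[OF x nx] by (simp add: right_diff_distrib)
          finally show ?thesis using s by (intro mult_left_mono) auto
        qed simp
      qed
      also have "\<dots> = vertex_cond x * Y x h x" unfolding Y_def sum_distrib_left by (simp add: mult_ac)
      finally show ?thesis .
    qed
    also have "min (vertex_cond x) (vertex_cond x * Y x h x) = vertex_cond x * min 1 (Y x h x)"
      using sum_nonneg[of B "C x"] C_nonneg unfolding vertex_cond_def[symmetric] by (simp add: min_mult_distrib_left)
    finally show "(\<Sum>b\<in>B. C x b * \<Phi> (h(x := b)) (collapse A b)) \<le> vertex_cond x * \<Phi> h x"
      using x unfolding \<Phi>_def by (simp add: distrib_left)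
  qed
  have L: "ex A (\<lambda>f. \<Phi> f \<rho>) = ex A (\<lambda>f. min 1 (\<Sum>w\<in>S. of_bool (active A v Far f w) * s (orb f w)))"
    by (rule ex_cong) (use nr in \<open>simp add: \<Phi>_def Y_def actr phi0\<close>)
  let ?q = "\<lambda>f w. of_bool (active A v Far f w) * (s (orb f w) * (1 - (\<Sum>b\<in>A. boundary_cond A b * \<phi> (orb f w) b) / boundary_total A))"
  have "ex A (\<lambda>f. \<Sum>b\<in>A. boundary_cond A b * \<Phi> (f(\<rho> := b)) b) \<le> ex A (\<lambda>f. vertex_cond v + boundary_total A * min 1 (\<Sum>w\<in>S. ?q f w))"
  proof (rule ex_mono[OF AB])
    fix f assume f: "f \<in> forests A"
    let ?Y = "\<lambda>b. \<Sum>w\<in>S. of_bool (active A v Far f w) * (s (orb f w) * (1 - \<phi> (orb f w) b))"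
    have "\<Phi> (f(\<rho> := b)) b \<le> hit A v b + min 1 (?Y b)" if b: "b \<in> A" for b
    proof -
      have 1: "(f(\<rho> := b))(\<rho> := \<rho>) = f" using actr(2)[OF f] by simp
      have "Y b (f(\<rho> := b)) b \<le> ?Y b" unfolding Y_def 1
      proof (rule sum_mono, rule mult_right_mono)
        fix w show "of_bool (active_off A v Far b (f(\<rho> := b)) w) \<le> (of_bool (active A v Far f w)::real)"
          unfolding active_off_def active_def 1 by auto
        show "0 \<le> s (orb f w) * (1 - \<phi> (orb f w) b)" using s phi1 by simp
      qed
      then show ?thesis unfolding \<Phi>_def using b by simp
    qed
    then have "(\<Sum>b\<in>A. boundary_cond A b * \<Phi> (f(\<rho> := b)) b) \<le> (\<Sum>b\<in>A. boundary_cond A b * (hit A v b + min 1 (?Y b)))"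
      by (intro sum_mono mult_left_mono boundary_cond_nonneg) auto
    also have "\<dots> = (\<Sum>b\<in>A. boundary_cond A b * hit A v b) + (\<Sum>b\<in>A. boundary_cond A b * min 1 (?Y b))"
      by (simp add: distrib_left sum.distrib)
    also have "(\<Sum>b\<in>A. boundary_cond A b * hit A v b) \<le> vertex_cond v" by (rule hit_flux[OF A v(1)])
    also have "(\<Sum>b\<in>A. boundary_cond A b * min 1 (?Y b)) \<le> min (boundary_total A) (\<Sum>b\<in>A. boundary_cond A b * ?Y b)"
      unfolding boundary_total_def by (rule sum_min_le) (auto simp: finA boundary_cond_nonneg)
    also have "\<dots> \<le> boundary_total A * min 1 (\<Sum>w\<in>S. ?q f w)"
    proof (cases "boundary_total A = 0")
      case True
      then show ?thesis by simp
    next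
      case False
      have "(\<Sum>b\<in>A. boundary_cond A b * ?Y b) = (\<Sum>w\<in>S. of_bool (active A v Far f w) * (s (orb f w) * (\<Sum>b\<in>A. boundary_cond A b * (1 - \<phi> (orb f w) b))))"
        unfolding sum_distrib_left by (subst sum.swap) (simp add: mult_ac)
      also have "\<dots> = (\<Sum>w\<in>S. boundary_total A * ?q f w)"
      proof (rule sum.cong[OF refl])
        fix w
        have "(\<Sum>b\<in>A. boundary_cond A b * (1 - \<phi> (orb f w) b)) = boundary_total A * (1 - (\<Sum>b\<in>A. boundary_cond A b * \<phi> (orb f w) b) / boundary_total A)"
          using False by (simp add: right_diff_distrib sum_subtractf boundary_total_def[symmetric])
        then show "of_bool (active A v Far f w) * (s (orb f w) * (\<Sum>b\<in>A. boundary_cond A b * (1 - \<phi> (orb f w) b))) = boundary_total A * ?q f w"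
          by simp
      qed
      finally have "(\<Sum>b\<in>A. boundary_cond A b * ?Y b) = boundary_total A * (\<Sum>w\<in>S. ?q f w)" by (simp add: sum_distrib_left)
      then show ?thesis using boundary_total_nonneg[of A] by (simp add: min_mult_distrib_left)
    qed
    finally show "(\<Sum>b\<in>A. boundary_cond A b * \<Phi> (f(\<rho> := b)) b) \<le> vertex_cond v + boundary_total A * min 1 (\<Sum>w\<in>S. ?q f w)" by simp
  qed
  also have "\<dots> = vertex_cond v + boundary_total A * ex A (\<lambda>f. min 1 (\<Sum>w\<in>S. ?q f w))"
    unfolding ex_add ex_cmult ex_const[OF A] ..
  finally show ?thesis using step unfolding L by simp
qed

text \<open>Iteration with \<open>s\<close> equal to successive powers of the survival factor. The
  truncation by one is used in every step, where newly created paths must together cost at most one,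
  and is given up only after the last.\<close>

lemma excursion_bound:
  assumes A: "A \<subseteq> B - {\<rho>}" and v: "v \<in> B - A" "v \<noteq> \<rho>"
    and phi1: "\<And>K x. \<phi> K x \<le> (1::real)" "\<And>K x. \<phi> K x \<ge> 0" and phi0: "\<And>K x. x \<notin> A \<Longrightarrow> \<phi> K x = 0"
    and phisub: "\<And>K x. x \<in> A \<Longrightarrow> x \<notin> K \<Longrightarrow> vertex_cond x * \<phi> K x \<le> (\<Sum>b\<in>B. C x b * \<phi> K b)"
  shows "boundary_total A * ex A (\<lambda>f. min 1 (\<Sum>w\<in>S. of_bool (active A v Far f w))) \<le>
     real n * vertex_cond v + boundary_total A * ex A (\<lambda>f. \<Sum>w\<in>S. of_bool (active A v Far f w) *
        (1 - (\<Sum>b\<in>A. boundary_cond A b * \<phi> (orb f w) b) / boundary_total A) ^ n)"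
proof -
  define \<theta> where "\<theta> K = 1 - (\<Sum>b\<in>A. boundary_cond A b * \<phi> K b) / boundary_total A" for K
  have th0: "\<theta> K \<ge> 0" for K
  proof -
    have "(\<Sum>b\<in>A. boundary_cond A b * \<phi> K b) \<le> (\<Sum>b\<in>A. boundary_cond A b * 1)"
      by (intro sum_mono mult_left_mono phi1 boundary_cond_nonneg)
    then show ?thesis using boundary_total_nonneg[of A] unfolding \<theta>_def boundary_total_def
      by (cases "sum (boundary_cond A) A = 0") auto
  qed
  define a where "a n = ex A (\<lambda>f. min 1 (\<Sum>w\<in>S. of_bool (active A v Far f w) * \<theta> (orb f w) ^ n))" for n
  have step: "boundary_total A * a n \<le> vertex_cond v + boundary_total A * a (Suc n)" for n
    using excursion_step_act[OF A v, where s="\<lambda>K. \<theta> K ^ n" and \<phi>=\<phi> and S=S and Far=Far] th0 phi1 phi0 phisub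
    unfolding a_def \<theta>_def[symmetric] power_Suc2 by simp
  have "boundary_total A * a 0 \<le> real n * vertex_cond v + boundary_total A * a n"
  proof (induction n)
    case (Suc n) then show ?case using step[of n] by (simp add: distrib_right)
  qed simp
  also have "a n \<le> ex A (\<lambda>f. \<Sum>w\<in>S. of_bool (active A v Far f w) * \<theta> (orb f w) ^ n)"
    unfolding a_def by (rule ex_mono) (use A in auto)
  finally show ?thesis using boundary_total_nonneg[of A] unfolding a_def \<theta>_def by (simp add: mult_left_mono)
qed

end

section \<open>The upper bound in finite networks\<close>

text \<open>\<open>U\<close> is a majorant of the Green function that will not depend on the finite network, so that all
  estimates are uniform in the network.\<close>

locale bounded_net = finite_net B C \<rho> for B :: "'b set" and C and \<rho> +
  fixes U :: "'b \<Rightarrow> 'b \<Rightarrow> real" and d :: "'b \<Rightarrow> 'b \<Rightarrow> nat" and M C0 K0 :: real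
  assumes M1: "M \<ge> 1" and C0: "C0 \<ge> 0" and K0: "K0 \<ge> 0"
    and vertex_cond_lower: "x \<in> B - {\<rho>} \<Longrightarrow> inverse M \<le> vertex_cond x" and vertex_cond_upper: "x \<in> B - {\<rho>} \<Longrightarrow> vertex_cond x \<le> M"
    and U_nonneg: "U x y \<ge> 0" and U_rho: "U \<rho> y = 0"
    and U_super: "x \<in> B - {\<rho>} \<Longrightarrow> y \<in> B - {\<rho>} \<Longrightarrow> (\<Sum>z\<in>B. C x z * U z y) + vertex_cond x * of_bool (x = y) \<le> vertex_cond x * U x y"
    and U_rev: "x \<in> B - {\<rho>} \<Longrightarrow> y \<in> B - {\<rho>} \<Longrightarrow> U x y \<le> M\<^sup>2 * U y x"
    and U_ball: "x \<in> B - {\<rho>} \<Longrightarrow> r \<ge> 1 \<Longrightarrow> (\<Sum>w\<in>{w\<in>B-{\<rho>}. d x w \<le> r}. U x w) \<le> C0 * real r"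
    and U_sq: "x \<in> B - {\<rho>} \<Longrightarrow> (\<Sum>y\<in>B-{\<rho>}. (U x y)\<^sup>2) \<le> K0"
    and d_refl: "x \<in> B - {\<rho>} \<Longrightarrow> d x x = 0" and d_sym: "x \<in> B - {\<rho>} \<Longrightarrow> y \<in> B - {\<rho>} \<Longrightarrow> d x y = d y x"
    and d_tri: "x \<in> B - {\<rho>} \<Longrightarrow> y \<in> B - {\<rho>} \<Longrightarrow> z \<in> B - {\<rho>} \<Longrightarrow> d x z \<le> d x y + d y z"
    and d_edge: "x \<in> B - {\<rho>} \<Longrightarrow> y \<in> B - {\<rho>} \<Longrightarrow> C x y > 0 \<Longrightarrow> d x y \<le> 1"
begin

section \<open>Bounds of forest probabilities by the Green majorant\<close>

lemma vertex_cond_pos: "x \<in> B - {\<rho>} \<Longrightarrow> vertex_cond x > 0"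
  using vertex_cond_lower[of x] M1 by (smt (verit) positive_imp_inverse_positive)

lemma U_diag: "x \<in> B - {\<rho>} \<Longrightarrow> U x x \<ge> 1"
proof -
  assume x: "x \<in> B - {\<rho>}"
  have "0 \<le> (\<Sum>z\<in>B. C x z * U z x)" by (intro sum_nonneg mult_nonneg_nonneg C_nonneg U_nonneg)
  then have "vertex_cond x * 1 \<le> vertex_cond x * U x x" using U_super[OF x x] by simp
  then show ?thesis using vertex_cond_pos[OF x] by simp
qed

lemma hit_le_U:
  assumes A: "A \<subseteq> B - {\<rho>}" and b: "b \<in> B - {\<rho>}" "b \<notin> A" and x: "x \<in> B"
  shows "hit A b x \<le> U x b"
proof (rule hit_le_super[OF A _ _ _ _ x])
  fix y assume y: "y \<in> A"
  then have "y \<in> B - {\<rho>}" "y \<noteq> b" using A b by auto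
  then show "(\<Sum>z\<in>B. C y z * U z b) \<le> vertex_cond y * U y b" using U_super[of y b] b by simp
qed (use b U_nonneg U_diag in auto)

lemma green_le_U:
  assumes A: "A \<subseteq> B - {\<rho>}" and y: "y \<in> A" and x: "x \<in> B"
  shows "vertex_cond y * green A y x \<le> U x y"
proof -
  define D where "D = (\<lambda>x. vertex_cond y * green A y x - U x y)"
  have 1: "vertex_cond z * D z \<le> (\<Sum>u\<in>B. C z u * D u)" if z: "z \<in> A" for z
  proof -
    have "vertex_cond z * D z = vertex_cond y * (vertex_cond z * green A y z) - vertex_cond z * U z y" by (simp add: D_def algebra_simps)
    also have "\<dots> = vertex_cond y * (\<Sum>u\<in>B. C z u * green A y u) + vertex_cond y * of_bool (z = y) - vertex_cond z * U z y"
      unfolding green_eq[OF A z y] by (simp add: distrib_left)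
    also have "\<dots> \<le> vertex_cond y * (\<Sum>u\<in>B. C z u * green A y u) - (\<Sum>u\<in>B. C z u * U u y)"
    proof -
      have "z \<in> B - {\<rho>}" "y \<in> B - {\<rho>}" using A y z by auto
      then show ?thesis using U_super[of z y] by (cases "z = y") auto
    qed
    also have "\<dots> = (\<Sum>u\<in>B. C z u * D u)"
      by (simp add: D_def right_diff_distrib sum_subtractf sum_distrib_left mult_ac)
    finally show ?thesis .
  qed
  have 2: "D z \<le> 0" if "z \<in> B - A" for z using that U_nonneg by (simp add: D_def green_def)
  have "D x \<le> 0" by (rule max_principle[OF A 1 2 _ x]) auto
  then show ?thesis by (simp add: D_def)
qed

lemma orb_agree:
  assumes "\<And>z. z \<in> orb f y \<Longrightarrow> f z = g z" and "x \<in> orb f y"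
  shows "orb f x = orb g x"
  by (rule orb_cong) (use assms orb_trans[OF assms(2)] in auto)

lemma hit_Diff_le_U:
  assumes "A \<subseteq> B - {\<rho>}" "y \<in> A" "w \<in> A" "y \<in> K"
  shows "hit (A - K) y w \<le> U w y"
  using assms by (intro hit_le_U) auto

lemma two_point_le:
  assumes A: "A \<subseteq> B - {\<rho>}" and w: "w \<in> A" and y: "y \<in> A" and v: "v \<in> B - {\<rho>}" "v \<notin> A"
  shows "pr A (\<lambda>f. y \<in> orb f w \<and> v \<in> orb f y) \<le> U w y * U y v"
proof -
  have "pr A (\<lambda>f. y \<in> orb f w \<and> v \<in> orb f y) = ex A (\<lambda>f. of_bool (y \<in> orb f w) * of_bool (v \<in> orb f y))"
    unfolding pr_def by (simp add: of_bool_conj)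
  also have "\<dots> \<le> U w y * ex A (\<lambda>f. of_bool (v \<in> orb f y))"
  proof (rule two_point[OF A w y])
    fix f g assume "\<And>x. x \<in> orb f y \<Longrightarrow> f x = g x"
    then have "orb f y = orb g y" by (rule orb_cong)
    then show "of_bool (v \<in> orb f y) = (of_bool (v \<in> orb g y)::real)" by simp
  qed (use hit_Diff_le_U[OF A y w] in auto)
  also have "ex A (\<lambda>f. of_bool (v \<in> orb f y)) = hit A v y" by (simp add: hit_def pr_def)
  also have "U w y * hit A v y \<le> U w y * U y v"
    by (intro mult_left_mono hit_le_U A U_nonneg) (use v y A in auto)
  finally show ?thesis .
qed

text \<open>\<open>two_point\<close> is applied twice, the last stretch being revealed first: what
  happens after \<open>y\<close> depends only on the path of \<open>y\<close>. Each stretch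
  contributes one factor of \<open>U\<close>.\<close>

lemma three_point_le:
  assumes A: "A \<subseteq> B - {\<rho>}" and w: "w \<in> A" and y: "y \<in> A" and x: "x \<in> A" and v: "v \<in> B - {\<rho>}" "v \<notin> A"
  shows "pr A (\<lambda>f. y \<in> orb f w \<and> x \<in> orb f y \<and> v \<in> orb f x) \<le> U w y * (U y x * U x v)"
proof -
  have "pr A (\<lambda>f. y \<in> orb f w \<and> x \<in> orb f y \<and> v \<in> orb f x) =
      ex A (\<lambda>f. of_bool (y \<in> orb f w) * of_bool (x \<in> orb f y \<and> v \<in> orb f x))"
    unfolding pr_def by (simp add: of_bool_conj)
  also have "\<dots> \<le> U w y * ex A (\<lambda>f. of_bool (x \<in> orb f y \<and> v \<in> orb f x))"
  proof (rule two_point[OF A w y])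
    fix f g assume *: "\<And>x. x \<in> orb f y \<Longrightarrow> f x = g x"
    then have "orb f y = orb g y" by (rule orb_cong)
    moreover have "x \<in> orb f y \<Longrightarrow> orb f x = orb g x" using orb_agree[of f y g x] * by auto
    ultimately have "(x \<in> orb f y \<and> v \<in> orb f x) = (x \<in> orb g y \<and> v \<in> orb g x)" by auto
    then show "of_bool (x \<in> orb f y \<and> v \<in> orb f x) = (of_bool (x \<in> orb g y \<and> v \<in> orb g x)::real)" by simp
  qed (use hit_Diff_le_U[OF A y w] in auto)
  also have "ex A (\<lambda>f. of_bool (x \<in> orb f y \<and> v \<in> orb f x)) \<le> U y x * U x v"
    using two_point_le[OF A y x v] by (simp add: pr_def)
  finally show ?thesis using U_nonneg[of w y] by (simp add: mult_left_mono)
qed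

lemma U_ball_rev:
  assumes v: "v \<in> B - {\<rho>}" and r: "r \<ge> 1" and S: "S \<subseteq> {w\<in>B-{\<rho>}. d w v \<le> r}"
  shows "(\<Sum>w\<in>S. U w v) \<le> M\<^sup>2 * (C0 * real r)"
proof -
  have "(\<Sum>w\<in>S. U w v) \<le> (\<Sum>w\<in>{w\<in>B-{\<rho>}. d v w \<le> r}. U w v)"
    by (rule sum_mono2) (use finB S v d_sym U_nonneg in \<open>auto simp: subset_iff\<close>)
  also have "\<dots> \<le> (\<Sum>w\<in>{w\<in>B-{\<rho>}. d v w \<le> r}. M\<^sup>2 * U v w)"
    by (rule sum_mono) (use U_rev v in auto)
  also have "\<dots> \<le> M\<^sup>2 * (C0 * real r)"
    unfolding sum_distrib_left[symmetric] using U_ball[OF v r] M1 by (intro mult_left_mono) auto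
  finally show ?thesis .
qed

lemma U_sq_rev:
  assumes y: "y \<in> B - {\<rho>}" and S: "S \<subseteq> B - {\<rho>}"
  shows "(\<Sum>x\<in>S. (U x y)\<^sup>2) \<le> M ^ 4 * K0"
proof -
  have "(\<Sum>x\<in>S. (U x y)\<^sup>2) \<le> (\<Sum>x\<in>B-{\<rho>}. (U x y)\<^sup>2)"
    by (rule sum_mono2) (use finB S in auto)
  also have "\<dots> \<le> (\<Sum>x\<in>B-{\<rho>}. M ^ 4 * (U y x)\<^sup>2)"
  proof (rule sum_mono)
    fix x assume "x \<in> B - {\<rho>}"
    then have "(U x y)\<^sup>2 \<le> (M\<^sup>2 * U y x)\<^sup>2" using U_rev[of x y] y U_nonneg by (intro power_mono) auto
    then show "(U x y)\<^sup>2 \<le> M ^ 4 * (U y x)\<^sup>2" by (simp add: power_mult_distrib power_mult[symmetric])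
  qed
  also have "\<dots> \<le> M ^ 4 * K0"
    unfolding sum_distrib_left[symmetric] using U_sq[OF y] M1 by (intro mult_left_mono) auto
  finally show ?thesis .
qed

lemma step_d:
  assumes f: "f \<in> forests A" "wt A f > 0" and A: "A \<subseteq> B - {\<rho>}" and x: "x \<in> A" "f x \<in> B - {\<rho>}"
  shows "d x (f x) \<le> 1"
proof -
  have "finite A" using A finB finite_subset by blast
  have "C x (f x) \<noteq> 0"
    using f(2) x(1) \<open>finite A\<close> unfolding wt_def by (metis less_irrefl prod_zero)
  then have "C x (f x) > 0" using C_nonneg[of x "f x"] by simp
  then show ?thesis using d_edge[of x "f x"] x A by auto
qed

text \<open>A discrete intermediate value argument: a step lowers the distance to \<open>v\<close>
  by at most one and the path ends at \<open>v\<close>, so it cannot pass below level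
  \<open>j\<close> without meeting it.\<close>

lemma level:
  assumes f: "f \<in> forests A" "wt A f > 0" and A: "A \<subseteq> B - {\<rho>}" and v: "v \<in> B - {\<rho>}" "v \<notin> A"
    and u: "u \<in> A" "v \<in> orb f u" and j: "1 \<le> j" "j \<le> d u v"
  shows "\<exists>w\<in>orb f u. w \<in> A \<and> d w v = j"
proof (rule ccontr)
  assume n: "\<not> ?thesis"
  let ?S = "{x \<in> orb f u. x \<in> A \<and> d x v > j}"
  have "orb f u \<subseteq> ?S"
  proof (rule orb_least)
    show "u \<in> ?S" using n u j le_neq_implies_less[of j "d u v"] by auto
    show "f ` ?S \<subseteq> ?S"
    proof (rule image_subsetI)
      fix x assume x: "x \<in> ?S"
      have fo: "f x \<in> orb f u" using x orb_step[of x f u] by auto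
      have "f x = v" if "f x \<notin> A" using forest_exit_unique[OF f(1) fo u(2) that v(2)] .
      then have fB: "f x \<in> B - {\<rho>}" using A v by blast
      have d1: "d x (f x) \<le> 1" using step_d[OF f A _ fB] x by auto
      have xB: "x \<in> B - {\<rho>}" using x A by auto
      have "d x v \<le> d x (f x) + d (f x) v" by (rule d_tri[OF xB fB v(1)])
      then have dj: "d (f x) v \<ge> j" using d1 x by auto
      have "f x \<in> A"
      proof (rule ccontr)
        assume "f x \<notin> A"
        then have "f x = v" using forest_exit_unique[OF f(1) fo u(2) _ v(2)] by auto
        then show False using dj d_refl[OF v(1)] j by auto
      qed
      moreover from this have "d (f x) v \<noteq> j" using n fo by auto
      ultimately show "f x \<in> ?S" using fo dj by auto
    qed
  qed
  then show False using u v by auto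
qed

text \<open>Reveal the path of \<open>w\<close> first. On the remaining domain \<open>w\<close> is a
  boundary point, and a far \<open>u\<close> that leads to \<open>w\<close> is the event of the
  induction hypothesis at \<open>w\<close>. The conditional bound \<open>q\<close> is uniform, so it
  multiplies any weight \<open>\<Theta>\<close> of the revealed path.\<close>

lemma active_bound:
  assumes A: "A \<subseteq> B - {\<rho>}" and v: "v \<in> B - {\<rho>}" "v \<notin> A" and w: "w \<in> A" and r: "r \<ge> 1"
    and \<Theta>: "\<And>K. \<Theta> K \<ge> 0"
    and IH: "\<And>A' v'. A' \<subseteq> B - {\<rho>} \<Longrightarrow> v' \<in> B - {\<rho>} \<Longrightarrow> v' \<notin> A' \<Longrightarrow> pr A' (\<lambda>f. \<exists>u\<in>A'. v' \<in> orb f u \<and> r \<le> d u v') \<le> q"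
  shows "ex A (\<lambda>f. of_bool (active A v (\<lambda>u w. r \<le> d u w) f w) * \<Theta> (orb f w)) \<le>
     q * ex A (\<lambda>f. of_bool (v \<in> orb f w) * \<Theta> (orb f w))" (is "ex A (\<lambda>f. ?X f) \<le> _")
proof -
  have "ex A ?X \<le> ex A (\<lambda>f. q * (of_bool (v \<in> orb f w) * \<Theta> (orb f w)))"
    unfolding tower[OF A, of ?X w]
  proof (rule ex_mono)
    fix f assume f: "f \<in> forests A"
    let ?A' = "A - orb f w"
    let ?J = "\<lambda>f' x. if x \<in> orb f w then f x else f' x"
    have A': "?A' \<subseteq> B - {\<rho>}" using A by auto
    have "ex ?A' (\<lambda>f'. ?X (?J f')) \<le> ex ?A' (\<lambda>f'. (of_bool (v \<in> orb f w) * \<Theta> (orb f w)) * of_bool (\<exists>u\<in>?A'. w \<in> orb f' u \<and> r \<le> d u w))"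
    proof (rule ex_mono)
      fix f' assume f': "f' \<in> forests ?A'"
      have J: "?J f' \<in> forests A" by (rule forests_join[OF f f'])
      have oJ: "orb (?J f') w = orb f w" by (rule orb_cong[symmetric]) auto
      have "v \<in> orb f w \<and> (\<exists>u\<in>?A'. w \<in> orb f' u \<and> r \<le> d u w)" if active: "active A v (\<lambda>u w. r \<le> d u w) (?J f') w"
      proof -
        obtain u where u: "u \<in> A" "r \<le> d u w" "w \<in> orb (?J f') u" "v \<in> orb (?J f') u"
          using active unfolding active_def by blast
        have vw: "v \<in> orb f w"
          using orb_linear[OF u(3,4)] forest_orb_out[OF J v(2)] oJ v w by auto
        have uw: "u \<noteq> w" using u(2) r d_refl[of w] subsetD[OF A w] by auto
        have un: "u \<notin> orb f w" using forest_acyclic[OF J _ u(3)] oJ uw by metis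
        obtain b where b: "b \<in> orb f' u" "b \<notin> ?A'" using forest_exit[OF f', of u] by blast
        have "w \<in> orb f' u \<or> w \<in> orb f b" using join_orbit[OF f f' b] u(3) by blast
        moreover have "b = w" if wb: "w \<in> orb f b"
        proof -
          have "b \<in> A" using forest_orb_out[OF f, of b] wb w by (cases "b \<in> A") auto
          then show ?thesis using forest_acyclic[OF f _ wb] b(2) by blast
        qed
        ultimately have "w \<in> orb f' u" using b by auto
        then show ?thesis using vw un u by blast
      qed
      then show "?X (?J f') \<le> (of_bool (v \<in> orb f w) * \<Theta> (orb f w)) * of_bool (\<exists>u\<in>?A'. w \<in> orb f' u \<and> r \<le> d u w)"
        unfolding oJ using \<Theta>[of "orb f w"] by (cases "active A v (\<lambda>u w. r \<le> d u w) (?J f') w") auto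
    qed (use A in auto)
    also have "\<dots> = (of_bool (v \<in> orb f w) * \<Theta> (orb f w)) * pr ?A' (\<lambda>f'. \<exists>u\<in>?A'. w \<in> orb f' u \<and> r \<le> d u w)"
      unfolding ex_cmult pr_def ..
    also have "\<dots> \<le> (of_bool (v \<in> orb f w) * \<Theta> (orb f w)) * q"
      by (rule mult_left_mono[OF IH[OF A']]) (use w A \<Theta> in auto)
    finally show "ex ?A' (\<lambda>f'. ?X (?J f')) \<le> q * (of_bool (v \<in> orb f w) * \<Theta> (orb f w))" by (simp add: mult_ac)
  qed (use A in auto)
  then show ?thesis by (simp add: ex_cmult)
qed

section \<open>Energy and capacity of paths near \<open>v\<close>\<close>

definition trace :: "'b set \<Rightarrow> 'b \<Rightarrow> nat \<Rightarrow> 'b set \<Rightarrow> 'b set" where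
  "trace A v r K = {x \<in> K \<inter> A. d x v \<le> r}"

text \<open>The Green energy of the counting measure on the trace. A trace of at least
  \<open>r\<close> points with energy of order \<open>r\<close> has capacity of order
  \<open>r\<close>.\<close>

definition energy :: "'b set \<Rightarrow> 'b \<Rightarrow> nat \<Rightarrow> 'b set \<Rightarrow> real" where
  "energy A v r K = (\<Sum>x\<in>trace A v r K. \<Sum>y\<in>trace A v r K. U x y)"

text \<open>Two points \<open>x\<close> and \<open>y\<close> on the path of \<open>w\<close> come in
  one of two orders, and \<open>three_point_le\<close> bounds each order by a product of three
  factors. Together with the factor \<open>U x y\<close> of the energy this contains a square, which
  the bubble bound sums over one variable; the sums over the other two cost a factor of order
  \<open>r\<close> each.\<close>

lemma energy_bound:
  assumes A: "A \<subseteq> B - {\<rho>}" and v: "v \<in> B - {\<rho>}" "v \<notin> A" and r: "r \<ge> 1"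
  shows "(\<Sum>w\<in>{w\<in>A. d w v \<le> 2 * r}. ex A (\<lambda>f. of_bool (v \<in> orb f w) * energy A v r (orb f w)))
    \<le> 6 * M ^ 10 * C0\<^sup>2 * K0 * (real r)\<^sup>2"
proof -
  let ?Bv = "{x\<in>A. d x v \<le> r}" and ?W = "{w\<in>A. d w v \<le> 2 * r}"
  have finA: "finite A" using A finB finite_subset by blast
  have fin: "finite ?Bv" "finite ?W" using finA by auto
  have pt: "ex A (\<lambda>f. of_bool (v \<in> orb f w) * (of_bool (x \<in> orb f w) * of_bool (y \<in> orb f w)))
     \<le> U w x * (U x y * U y v) + U w y * (U y x * U x v)" if "w \<in> A" "x \<in> A" "y \<in> A" for w x y
  proof -
    have "ex A (\<lambda>f. of_bool (v \<in> orb f w) * (of_bool (x \<in> orb f w) * of_bool (y \<in> orb f w)))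
      \<le> ex A (\<lambda>f. of_bool (x \<in> orb f w \<and> y \<in> orb f x \<and> v \<in> orb f y) + of_bool (y \<in> orb f w \<and> x \<in> orb f y \<and> v \<in> orb f x))"
    proof (rule ex_mono)
      fix f assume f: "f \<in> forests A"
      have "v \<in> orb f z" if "v \<in> orb f w" "z \<in> orb f w" "z \<in> A" for z
        using orb_linear[OF that(1,2)] forest_orb_out[OF f v(2)] that(3) v by auto
      then show "of_bool (v \<in> orb f w) * (of_bool (x \<in> orb f w) * of_bool (y \<in> orb f w)) \<le>
        (of_bool (x \<in> orb f w \<and> y \<in> orb f x \<and> v \<in> orb f y) + of_bool (y \<in> orb f w \<and> x \<in> orb f y \<and> v \<in> orb f x) :: real)"
        using orb_linear[of x f w y] \<open>x \<in> A\<close> \<open>y \<in> A\<close> by auto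
    qed (use A in auto)
    also have "\<dots> \<le> U w x * (U x y * U y v) + U w y * (U y x * U x v)"
      unfolding ex_add pr_def[symmetric] using that by (intro add_mono three_point_le A v)
    finally show ?thesis .
  qed
  have e: "energy A v r K = (\<Sum>x\<in>?Bv. \<Sum>y\<in>?Bv. U x y * (of_bool (x \<in> K) * of_bool (y \<in> K)))" for K
  proof -
    have s: "(\<Sum>x\<in>trace A v r K. g x) = (\<Sum>x\<in>?Bv. of_bool (x \<in> K) * g x)" for g :: "'b \<Rightarrow> real"
      by (rule sum.mono_neutral_cong_left) (use fin in \<open>auto simp: trace_def\<close>)
    show ?thesis unfolding energy_def s by (simp add: sum_distrib_left mult_ac)
  qed
  have "ex A (\<lambda>f. of_bool (v \<in> orb f w) * energy A v r (orb f w)) \<le>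
     (\<Sum>x\<in>?Bv. \<Sum>y\<in>?Bv. U x y * (U w x * (U x y * U y v) + U w y * (U y x * U x v)))" if w: "w \<in> ?W" for w
  proof -
    have "ex A (\<lambda>f. of_bool (v \<in> orb f w) * energy A v r (orb f w)) =
      (\<Sum>x\<in>?Bv. \<Sum>y\<in>?Bv. U x y * ex A (\<lambda>f. of_bool (v \<in> orb f w) * (of_bool (x \<in> orb f w) * of_bool (y \<in> orb f w))))"
      unfolding e sum_distrib_left ex_sum ex_cmult[symmetric] by (simp only: mult.left_commute)
    also have "\<dots> \<le> (\<Sum>x\<in>?Bv. \<Sum>y\<in>?Bv. U x y * (U w x * (U x y * U y v) + U w y * (U y x * U x v)))"
      by (intro sum_mono mult_left_mono pt U_nonneg) (use w in auto)
    finally show ?thesis .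
  qed
  then have "(\<Sum>w\<in>?W. ex A (\<lambda>f. of_bool (v \<in> orb f w) * energy A v r (orb f w))) \<le>
     (\<Sum>w\<in>?W. \<Sum>x\<in>?Bv. \<Sum>y\<in>?Bv. U x y * (U w x * (U x y * U y v) + U w y * (U y x * U x v)))"
    by (rule sum_mono)
  also have "\<dots> = (\<Sum>w\<in>?W. \<Sum>x\<in>?Bv. \<Sum>y\<in>?Bv. U w x * ((U x y)\<^sup>2 * U y v)) +
     (\<Sum>w\<in>?W. \<Sum>x\<in>?Bv. \<Sum>y\<in>?Bv. U w y * (U x y * U y x * U x v))"
    by (simp add: distrib_left sum.distrib power2_eq_square mult_ac)
  also have "(\<Sum>w\<in>?W. \<Sum>x\<in>?Bv. \<Sum>y\<in>?Bv. U w y * (U x y * U y x * U x v)) \<le>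
     (\<Sum>w\<in>?W. \<Sum>x\<in>?Bv. \<Sum>y\<in>?Bv. U w y * (M\<^sup>2 * (U y x)\<^sup>2 * U x v))"
  proof (intro sum_mono)
    fix w x y assume xy: "x \<in> ?Bv" "y \<in> ?Bv"
    have "U x y * U y x \<le> M\<^sup>2 * U y x * U y x"
      using xy A by (intro mult_right_mono U_rev U_nonneg) auto
    then show "U w y * (U x y * U y x * U x v) \<le> U w y * (M\<^sup>2 * (U y x)\<^sup>2 * U x v)"
      by (intro mult_left_mono mult_right_mono U_nonneg) (simp add: power2_eq_square mult.assoc)
  qed
  also have "\<dots> = M\<^sup>2 * (\<Sum>w\<in>?W. \<Sum>x\<in>?Bv. \<Sum>y\<in>?Bv. U w x * ((U x y)\<^sup>2 * U y v))"
    by (subst sum.swap[of _ ?Bv ?Bv]) (simp add: sum_distrib_left mult_ac)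
  finally have 1: "(\<Sum>w\<in>?W. ex A (\<lambda>f. of_bool (v \<in> orb f w) * energy A v r (orb f w))) \<le>
     (1 + M\<^sup>2) * (\<Sum>w\<in>?W. \<Sum>x\<in>?Bv. \<Sum>y\<in>?Bv. U w x * ((U x y)\<^sup>2 * U y v))"
    by (simp add: distrib_right)
  have "(\<Sum>w\<in>?W. \<Sum>x\<in>?Bv. \<Sum>y\<in>?Bv. U w x * ((U x y)\<^sup>2 * U y v)) =
    (\<Sum>x\<in>?Bv. (\<Sum>w\<in>?W. U w x) * (\<Sum>y\<in>?Bv. (U x y)\<^sup>2 * U y v))"
    by (subst sum.swap) (simp add: sum_product)
  \<comment> \<open>The radius \<open>3 * r\<close> arises because \<open>w\<close> is within
    \<open>2 * r\<close> of \<open>v\<close> and \<open>x\<close> within \<open>r\<close>.\<close>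
  also have "\<dots> \<le> (\<Sum>x\<in>?Bv. (M\<^sup>2 * (C0 * real (3 * r))) * (\<Sum>y\<in>?Bv. (U x y)\<^sup>2 * U y v))"
  proof (intro sum_mono mult_right_mono)
    fix x assume x: "x \<in> ?Bv"
    show "(\<Sum>w\<in>?W. U w x) \<le> M\<^sup>2 * (C0 * real (3 * r))"
    proof (rule U_ball_rev)
      show "?W \<subseteq> {w \<in> B - {\<rho>}. d w x \<le> 3 * r}"
      proof
        fix w assume w: "w \<in> ?W"
        then have "d w x \<le> d w v + d v x" using x A v by (intro d_tri) auto
        moreover have "d v x = d x v" using x A v by (intro d_sym) auto
        ultimately show "w \<in> {w \<in> B - {\<rho>}. d w x \<le> 3 * r}" using w x A by auto
      qed
    qed (use x A r in auto)
  qed (intro sum_nonneg mult_nonneg_nonneg U_nonneg zero_le_power2)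
  also have "\<dots> = (M\<^sup>2 * (C0 * real (3 * r))) * (\<Sum>y\<in>?Bv. U y v * (\<Sum>x\<in>?Bv. (U x y)\<^sup>2))"
    unfolding sum_distrib_left[symmetric] by (subst sum.swap) (simp add: sum_distrib_left mult_ac)
  also have "\<dots> \<le> (M\<^sup>2 * (C0 * real (3 * r))) * (\<Sum>y\<in>?Bv. U y v * (M ^ 4 * K0))"
    by (intro mult_left_mono sum_mono U_sq_rev U_nonneg mult_nonneg_nonneg C0) (use A in auto)
  also have "\<dots> \<le> (M\<^sup>2 * (C0 * real (3 * r))) * ((M\<^sup>2 * (C0 * real r)) * (M ^ 4 * K0))"
    unfolding sum_distrib_right[symmetric] using M1
    by (intro mult_left_mono mult_right_mono U_ball_rev v r mult_nonneg_nonneg C0 K0) (use A in auto)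
  also have "\<dots> = 3 * M ^ 8 * C0\<^sup>2 * K0 * (real r)\<^sup>2" by (simp add: power2_eq_square eval_nat_numeral)
  finally have 2: "(\<Sum>w\<in>?W. \<Sum>x\<in>?Bv. \<Sum>y\<in>?Bv. U w x * ((U x y)\<^sup>2 * U y v)) \<le> 3 * M ^ 8 * C0\<^sup>2 * K0 * (real r)\<^sup>2" .
  have "1 + M\<^sup>2 \<le> 2 * M\<^sup>2" using M1 by simp
  then have "(1 + M\<^sup>2) * (3 * M ^ 8 * C0\<^sup>2 * K0 * (real r)\<^sup>2) \<le> (2 * M\<^sup>2) * (3 * M ^ 8 * C0\<^sup>2 * K0 * (real r)\<^sup>2)"
    using M1 K0 by (intro mult_right_mono) auto
  also have "\<dots> = 6 * M ^ 10 * C0\<^sup>2 * K0 * (real r)\<^sup>2" by (simp add: eval_nat_numeral)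
  finally have 3: "(1 + M\<^sup>2) * (3 * M ^ 8 * C0\<^sup>2 * K0 * (real r)\<^sup>2) \<le> 6 * M ^ 10 * C0\<^sup>2 * K0 * (real r)\<^sup>2" .
  have "0 \<le> 1 + M\<^sup>2" by simp
  then show ?thesis by (rule order_trans[OF 1 order_trans[OF mult_left_mono[OF 2] 3]])
qed

text \<open>\<open>phi A v r L K\<close> is a lower bound for the probability that the random walk killed outside \<open>A\<close> hits \<open>K\<close>: it is the
  potential of the vertex conductances on the part of \<open>K\<close> where the potential of all of \<open>trace A v r K\<close> is bounded.\<close>

definition good :: "'b set \<Rightarrow> 'b \<Rightarrow> nat \<Rightarrow> real \<Rightarrow> 'b set \<Rightarrow> bool" where
  "good A v r L K \<longleftrightarrow> energy A v r K \<le> L * real r \<and> r \<le> card (trace A v r K)"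

definition core :: "'b set \<Rightarrow> 'b \<Rightarrow> nat \<Rightarrow> real \<Rightarrow> 'b set \<Rightarrow> 'b set" where
  "core A v r L K = {x \<in> trace A v r K. (\<Sum>y\<in>trace A v r K. U x y) \<le> 2 * L}"

definition phi :: "'b set \<Rightarrow> 'b \<Rightarrow> nat \<Rightarrow> real \<Rightarrow> 'b set \<Rightarrow> 'b \<Rightarrow> real" where
  "phi A v r L K x = (if good A v r L K then (\<Sum>y\<in>core A v r L K. vertex_cond y * green A y x) / (2 * L) else 0)"

lemma core_sub: "core A v r L K \<subseteq> K \<inter> A" unfolding core_def trace_def by auto

text \<open>The potential is harmonic at the points of \<open>A\<close> off the core, so by the
  maximum principle it has to be bounded only on the core, where the inequality in
  \<open>core\<close> applies. Its flux through the boundary is, by \<open>green_flux\<close>, the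
  total conductance of the core divided by \<open>2 * L\<close>.\<close>

lemma phi_props:
  assumes A: "A \<subseteq> B - {\<rho>}" and L: "L > 0"
  shows "phi A v r L K x \<ge> 0" "x \<notin> A \<Longrightarrow> phi A v r L K x = 0"
    "x \<in> A \<Longrightarrow> x \<notin> K \<Longrightarrow> vertex_cond x * phi A v r L K x \<le> (\<Sum>b\<in>B. C x b * phi A v r L K b)"
    "x \<in> B \<Longrightarrow> phi A v r L K x \<le> 1"
    "good A v r L K \<Longrightarrow> (\<Sum>b\<in>A. boundary_cond A b * phi A v r L K b) \<ge> real r / (4 * L * M)"
proof -
  let ?c = "core A v r L K" and ?t = "trace A v r K"
  have finA: "finite A" using A finB finite_subset by blast
  have fin: "finite ?c" "finite ?t" using finA by (auto simp: core_def trace_def)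
  have cA: "?c \<subseteq> A" using core_sub by blast
  show "phi A v r L K x \<ge> 0"
    unfolding phi_def using L cA A vertex_cond_pos green_nonneg[OF A] by (auto intro!: divide_nonneg_pos sum_nonneg mult_nonneg_nonneg simp: less_imp_le subset_iff)
  show off: "x \<notin> A \<Longrightarrow> phi A v r L K x = 0" for x unfolding phi_def green_def by simp
  have eq: "vertex_cond x * phi A v r L K x = (\<Sum>b\<in>B. C x b * phi A v r L K b)" if x: "x \<in> A" "x \<notin> ?c" for x
  proof (cases "good A v r L K")
    case True
    have "vertex_cond x * (\<Sum>y\<in>?c. vertex_cond y * green A y x) = (\<Sum>y\<in>?c. vertex_cond y * (vertex_cond x * green A y x))"
      by (simp add: sum_distrib_left mult_ac)
    also have "\<dots> = (\<Sum>y\<in>?c. vertex_cond y * (\<Sum>b\<in>B. C x b * green A y b))"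
      using x cA by (intro sum.cong refl) (subst green_eq[OF A], auto)
    also have "\<dots> = (\<Sum>b\<in>B. C x b * (\<Sum>y\<in>?c. vertex_cond y * green A y b))"
      unfolding sum_distrib_left by (subst sum.swap) (simp add: mult_ac)
    finally show ?thesis unfolding phi_def using True
      by (simp add: sum_divide_distrib[symmetric])
  qed (simp add: phi_def)
  show "x \<in> A \<Longrightarrow> x \<notin> K \<Longrightarrow> vertex_cond x * phi A v r L K x \<le> (\<Sum>b\<in>B. C x b * phi A v r L K b)"
    using eq[of x] core_sub by fastforce
  show "phi A v r L K x \<le> 1" if x: "x \<in> B"
  proof (rule max_principle[where A="A - ?c" and D="phi A v r L K", OF _ _ _ _ x])
    fix z assume "z \<in> B - (A - ?c)"
    then consider "z \<notin> A" | "z \<in> ?c" by auto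
    then show "phi A v r L K z \<le> 1"
    proof cases
      case 2
      then have zB: "z \<in> B" using cA A by auto
      show ?thesis
      proof (cases "good A v r L K")
        case True
        have "(\<Sum>y\<in>?c. vertex_cond y * green A y z) \<le> (\<Sum>y\<in>?c. U z y)"
          by (intro sum_mono green_le_U A zB) (use cA in auto)
        also have "\<dots> \<le> (\<Sum>y\<in>?t. U z y)"
          by (rule sum_mono2) (use fin U_nonneg in \<open>auto simp: core_def\<close>)
        also have "\<dots> \<le> 2 * L" using 2 by (simp add: core_def)
        finally show ?thesis unfolding phi_def using L by simp
      qed (simp add: phi_def)
    qed (simp add: off)
  qed (use A eq in auto)
  show "(\<Sum>b\<in>A. boundary_cond A b * phi A v r L K b) \<ge> real r / (4 * L * M)" if g: "good A v r L K"
  proof -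
    have "(\<Sum>b\<in>A. boundary_cond A b * phi A v r L K b) = (\<Sum>b\<in>A. \<Sum>y\<in>?c. vertex_cond y * (boundary_cond A b * green A y b)) / (2 * L)"
      unfolding phi_def using g by (simp add: sum_divide_distrib[symmetric] sum_distrib_left mult_ac)
    also have "(\<Sum>b\<in>A. \<Sum>y\<in>?c. vertex_cond y * (boundary_cond A b * green A y b)) = (\<Sum>y\<in>?c. vertex_cond y * (\<Sum>b\<in>A. boundary_cond A b * green A y b))"
      by (subst sum.swap) (simp add: sum_distrib_left)
    also have "\<dots> = (\<Sum>y\<in>?c. vertex_cond y)" using green_flux[OF A] cA by (intro sum.cong) auto
    finally have s: "(\<Sum>b\<in>A. boundary_cond A b * phi A v r L K b) = sum vertex_cond ?c / (2 * L)" .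
    have "real (card ?c) * inverse M \<le> sum vertex_cond ?c"
      using sum_mono[of ?c "\<lambda>_. inverse M" vertex_cond] vertex_cond_lower cA A by (auto simp: subset_iff)
    moreover have "real r / 2 \<le> real (card ?c)"
    proof -
      \<comment> \<open>Markov's inequality: each point of the trace outside the core contributes
        more than \<open>2 * L\<close> to an energy of at most \<open>L * real r\<close>, so there
        are at most \<open>r / 2\<close> such points.\<close>
      have "(2 * L) * real (card (?t - ?c)) = (\<Sum>x\<in>?t - ?c. 2 * L)" by simp
      also have "\<dots> \<le> (\<Sum>x\<in>?t - ?c. \<Sum>y\<in>?t. U x y)" by (rule sum_mono) (auto simp: core_def)
      also have "\<dots> \<le> energy A v r K" unfolding energy_def
        by (rule sum_mono2) (use fin U_nonneg in \<open>auto intro: sum_nonneg\<close>)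
      also have "\<dots> \<le> L * real r" using g by (simp add: good_def)
      finally have "2 * real (card (?t - ?c)) \<le> real r" using L by simp
      moreover have "card (?t - ?c) = card ?t - card ?c" "card ?c \<le> card ?t"
        using fin by (auto intro!: card_Diff_subset card_mono simp: core_def)
      moreover have "r \<le> card ?t" using g by (simp add: good_def)
      ultimately show ?thesis by (simp add: of_nat_diff)
    qed
    ultimately have "real r / 2 * inverse M \<le> sum vertex_cond ?c"
      using M1 by (smt (verit) inverse_nonnegative_iff_nonnegative mult_right_mono)
    then have "real r / 2 * inverse M / (2 * L) \<le> sum vertex_cond ?c / (2 * L)" using L by (intro divide_right_mono) auto
    then show ?thesis unfolding s by (simp add: field_simps)
  qed
qed


text \<open>A path from distance \<open>3 * r\<close> crosses every level \<open>j\<close> between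
  \<open>r\<close> and \<open>2 * r\<close> at some \<open>w\<close> that is at least
  \<open>r\<close> away from its start. \<open>excursion_bound\<close> is applied to each level
  separately; averaging over the \<open>r\<close> levels replaces sums over spheres by a sum over
  the shell, of order \<open>r\<close>, divided by \<open>r\<close>.\<close>

lemma scale_step_aux:
  assumes A: "A \<subseteq> B - {\<rho>}" "A \<noteq> {}" and v: "v \<in> B - {\<rho>}" "v \<notin> A" and r: "r \<ge> 1" and L: "L > 0"
    and IH: "\<And>A' v'. A' \<subseteq> B - {\<rho>} \<Longrightarrow> v' \<in> B - {\<rho>} \<Longrightarrow> v' \<notin> A' \<Longrightarrow> pr A' (\<lambda>f. \<exists>u\<in>A'. v' \<in> orb f u \<and> r \<le> d u v') \<le> q"
    and e: "e \<ge> 0" and n: "\<And>K. (1 - (\<Sum>b\<in>A. boundary_cond A b * phi A v r L K b) / boundary_total A) ^ n \<le> (if good A v r L K then e else 1)"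
    and boundary_total: "boundary_total A > 0"
  shows "pr A (\<lambda>f. \<exists>u\<in>A. v \<in> orb f u \<and> 3 * r \<le> d u v) \<le>
    real n * M / boundary_total A + q * (6 * M ^ 10 * C0\<^sup>2 * K0 / L + e * (2 * M\<^sup>2 * C0))"
proof -
  have finA: "finite A" and AB: "A \<subseteq> B" using A finB finite_subset by auto
  have q0: "q \<ge> 0" using IH[of "{}" v] v(1) pr_nonneg[of "{}"] by (smt (verit) empty_iff empty_subsetI)
  let ?Far = "\<lambda>u w. r \<le> d u w"
  define \<Theta> where "\<Theta> K = (if good A v r L K then e else 1)" for K
  define S where "S j = {w \<in> A. d w v = j}" for j
  let ?W = "{w \<in> A. d w v \<le> 2 * r}"
  define p where "p = pr A (\<lambda>f. \<exists>u\<in>A. v \<in> orb f u \<and> 3 * r \<le> d u v)"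
  have one: "boundary_total A * p \<le> real n * M + boundary_total A * (q * (\<Sum>w\<in>S j. ex A (\<lambda>f. of_bool (v \<in> orb f w) * \<Theta> (orb f w))))"
    if j: "j \<in> {r<..2*r}" for j
  proof -
    have "p \<le> ex A (\<lambda>f. min 1 (\<Sum>w\<in>S j. of_bool (active A v ?Far f w)))" unfolding p_def pr_def
    proof (rule ex_mono[OF AB])
      fix f assume f: "f \<in> forests A" "wt A f > 0"
      have fS: "finite (S j)" using finA by (simp add: S_def)
      show "of_bool (\<exists>u\<in>A. v \<in> orb f u \<and> 3 * r \<le> d u v) \<le> (min 1 (\<Sum>w\<in>S j. of_bool (active A v ?Far f w)) :: real)"
      proof (cases "\<exists>u\<in>A. v \<in> orb f u \<and> 3 * r \<le> d u v")
        case True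
        then obtain u where u: "u \<in> A" "v \<in> orb f u" "3 * r \<le> d u v" by auto
        then obtain w where w: "w \<in> orb f u" "w \<in> A" "d w v = j"
          using level[OF f A(1) v u(1,2), of j] j r by auto
        have "d u v \<le> d u w + d w v" by (rule d_tri) (use u w A v in auto)
        then have "r \<le> d u w" using u(3) w(3) j by auto
        then have "active A v ?Far f w" unfolding active_def using u w by blast
        then have "(1::real) \<le> (\<Sum>w\<in>S j. of_bool (active A v ?Far f w))"
          using member_le_sum[of w "S j" "\<lambda>w. of_bool (active A v ?Far f w) :: real"] fS w by (auto simp: S_def)
        then show ?thesis by simp
      next
        case False
        then have "(of_bool (\<exists>u\<in>A. v \<in> orb f u \<and> 3 * r \<le> d u v) :: real) = 0" by (simp only: of_bool_eq)
        then show ?thesis by (simp only:) (simp add: sum_nonneg)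
      qed
    qed
    then have p1: "boundary_total A * p \<le> boundary_total A * ex A (\<lambda>f. min 1 (\<Sum>w\<in>S j. of_bool (active A v ?Far f w)))"
      using boundary_total by (intro mult_left_mono) auto
    \<comment> \<open>\<open>excursion_bound\<close> asks for the bound by one at all points, while
      \<open>phi_props\<close> gives it on \<open>B\<close>. Writing the potential with an explicit
      zero off \<open>A\<close>, where it vanishes, settles the points outside
      \<open>B\<close>.\<close>
    have p2: "boundary_total A * ex A (\<lambda>f. min 1 (\<Sum>w\<in>S j. of_bool (active A v ?Far f w))) \<le> real n * vertex_cond v + boundary_total A * ex A (\<lambda>f. \<Sum>w\<in>S j. of_bool (active A v ?Far f w) *
        (1 - (\<Sum>b\<in>A. boundary_cond A b * phi' (orb f w) b) / boundary_total A) ^ n)"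
      if "phi' = (\<lambda>K x. if x \<in> A then phi A v r L K x else 0)" for phi'
    proof (rule excursion_bound[OF A(1)])
      fix K x
      have *: "phi' K x = phi A v r L K x" for K x using phi_props(2)[OF A(1) L, of x v r K] that by simp
      show "phi' K x \<le> 1" using phi_props(4)[OF A(1) L, of x v r K] AB that by auto
      show "phi' K x \<ge> 0" unfolding * by (rule phi_props(1)[OF A(1) L])
      show "x \<notin> A \<Longrightarrow> phi' K x = 0" using that by simp
      show "x \<in> A \<Longrightarrow> x \<notin> K \<Longrightarrow> vertex_cond x * phi' K x \<le> (\<Sum>b\<in>B. C x b * phi' K b)"
        unfolding * by (rule phi_props(3)[OF A(1) L])
    qed (use v in auto)
    from order_trans[OF p1 p2[OF refl]] have "boundary_total A * p \<le> real n * vertex_cond v + boundary_total A * ex A (\<lambda>f. \<Sum>w\<in>S j. of_bool (active A v ?Far f w) *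
        (1 - (\<Sum>b\<in>A. boundary_cond A b * phi A v r L (orb f w) b) / boundary_total A) ^ n)"
      by (simp cong: sum.cong)
    also have "ex A (\<lambda>f. \<Sum>w\<in>S j. of_bool (active A v ?Far f w) *
        (1 - (\<Sum>b\<in>A. boundary_cond A b * phi A v r L (orb f w) b) / boundary_total A) ^ n) \<le>
        ex A (\<lambda>f. \<Sum>w\<in>S j. of_bool (active A v ?Far f w) * \<Theta> (orb f w))"
      by (intro ex_mono[OF AB] sum_mono mult_left_mono) (auto simp: \<Theta>_def n[THEN order_trans])
    also have "\<dots> = (\<Sum>w\<in>S j. ex A (\<lambda>f. of_bool (active A v ?Far f w) * \<Theta> (orb f w)))" by (rule ex_sum)
    also have "\<dots> \<le> (\<Sum>w\<in>S j. q * ex A (\<lambda>f. of_bool (v \<in> orb f w) * \<Theta> (orb f w)))"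
      by (intro sum_mono active_bound A v r IH) (auto simp: S_def \<Theta>_def e)
    also have "real n * vertex_cond v \<le> real n * M" using vertex_cond_upper[OF v(1)] by (intro mult_left_mono) auto
    finally show ?thesis using boundary_total by (simp add: sum_distrib_left mult_left_mono)
  qed
  define T where "T = (\<Sum>w\<in>{w\<in>A. r < d w v \<and> d w v \<le> 2 * r}. ex A (\<lambda>f. of_bool (v \<in> orb f w) * \<Theta> (orb f w)))"
  have "real r * (boundary_total A * p) = (\<Sum>j\<in>{r<..2*r}. boundary_total A * p)" by simp
  also have "\<dots> \<le> (\<Sum>j\<in>{r<..2*r}. real n * M + boundary_total A * (q * (\<Sum>w\<in>S j. ex A (\<lambda>f. of_bool (v \<in> orb f w) * \<Theta> (orb f w)))))"
    by (rule sum_mono[OF one])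
  also have "\<dots> = real r * (real n * M) + boundary_total A * (q * (\<Sum>j\<in>{r<..2*r}. \<Sum>w\<in>S j. ex A (\<lambda>f. of_bool (v \<in> orb f w) * \<Theta> (orb f w))))"
    by (simp add: sum.distrib sum_distrib_left)
  also have "(\<Sum>j\<in>{r<..2*r}. \<Sum>w\<in>S j. ex A (\<lambda>f. of_bool (v \<in> orb f w) * \<Theta> (orb f w))) = T"
  proof -
    have "(\<Union>j\<in>{r<..2*r}. S j) = {w\<in>A. r < d w v \<and> d w v \<le> 2 * r}" by (auto simp: S_def)
    then show ?thesis unfolding T_def
      by (subst sum.UNION_disjoint[symmetric]) (use finA in \<open>auto simp: S_def\<close>)
  qed
  finally have main: "real r * (boundary_total A * p) \<le> real r * (real n * M) + boundary_total A * (q * T)" .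
  have "T \<le> (\<Sum>w\<in>{w\<in>A. r < d w v \<and> d w v \<le> 2 * r}. 1 / (L * real r) * ex A (\<lambda>f. of_bool (v \<in> orb f w) * energy A v r (orb f w))
      + e * ex A (\<lambda>f. of_bool (v \<in> orb f w)))"
    unfolding T_def
  proof (rule sum_mono)
    fix w assume w: "w \<in> {w\<in>A. r < d w v \<and> d w v \<le> 2 * r}"
    have "ex A (\<lambda>f. of_bool (v \<in> orb f w) * \<Theta> (orb f w)) \<le>
      ex A (\<lambda>f. 1 / (L * real r) * (of_bool (v \<in> orb f w) * energy A v r (orb f w)) + e * of_bool (v \<in> orb f w))"
    proof (rule ex_mono[OF AB])
      fix f assume f: "f \<in> forests A" "wt A f > 0"
      have e0: "energy A v r (orb f w) \<ge> 0" unfolding energy_def by (intro sum_nonneg U_nonneg)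
      have "\<Theta> (orb f w) \<le> 1 / (L * real r) * energy A v r (orb f w) + e" if vw: "v \<in> orb f w"
      proof (cases "good A v r L (orb f w)")
        case True
        then show ?thesis using e0 L by (simp add: \<Theta>_def)
      next
        case False
        let ?t = "trace A v r (orb f w)"
        have ft: "finite ?t" using finA by (simp add: trace_def)
        \<comment> \<open>The path of \<open>w\<close> meets every level from 1 to \<open>r\<close>,
          so its trace has at least \<open>r\<close> points. If it is not good, then its energy is
          too large, and the indicator is at most the normalised energy.\<close>
        have "{1..r} \<subseteq> (\<lambda>x. d x v) ` ?t"
        proof
          fix i assume i: "i \<in> {1..r}"
          then obtain x where "x \<in> orb f w" "x \<in> A" "d x v = i"
            using level[OF f A(1) v _ vw, of i] w by auto
          then show "i \<in> (\<lambda>x. d x v) ` ?t" using i by (auto simp: trace_def)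
        qed
        then have "card {1..r} \<le> card ?t" using ft surj_card_le by blast
        then have "L * real r < energy A v r (orb f w)" using False by (auto simp: good_def)
        then have "1 \<le> 1 / (L * real r) * energy A v r (orb f w)" using L r by (simp add: field_simps)
        then show ?thesis using False e by (simp add: \<Theta>_def)
      qed
      then show "of_bool (v \<in> orb f w) * \<Theta> (orb f w) \<le>
         1 / (L * real r) * (of_bool (v \<in> orb f w) * energy A v r (orb f w)) + e * of_bool (v \<in> orb f w)" by auto
    qed
    then show "ex A (\<lambda>f. of_bool (v \<in> orb f w) * \<Theta> (orb f w)) \<le>
      1 / (L * real r) * ex A (\<lambda>f. of_bool (v \<in> orb f w) * energy A v r (orb f w)) + e * ex A (\<lambda>f. of_bool (v \<in> orb f w))"
      unfolding ex_add ex_cmult .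
  qed
  also have "\<dots> \<le> (\<Sum>w\<in>?W. 1 / (L * real r) * ex A (\<lambda>f. of_bool (v \<in> orb f w) * energy A v r (orb f w))
      + e * ex A (\<lambda>f. of_bool (v \<in> orb f w)))"
  proof (rule sum_mono2)
    fix w
    have "ex A (\<lambda>f. of_bool (v \<in> orb f w) * energy A v r (orb f w)) \<ge> 0"
      by (rule ex_nonneg) (auto simp: energy_def intro!: sum_nonneg U_nonneg)
    moreover have "ex A (\<lambda>f. of_bool (v \<in> orb f w)) \<ge> 0" by (rule ex_nonneg) auto
    ultimately show "0 \<le> 1 / (L * real r) * ex A (\<lambda>f. of_bool (v \<in> orb f w) * energy A v r (orb f w))
      + e * ex A (\<lambda>f. of_bool (v \<in> orb f w))" using L e by simp
  qed (use finA in auto)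
  also have "\<dots> = 1 / (L * real r) * (\<Sum>w\<in>?W. ex A (\<lambda>f. of_bool (v \<in> orb f w) * energy A v r (orb f w)))
      + e * (\<Sum>w\<in>?W. hit A v w)"
    by (simp add: sum.distrib sum_distrib_left hit_def pr_def)
  also have "\<dots> \<le> 1 / (L * real r) * (6 * M ^ 10 * C0\<^sup>2 * K0 * (real r)\<^sup>2) + e * (M\<^sup>2 * (C0 * real (2 * r)))"
  proof (intro add_mono mult_left_mono energy_bound A v r e)
    have "(\<Sum>w\<in>?W. hit A v w) \<le> (\<Sum>w\<in>?W. U w v)"
      by (intro sum_mono hit_le_U A v) (use AB in auto)
    also have "\<dots> \<le> M\<^sup>2 * (C0 * real (2 * r))" by (rule U_ball_rev[OF v(1)]) (use A r in auto)
    finally show "(\<Sum>w\<in>?W. hit A v w) \<le> M\<^sup>2 * (C0 * real (2 * r))" .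
  qed (use L in auto)
  also have "\<dots> = real r * (6 * M ^ 10 * C0\<^sup>2 * K0 / L + e * (2 * M\<^sup>2 * C0))"
    using L r by (simp add: field_simps power2_eq_square)
  finally have T: "T \<le> real r * (6 * M ^ 10 * C0\<^sup>2 * K0 / L + e * (2 * M\<^sup>2 * C0))" (is "T \<le> real r * ?t") .
  have "boundary_total A * (q * T) \<le> boundary_total A * (q * (real r * ?t))" using T q0 boundary_total by (intro mult_left_mono) auto
  then have "real r * (boundary_total A * p) \<le> real r * (real n * M + boundary_total A * (q * ?t))" using main by (simp add: algebra_simps)
  then have "boundary_total A * p \<le> real n * M + boundary_total A * (q * ?t)" using r by simp
  then have "p \<le> real n * M / boundary_total A + q * ?t" using boundary_total by (simp add: field_simps)
  then show ?thesis unfolding p_def .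
qed

text \<open>\<open>Lc\<close> and \<open>tc\<close> make the contributions of large energy and of
  surviving paths at most 1/12 each, the latter through \<open>exp t \<ge> 1 + t\<close>. With the
  flux bound \<open>real r / (4 * Lc * M)\<close> the excursions then cost
  \<open>Dc / (6 * real r)\<close>. The added ones keep the constants away from zero, and
  \<open>Dc \<ge> 1\<close> starts the induction at scale one.\<close>

definition Lc :: real where "Lc = 72 * M ^ 10 * C0\<^sup>2 * K0 + 1"
definition tc :: real where "tc = 24 * M\<^sup>2 * C0 + 1"
definition Dc :: real where "Dc = 24 * (tc + 1) * Lc * M\<^sup>2"

lemma const_bounds: "Lc \<ge> 1" "tc \<ge> 1" "Dc \<ge> 1" "6 * M ^ 10 * C0\<^sup>2 * K0 / Lc \<le> 1 / 12" "exp (- tc) * (2 * M\<^sup>2 * C0) \<le> 1 / 12"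
proof -
  show L: "Lc \<ge> 1" and t: "tc \<ge> 1" unfolding Lc_def tc_def using M1 C0 K0 by auto
  have "1 * 1 * 1 * 1 \<le> 24 * (tc + 1) * Lc * M\<^sup>2" using L t M1 by (intro mult_mono) auto
  then show "Dc \<ge> 1" by (simp add: Dc_def)
  have "0 \<le> M ^ 10 * C0\<^sup>2 * K0" using M1 K0 by simp
  then show "6 * M ^ 10 * C0\<^sup>2 * K0 / Lc \<le> 1 / 12" using L by (simp add: field_simps) (simp add: Lc_def)
  have "exp tc \<ge> 24 * M\<^sup>2 * C0" using exp_ge_add_one_self[of tc] by (simp add: tc_def)
  then have "exp (- tc) * (24 * M\<^sup>2 * C0) \<le> exp (- tc) * exp tc" by (intro mult_left_mono) auto
  then show "exp (- tc) * (2 * M\<^sup>2 * C0) \<le> 1 / 12" by (simp add: exp_minus)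
qed

lemma scale_step:
  assumes A: "A \<subseteq> B - {\<rho>}" and v: "v \<in> B - {\<rho>}" "v \<notin> A" and r: "r \<ge> 1"
    and IH: "\<And>A' v'. A' \<subseteq> B - {\<rho>} \<Longrightarrow> v' \<in> B - {\<rho>} \<Longrightarrow> v' \<notin> A' \<Longrightarrow> pr A' (\<lambda>f. \<exists>u\<in>A'. v' \<in> orb f u \<and> r \<le> d u v') \<le> Dc / real r"
  shows "pr A (\<lambda>f. \<exists>u\<in>A. v \<in> orb f u \<and> 3 * r \<le> d u v) \<le> Dc / real (3 * r)"
proof (cases "A = {}")
  case True
  then have "pr A (\<lambda>f. \<exists>u\<in>A. v \<in> orb f u \<and> 3 * r \<le> d u v) = 0" by (simp add: pr_def ex_def)
  then show ?thesis using const_bounds by simp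
next
  case False
  have L: "Lc > 0" using const_bounds by auto
  have finA: "finite A" using A finB finite_subset by blast
  obtain x y where xy: "x \<in> A" "y \<in> B - A" "C x y > 0" using leaving[OF A False] by auto
  have "0 < C y x" using xy C_sym[of x y] by simp
  also have "\<dots> \<le> boundary_cond A x" unfolding boundary_cond_def
    using xy finB C_nonneg by (intro member_le_sum) auto
  also have "\<dots> \<le> boundary_total A" unfolding boundary_total_def using xy finA boundary_cond_nonneg by (intro member_le_sum) auto
  finally have boundary_total: "boundary_total A > 0" .
  define \<tau> where "\<tau> = real r / (4 * Lc * M)"
  have \<tau>: "\<tau> > 0" using r L M1 by (simp add: \<tau>_def)
  let ?s = "\<lambda>K. \<Sum>b\<in>A. boundary_cond A b * phi A v r Lc K b"
  have s_le: "?s K \<le> boundary_total A" for K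
    unfolding boundary_total_def using phi_props(4)[OF A L] A boundary_cond_nonneg
    by (intro sum_mono) (metis (no_types, lifting) Diff_subset mult.right_neutral mult_left_mono subset_iff)
  have s_ge: "good A v r Lc K \<Longrightarrow> ?s K \<ge> \<tau>" for K unfolding \<tau>_def by (rule phi_props(5)[OF A L])
  have s_0: "\<not> good A v r Lc K \<Longrightarrow> ?s K = 0" for K by (simp add: phi_def)
  have q: "Dc / real r \<ge> 0" using const_bounds by simp
  have "\<exists>n e. e \<ge> 0 \<and> (\<forall>K. (1 - ?s K / boundary_total A) ^ n \<le> (if good A v r Lc K then e else 1)) \<and>
     e * (2 * M\<^sup>2 * C0) \<le> 1 / 12 \<and> real n * M / boundary_total A \<le> (tc + 1) * M / \<tau>"
  proof (cases "boundary_total A < \<tau>")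
    case True
    \<comment> \<open>The flux of the potential is at most the boundary conductance, so in this case
      no path is good, and zero excursions suffice.\<close>
    then have "\<not> good A v r Lc K" for K using s_ge[of K] s_le[of K] by auto
    then show ?thesis using \<tau> M1 const_bounds by (intro exI[of _ 0] exI[of _ "0::real"]) auto
  next
    case False
    \<comment> \<open>Enough excursions to bring the survival probability of a good path below
      \<open>exp (- tc)\<close>. Rounding up adds at most one excursion, and here one is at most
      \<open>boundary_total A / \<tau>\<close>; hence the factor \<open>tc + 1\<close>.\<close>
    define n where "n = nat \<lceil>tc * boundary_total A / \<tau>\<rceil>"
    have n: "real n \<ge> tc * boundary_total A / \<tau>" "real n \<le> tc * boundary_total A / \<tau> + 1"
      unfolding n_def using const_bounds boundary_total \<tau> by (auto simp: of_nat_nat le_of_int_ceiling)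
    have "(1 - ?s K / boundary_total A) ^ n \<le> (if good A v r Lc K then exp (- tc) else 1)" for K
    proof (cases "good A v r Lc K")
      case True
      have "0 \<le> 1 - ?s K / boundary_total A" using s_le[of K] boundary_total by simp
      moreover have "1 - ?s K / boundary_total A \<le> 1 - \<tau> / boundary_total A" using s_ge[OF True] boundary_total by (simp add: divide_right_mono)
      moreover have "1 - \<tau> / boundary_total A \<le> exp (- (\<tau> / boundary_total A))" using exp_ge_add_one_self[of "- (\<tau> / boundary_total A)"] by simp
      ultimately have "(1 - ?s K / boundary_total A) ^ n \<le> exp (- (\<tau> / boundary_total A)) ^ n" by (intro power_mono) auto
      also have "\<dots> = exp (- (real n * (\<tau> / boundary_total A)))" by (simp add: exp_of_nat_mult[symmetric])
      also have "\<dots> \<le> exp (- tc)" using n(1) \<tau> boundary_total by (simp add: field_simps)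
      finally show ?thesis using True by simp
    next
      case False then show ?thesis by (simp add: s_0)
    qed
    moreover have "real n * M / boundary_total A \<le> (tc + 1) * M / \<tau>"
    proof -
      have "real n \<le> tc * boundary_total A / \<tau> + boundary_total A / \<tau>" using n(2) False \<tau> by (simp add: field_simps)
      then have "real n * M / boundary_total A \<le> (tc * boundary_total A / \<tau> + boundary_total A / \<tau>) * M / boundary_total A"
        using boundary_total M1 by (intro divide_right_mono mult_right_mono) auto
      also have "\<dots> = (tc + 1) * M / \<tau>" using boundary_total \<tau> by (simp add: field_simps)
      finally show ?thesis .
    qed
    ultimately show ?thesis using const_bounds by (intro exI[of _ n] exI[of _ "exp (- tc)"]) auto
  qed
  then obtain n e where ne: "e \<ge> 0" "\<And>K. (1 - ?s K / boundary_total A) ^ n \<le> (if good A v r Lc K then e else 1)"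
     "e * (2 * M\<^sup>2 * C0) \<le> 1 / 12" "real n * M / boundary_total A \<le> (tc + 1) * M / \<tau>" by blast
  have "pr A (\<lambda>f. \<exists>u\<in>A. v \<in> orb f u \<and> 3 * r \<le> d u v) \<le>
    real n * M / boundary_total A + Dc / real r * (6 * M ^ 10 * C0\<^sup>2 * K0 / Lc + e * (2 * M\<^sup>2 * C0))"
    by (rule scale_step_aux[OF A False v r L IH ne(1,2) boundary_total])
  also have "\<dots> \<le> (tc + 1) * M / \<tau> + Dc / real r * (1 / 12 + 1 / 12)"
    by (intro add_mono mult_left_mono ne const_bounds q)
  also have "(tc + 1) * M / \<tau> = Dc / (6 * real r)"
    unfolding \<tau>_def Dc_def using r L M1 by (simp add: field_simps power2_eq_square)
  also have "Dc / (6 * real r) + Dc / real r * (1 / 12 + 1 / 12) = Dc / real (3 * r)"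
    using r by (simp add: field_simps)
  finally show ?thesis .
qed

lemma upper_scale:
  assumes "A \<subseteq> B - {\<rho>}" "v \<in> B - {\<rho>}" "v \<notin> A"
  shows "pr A (\<lambda>f. \<exists>u\<in>A. v \<in> orb f u \<and> 3 ^ k \<le> d u v) \<le> Dc / real (3 ^ k)"
  using assms
proof (induction k arbitrary: A v)
  case 0
  then show ?case using pr_le1[OF 0(1), of "\<lambda>f. \<exists>u\<in>A. v \<in> orb f u \<and> 3 ^ 0 \<le> d u v"] const_bounds by simp
next
  case (Suc k)
  show ?case using scale_step[OF Suc.prems, of "3 ^ k"] Suc.IH by simp
qed

text \<open>A vertex inside the domain is moved to the boundary by conditioning on its path to the root.\<close>

lemma upper_past:
  assumes A: "A \<subseteq> B - {\<rho>}" and v: "v \<in> A" and r: "r \<ge> 1"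
  shows "pr A (\<lambda>f. \<exists>u\<in>A. v \<in> orb f u \<and> r \<le> d u v) \<le> 3 * Dc / real r"
proof -
  obtain k where k: "3 ^ k \<le> r" "r < 3 ^ Suc k" using ex_power_ivl1[of 3 r] r by auto
  have dvv: "d v v = 0" using d_refl v A by blast
  let ?X = "\<lambda>f. of_bool (\<exists>u\<in>A. v \<in> orb f u \<and> r \<le> d u v) :: real"
  have "ex A ?X \<le> ex A (\<lambda>f. Dc / real (3 ^ k))" unfolding tower[OF A, of ?X v]
  proof (rule ex_mono)
    fix f assume f: "f \<in> forests A"
    let ?A' = "A - orb f v"
    let ?J = "\<lambda>f' x. if x \<in> orb f v then f x else f' x"
    have "ex ?A' (\<lambda>f'. ?X (?J f')) \<le> ex ?A' (\<lambda>f'. of_bool (\<exists>u\<in>?A'. v \<in> orb f' u \<and> 3 ^ k \<le> d u v))"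
    proof (rule ex_mono)
      fix f' assume f': "f' \<in> forests ?A'"
      have J: "?J f' \<in> forests A" by (rule forests_join[OF f f'])
      have oJ: "orb (?J f') v = orb f v" by (rule orb_cong[symmetric]) auto
      have "\<exists>u\<in>?A'. v \<in> orb f' u \<and> 3 ^ k \<le> d u v" if ex: "\<exists>u\<in>A. v \<in> orb (?J f') u \<and> r \<le> d u v"
      proof -
        obtain u where u: "u \<in> A" "v \<in> orb (?J f') u" "r \<le> d u v" using ex by blast
        have uv: "u \<noteq> v" using u(3) r dvv by auto
        have un: "u \<notin> orb f v" using forest_acyclic[OF J _ u(2)] oJ uv by metis
        obtain b where b: "b \<in> orb f' u" "b \<notin> ?A'" using forest_exit[OF f', of u] by blast
        have "v \<in> orb f' u \<or> v \<in> orb f b" using join_orbit[OF f f' b] u(2) by blast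
        moreover have "b = v" if wb: "v \<in> orb f b"
        proof -
          have "b \<in> A" using forest_orb_out[OF f, of b] wb v by (cases "b \<in> A") auto
          then show ?thesis using forest_acyclic[OF f _ wb] b(2) by blast
        qed
        ultimately have "v \<in> orb f' u" using b by auto
        then show ?thesis using un u k by auto
      qed
      then show "?X (?J f') \<le> of_bool (\<exists>u\<in>?A'. v \<in> orb f' u \<and> 3 ^ k \<le> d u v)" by auto
    qed (use A in auto)
    also have "\<dots> \<le> Dc / real (3 ^ k)"
      using upper_scale[of ?A' v k] A v by (auto simp: pr_def)
    finally show "ex ?A' (\<lambda>f'. ?X (?J f')) \<le> Dc / real (3 ^ k)" .
  qed (use A in auto)
  also have "\<dots> = Dc / real (3 ^ k)" by (rule ex_const[OF A])
  also have "\<dots> \<le> 3 * Dc / real r"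
  proof -
    have "real r \<le> 3 * real (3 ^ k)" using k(2) by (metis less_imp_le of_nat_le_iff of_nat_mult of_nat_numeral power_Suc)
    then show ?thesis using const_bounds r by (simp add: field_simps mult_left_mono)
  qed
  finally show ?thesis by (simp add: pr_def)
qed

end

section \<open>Lower bound: paths that avoid a set\<close>

context finite_net begin

lemma orb_join_avoid:
  assumes f: "f \<in> forests A" and f': "f' \<in> forests (A - orb f z)" and v: "v \<in> orb f' w" "v \<notin> A" "v \<notin> orb f z"
  shows "orb (\<lambda>x. if x \<in> orb f z then f x else f' x) w = orb f' w"
  using join_orbit[OF f f' v(1)] v forest_orb_out[OF f v(2)] by auto

text \<open>The path to the root is less likely to meet a set than the random walk is.\<close>

lemma avoid_mono_single:
  assumes A: "A \<subseteq> B - {\<rho>}" and b: "b \<in> B - A" and s: "s \<in> A" "s \<in> S"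
  shows "pr (A - {s}) (\<lambda>f. b \<in> orb f z \<and> orb f z \<inter> S = {}) \<le> pr A (\<lambda>f. b \<in> orb f z \<and> orb f z \<inter> S = {})"
proof -
  have AB: "A \<subseteq> B" and As: "A - {s} \<subseteq> B - {\<rho>}" using A by auto
  let ?P = "\<lambda>f. b \<in> orb f z \<and> orb f z \<inter> S = {}"
  let ?A' = "A - {s}"
  \<comment> \<open>Cut the edge of \<open>s\<close>. On the event the path of \<open>z\<close> does
    not use this edge, so restoring it leaves the event unchanged; all that remains is that the path
    of its target \<open>y\<close> does not return to \<open>s\<close>.\<close>
  have 1: "Z A * pr A ?P = (\<Sum>y\<in>B. C s y * (Z ?A' * ex ?A' (\<lambda>f. of_bool (s \<notin> orb f y) * of_bool (?P f))))"
  proof -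
    have "Z A * pr A ?P = (\<Sum>f\<in>forests A. wt A f * of_bool (?P f))"
      using sum_wt[OF A, of "\<lambda>f. of_bool (?P f)"] by (simp add: pr_def)
    also have "\<dots> = (\<Sum>y\<in>B. \<Sum>f\<in>forests ?A'. C s y * wt ?A' f * (of_bool (s \<notin> orb f y) * of_bool (?P (f(s := y)))))"
      by (rule cut_sum[OF AB s(1)])
    also have "\<dots> = (\<Sum>y\<in>B. \<Sum>f\<in>forests ?A'. C s y * (wt ?A' f * (of_bool (s \<notin> orb f y) * of_bool (?P f))))"
    proof (rule sum.cong[OF refl], rule sum.cong[OF refl])
      fix y f assume f: "f \<in> forests ?A'"
      have fs: "f s = s" using forestsD(2)[OF f] by simp
      have "?P (f(s := y)) \<longleftrightarrow> ?P f" if y: "s \<notin> orb f y"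
      proof (cases "s \<in> orb f z")
        case True
        then have "s \<in> orb (f(s := y)) z" using orb_upd_absorb[OF fs y, of z] by simp
        then show ?thesis using True s by blast
      next
        case False
        then show ?thesis using orb_upd[of s f z y] by simp
      qed
      then show "C s y * wt ?A' f * (of_bool (s \<notin> orb f y) * of_bool (?P (f(s := y)))) =
        C s y * (wt ?A' f * (of_bool (s \<notin> orb f y) * of_bool (?P f)))" by auto
    qed
    finally show ?thesis by (simp only: sum_distrib_left[symmetric] sum_wt[OF As]) (simp add: mult_ac)
  qed
  have 2: "Z A = (\<Sum>y\<in>B. C s y * (Z ?A' * ex ?A' (\<lambda>f. of_bool (s \<notin> orb f y))))"
  proof -
    have "Z A = (\<Sum>f\<in>forests A. wt A f * 1)" by (simp add: Z_def)
    also have "\<dots> = (\<Sum>y\<in>B. \<Sum>f\<in>forests ?A'. C s y * wt ?A' f * (of_bool (s \<notin> orb f y) * 1))"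
      by (rule cut_sum[OF AB s(1)])
    also have "\<dots> = (\<Sum>y\<in>B. \<Sum>f\<in>forests ?A'. C s y * (wt ?A' f * of_bool (s \<notin> orb f y)))" by (simp add: mult_ac)
    finally show ?thesis by (simp only: sum_distrib_left[symmetric] sum_wt[OF As]) (simp add: mult_ac)
  qed
  \<comment> \<open>Positive correlation: given the path of \<open>z\<close>, which misses
    \<open>s\<close>, the other paths live on a smaller domain with more places to stop, so the path
    of \<open>y\<close> is less likely to reach \<open>s\<close>.\<close>
  have pos: "pr ?A' ?P * ex ?A' (\<lambda>f. of_bool (s \<notin> orb f y)) \<le> ex ?A' (\<lambda>f. of_bool (s \<notin> orb f y) * of_bool (?P f))"
    if y: "y \<in> B" for y
  proof -
    let ?e = "ex ?A' (\<lambda>f. of_bool (s \<notin> orb f y)) :: real"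
    let ?X = "\<lambda>f. of_bool (s \<notin> orb f y) * of_bool (?P f) :: real"
    have e: "?e = 1 - hit ?A' s y" unfolding hit_def using pr_not[OF As, of "\<lambda>f. s \<in> orb f y"] by (simp add: pr_def)
    have "pr ?A' ?P * ?e = ex ?A' (\<lambda>f. ?e * of_bool (?P f))" unfolding ex_cmult pr_def by simp
    also have "\<dots> \<le> ex ?A' ?X" unfolding tower[OF As, of ?X z]
    proof (rule ex_mono)
      fix f assume f: "f \<in> forests ?A'"
      let ?A2 = "?A' - orb f z"
      let ?J = "\<lambda>f' x. if x \<in> orb f z then f x else f' x"
      have A2: "?A2 \<subseteq> B - {\<rho>}" using A by auto
      have oJ: "orb (?J f') z = orb f z" for f' by (rule orb_cong[symmetric]) auto
      show "?e * of_bool (?P f) \<le> ex ?A2 (\<lambda>f'. ?X (?J f'))"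
      proof (cases "?P f")
        case True
        then have sz: "s \<notin> orb f z" using s by auto
        have "ex ?A2 (\<lambda>f'. of_bool (s \<notin> orb f' y)) \<le> ex ?A2 (\<lambda>f'. ?X (?J f'))"
        proof (rule ex_mono)
          fix f' assume f': "f' \<in> forests ?A2"
          obtain c where c: "c \<in> orb f' y" "c \<notin> ?A2" using forest_exit[OF f', of y] by blast
          have "s \<notin> orb (?J f') y" if sy: "s \<notin> orb f' y"
          proof -
            have "s \<notin> orb f c"
            proof
              assume sc: "s \<in> orb f c"
              show False
              proof (cases "c \<in> orb f z")
                case True then show False using sc sz orb_trans[OF True] by auto
              next
                case False
                then have "c \<notin> ?A'" using c by auto
                then have "c = s" using forest_orb_out[OF f, of c] sc by auto
                then show False using c sy by simp
              qed
            qed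
            then show ?thesis using join_orbit[OF f f' c] sy by auto
          qed
          then show "of_bool (s \<notin> orb f' y) \<le> ?X (?J f')" unfolding oJ using True by auto
        qed (use A in auto)
        moreover have "ex ?A2 (\<lambda>f'. of_bool (s \<notin> orb f' y)) = 1 - hit ?A2 s y"
          unfolding hit_def using pr_not[OF A2, of "\<lambda>f. s \<in> orb f y"] by (simp add: pr_def)
        moreover have "hit ?A2 s y \<le> hit ?A' s y"
        proof (rule hit_le_super[OF A2 _ _ _ _ y])
          have AB': "?A' \<subseteq> B" using AB by auto
          fix x assume "x \<in> ?A2"
          then show "(\<Sum>c\<in>B. C x c * hit ?A' s c) \<le> vertex_cond x * hit ?A' s x"
            using hit_harmonic[OF AB', of x s] by auto
        qed (use s AB hit_nonneg hit_boundary[OF As, of s s] in auto)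
        ultimately show ?thesis using True e by simp
      next
        case False
        then have o: "of_bool (?P f) = (0::real)" by (simp only: of_bool_eq)
        show ?thesis unfolding o mult_zero_right by (rule ex_nonneg) simp
      qed
    qed (use AB in auto)
    finally show ?thesis .
  qed
  have "Z A * pr ?A' ?P = (\<Sum>y\<in>B. C s y * (Z ?A' * (pr ?A' ?P * ex ?A' (\<lambda>f. of_bool (s \<notin> orb f y)))))"
    by (subst 2) (simp add: sum_distrib_left sum_distrib_right mult_ac)
  also have "\<dots> \<le> Z A * pr A ?P" unfolding 1
    using Z_pos[OF As] by (intro sum_mono mult_left_mono pos C_nonneg) auto
  finally show ?thesis using Z_pos[OF A] by simp
qed

lemma avoid_mono:
  assumes A: "A \<subseteq> B - {\<rho>}" and b: "b \<in> B - A" and T: "T \<subseteq> A" "T \<subseteq> S"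
  shows "pr (A - T) (\<lambda>f. b \<in> orb f z \<and> orb f z \<inter> S = {}) \<le> pr A (\<lambda>f. b \<in> orb f z \<and> orb f z \<inter> S = {})"
proof -
  have "finite T" using T A finB finite_subset by (metis Diff_subset)
  then show ?thesis using T
  proof (induction T)
    case (insert s T)
    have "A - insert s T = A - T - {s}" by auto
    then have "pr (A - insert s T) (\<lambda>f. b \<in> orb f z \<and> orb f z \<inter> S = {}) \<le> pr (A - T) (\<lambda>f. b \<in> orb f z \<and> orb f z \<inter> S = {})"
      using avoid_mono_single[of "A - T" b s S z] insert.prems insert.hyps A b by auto
    then show ?case using insert by auto
  qed simp
qed

text \<open>On \<open>A - S\<close> the set \<open>S\<close> belongs to the boundary, so a path that
  ends at \<open>b\<close> has not met it. The left-hand side is also the probability that the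
  random walk from \<open>z\<close> exits \<open>A - S\<close> at \<open>b\<close>.\<close>

lemma avoid_ge_hit:
  assumes A: "A \<subseteq> B - {\<rho>}" and b: "b \<in> B - A" "b \<notin> S" and S: "S \<subseteq> A" and z: "z \<notin> S"
  shows "hit (A - S) b z \<le> pr A (\<lambda>f. b \<in> orb f z \<and> orb f z \<inter> S = {})"
proof -
  have "hit (A - S) b z \<le> pr (A - S) (\<lambda>f. b \<in> orb f z \<and> orb f z \<inter> S = {})"
    unfolding hit_def
  proof (rule pr_mono)
    fix f assume f: "f \<in> forests (A - S)" and bz: "b \<in> orb f z"
    have "x \<notin> S" if "x \<in> orb f z" for x
      using forest_exit_unique[OF f that bz] b by auto
    then show "b \<in> orb f z \<and> orb f z \<inter> S = {}" using bz by auto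
  qed (use A in auto)
  also have "\<dots> \<le> pr A (\<lambda>f. b \<in> orb f z \<and> orb f z \<inter> S = {})" by (rule avoid_mono[OF A b(1) S]) simp
  finally show ?thesis .
qed

definition step_pr :: "'b \<Rightarrow> 'b \<Rightarrow> real" where "step_pr x y = C x y / vertex_cond x"

fun walk_pr :: "'b \<Rightarrow> 'b list \<Rightarrow> real" where
  "walk_pr x [] = 1" | "walk_pr x (y # ys) = step_pr x y * walk_pr y ys"

text \<open>The probability that the walk from \<open>w\<close> makes the steps in the list and then
  a last one to \<open>v\<close>.\<close>

fun rev_walk_pr :: "'b \<Rightarrow> 'b \<Rightarrow> 'b list \<Rightarrow> real" where
  "rev_walk_pr v w [] = step_pr w v" | "rev_walk_pr v w (x # ks) = step_pr w x * rev_walk_pr v x ks"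

lemma walk_pr_snoc: "walk_pr x (ys @ [y, z]) = walk_pr x (ys @ [y]) * step_pr y z"
  by (induction ys arbitrary: x) auto

text \<open>Detailed balance, applied edge by edge along the list.\<close>

lemma walk_pr_rw:
  assumes pos: "\<And>x. x \<in> insert v (insert w (set ks)) \<Longrightarrow> vertex_cond x > 0"
  shows "vertex_cond v * walk_pr v (rev (w # ks)) = vertex_cond w * rev_walk_pr v w ks"
  using assms
proof (induction ks arbitrary: w)
  case Nil
  then have "vertex_cond v > 0" "vertex_cond w > 0" by auto
  then show ?case by (simp add: step_pr_def C_sym)
next
  case (Cons x ks)
  have "vertex_cond v * walk_pr v (rev (w # x # ks)) = vertex_cond v * walk_pr v (rev (x # ks)) * step_pr x w"
    using walk_pr_snoc[of v "rev ks" x w] by simp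
  also have "\<dots> = vertex_cond x * rev_walk_pr v x ks * step_pr x w" using Cons by auto
  also have "\<dots> = vertex_cond w * rev_walk_pr v w (x # ks)"
    using Cons.prems[of x] Cons.prems[of w] by (simp add: step_pr_def C_sym)
  finally show ?case .
qed

lemma step_pr_nonneg: "step_pr x y \<ge> 0"
  unfolding step_pr_def vertex_cond_def by (intro divide_nonneg_nonneg sum_nonneg C_nonneg)

lemma walk_pr_nonneg: "walk_pr x ys \<ge> 0"
  by (induction ys arbitrary: x) (auto intro: mult_nonneg_nonneg step_pr_nonneg)

text \<open>The lists describe disjoint events, namely walks inside \<open>A\<close> that leave it
  by a step to \<open>v\<close>. Bounding their length keeps the sum finite and permits an induction
  on the first step.\<close>

lemma rev_walk_pr_sum_le_hit:
  assumes A: "A \<subseteq> B - {\<rho>}" and v: "v \<in> B - A" and pos: "\<And>x. x \<in> A \<Longrightarrow> vertex_cond x > 0" and w: "w \<in> A"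
  shows "(\<Sum>ks\<in>{ks. set ks \<subseteq> A \<and> length ks < n}. rev_walk_pr v w ks) \<le> hit A v w"
  using w
proof (induction n arbitrary: w)
  case 0
  then show ?case by (simp add: hit_nonneg)
next
  case (Suc n)
  have finA: "finite A" and AB: "A \<subseteq> B" using A finB finite_subset by auto
  let ?L = "\<lambda>n. {ks. set ks \<subseteq> A \<and> length ks < n}"
  have finL: "finite (?L n)" for n
    by (rule finite_subset[OF _ finite_lists_length_le[OF finA, of n]]) auto
  have "?L (Suc n) = insert [] ((\<lambda>(x,ks). x # ks) ` (A \<times> ?L n))"
  proof
    show "?L (Suc n) \<subseteq> insert [] ((\<lambda>(x,ks). x # ks) ` (A \<times> ?L n))"
    proof
      fix ks assume "ks \<in> ?L (Suc n)"
      then show "ks \<in> insert [] ((\<lambda>(x,ks). x # ks) ` (A \<times> ?L n))" by (cases ks) auto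
    qed
  qed auto
  then have "(\<Sum>ks\<in>?L (Suc n). rev_walk_pr v w ks) = rev_walk_pr v w [] + (\<Sum>ks\<in>(\<lambda>(x,ks). x # ks) ` (A \<times> ?L n). rev_walk_pr v w ks)"
    using finA finL by (subst sum.insert[symmetric]) auto
  also have "(\<Sum>ks\<in>(\<lambda>(x,ks). x # ks) ` (A \<times> ?L n). rev_walk_pr v w ks) = (\<Sum>(x,ks)\<in>A \<times> ?L n. step_pr w x * rev_walk_pr v x ks)"
    by (subst sum.reindex) (auto simp: inj_on_def case_prod_unfold)
  also have "\<dots> = (\<Sum>x\<in>A. step_pr w x * (\<Sum>ks\<in>?L n. rev_walk_pr v x ks))"
    by (simp add: sum.cartesian_product sum_distrib_left)
  also have "\<dots> \<le> (\<Sum>x\<in>A. step_pr w x * hit A v x)"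
    by (intro sum_mono mult_left_mono Suc.IH step_pr_nonneg)
  also have "rev_walk_pr v w [] = step_pr w v * hit A v v" using v hit_boundary[OF A, of v v] by simp
  also have "step_pr w v * hit A v v + (\<Sum>x\<in>A. step_pr w x * hit A v x) = (\<Sum>x\<in>insert v A. step_pr w x * hit A v x)"
    using v finA by simp
  also have "\<dots> \<le> (\<Sum>x\<in>B. step_pr w x * hit A v x)"
    by (rule sum_mono2) (use v AB finB in \<open>auto intro: mult_nonneg_nonneg step_pr_nonneg hit_nonneg\<close>)
  also have "\<dots> = hit A v w"
    using hit_harmonic[OF AB Suc.prems, of v] v pos[OF Suc.prems]
    by (simp add: step_pr_def sum_divide_distrib[symmetric] field_simps)
  finally show ?case by simp
qed

end

section \<open>Lower bound: first and second moments\<close>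

context bounded_net begin

text \<open>First moment: the number of \<open>w\<close> in \<open>An\<close> whose path reaches \<open>v\<close> inside \<open>D\<close>. Given the path
  of a neighbour \<open>z\<close> of \<open>v\<close> to the root, the number of such \<open>w\<close> is governed by the walk from \<open>v\<close> avoiding
  this path.\<close>

definition arm :: "'b \<Rightarrow> 'b set \<Rightarrow> 'b \<Rightarrow> ('b \<Rightarrow> 'b) \<Rightarrow> bool" where
  "arm v D w f \<longleftrightarrow> v \<in> orb f w \<and> orb f w \<subseteq> D \<union> orb f v"

text \<open>Cut the edge of \<open>v\<close> and let \<open>z\<close> be its target. A path from
  \<open>z\<close> to \<open>\<rho>\<close> is revealed and becomes an obstacle, which the path from
  \<open>w\<close> to \<open>v\<close> inside \<open>D\<close> has to avoid;
  \<open>avoid_ge_hit\<close> compares this with a random walk. Restoring the edge gives a forest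
  counted by \<open>arm\<close>.\<close>

lemma first_moment_cut:
  assumes v: "v \<in> B - {\<rho>}" and D: "D \<subseteq> B - {\<rho>}" and w: "w \<noteq> v"
  shows "(\<Sum>z\<in>B. step_pr v z * ex (B - {\<rho>} - {v}) (\<lambda>f. of_bool (\<rho> \<in> orb f z) * hit ((B - {\<rho>} - {v} - orb f z) \<inter> D) v w))
    \<le> pr (B - {\<rho>}) (arm v D w)"
proof -
  let ?A = "B - {\<rho>}" and ?A1 = "B - {\<rho>} - {v}"
  have A: "?A \<subseteq> B - {\<rho>}" "?A1 \<subseteq> B - {\<rho>}" "?A \<subseteq> B" by auto
  have Zp: "Z ?A > 0" "Z ?A1 > 0" using Z_pos A by auto
  have cv: "vertex_cond v > 0" by (rule vertex_cond_pos[OF v])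
  define e where "e z = ex ?A1 (\<lambda>f. of_bool (v \<notin> orb f z) * of_bool (v \<in> orb f w \<and> orb f w \<subseteq> insert v D))" for z
  have e0: "e z \<ge> 0" for z unfolding e_def by (rule ex_nonneg) auto
  have lb: "ex ?A1 (\<lambda>f. of_bool (\<rho> \<in> orb f z) * hit ((?A1 - orb f z) \<inter> D) v w) \<le> e z" if z: "z \<in> B" for z
  proof -
    let ?X = "\<lambda>f. of_bool (v \<notin> orb f z) * of_bool (v \<in> orb f w \<and> orb f w \<subseteq> insert v D) :: real"
    show ?thesis unfolding e_def tower[OF A(2), of ?X z]
    proof (rule ex_mono)
      fix f assume f: "f \<in> forests ?A1"
      let ?A2 = "?A1 - orb f z"
      let ?J = "\<lambda>f' x. if x \<in> orb f z then f x else f' x"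
      have oJ: "orb (?J f') z = orb f z" for f' by (rule orb_cong[symmetric]) auto
      have A2: "?A2 \<subseteq> B - {\<rho>}" by auto
      show "of_bool (\<rho> \<in> orb f z) * hit (?A2 \<inter> D) v w \<le> ex ?A2 (\<lambda>f'. ?X (?J f'))"
      proof (cases "\<rho> \<in> orb f z")
        case True
        then have vz: "v \<notin> orb f z" using forest_exit_unique[OF f True, of v] v by auto
        have "hit (?A2 \<inter> D) v w \<le> pr ?A2 (\<lambda>f'. v \<in> orb f' w \<and> orb f' w \<subseteq> insert v D)"
        proof (cases "w \<in> ?A2 - D")
          case True
          then have "w \<notin> ?A2 \<inter> D" by auto
          then have "hit (?A2 \<inter> D) v w = 0" using hit_boundary[of "?A2 \<inter> D" w v] w by auto
          then show ?thesis using pr_nonneg by simp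
        next
          case False
          have "?A2 \<inter> D = ?A2 - (?A2 - D)" by auto
          then have "hit (?A2 \<inter> D) v w \<le> pr ?A2 (\<lambda>f'. v \<in> orb f' w \<and> orb f' w \<inter> (?A2 - D) = {})"
            using avoid_ge_hit[OF A2, of v "?A2 - D" w] v False by simp
          also have "\<dots> \<le> pr ?A2 (\<lambda>f'. v \<in> orb f' w \<and> orb f' w \<subseteq> insert v D)"
          proof (rule pr_mono)
            fix f' assume f': "f' \<in> forests ?A2" and vw: "v \<in> orb f' w \<and> orb f' w \<inter> (?A2 - D) = {}"
            have "x = v" if "x \<in> orb f' w" "x \<notin> ?A2" for x
              using forest_exit_unique[OF f' that(1), of v] vw that(2) by auto
            then show "v \<in> orb f' w \<and> orb f' w \<subseteq> insert v D" using vw by blast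
          qed auto
          finally show ?thesis .
        qed
        also have "\<dots> \<le> ex ?A2 (\<lambda>f'. ?X (?J f'))" unfolding pr_def
        proof (rule ex_mono)
          fix f' assume f': "f' \<in> forests ?A2"
          have "orb (?J f') w = orb f' w" if "v \<in> orb f' w"
            by (rule orb_join_avoid[OF f f' that]) (use vz in auto)
          then show "of_bool (v \<in> orb f' w \<and> orb f' w \<subseteq> insert v D) \<le> ?X (?J f')"
            unfolding oJ using vz by auto
        qed auto
        finally show ?thesis using True by simp
      next
        case False
        then show ?thesis by (simp add: ex_nonneg)
      qed
    qed auto
  qed
  have "(\<Sum>z\<in>B. C v z * (Z ?A1 * e z)) \<le> Z ?A * pr ?A (arm v D w)"
  proof -
    have "(\<Sum>z\<in>B. C v z * (Z ?A1 * e z)) = (\<Sum>z\<in>B. \<Sum>f\<in>forests ?A1. C v z * wt ?A1 f * (of_bool (v \<notin> orb f z) * of_bool (v \<in> orb f w \<and> orb f w \<subseteq> insert v D)))"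
      unfolding e_def by (subst mult.commute[of "Z ?A1"]) (simp only: sum_wt[OF A(2), symmetric] sum_distrib_left mult.assoc)
    also have "\<dots> \<le> (\<Sum>z\<in>B. \<Sum>f\<in>forests ?A1. C v z * wt ?A1 f * (of_bool (v \<notin> orb f z) * of_bool (arm v D w (f(v := z)))))"
    proof (rule sum_mono, rule sum_mono, rule mult_left_mono)
      fix z f assume f: "f \<in> forests ?A1"
      have fv: "f v = v" using forestsD(2)[OF f] by simp
      have "arm v D w (f(v := z))" if "v \<notin> orb f z" "v \<in> orb f w" "orb f w \<subseteq> insert v D"
        unfolding arm_def using orb_upd_absorb[OF fv that(1), of w] orb_upd_absorb[OF fv that(1), of v] that by auto
      then show "of_bool (v \<notin> orb f z) * of_bool (v \<in> orb f w \<and> orb f w \<subseteq> insert v D)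
         \<le> (of_bool (v \<notin> orb f z) * of_bool (arm v D w (f(v := z))) :: real)" by auto
    qed (simp add: C_nonneg wt_nonneg)
    also have "\<dots> = (\<Sum>f\<in>forests ?A. wt ?A f * of_bool (arm v D w f))"
      by (rule cut_sum[symmetric]) (use v in auto)
    also have "\<dots> = Z ?A * pr ?A (arm v D w)" using sum_wt[OF A(1), of "\<lambda>f. of_bool (arm v D w f)"] by (simp add: pr_def)
    finally show ?thesis .
  qed
  \<comment> \<open>For the normalisation, the condition that the path of the new successor avoids
    \<open>v\<close> may be dropped.\<close>
  moreover have "Z ?A \<le> vertex_cond v * Z ?A1"
  proof -
    have "Z ?A = (\<Sum>f\<in>forests ?A. wt ?A f * 1)" by (simp add: Z_def)
    also have "\<dots> = (\<Sum>y\<in>B. \<Sum>f\<in>forests ?A1. C v y * wt ?A1 f * (of_bool (v \<notin> orb f y) * 1))"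
      by (rule cut_sum) (use v in auto)
    also have "\<dots> \<le> (\<Sum>y\<in>B. \<Sum>f\<in>forests ?A1. C v y * wt ?A1 f * 1)"
      by (intro sum_mono mult_left_mono) (auto simp: C_nonneg wt_nonneg)
    also have "\<dots> = vertex_cond v * Z ?A1" by (simp add: vertex_cond_def Z_def sum_distrib_left sum_distrib_right) (rule sum.swap)
    finally show ?thesis .
  qed
  ultimately have "(\<Sum>z\<in>B. C v z * (Z ?A1 * e z)) \<le> vertex_cond v * Z ?A1 * pr ?A (arm v D w)"
    using mult_right_mono[OF _ pr_nonneg[of ?A "arm v D w"]] by fastforce
  then have "Z ?A1 * (\<Sum>z\<in>B. C v z * e z) \<le> Z ?A1 * (vertex_cond v * pr ?A (arm v D w))"
    by (simp add: sum_distrib_left sum_distrib_right mult_ac)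
  then have "(\<Sum>z\<in>B. C v z * e z) \<le> vertex_cond v * pr ?A (arm v D w)" using Zp by simp
  then have "(\<Sum>z\<in>B. step_pr v z * e z) \<le> pr ?A (arm v D w)"
    using cv by (simp add: step_pr_def sum_divide_distrib[symmetric] field_simps)
  moreover have "(\<Sum>z\<in>B. step_pr v z * ex ?A1 (\<lambda>f. of_bool (\<rho> \<in> orb f z) * hit ((?A1 - orb f z) \<inter> D) v w)) \<le> (\<Sum>z\<in>B. step_pr v z * e z)"
    by (intro sum_mono mult_left_mono lb step_pr_nonneg)
  ultimately show ?thesis by simp
qed

text \<open>The probability that the walk from \<open>v\<close> reaches \<open>\<rho>\<close> before
  it returns to \<open>v\<close> or meets \<open>S\<close>. The first step is separate because the
  walk starts at a forbidden point.\<close>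

definition esc :: "'b \<Rightarrow> 'b set \<Rightarrow> real" where
  "esc v S = (\<Sum>z\<in>B. step_pr v z * (if z \<in> S then 0 else hit (B - {\<rho>} - {v} - S) \<rho> z))"

text \<open>The lists are walks from \<open>v\<close> that do not return to it, and
  \<open>esc\<close> is the chance that a second walk from \<open>v\<close> escapes without meeting
  them. This second walk is replaced by a forest path, which is more likely to avoid the list. For a
  fixed forest path, the lists that avoid it are then reversed into walks from points of
  \<open>An\<close> that end at their first visit to \<open>v\<close>.\<close>

lemma first_moment:
  assumes v: "v \<in> B - {\<rho>}" and D: "D \<subseteq> B - {\<rho>} - {v}" and An: "An \<subseteq> D"
  shows "(\<Sum>l\<in>{l. l \<noteq> [] \<and> set l \<subseteq> D \<and> last l \<in> An \<and> length l \<le> n}. walk_pr v l * esc v (set l))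
    \<le> M\<^sup>2 * (\<Sum>w\<in>An. pr (B - {\<rho>}) (arm v D w))"
proof -
  let ?A1 = "B - {\<rho>} - {v}"
  have A1: "?A1 \<subseteq> B - {\<rho>}" by auto
  have finD: "finite D" "finite An" using D An finB by (meson finite_Diff finite_subset)+
  let ?Ls = "{l. l \<noteq> [] \<and> set l \<subseteq> D \<and> last l \<in> An \<and> length l \<le> n}"
  have finL: "finite ?Ls" by (rule finite_subset[OF _ finite_lists_length_le[OF finD(1), of n]]) auto
  have pos: "x \<in> B - {\<rho>} \<Longrightarrow> vertex_cond x > 0" for x by (rule vertex_cond_pos)
  have ratio: "vertex_cond w * x \<le> M\<^sup>2 * (vertex_cond v * x)" if "w \<in> B - {\<rho>}" "x \<ge> 0" for w x
  proof -
    have "vertex_cond w \<le> M * 1" using vertex_cond_upper[OF that(1)] by simp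
    also have "1 \<le> M * vertex_cond v" using vertex_cond_lower[OF v] M1 by (simp add: field_simps)
    finally have "vertex_cond w \<le> M * (M * vertex_cond v)" using M1 by simp
    then show ?thesis using mult_right_mono[OF _ that(2), of "vertex_cond w" "M\<^sup>2 * vertex_cond v"] by (simp add: power2_eq_square mult_ac)
  qed
  have walk: "(\<Sum>l\<in>?Ls. walk_pr v l * of_bool (set l \<inter> K = {})) \<le> M\<^sup>2 * (\<Sum>w\<in>An. hit ((?A1 - K) \<inter> D) v w)" for K
  proof -
    let ?E = "(?A1 - K) \<inter> D"
    have E: "?E \<subseteq> B - {\<rho>}" by auto
    have "(\<Sum>l\<in>?Ls. walk_pr v l * of_bool (set l \<inter> K = {})) = (\<Sum>l\<in>{l\<in>?Ls. set l \<inter> K = {}}. walk_pr v l)"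
      by (rule sum.mono_neutral_cong_right) (use finL in auto)
    also have "\<dots> = (\<Sum>(w,ks)\<in>(SIGMA w:An \<inter> ?E. {ks. set ks \<subseteq> ?E \<and> length ks < n}). walk_pr v (rev (w # ks)))"
    proof (rule sum.reindex_bij_witness[of _ "\<lambda>(w,ks). rev (w # ks)" "\<lambda>l. (last l, rev (butlast l))"], goal_cases)
      case (1 l) then show ?case by simp
    next
      case (2 l)
      then have l: "l = butlast l @ [last l]" by simp
      then have "set l = insert (last l) (set (butlast l))" by (metis list.set(1,2) set_append Un_insert_right sup_bot_right)
      moreover have "length (butlast l) < n" using 2 by (cases l rule: rev_cases) auto
      ultimately show ?case using 2 D by auto
    next
      case (3 p) then show ?case by (auto simp: butlast_append)
    next
      case (4 p) then show ?case using An by auto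
    qed auto
    also have "\<dots> \<le> (\<Sum>(w,ks)\<in>(SIGMA w:An \<inter> ?E. {ks. set ks \<subseteq> ?E \<and> length ks < n}). M\<^sup>2 * rev_walk_pr v w ks)"
    proof (rule sum_mono)
      fix p assume "p \<in> (SIGMA w:An \<inter> ?E. {ks. set ks \<subseteq> ?E \<and> length ks < n})"
      then obtain w ks where p: "p = (w, ks)" and w: "w \<in> ?E" and ks: "set ks \<subseteq> ?E" by blast
      have "vertex_cond v * walk_pr v (rev (w # ks)) = vertex_cond w * rev_walk_pr v w ks"
        by (rule walk_pr_rw) (use v w ks pos in auto)
      moreover have "rev_walk_pr v w ks \<ge> 0" 
        by (induction ks arbitrary: w) (auto intro: step_pr_nonneg mult_nonneg_nonneg)
      ultimately have "vertex_cond v * walk_pr v (rev (w # ks)) \<le> vertex_cond v * (M\<^sup>2 * rev_walk_pr v w ks)"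
        using ratio[of w "rev_walk_pr v w ks"] w by (simp add: mult_ac)
      then show "(case p of (w, ks) \<Rightarrow> walk_pr v (rev (w # ks))) \<le> (case p of (w, ks) \<Rightarrow> M\<^sup>2 * rev_walk_pr v w ks)"
        using pos[OF v] unfolding p by simp
    qed
    also have "\<dots> = M\<^sup>2 * (\<Sum>w\<in>An \<inter> ?E. \<Sum>ks\<in>{ks. set ks \<subseteq> ?E \<and> length ks < n}. rev_walk_pr v w ks)"
    proof -
      have "finite {ks. set ks \<subseteq> ?E \<and> length ks < n}"
        by (rule finite_subset[OF _ finite_lists_length_le[of ?E n]]) (use finD in auto)
      then show ?thesis using finD by (subst sum.Sigma) (auto simp: sum_distrib_left case_prod_unfold)
    qed
    also have "\<dots> \<le> M\<^sup>2 * (\<Sum>w\<in>An \<inter> ?E. hit ?E v w)"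
      by (intro mult_left_mono sum_mono rev_walk_pr_sum_le_hit E) (use v pos in auto)
    also have "\<dots> \<le> M\<^sup>2 * (\<Sum>w\<in>An. hit ?E v w)"
      by (intro mult_left_mono sum_mono2) (use finD hit_nonneg in auto)
    finally show ?thesis .
  qed
  have "(\<Sum>l\<in>?Ls. walk_pr v l * esc v (set l)) \<le>
     (\<Sum>l\<in>?Ls. walk_pr v l * (\<Sum>z\<in>B. step_pr v z * ex ?A1 (\<lambda>f. of_bool (\<rho> \<in> orb f z) * of_bool (set l \<inter> orb f z = {}))))"
  proof (rule sum_mono, rule mult_left_mono[OF _ walk_pr_nonneg])
    fix l assume l: "l \<in> ?Ls"
    show "esc v (set l) \<le> (\<Sum>z\<in>B. step_pr v z * ex ?A1 (\<lambda>f. of_bool (\<rho> \<in> orb f z) * of_bool (set l \<inter> orb f z = {})))"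
      unfolding esc_def
    proof (rule sum_mono, rule mult_left_mono[OF _ step_pr_nonneg])
      fix z
      show "(if z \<in> set l then 0 else hit (?A1 - set l) \<rho> z) \<le> ex ?A1 (\<lambda>f. of_bool (\<rho> \<in> orb f z) * of_bool (set l \<inter> orb f z = {}))"
      proof (cases "z \<in> set l")
        case False
        then have "hit (?A1 - set l) \<rho> z \<le> pr ?A1 (\<lambda>f. \<rho> \<in> orb f z \<and> orb f z \<inter> set l = {})"
          using l D rhoB by (intro avoid_ge_hit A1) auto
        then show ?thesis using False by (simp add: pr_def of_bool_conj Int_commute)
      qed (simp add: ex_nonneg)
    qed
  qed
  also have "\<dots> = (\<Sum>z\<in>B. step_pr v z * ex ?A1 (\<lambda>f. of_bool (\<rho> \<in> orb f z) * (\<Sum>l\<in>?Ls. walk_pr v l * of_bool (set l \<inter> orb f z = {}))))"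
    unfolding sum_distrib_left ex_sum
    by (subst sum.swap) (simp add: ex_cmult[symmetric] mult_ac)
  also have "\<dots> \<le> (\<Sum>z\<in>B. step_pr v z * ex ?A1 (\<lambda>f. of_bool (\<rho> \<in> orb f z) * (M\<^sup>2 * (\<Sum>w\<in>An. hit ((?A1 - orb f z) \<inter> D) v w))))"
    by (intro sum_mono mult_left_mono step_pr_nonneg ex_mono walk) auto
  also have "\<dots> = M\<^sup>2 * (\<Sum>w\<in>An. \<Sum>z\<in>B. step_pr v z * ex ?A1 (\<lambda>f. of_bool (\<rho> \<in> orb f z) * hit ((?A1 - orb f z) \<inter> D) v w))"
    unfolding sum_distrib_left ex_sum
    by (subst sum.swap) (simp add: ex_cmult[symmetric] mult_ac)
  also have "\<dots> \<le> M\<^sup>2 * (\<Sum>w\<in>An. pr (B - {\<rho>}) (arm v D w))"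
    by (intro mult_left_mono sum_mono first_moment_cut v) (use D An in auto)
  finally show ?thesis .
qed

text \<open>Reveal the path of \<open>w\<close>. The path of \<open>w'\<close> joins it at some
  \<open>y\<close>, and since both stay in \<open>D\<close> until they reach \<open>v\<close>, this
  \<open>y\<close> is \<open>v\<close> or a point of \<open>D\<close>. The factors belong to the
  stretches from \<open>w\<close> to \<open>y\<close>, from \<open>w'\<close> to \<open>y\<close>
  and from \<open>y\<close> to \<open>v\<close>.\<close>

lemma second_moment_pair:
  assumes v: "v \<in> B - {\<rho>}" and D: "D \<subseteq> B - {\<rho>}" and w: "w \<in> D" "w' \<in> D"
  shows "pr (B - {\<rho>}) (\<lambda>f. arm v D w f \<and> arm v D w' f) \<le> (\<Sum>y\<in>insert v D. U w y * (U w' y * U y v))"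
proof -
  let ?A = "B - {\<rho>}"
  have A: "?A \<subseteq> B - {\<rho>}" "?A \<subseteq> B" by auto
  have finD: "finite D" using D finB by (meson finite_Diff finite_subset)
  let ?X = "\<lambda>f. of_bool (arm v D w f \<and> arm v D w' f) :: real"
  have "ex ?A ?X \<le> ex ?A (\<lambda>f. \<Sum>y\<in>insert v D. U w' y * of_bool (y \<in> orb f w \<and> v \<in> orb f y))"
    unfolding tower[OF A(1), of ?X w]
  proof (rule ex_mono[OF A(2)])
    fix f assume f: "f \<in> forests ?A"
    let ?A' = "?A - orb f w"
    let ?J = "\<lambda>f' x. if x \<in> orb f w then f x else f' x"
    have A': "?A' \<subseteq> B - {\<rho>}" by auto
    have "ex ?A' (\<lambda>f'. ?X (?J f')) \<le> ex ?A' (\<lambda>f'. \<Sum>y\<in>insert v D. of_bool (y \<in> orb f w \<and> v \<in> orb f y) * of_bool (y \<in> orb f' w'))"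
    proof (rule ex_mono)
      fix f' assume f': "f' \<in> forests ?A'"
      have J: "?J f' \<in> forests ?A" by (rule forests_join[OF f f'])
      have oJ: "orb (?J f') w = orb f w" by (rule orb_cong[symmetric]) auto
      have "\<exists>y\<in>insert v D. (y \<in> orb f w \<and> v \<in> orb f y) \<and> y \<in> orb f' w'" if ar: "arm v D w (?J f')" "arm v D w' (?J f')"
      proof -
        have vw: "v \<in> orb f w" using ar(1) unfolding arm_def oJ by auto
        obtain y where y: "y \<in> orb f' w'" "y \<notin> ?A'" using forest_exit[OF f', of w'] by blast
        have "v \<in> orb f' w' \<or> v \<in> orb f y" using ar(2) join_orbit[OF f f' y] unfolding arm_def by auto
        moreover have "v \<in> orb f' w' \<Longrightarrow> v = y" using forest_exit_unique[OF f' _ y(1) _ y(2)] vw by auto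
        ultimately have vy: "v \<in> orb f y" by auto
        have yA: "y \<in> ?A" 
        proof (rule ccontr)
          assume "y \<notin> ?A"
          then have "v = y" using forest_orb_out[OF f, of y] vy by auto
          then show False using \<open>y \<notin> ?A\<close> v by auto
        qed
        then have yw: "y \<in> orb f w" using y by auto
        have yJ: "y \<in> orb (?J f') w'" using join_orbit[OF f f' y] y by auto
        have Jv: "orb (?J f') v = orb f v" by (rule orb_cong[symmetric]) (use orb_trans[OF vw] in auto)
        have "y \<in> insert v D"
        proof (cases "y \<in> orb f v")
          case True
          then show ?thesis using forest_acyclic[OF f True vy] by simp
        next
          case False
          then show ?thesis using ar(2) yJ unfolding arm_def Jv by auto
        qed
        then show ?thesis using yw vy y by auto
      qed
      moreover have "(1::real) \<le> (\<Sum>y\<in>insert v D. of_bool (y \<in> orb f w \<and> v \<in> orb f y) * of_bool (y \<in> orb f' w'))"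
        if h: "\<exists>y\<in>insert v D. (y \<in> orb f w \<and> v \<in> orb f y) \<and> y \<in> orb f' w'"
      proof -
        obtain y where y: "y \<in> insert v D" "y \<in> orb f w" "v \<in> orb f y" "y \<in> orb f' w'" using h by blast
        have "of_bool (y \<in> orb f w \<and> v \<in> orb f y) * of_bool (y \<in> orb f' w') \<le>
          (\<Sum>y\<in>insert v D. of_bool (y \<in> orb f w \<and> v \<in> orb f y) * of_bool (y \<in> orb f' w') :: real)"
          by (rule member_le_sum[OF y(1)]) (use finD in auto)
        then show ?thesis using y by simp
      qed
      ultimately show "?X (?J f') \<le> (\<Sum>y\<in>insert v D. of_bool (y \<in> orb f w \<and> v \<in> orb f y) * of_bool (y \<in> orb f' w'))"
        by (cases "arm v D w (?J f') \<and> arm v D w' (?J f')") (auto intro: sum_nonneg)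
    qed auto
    also have "\<dots> = (\<Sum>y\<in>insert v D. of_bool (y \<in> orb f w \<and> v \<in> orb f y) * hit ?A' y w')"
      unfolding ex_sum ex_cmult hit_def pr_def ..
    also have "\<dots> \<le> (\<Sum>y\<in>insert v D. U w' y * of_bool (y \<in> orb f w \<and> v \<in> orb f y))"
    proof (rule sum_mono)
      fix y assume y: "y \<in> insert v D"
      show "of_bool (y \<in> orb f w \<and> v \<in> orb f y) * hit ?A' y w' \<le> U w' y * of_bool (y \<in> orb f w \<and> v \<in> orb f y)"
        using hit_le_U[OF A', of y w'] y v D w by (cases "y \<in> orb f w") auto
    qed
    finally show "ex ?A' (\<lambda>f'. ?X (?J f')) \<le> (\<Sum>y\<in>insert v D. U w' y * of_bool (y \<in> orb f w \<and> v \<in> orb f y))" .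
  qed
  also have "\<dots> = (\<Sum>y\<in>insert v D. U w' y * pr ?A (\<lambda>f. y \<in> orb f w \<and> v \<in> orb f y))"
    unfolding ex_sum ex_cmult pr_def ..
  also have "\<dots> \<le> (\<Sum>y\<in>insert v D. U w' y * (U w y * U y v))"
  proof (rule sum_mono, rule mult_left_mono[OF _ U_nonneg])
    fix y assume y: "y \<in> insert v D"
    have yA: "y \<in> ?A" "w \<in> ?A" using y v w D by auto
    have "pr ?A (\<lambda>f. y \<in> orb f w \<and> v \<in> orb f y) = ex ?A (\<lambda>f. of_bool (y \<in> orb f w) * of_bool (v \<in> orb f y))"
      unfolding pr_def by (simp add: of_bool_conj)
    also have "\<dots> \<le> U w y * ex ?A (\<lambda>f. of_bool (v \<in> orb f y))"
    proof (rule two_point[OF A(1) yA(2,1)])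
      fix f g assume "\<And>x. x \<in> orb f y \<Longrightarrow> f x = g x"
      then have "orb f y = orb g y" by (rule orb_cong)
      then show "of_bool (v \<in> orb f y) = (of_bool (v \<in> orb g y)::real)" by simp
    qed (use hit_Diff_le_U[OF A(1) yA] in auto)
    also have "ex ?A (\<lambda>f. of_bool (v \<in> orb f y)) \<le> U y v * ex ?A (\<lambda>f. 1)"
      using two_point[OF A(1) yA(1), of v "U y v" "\<lambda>_. 1"] hit_Diff_le_U[OF A(1) _ yA(1), of v] v by auto
    also have "U y v * ex ?A (\<lambda>f. 1) = U y v" using ex_const[OF A(1), of 1] by simp
    finally show "pr ?A (\<lambda>f. y \<in> orb f w \<and> v \<in> orb f y) \<le> U w y * U y v" using U_nonneg by (simp add: mult_left_mono)
  qed
  finally show ?thesis unfolding pr_def by (simp add: mult_ac)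
qed

text \<open>The meeting point is summed last: both starting points lie within \<open>2 * s\<close>
  of it and it lies within \<open>s\<close> of \<open>v\<close>, which explains the factor 4 and the
  third power of \<open>s\<close>.\<close>

lemma second_moment:
  assumes v: "v \<in> B - {\<rho>}" and D: "D \<subseteq> {x \<in> B - {\<rho>}. d x v \<le> s}" and s: "s \<ge> 1" and An: "An \<subseteq> D"
  shows "ex (B - {\<rho>}) (\<lambda>f. (\<Sum>w\<in>An. of_bool (arm v D w f))\<^sup>2) \<le> 4 * M ^ 6 * C0 ^ 3 * real s ^ 3"
proof -
  let ?A = "B - {\<rho>}"
  have DA: "D \<subseteq> ?A" using D by auto
  have fin: "finite D" "finite An" using D An finB by (auto intro: finite_subset)
  have sq: "(\<Sum>w\<in>An. of_bool (arm v D w f))\<^sup>2 = (\<Sum>w\<in>An. \<Sum>w'\<in>An. of_bool (arm v D w f \<and> arm v D w' f) :: real)" for f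
    by (simp add: power2_eq_square sum_product of_bool_conj)
  have "ex ?A (\<lambda>f. (\<Sum>w\<in>An. of_bool (arm v D w f))\<^sup>2) = (\<Sum>w\<in>An. \<Sum>w'\<in>An. pr ?A (\<lambda>f. arm v D w f \<and> arm v D w' f))"
    unfolding sq ex_sum pr_def ..
  also have "\<dots> \<le> (\<Sum>w\<in>An. \<Sum>w'\<in>An. \<Sum>y\<in>insert v D. U w y * (U w' y * U y v))"
    by (intro sum_mono second_moment_pair v DA) (use An in auto)
  also have "\<dots> = (\<Sum>y\<in>insert v D. (\<Sum>w\<in>An. U w y) * (\<Sum>w\<in>An. U w y) * U y v)"
  proof -
    have "(\<Sum>w\<in>An. \<Sum>w'\<in>An. \<Sum>y\<in>insert v D. U w y * (U w' y * U y v)) = (\<Sum>w\<in>An. \<Sum>y\<in>insert v D. \<Sum>w'\<in>An. U w y * (U w' y * U y v))"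
      by (rule sum.cong[OF refl], rule sum.swap)
    also have "\<dots> = (\<Sum>y\<in>insert v D. \<Sum>w\<in>An. \<Sum>w'\<in>An. U w y * (U w' y * U y v))" by (rule sum.swap)
    finally show ?thesis by (simp add: sum_distrib_left sum_distrib_right mult_ac)
  qed
  also have "\<dots> \<le> (\<Sum>y\<in>insert v D. (M\<^sup>2 * (C0 * real (2 * s))) * (M\<^sup>2 * (C0 * real (2 * s))) * U y v)"
  proof (intro sum_mono mult_right_mono U_nonneg mult_mono)
    fix y assume y: "y \<in> insert v D"
    have yA: "y \<in> ?A" "d v y \<le> s" using y D v d_sym[of y v] d_refl[of v] by auto
    show le: "(\<Sum>w\<in>An. U w y) \<le> M\<^sup>2 * (C0 * real (2 * s))"
    proof (rule U_ball_rev[OF yA(1)])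
      show "An \<subseteq> {w \<in> B - {\<rho>}. d w y \<le> 2 * s}"
      proof
        fix w assume "w \<in> An"
        then have w: "w \<in> ?A" "d w v \<le> s" using An D by auto
        have "d w y \<le> d w v + d v y" by (rule d_tri) (use w v yA in auto)
        then show "w \<in> {w \<in> B - {\<rho>}. d w y \<le> 2 * s}" using w yA by auto
      qed
    qed (use s in auto)
    show "(\<Sum>w\<in>An. U w y) \<le> M\<^sup>2 * (C0 * real (2 * s))" by (rule le)
  qed (use C0 U_nonneg in \<open>auto intro: sum_nonneg\<close>)
  also have "\<dots> = (M\<^sup>2 * (C0 * real (2 * s))) * (M\<^sup>2 * (C0 * real (2 * s))) * (\<Sum>y\<in>insert v D. U y v)"
    by (simp add: sum_distrib_left)
  also have "\<dots> \<le> (M\<^sup>2 * (C0 * real (2 * s))) * (M\<^sup>2 * (C0 * real (2 * s))) * (M\<^sup>2 * (C0 * real s))"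
    using C0 by (intro mult_left_mono U_ball_rev v s) (use D v d_refl[of v] in auto)
  also have "\<dots> = 4 * M ^ 6 * C0 ^ 3 * real s ^ 3" by (simp add: eval_nat_numeral)
  finally show ?thesis .
qed

text \<open>The second moment method, obtained by integrating a pointwise quadratic inequality with
  a free parameter \<open>t\<close>; the choice \<open>t = m / Q\<close> replaces the Cauchy-Schwarz
  inequality.\<close>

lemma ex_pos_lower:
  assumes A: "A \<subseteq> B - {\<rho>}" and X0: "\<And>f. X f \<ge> 0" and m: "m \<le> ex A X" "m \<ge> 0"
    and q: "ex A (\<lambda>f. (X f)\<^sup>2) \<le> Q" "Q > 0"
  shows "m\<^sup>2 / Q \<le> pr A (\<lambda>f. X f > 0)"
proof -
  have "m * (2 * t) \<le> t\<^sup>2 * Q + pr A (\<lambda>f. X f > 0)" if t: "t \<ge> 0" for t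
  proof -
    have "m * (2 * t) \<le> 2 * t * ex A X" using mult_left_mono[OF m(1), of "2 * t"] t by (simp add: mult_ac)
    also have "\<dots> \<le> ex A (\<lambda>f. t\<^sup>2 * (X f)\<^sup>2 + of_bool (X f > 0))"
      unfolding ex_cmult[symmetric]
    proof (rule ex_mono)
      fix f
      have "0 \<le> (t * X f - 1)\<^sup>2" by simp
      then have "2 * t * X f \<le> t\<^sup>2 * (X f)\<^sup>2 + 1" by (simp add: power2_eq_square algebra_simps)
      then show "2 * t * X f \<le> t\<^sup>2 * (X f)\<^sup>2 + of_bool (X f > 0)" using X0[of f] by (cases "X f = 0") auto
    qed (use A in auto)
    also have "\<dots> \<le> t\<^sup>2 * Q + pr A (\<lambda>f. X f > 0)"
      unfolding ex_add ex_cmult pr_def using q by (intro add_mono mult_left_mono) auto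
    finally show ?thesis .
  qed
  from this[of "m / Q"] show ?thesis using m q by (simp add: field_simps power2_eq_square)
qed

lemma lower_arm:
  assumes v: "v \<in> B - {\<rho>}" and D: "D \<subseteq> {x \<in> B - {\<rho>} - {v}. d x v \<le> s}" and s: "s \<ge> 1" and An: "An \<subseteq> D"
    and m: "0 \<le> m" "m \<le> (\<Sum>l\<in>{l. l \<noteq> [] \<and> set l \<subseteq> D \<and> last l \<in> An \<and> length l \<le> n}. walk_pr v l * esc v (set l))"
    and C0p: "C0 > 0"
  shows "m\<^sup>2 / (4 * M ^ 10 * C0 ^ 3 * real s ^ 3) \<le> pr (B - {\<rho>}) (\<lambda>f. \<exists>w\<in>An. arm v D w f)"
proof -
  let ?A = "B - {\<rho>}"
  let ?X = "\<lambda>f. \<Sum>w\<in>An. of_bool (arm v D w f) :: real"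
  have "m \<le> M\<^sup>2 * ex ?A ?X"
    unfolding ex_sum using m first_moment[OF v _ An, of n] D by (simp add: pr_def subset_iff)
  then have mX: "m / M\<^sup>2 \<le> ex ?A ?X" using M1 by (simp add: field_simps)
  have "(m / M\<^sup>2)\<^sup>2 / (4 * M ^ 6 * C0 ^ 3 * real s ^ 3) \<le> pr ?A (\<lambda>f. ?X f > 0)"
  proof (rule ex_pos_lower[OF _ _ mX])
    show "ex ?A (\<lambda>f. (?X f)\<^sup>2) \<le> 4 * M ^ 6 * C0 ^ 3 * real s ^ 3"
      by (rule second_moment[OF v _ s An]) (use D in auto)
  qed (use m M1 C0p s in \<open>auto intro: sum_nonneg\<close>)
  also have "\<dots> \<le> pr ?A (\<lambda>f. \<exists>w\<in>An. arm v D w f)"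
  proof (rule pr_mono)
    fix f assume "?X f > 0"
    then have "?X f \<noteq> 0" by simp
    then obtain w where "w \<in> An" "(of_bool (arm v D w f) :: real) \<noteq> 0" by (rule sum.not_neutral_contains_not_neutral)
    then show "\<exists>w\<in>An. arm v D w f" by auto
  qed auto
  finally show ?thesis using M1 by (simp add: power_divide field_simps eval_nat_numeral)
qed

end

section \<open>The random walk\<close>

lemma nn_integral_has_sum:
  fixes f :: "'a \<Rightarrow> real"
  assumes f: "(f has_sum s) A" and nn: "\<And>x. x \<in> A \<Longrightarrow> f x \<ge> 0"
  shows "(\<integral>\<^sup>+x. ennreal (f x) \<partial>count_space A) = ennreal s"
proof -
  have "f summable_on A" "infsum f A = s" using f by (auto simp: infsumI summable_on_def)
  then have "Infinite_Set_Sum.abs_summable_on f A"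
    using abs_summable_equivalent summable_on_iff_abs_summable_on_real by blast
  then show ?thesis
    using nn \<open>infsum f A = s\<close> by (simp add: nn_integral_conv_infsetsum infsetsum_infsum)
qed

lemma is_walk_verts: "is_walk N u p v \<Longrightarrow> u \<in> verts N \<and> v \<in> verts N"
  by (induction N u p v rule: is_walk.induct) auto

lemma is_walk_append: "is_walk N u p w \<Longrightarrow> is_walk N w q v \<Longrightarrow> is_walk N u (p @ q) v"
  by (induction N u p w rule: is_walk.induct) auto

lemma is_walk_rev: "is_walk N u p v \<Longrightarrow> \<exists>q. is_walk N v q u \<and> length q = length p"
proof (induction p arbitrary: u)
  case Nil
  then show ?case by auto
next
  case (Cons a p)
  obtain x e where a: "a = (x, e)" by (cases a)
  from Cons.prems a obtain w where w: "x = u" "u \<in> verts N" "e \<in> edges N" "ends N e = Upair u w" "is_walk N w p v" by auto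
  from Cons.IH[OF w(5)] obtain q where q: "is_walk N v q w" "length q = length p" by auto
  have "is_walk N w [(w, e)] u" using w is_walk_verts[OF w(5)] by auto
  then show ?case using is_walk_append[OF q(1)] q(2) by (intro exI[of _ "q @ [(w, e)]"]) auto
qed

section \<open>Transition probabilities and graph distance\<close>

locale csm_network = network G for G :: "('v, 'e) network" +
  assumes csm: "controlled_stationary_measure G"
begin

abbreviation "V \<equiv> verts G"
abbreviation "E \<equiv> edges G"

definition Eb :: "'v \<Rightarrow> 'v \<Rightarrow> 'e set" where "Eb x y = {e \<in> E. ends G e = Upair x y}"
definition pair_cond :: "'v \<Rightarrow> 'v \<Rightarrow> real" where "pair_cond x y = (\<Sum>\<^sub>\<infinity>e\<in>Eb x y. cond G e)"
abbreviation trans_pr :: "'v \<Rightarrow> 'v \<Rightarrow> real" where "trans_pr \<equiv> trans_prob G"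

lemma Eb_sym: "Eb x y = Eb y x" unfolding Eb_def by auto
lemma pair_cond_sym: "pair_cond x y = pair_cond y x" unfolding pair_cond_def by (simp add: Eb_sym)
lemma pair_cond_nonneg: "pair_cond x y \<ge> 0"
  unfolding pair_cond_def by (rule infsum_nonneg) (auto simp: Eb_def intro: less_imp_le cond_pos)
lemma trans_pr_eq: "trans_pr x y = pair_cond x y / vcond G x" unfolding trans_prob_def pair_cond_def Eb_def ..
lemma Eb_incident: "Eb x y \<subseteq> incident G x" unfolding Eb_def incident_def by auto
lemma Eb_verts: "e \<in> Eb x y \<Longrightarrow> x \<in> V \<and> y \<in> V" using ends_verts[of e] unfolding Eb_def by auto

lemma Eb_summable: "cond G summable_on Eb x y"
proof (cases "Eb x y = {}")
  case False
  then have "x \<in> V" using Eb_verts by auto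
  then show ?thesis by (rule summable_on_subset_banach[OF vcond_finite Eb_incident])
qed simp

lemma pair_cond_pos_iff: "pair_cond x y > 0 \<longleftrightarrow> Eb x y \<noteq> {}"
proof
  assume "pair_cond x y > 0" then show "Eb x y \<noteq> {}" unfolding pair_cond_def by auto
next
  assume "Eb x y \<noteq> {}"
  then obtain e where e: "e \<in> Eb x y" by auto
  have "sum (cond G) {e} \<le> pair_cond x y" unfolding pair_cond_def
    by (rule finite_sum_le_infsum[OF Eb_summable]) (use e cond_pos in \<open>auto simp: Eb_def less_imp_le\<close>)
  then show "pair_cond x y > 0" using cond_pos[of e] e by (auto simp: Eb_def)
qed

lemma incident_decomp: "incident G x = (\<Union>y\<in>V. Eb x y)" if "x \<in> V"
proof
  show "incident G x \<subseteq> (\<Union>y\<in>V. Eb x y)"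
  proof
    fix e assume e: "e \<in> incident G x"
    obtain a b where ab: "ends G e = Upair a b" by (cases "ends G e") auto
    then have "x = a \<or> x = b" "e \<in> E" using e by (auto simp: incident_def)
    moreover have "a \<in> V" "b \<in> V" using ends_verts[of e] ab calculation(2) by auto
    ultimately show "e \<in> (\<Union>y\<in>V. Eb x y)" using ab by (auto simp: Eb_def)
  qed
  show "(\<Union>y\<in>V. Eb x y) \<subseteq> incident G x" using Eb_incident by auto
qed

lemma pair_cond_has_sum: assumes x: "x \<in> V" shows "(pair_cond x has_sum vcond G x) V"
proof (rule has_sum_SigmaD[where f="cond G \<circ> snd" and B="Eb x"])
  have inj: "inj_on snd (Sigma V (Eb x))" by (auto simp: inj_on_def Eb_def)
  have im: "snd ` Sigma V (Eb x) = incident G x" unfolding incident_decomp[OF x] by force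
  have "(cond G has_sum vcond G x) (incident G x)"
    unfolding vcond_def using vcond_finite[OF x] by (rule has_sum_infsum)
  then show "((cond G \<circ> snd) has_sum vcond G x) (Sigma V (Eb x))"
    using has_sum_reindex[OF inj, of "cond G" "vcond G x"] im by simp
  show "((\<lambda>y'. (cond G \<circ> snd) (y, y')) has_sum pair_cond x y) (Eb x y)" for y
    using has_sum_infsum[OF Eb_summable] by (simp add: pair_cond_def)
qed

lemma vcond_pos: "x \<in> V \<Longrightarrow> vcond G x > 0"
  using csm unfolding controlled_stationary_measure_def
  by (meson inverse_positive_iff_positive less_le_trans)

lemma trans_pr_nonneg: "x \<in> V \<Longrightarrow> trans_pr x y \<ge> 0" unfolding trans_pr_eq using pair_cond_nonneg vcond_pos[of x] by simp

lemma trans_pr_out: "y \<notin> V \<Longrightarrow> trans_pr x y = 0"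
  using Eb_verts[of _ x y] unfolding trans_pr_eq pair_cond_def by (metis div_0 ex_in_conv infsum_empty)

lemma trans_pr_has_sum: assumes "x \<in> V" shows "(trans_pr x has_sum 1) V"
  using has_sum_cmult_left[OF pair_cond_has_sum[OF assms], of "inverse (vcond G x)"] vcond_pos[OF assms]
  by (simp add: trans_pr_eq[abs_def] divide_inverse)

lemma trans_pr_pos_iff: "x \<in> V \<Longrightarrow> trans_pr x y > 0 \<longleftrightarrow> Eb x y \<noteq> {}"
  unfolding trans_pr_eq using vcond_pos[of x] pair_cond_pos_iff[of x y] by (simp add: zero_less_divide_iff)

text \<open>Off \<open>V\<close> the kernel stays where it is, a default that makes
  \<open>K x\<close> a probability distribution for every \<open>x\<close>.\<close>

definition K :: "'v \<Rightarrow> 'v pmf" where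
  "K x = embed_pmf (\<lambda>y. if x \<in> V then trans_pr x y else of_bool (y = x))"

lemma pmf_K: "pmf (K x) y = (if x \<in> V then trans_pr x y else of_bool (y = x))"
  unfolding K_def
proof (rule pmf_embed_pmf)
  show "0 \<le> (if x \<in> V then trans_pr x y else of_bool (y = x))" for y using trans_pr_nonneg by auto
  show "(\<integral>\<^sup>+ y. ennreal (if x \<in> V then trans_pr x y else of_bool (y = x)) \<partial>count_space UNIV) = 1"
  proof (cases "x \<in> V")
    case True
    have "(\<integral>\<^sup>+ y. ennreal (trans_pr x y) \<partial>count_space UNIV) = (\<integral>\<^sup>+ y. ennreal (trans_pr x y) \<partial>count_space V)"
      by (rule nn_integral_count_space_eq) (auto simp: trans_pr_out)
    also have "\<dots> = 1" using nn_integral_has_sum[OF trans_pr_has_sum[OF True]] trans_pr_nonneg[OF True] by simp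
    finally show ?thesis using True by simp
  next
    case False
    have "(\<integral>\<^sup>+ y. ennreal (of_bool (y = x)) \<partial>count_space UNIV) = (\<integral>\<^sup>+ y. indicator {x} y \<partial>count_space UNIV)"
      by (rule nn_integral_cong) (auto simp: indicator_def)
    also have "\<dots> = 1" by simp
    finally show ?thesis using False by simp
  qed
qed

lemma set_K: "x \<in> V \<Longrightarrow> set_pmf (K x) = {y. trans_pr x y > 0}"
  using trans_pr_nonneg[of x] by (auto simp: set_pmf_eq pmf_K order_less_le)

lemma set_K_V: "x \<in> V \<Longrightarrow> set_pmf (K x) \<subseteq> V"
  using set_K[of x] trans_pr_out by force

lemma gdist_le: "is_walk G u p v \<Longrightarrow> gdist G u v \<le> length p"
  unfolding gdist_def by (rule Least_le) auto

lemma gdist_walk: assumes "u \<in> V" "v \<in> V" shows "\<exists>p. is_walk G u p v \<and> length p = gdist G u v"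
proof -
  obtain p where "is_walk G u p v" using connected assms unfolding connected_net_def by blast
  then have "\<exists>n p. is_walk G u p v \<and> length p = n" by blast
  then show ?thesis unfolding gdist_def by (rule LeastI_ex)
qed

lemma gdist_refl: "u \<in> V \<Longrightarrow> gdist G u u = 0" using gdist_le[of u "[]" u] by simp

lemma gdist_sym: assumes "u \<in> V" "v \<in> V" shows "gdist G u v = gdist G v u"
proof -
  have "gdist G a b \<le> gdist G b a" if "a \<in> V" "b \<in> V" for a b
    using gdist_walk[OF that(2,1)] is_walk_rev gdist_le by metis
  then show ?thesis using assms by (simp add: antisym)
qed

lemma gdist_triangle:
  assumes "u \<in> V" "v \<in> V" "w \<in> V" shows "gdist G u w \<le> gdist G u v + gdist G v w"
proof -
  obtain p q where "is_walk G u p v" "length p = gdist G u v" "is_walk G v q w" "length q = gdist G v w"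
    using gdist_walk assms by metis
  then show ?thesis using gdist_le[OF is_walk_append] by (metis length_append)
qed

lemma gdist_edge: assumes "Eb x y \<noteq> {}" shows "gdist G x y \<le> 1"
proof -
  obtain e where e: "e \<in> Eb x y" using assms by auto
  then have "is_walk G x [(x, e)] y" using Eb_verts[OF e] by (auto simp: Eb_def)
  then show ?thesis using gdist_le by fastforce
qed

text \<open>Degrees may be infinite, but a summable family of positive conductances is countable.
  Hence the vertices reached in \<open>n\<close> steps are countable for each \<open>n\<close>, and
  connectedness exhausts \<open>V\<close> by them.\<close>

lemma countable_V: "countable V"
proof -
  obtain v0 where v0: "v0 \<in> V" using connected unfolding connected_net_def by auto
  define A where "A = rec_nat {v0} (\<lambda>_ X. (\<Union>x\<in>X \<inter> V. \<Union>e\<in>incident G x. set_uprod (ends G e)))"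
  have A0: "A 0 = {v0}" and AS: "A (Suc n) = (\<Union>x\<in>A n \<inter> V. \<Union>e\<in>incident G x. set_uprod (ends G e))" for n
    by (auto simp: A_def)
  have inc: "countable (incident G x)" if "x \<in> V" for x
  proof -
    have "{e \<in> incident G x. cond G e \<noteq> 0} = incident G x"
      using cond_pos by (force simp: incident_def)
    then show ?thesis using summable_countable_real[OF vcond_finite[OF that]] by simp
  qed
  have cA: "countable (A n)" for n
  proof (induction n)
    case (Suc n)
    then show ?case unfolding AS by (intro countable_UN countable_finite[OF finite_set_uprod] inc countable_Int1) auto
  qed (simp add: A0)
  have reach: "is_walk G u p v \<Longrightarrow> u \<in> A k \<Longrightarrow> v \<in> A (k + length p)" for u p v k
  proof (induction p arbitrary: u k)
    case (Cons a p)
    obtain x e where a: "a = (x, e)" by (cases a)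
    from Cons.prems a obtain w where w: "u \<in> V" "e \<in> E" "ends G e = Upair u w" "is_walk G w p v" by auto
    then have "w \<in> A (Suc k)" unfolding AS using Cons.prems(2)
      by (intro UN_I[of u] UN_I[of e]) (auto simp: incident_def)
    from Cons.IH[OF w(4) this] show ?case by simp
  qed auto
  have "V \<subseteq> (\<Union>n. A n)"
  proof
    fix v assume "v \<in> V"
    then obtain p where "is_walk G v0 p v" using gdist_walk[OF v0] by blast
    then show "v \<in> (\<Union>n. A n)" using reach[of v0 p v 0] A0 by auto
  qed
  moreover have "countable (\<Union>n. A n)" using cA by (intro countable_UN) auto
  ultimately show ?thesis by (rule countable_subset)
qed

section \<open>The law of the trajectory and of its finite segments\<close>

fun L :: "nat \<Rightarrow> 'v \<Rightarrow> 'v list pmf" where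
  "L 0 x = return_pmf []"
| "L (Suc n) x = bind_pmf (K x) (\<lambda>y. map_pmf ((#) y) (L n y))"

fun list_pr :: "'v \<Rightarrow> 'v list \<Rightarrow> real" where
  "list_pr x [] = 1" | "list_pr x (y # l) = trans_pr x y * list_pr y l"

fun chain :: "'v \<Rightarrow> 'v list \<Rightarrow> bool" where
  "chain x [] = True" | "chain x (y # l) \<longleftrightarrow> trans_pr x y > 0 \<and> chain y l"

lemma set_L: "x \<in> V \<Longrightarrow> l \<in> set_pmf (L n x) \<Longrightarrow> length l = n \<and> set l \<subseteq> V \<and> chain x l"
proof (induction n arbitrary: x l)
  case (Suc n)
  then obtain y l' where y: "y \<in> set_pmf (K x)" "l' \<in> set_pmf (L n y)" "l = y # l'" by auto
  have "y \<in> V" "trans_pr x y > 0" using set_K_V[of x] set_K[of x] y Suc.prems by auto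
  then show ?case using Suc.IH[of y l'] y by auto
qed auto

lemma pmf_L_Cons: "pmf (L (Suc n) x) (y # l) = pmf (K x) y * pmf (L n y) l"
proof -
  have *: "pmf (map_pmf ((#) z) (L n z)) (y # l) = (if z = y then pmf (L n y) l else 0)" for z
  proof (cases "z = y")
    case True
    then show ?thesis using pmf_map_inj'[of "(#) y" "L n y" l] by (simp add: inj_def)
  next
    case False
    then have "y # l \<notin> set_pmf (map_pmf ((#) z) (L n z))" by auto
    then have "pmf (map_pmf ((#) z) (L n z)) (y # l) = 0" by (rule pmf_eq_0_set_pmf[THEN iffD2])
    then show ?thesis using False by simp
  qed
  show ?thesis unfolding L.simps pmf_bind *
    by (subst integral_measure_pmf_real[where A="{y}"]) (auto split: if_splits)
qed

lemma pmf_L: "x \<in> V \<Longrightarrow> set l \<subseteq> V \<Longrightarrow> pmf (L (length l) x) l = list_pr x l"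
proof (induction l arbitrary: x)
  case (Cons y l)
  then show ?case using pmf_L_Cons[of "length l" x y l] by (simp add: pmf_K)
qed (simp add: pmf_return)

lemma Ionescu_Tulcea_walk: assumes v: "v \<in> V" shows "Ionescu_Tulcea (walk_kernel G v) (\<lambda>_. count_space V)"
proof (rule Ionescu_Tulcea.intro)
  fix i :: nat
  have pm: "prob_space (point_measure V (\<lambda>y. ennreal (trans_pr x y)))" if "x \<in> V" for x
  proof (rule prob_spaceI)
    show "emeasure (point_measure V (\<lambda>y. ennreal (trans_pr x y))) (space (point_measure V (\<lambda>y. ennreal (trans_pr x y)))) = 1"
      using nn_integral_has_sum[OF trans_pr_has_sum[OF that]] trans_pr_nonneg[OF that]
      by (simp add: space_point_measure point_measure_def emeasure_density
          nn_integral_count_space_indicator[symmetric] cong: nn_integral_cong_simp)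
  qed
  have ret: "prob_space (return (count_space V) v)" by (rule prob_space_return) (simp add: v)
  show "prob_space (walk_kernel G v i x)" if sp: "x \<in> space (Pi\<^sub>M {0..<i} (\<lambda>_. count_space V))" for x
  proof (cases "i = 0")
    case False
    then have "x (i - 1) \<in> V" using sp by (auto simp: space_PiM PiE_iff)
    then show ?thesis using False pm by (simp add: walk_kernel_def)
  qed (simp add: walk_kernel_def ret)
  show "walk_kernel G v i \<in> measurable (Pi\<^sub>M {0..<i} (\<lambda>_. count_space V)) (subprob_algebra (count_space V))"
  proof (cases "i = 0")
    case True
    then have "walk_kernel G v i = (\<lambda>_. return (count_space V) v)" by (auto simp: walk_kernel_def)
    moreover have "return (count_space V) v \<in> space (subprob_algebra (count_space V))"
      using ret by (auto simp: space_subprob_algebra intro: prob_space_imp_subprob_space)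
    ultimately show ?thesis by (simp add: measurable_const)
  next
    case False
    have 1: "(\<lambda>x. point_measure V (\<lambda>y. ennreal (trans_pr x y))) \<in> measurable (count_space V) (subprob_algebra (count_space V))"
      using pm by (auto simp: space_subprob_algebra sets_point_measure_count_space intro: prob_space_imp_subprob_space)
    have "(\<lambda>\<omega>. \<omega> (i - 1)) \<in> measurable (Pi\<^sub>M {0..<i} (\<lambda>_. count_space V)) (count_space V)"
      using False by (intro measurable_component_singleton) auto
    from measurable_compose[OF this 1] show ?thesis
      using False by (simp add: walk_kernel_def[abs_def])
  qed
qed

abbreviation "W v \<equiv> random_walk G v"

lemma W_props:
  assumes v: "v \<in> V"
  shows "prob_space (W v)" "sets (W v) = sets (PiM UNIV (\<lambda>_. count_space V))" "space (W v) = UNIV \<rightarrow>\<^sub>E V"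
proof -
  interpret Ionescu_Tulcea "walk_kernel G v" "\<lambda>_. count_space V" by (rule Ionescu_Tulcea_walk[OF v])
  show "sets (W v) = sets (PiM UNIV (\<lambda>_. count_space V))" unfolding random_walk_def by (rule PF.sets_lim)
  then show "space (W v) = UNIV \<rightarrow>\<^sub>E V" using sets_eq_imp_space_eq[of "W v"] by (simp add: space_PiM)
  show "prob_space (W v)"
  proof (rule prob_spaceI)
    have "emeasure (W v) (space (W v)) = emeasure PF.lim (PF.emb UNIV {} (space (CI {})))"
      unfolding random_walk_def by (rule arg_cong[where f="emeasure _"]) (auto simp: prod_emb_def space_PiM PF.space_P)
    also have "\<dots> = emeasure (CI {}) (space (CI {}))" by (rule lim) (auto simp: PF.sets_P[symmetric])
    also have "\<dots> = 1" by (rule prob_space.emeasure_space_1[OF PF.prob_space_P]) auto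
    finally show "emeasure (W v) (space (W v)) = 1" .
  qed
qed

lemma W_coord: assumes "v \<in> V" shows "(\<lambda>\<omega>. \<omega> n) \<in> measurable (W v) (count_space V)"
  unfolding measurable_cong_sets[OF W_props(2)[OF assms] refl] by (rule measurable_component_singleton) simp

text \<open>The kernels are evaluated at singletons, one time step after another. Time zero carries
  the point mass at \<open>v\<close>, so the segment has one entry more than
  \<open>l\<close>.\<close>

lemma W_cylinder:
  assumes v: "v \<in> V" and l: "set l \<subseteq> V" "length l = n"
  shows "emeasure (W v) {\<omega> \<in> space (W v). map \<omega> [0..<Suc n] = v # l} = ennreal (list_pr v l)"
proof -
  interpret Ionescu_Tulcea_walk: Ionescu_Tulcea "walk_kernel G v" "\<lambda>_. count_space V" by (rule Ionescu_Tulcea_walk[OF v])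
  let ?M = "\<lambda>_::nat. count_space V" and ?P = "walk_kernel G v"
  define X where "X m w = restrict (\<lambda>i. w ! i) {0..<m}" for m and w :: "'v list"
  have Xs: "X m w \<in> space (PiM {0..<m} ?M)" if "set w \<subseteq> V" "m \<le> length w" for m w
    using that by (auto simp: X_def space_PiM subset_iff)
  have single: "{f} \<in> sets (PiM {0..<m} ?M)" if "f \<in> space (PiM {0..<m} ?M)" for f m
  proof -
    have "{f} = PiE {0..<m} (\<lambda>i. {f i})" using that by (intro PiE_singleton[symmetric]) (simp add: space_PiM PiE_def)
    also have "\<dots> \<in> sets (PiM {0..<m} ?M)" using that by (intro sets_PiM_I_finite) (auto simp: space_PiM)
    finally show ?thesis .
  qed
  have step: "emeasure (Ionescu_Tulcea_walk.C 0 (Suc m) (\<lambda>x. undefined)) {X (Suc m) w} =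
     emeasure (Ionescu_Tulcea_walk.C 0 m (\<lambda>x. undefined)) {X m w} * emeasure (?P m (X m w)) {w ! m}"
    if w: "set w \<subseteq> V" "Suc m \<le> length w" for m w
  proof -
    have Xm: "X m w \<in> space (PiM {0..<m} ?M)" "X (Suc m) w \<in> space (PiM {0..<Suc m} ?M)" using Xs w by auto
    have u: "(\<lambda>x. undefined) \<in> space (PiM {0..<0} ?M)" by (simp add: space_PiM)
    have sC: "sets (Ionescu_Tulcea_walk.C 0 m (\<lambda>x. undefined)) = sets (PiM {0..<m} ?M)" using Ionescu_Tulcea_walk.sets_C[OF u, of m] by simp
    then have spC: "space (Ionescu_Tulcea_walk.C 0 m (\<lambda>x. undefined)) = space (PiM {0..<m} ?M)" by (rule sets_eq_imp_space_eq)
    have "emeasure (Ionescu_Tulcea_walk.C 0 (Suc m) (\<lambda>x. undefined)) {X (Suc m) w} =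
      (\<integral>\<^sup>+ \<omega>. emeasure (Ionescu_Tulcea_walk.eP m \<omega>) {X (Suc m) w} \<partial>Ionescu_Tulcea_walk.C 0 m (\<lambda>x. undefined))"
      using single[OF Xm(2)] Ionescu_Tulcea_walk.measurable_eP[of m] u
      by (simp, subst emeasure_bind[where N="PiM {0..<Suc m} ?M"]) 
         (auto simp: Ionescu_Tulcea_walk.space_C Ionescu_Tulcea_walk.space_PiM_not_empty space_PiM measurable_cong_sets[OF sC refl] spC PiE_eq_empty_iff intro: v)
    also have "\<dots> = (\<integral>\<^sup>+ \<omega>. emeasure (?P m (X m w)) {w ! m} * indicator {X m w} \<omega> \<partial>Ionescu_Tulcea_walk.C 0 m (\<lambda>x. undefined))"
    proof (rule nn_integral_cong)
      fix \<omega> assume "\<omega> \<in> space (Ionescu_Tulcea_walk.C 0 m (\<lambda>x. undefined))"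
      then have o: "\<omega> \<in> space (PiM {0..<m} ?M)" unfolding spC .
      have "fun_upd \<omega> m -` {X (Suc m) w} \<inter> V = (if \<omega> = X m w then {w ! m} else {})"
      proof -
        have "fun_upd \<omega> m x = X (Suc m) w \<longleftrightarrow> \<omega> = X m w \<and> x = w ! m" for x
        proof
          assume eq: "fun_upd \<omega> m x = X (Suc m) w"
          have "\<omega> i = X m w i" for i
            using fun_cong[OF eq, of i] o by (cases "i < m") (auto simp: X_def space_PiM PiE_def extensional_def split: if_splits)
          moreover have "x = w ! m" using fun_cong[OF eq, of m] by (simp add: X_def)
          ultimately show "\<omega> = X m w \<and> x = w ! m" by auto
        next
          assume "\<omega> = X m w \<and> x = w ! m"
          then show "fun_upd \<omega> m x = X (Suc m) w" by (auto simp: X_def fun_eq_iff)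
        qed
        then show ?thesis using w nth_mem[of m w] by auto
      qed
      then show "emeasure (Ionescu_Tulcea_walk.eP m \<omega>) {X (Suc m) w} = emeasure (?P m (X m w)) {w ! m} * indicator {X m w} \<omega>"
        using Ionescu_Tulcea_walk.emeasure_eP[OF o single[OF Xm(2)]] by (auto simp: indicator_def)
    qed
    also have "\<dots> = emeasure (?P m (X m w)) {w ! m} * emeasure (Ionescu_Tulcea_walk.C 0 m (\<lambda>x. undefined)) {X m w}"
      using single[OF Xm(1)] sC by (subst nn_integral_cmult_indicator) auto
    finally show ?thesis by (simp add: mult.commute)
  qed
  have main: "emeasure (Ionescu_Tulcea_walk.C 0 (Suc m) (\<lambda>x. undefined)) {X (Suc m) (v # l)} = ennreal (list_pr v (take m l))"
    if "m \<le> length l" for m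
    using that
  proof (induction m)
    case 0
    have "X 0 (v # l) = (\<lambda>x. undefined)" by (simp add: X_def fun_eq_iff)
    then have c0: "emeasure (Ionescu_Tulcea_walk.C 0 0 (\<lambda>x. undefined)) {X 0 (v # l)} = 1"
      by (simp add: space_PiM sets_PiM_empty)
    have k0: "emeasure (?P 0 (X 0 (v # l))) {(v # l) ! 0} = 1" using v by (simp add: walk_kernel_def)
    have "emeasure (Ionescu_Tulcea_walk.C 0 (Suc 0) (\<lambda>x. undefined)) {X (Suc 0) (v # l)} =
      emeasure (Ionescu_Tulcea_walk.C 0 0 (\<lambda>x. undefined)) {X 0 (v # l)} * emeasure (?P 0 (X 0 (v # l))) {(v # l) ! 0}"
      by (rule step) (use v l in auto)
    then show ?case by (simp only: c0 k0 take_0 list_pr.simps ennreal_1 mult_1)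
  next
    case (Suc m)
    have lm: "l ! m \<in> V" using Suc.prems l nth_mem[of m l] by auto
    have pl: "list_pr x (l' @ [y]) = list_pr x l' * trans_pr (last (x # l')) y" for x l' y
      by (induction l' arbitrary: x) auto
    have last: "last (v # take m l) = (v # l) ! m" using Suc.prems by (cases m) (auto simp: last_conv_nth take_Suc_conv_app_nth)
    have xv: "(v # l) ! m \<in> V" using Suc.prems l v nth_mem[of m "v # l"] by auto
    have k: "emeasure (?P (Suc m) (X (Suc m) (v # l))) {(v # l) ! Suc m} = ennreal (trans_pr ((v # l) ! m) (l ! m))"
      using lm by (simp add: walk_kernel_def X_def emeasure_point_measure_finite2)
    have p0: "list_pr v (take m l) \<ge> 0"
    proof -
      have "set l' \<subseteq> V \<Longrightarrow> x \<in> V \<Longrightarrow> list_pr x l' \<ge> 0" for x l' by (induction l' arbitrary: x) (auto simp: trans_pr_nonneg)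
      then show ?thesis using v l set_take_subset[of m l] by blast
    qed
    have IH: "emeasure (Ionescu_Tulcea_walk.C 0 (Suc m) (\<lambda>x. undefined)) {X (Suc m) (v # l)} = ennreal (list_pr v (take m l))"
      using Suc.prems by (intro Suc.IH) simp
    have "emeasure (Ionescu_Tulcea_walk.C 0 (Suc (Suc m)) (\<lambda>x. undefined)) {X (Suc (Suc m)) (v # l)} =
      emeasure (Ionescu_Tulcea_walk.C 0 (Suc m) (\<lambda>x. undefined)) {X (Suc m) (v # l)} * emeasure (?P (Suc m) (X (Suc m) (v # l))) {(v # l) ! Suc m}"
      by (rule step) (use v l Suc.prems in auto)
    also have "\<dots> = ennreal (list_pr v (take m l) * trans_pr ((v # l) ! m) (l ! m))"
      unfolding IH k using p0 trans_pr_nonneg[OF xv] by (simp add: ennreal_mult)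
    also have "list_pr v (take m l) * trans_pr ((v # l) ! m) (l ! m) = list_pr v (take (Suc m) l)"
    proof -
      have "take (Suc m) l = take m l @ [l ! m]" using Suc.prems by (intro take_Suc_conv_app_nth) simp
      then show ?thesis by (simp only: pl last)
    qed
    finally show ?case .
  qed
  have "{\<omega> \<in> space (W v). map \<omega> [0..<Suc n] = v # l} = prod_emb UNIV ?M {0..<Suc n} {X (Suc n) (v # l)}"
  proof -
    have "map \<omega> [0..<Suc n] = v # l \<longleftrightarrow> restrict \<omega> {0..<Suc n} = X (Suc n) (v # l)" for \<omega> :: "nat \<Rightarrow> 'v"
    proof -
      have "map \<omega> [0..<Suc n] = v # l \<longleftrightarrow> (\<forall>i<Suc n. \<omega> i = (v # l) ! i)"
        using l(2) by (auto simp: list_eq_iff_nth_eq simp del: upt_Suc)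
      also have "\<dots> \<longleftrightarrow> restrict \<omega> {0..<Suc n} = X (Suc n) (v # l)"
        by (auto simp: X_def restrict_def fun_eq_iff)
      finally show ?thesis .
    qed
    then show ?thesis unfolding prod_emb_def W_props(3)[OF v] by (auto simp: space_PiM)
  qed
  also have "emeasure (W v) \<dots> = emeasure (Ionescu_Tulcea_walk.CI {0..<Suc n}) {X (Suc n) (v # l)}"
    unfolding random_walk_def by (rule Ionescu_Tulcea_walk.lim) (use single Xs l v in auto)
  also have "\<dots> = emeasure (Ionescu_Tulcea_walk.C 0 (Suc n) (\<lambda>x. undefined)) (prod_emb {0..<Suc n} ?M {0..<Suc n} {X (Suc n) (v # l)})"
    by (rule Ionescu_Tulcea_walk.emeasure_CI) (use single Xs l v in auto)
  also have "prod_emb {0..<Suc n} ?M {0..<Suc n} {X (Suc n) (v # l)} = {X (Suc n) (v # l)}"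
    by (rule prod_emb_id) (use Xs[of "v # l" "Suc n"] l v in \<open>auto simp: space_PiM\<close>)
  finally show ?thesis using main[of n] l by simp
qed

lemma W_list_sets: assumes v: "v \<in> V" shows "{\<omega> \<in> space (W v). map \<omega> ns = l} \<in> sets (W v)"
proof (induction ns arbitrary: l)
  case (Cons n ns)
  show ?case
  proof (cases l)
    case l: (Cons y l')
    have "(\<lambda>\<omega>. \<omega> n) -` ({y} \<inter> V) \<inter> space (W v) \<in> sets (W v)"
      using W_coord[OF v] by (rule measurable_sets) simp
    then have "(\<lambda>\<omega>. \<omega> n) -` ({y} \<inter> V) \<inter> space (W v) \<inter> {\<omega> \<in> space (W v). map \<omega> ns = l'} \<in> sets (W v)"
      using Cons.IH[of l'] by (rule sets.Int)
    also have "(\<lambda>\<omega>. \<omega> n) -` ({y} \<inter> V) \<inter> space (W v) \<inter> {\<omega> \<in> space (W v). map \<omega> ns = l'} =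
      {\<omega> \<in> space (W v). map \<omega> (n # ns) = l}" unfolding l W_props(3)[OF v] by (auto simp: PiE_iff)
    finally show ?thesis .
  qed simp
qed (cases "l = []"; simp)

lemma W_list_measurable: assumes v: "v \<in> V" shows "(\<lambda>\<omega>. map \<omega> ns) \<in> measurable (W v) (count_space UNIV)"
proof -
  have "(\<lambda>\<omega>. map \<omega> ns) \<in> measurable (W v) (count_space (lists V))"
  proof (subst measurable_count_space_eq_countable)
    show "countable (lists V)" using countable_V by (rule countable_lists)
    have "(\<lambda>\<omega>. map \<omega> ns) -` {l} \<inter> space (W v) = {\<omega> \<in> space (W v). map \<omega> ns = l}" for l by auto
    then show "(\<lambda>\<omega>. map \<omega> ns) \<in> space (W v) \<rightarrow> lists V \<and> (\<forall>l\<in>lists V. (\<lambda>\<omega>. map \<omega> ns) -` {l} \<inter> space (W v) \<in> sets (W v))"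
      using W_list_sets[OF v, of ns] W_props(3)[OF v] by (auto simp: PiE_iff)
  qed
  then show ?thesis by (rule measurable_compose) simp
qed

lemma W_start: assumes v: "v \<in> V" shows "AE \<omega> in W v. \<omega> 0 = v"
proof -
  interpret prob_space "W v" by (rule W_props(1)[OF v])
  have "emeasure (W v) {\<omega> \<in> space (W v). \<omega> 0 = v} = 1" using W_cylinder[OF v, of "[]" 0] by simp
  then have "prob {\<omega> \<in> space (W v). \<omega> 0 = v} = 1" by (simp add: emeasure_eq_measure)
  then show ?thesis by (rule AE_prob_1[THEN AE_mp]) auto
qed

text \<open>Transfers the trajectory measure to the discrete laws \<open>L n v\<close>, in which
  computations over finitely many steps take place. Time zero is left out because the walk is then
  at \<open>v\<close> almost surely.\<close>

lemma W_law: assumes v: "v \<in> V"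
  shows "distr (W v) (count_space UNIV) (\<lambda>\<omega>. map \<omega> [1..<Suc n]) = measure_pmf (L n v)"
proof (rule measure_eqI_countable_AE[where \<Omega>="{l. set l \<subseteq> V \<and> length l = n}"])
  have m: "(\<lambda>\<omega>. map \<omega> [1..<Suc n]) \<in> measurable (W v) (count_space UNIV)" by (rule W_list_measurable[OF v])
  show "AE l in distr (W v) (count_space UNIV) (\<lambda>\<omega>. map \<omega> [1..<Suc n]). l \<in> {l. set l \<subseteq> V \<and> length l = n}"
    using W_props(3)[OF v] by (subst AE_distr_iff[OF m]) auto
  show "AE l in measure_pmf (L n v). l \<in> {l. set l \<subseteq> V \<and> length l = n}"
    using set_L[OF v] by (auto simp: AE_measure_pmf_iff)
  show "countable {l. set l \<subseteq> V \<and> length l = n}"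
    by (rule countable_subset[OF _ countable_lists[OF countable_V]]) auto
  fix l assume l: "l \<in> {l. set l \<subseteq> V \<and> length l = n}"
  have "emeasure (distr (W v) (count_space UNIV) (\<lambda>\<omega>. map \<omega> [1..<Suc n])) {l} =
     emeasure (W v) ((\<lambda>\<omega>. map \<omega> [1..<Suc n]) -` {l} \<inter> space (W v))"
    by (rule emeasure_distr[OF m]) simp
  also have "\<dots> = emeasure (W v) {\<omega> \<in> space (W v). map \<omega> [0..<Suc n] = v # l}"
  proof (rule emeasure_eq_AE)
    have e: "map \<omega> [0..<Suc n] = \<omega> 0 # map \<omega> [1..<Suc n]" for \<omega> :: "nat \<Rightarrow> 'v"
      by (simp add: upt_conv_Cons del: upt_Suc)
    show "AE \<omega> in W v. \<omega> \<in> (\<lambda>\<omega>. map \<omega> [1..<Suc n]) -` {l} \<inter> space (W v) \<longleftrightarrow> \<omega> \<in> {\<omega> \<in> space (W v). map \<omega> [0..<Suc n] = v # l}"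
      by (rule AE_mp[OF W_start[OF v]], rule AE_I2) (simp only: e, auto simp del: upt_Suc)
    show "(\<lambda>\<omega>. map \<omega> [1..<Suc n]) -` {l} \<inter> space (W v) \<in> sets (W v)" using m by (rule measurable_sets) simp
    have "{\<omega> \<in> space (W v). map \<omega> [0..<Suc n] = v # l} = (\<lambda>\<omega>. map \<omega> [0..<Suc n]) -` {v # l} \<inter> space (W v)" by auto
    also have "\<dots> \<in> sets (W v)" using W_list_measurable[OF v] by (rule measurable_sets) simp
    finally show "{\<omega> \<in> space (W v). map \<omega> [0..<Suc n] = v # l} \<in> sets (W v)" .
  qed
  also have "\<dots> = ennreal (list_pr v l)" using l by (intro W_cylinder v) auto
  also have "\<dots> = emeasure (measure_pmf (L n v)) {l}" using pmf_L[OF v, of l] l by (simp add: emeasure_pmf_single)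
  finally show "emeasure (distr (W v) (count_space UNIV) (\<lambda>\<omega>. map \<omega> [1..<Suc n])) {l} = emeasure (measure_pmf (L n v)) {l}" .
qed simp_all

end

text \<open>Keeping only finitely many intermediate states loses mass, which is the right direction
  for the supersolution property and the bubble bound of the Green function.\<close>

lemma pmf_bind_ge:
  assumes "finite F" shows "(\<Sum>z\<in>F. pmf N z * pmf (f z) y) \<le> pmf (bind_pmf N f) y"
proof -
  have "ennreal (\<Sum>z\<in>F. pmf N z * pmf (f z) y) = (\<Sum>z\<in>F. ennreal (pmf (f z) y) * indicator F z * ennreal (pmf N z))"
    by (subst sum_ennreal[symmetric]) (auto simp: ennreal_mult[symmetric] mult.commute intro!: sum.cong)
  also have "\<dots> = (\<integral>\<^sup>+z. ennreal (pmf (f z) y) * indicator F z \<partial>measure_pmf N)"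
    using assms by (intro nn_integral_measure_pmf_support[symmetric]) auto
  also have "\<dots> \<le> (\<integral>\<^sup>+z. ennreal (pmf (f z) y) \<partial>measure_pmf N)"
    by (intro nn_integral_mono) (auto simp: indicator_def)
  also have "\<dots> = ennreal (pmf (bind_pmf N f) y)" by (rule ennreal_pmf_bind[symmetric])
  finally show ?thesis by (simp add: ennreal_le_iff)
qed

section \<open>The Green function of the infinite network\<close>

locale ballistic_network = csm_network G for G :: "('v, 'e) network" +
  assumes bub: "bubble_norm G < \<infinity>" and ub: "uniformly_ballistic G"
begin

fun kernel_power :: "nat \<Rightarrow> 'v \<Rightarrow> 'v pmf" where
  "kernel_power 0 x = return_pmf x" | "kernel_power (Suc n) x = bind_pmf (K x) (kernel_power n)"

definition n_step :: "nat \<Rightarrow> 'v \<Rightarrow> 'v \<Rightarrow> real" where "n_step n x y = pmf (kernel_power n x) y"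

lemma kernel_power_add: "kernel_power (m + n) x = bind_pmf (kernel_power m x) (kernel_power n)"
proof (induction m arbitrary: x)
  case (Suc m)
  have "kernel_power (m + n) = (\<lambda>x. bind_pmf (kernel_power m x) (kernel_power n))" using Suc.IH by (rule ext)
  then show ?case by (simp add: bind_assoc_pmf)
qed (simp add: bind_return_pmf)

lemma kernel_power_Suc': "kernel_power (Suc n) x = bind_pmf (kernel_power n x) K"
proof -
  have "kernel_power 0 = return_pmf" by (rule ext) simp
  then have "kernel_power (Suc 0) = K" by (intro ext) (simp add: bind_return_pmf')
  then show ?thesis using kernel_power_add[of n "Suc 0" x] by simp
qed

lemma kernel_power_L: "map_pmf (\<lambda>l. last (x # l)) (L n x) = kernel_power n x"
proof (induction n arbitrary: x)
  case (Suc n)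
  have "map_pmf (\<lambda>l. last (x # l)) (map_pmf ((#) y) (L n y)) = kernel_power n y" for y
    using Suc.IH[of y] by (simp add: map_pmf_comp)
  then show ?case by (simp add: map_bind_pmf)
qed simp

lemma set_Kn: "x \<in> V \<Longrightarrow> set_pmf (kernel_power n x) \<subseteq> V"
  by (induction n arbitrary: x) (auto dest: set_K_V[THEN subsetD])

lemma n_step_nonneg: "n_step n x y \<ge> 0" by (simp add: n_step_def)

lemma n_step_step_prob: assumes x: "x \<in> V" shows "step_prob G n x y = n_step n x y"
proof -
  have "step_prob G n x y = measure (W x) ((\<lambda>\<omega>. map \<omega> [1..<Suc n]) -` {l. last (x # l) = y} \<inter> space (W x))"
    unfolding step_prob_def
  proof (rule measure_eq_AE)
    have e: "last (\<omega> 0 # map \<omega> [1..<Suc n]) = \<omega> n" for \<omega> :: "nat \<Rightarrow> 'v" by (cases n) auto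
    show "AE \<omega> in W x. \<omega> \<in> {\<omega> \<in> space (W x). \<omega> n = y} \<longleftrightarrow> \<omega> \<in> (\<lambda>\<omega>. map \<omega> [1..<Suc n]) -` {l. last (x # l) = y} \<inter> space (W x)"
      by (rule AE_mp[OF W_start[OF x]], rule AE_I2) (use e in \<open>auto simp del: upt_Suc last.simps\<close>)
    show "{\<omega> \<in> space (W x). \<omega> n = y} \<in> sets (W x)" using W_list_sets[OF x, of "[n]" "[y]"] by simp
    show "(\<lambda>\<omega>. map \<omega> [1..<Suc n]) -` {l. last (x # l) = y} \<inter> space (W x) \<in> sets (W x)"
      using W_list_measurable[OF x] by (rule measurable_sets) simp
  qed
  also have "\<dots> = measure (distr (W x) (count_space UNIV) (\<lambda>\<omega>. map \<omega> [1..<Suc n])) {l. last (x # l) = y}"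
    by (rule measure_distr[symmetric]) (use W_list_measurable[OF x] in auto)
  also have "\<dots> = measure_pmf.prob (map_pmf (\<lambda>l. last (x # l)) (L n x)) {y}"
    unfolding W_law[OF x] measure_map_pmf by (rule arg_cong[where f="measure _"]) auto
  finally show ?thesis unfolding kernel_power_L n_step_def by (simp add: measure_pmf_single)
qed

lemma Chapman_Kolmogorov_ge: "finite F \<Longrightarrow> (\<Sum>z\<in>F. n_step m x z * n_step n z y) \<le> n_step (m + n) x y"
  unfolding n_step_def kernel_power_add by (rule pmf_bind_ge)

lemma step_ge: "x \<in> V \<Longrightarrow> finite F \<Longrightarrow> (\<Sum>z\<in>F. trans_pr x z * n_step n z y) \<le> n_step (Suc n) x y"
  using pmf_bind_ge[of F "K x" "kernel_power n" y] by (simp add: n_step_def pmf_K)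

text \<open>Detailed balance for \<open>n\<close> steps. The sum over intermediate states may be
  infinite and is handled as a nonnegative integral.\<close>

lemma n_step_rev: "x \<in> V \<Longrightarrow> y \<in> V \<Longrightarrow> vcond G x * n_step n x y = vcond G y * n_step n y x"
proof (induction n arbitrary: x)
  case 0
  then show ?case by (cases "x = y") (auto simp: n_step_def)
next
  case (Suc n)
  have cx: "ennreal (vcond G z) \<noteq> \<infinity>" for z by simp
  have "ennreal (vcond G x * n_step (Suc n) x y) = ennreal (vcond G x) * (\<integral>\<^sup>+z. ennreal (pmf (K x) z) * ennreal (n_step n z y) \<partial>count_space UNIV)"
    using vcond_pos[OF Suc.prems(1)]
    by (simp add: n_step_def ennreal_mult ennreal_pmf_bind nn_integral_measure_pmf)
  also have "\<dots> = (\<integral>\<^sup>+z. ennreal (vcond G x) * (ennreal (pmf (K x) z) * ennreal (n_step n z y)) \<partial>count_space UNIV)"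
    by (rule nn_integral_cmult[symmetric]) simp
  also have "\<dots> = (\<integral>\<^sup>+z. ennreal (vcond G y) * (ennreal (n_step n y z) * ennreal (pmf (K z) x)) \<partial>count_space UNIV)"
  proof (rule nn_integral_cong)
    fix z
    have "vcond G x * (pmf (K x) z * n_step n z y) = vcond G y * (n_step n y z * pmf (K z) x)"
    proof (cases "z \<in> V")
      case True
      have "vcond G x * trans_pr x z = vcond G z * trans_pr z x"
        using vcond_pos[OF Suc.prems(1)] vcond_pos[OF True] by (simp add: trans_pr_eq pair_cond_sym[of x z])
      then have "vcond G x * (trans_pr x z * n_step n z y) = trans_pr z x * (vcond G z * n_step n z y)" by (simp add: algebra_simps)
      also have "\<dots> = trans_pr z x * (vcond G y * n_step n y z)" using Suc.IH[OF True Suc.prems(2)] by simp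
      finally show ?thesis using True Suc.prems by (simp add: pmf_K mult_ac)
    next
      case False
      then have "pmf (K x) z = 0" "n_step n y z = 0"
        using set_K_V[OF Suc.prems(1)] set_Kn[OF Suc.prems(2), of n] by (auto simp: n_step_def set_pmf_iff)
      then show ?thesis by simp
    qed
    then show "ennreal (vcond G x) * (ennreal (pmf (K x) z) * ennreal (n_step n z y)) =
      ennreal (vcond G y) * (ennreal (n_step n y z) * ennreal (pmf (K z) x))"
      using vcond_pos Suc.prems by (simp add: ennreal_mult[symmetric] n_step_nonneg less_imp_le)
  qed
  also have "\<dots> = ennreal (vcond G y) * (\<integral>\<^sup>+z. ennreal (n_step n y z) * ennreal (pmf (K z) x) \<partial>count_space UNIV)"
    by (rule nn_integral_cmult) simp
  also have "\<dots> = ennreal (vcond G y * n_step (Suc n) y x)"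
    using vcond_pos[OF Suc.prems(2)] unfolding n_step_def kernel_power_Suc'
    by (simp add: ennreal_mult ennreal_pmf_bind nn_integral_measure_pmf)
  finally show ?case using vcond_pos Suc.prems by (simp add: n_step_nonneg less_imp_le)
qed

definition b :: "nat \<Rightarrow> real" where "b n = enn2real (sup_norm_P G n)"

lemma sup_norm_le1: "sup_norm_P G n \<le> 1"
  unfolding sup_norm_P_def by (intro SUP_least) (simp add: n_step_step_prob n_step_def pmf_le_1)

lemma b_nonneg: "b n \<ge> 0" by (simp add: b_def)

lemma b_eq: "ennreal (b n) = sup_norm_P G n"
  unfolding b_def using sup_norm_le1[of n] by (intro ennreal_enn2real) (auto intro: le_less_trans)

lemma n_step_le_b: assumes "x \<in> V" "y \<in> V" shows "n_step n x y \<le> b n"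
proof -
  have "ennreal (n_step n x y) \<le> (SUP v\<in>V. ennreal (step_prob G n x v))"
    using assms by (intro SUP_upper2[of y]) (auto simp: n_step_step_prob)
  also have "\<dots> \<le> sup_norm_P G n" unfolding sup_norm_P_def using assms by (intro SUP_upper)
  finally show ?thesis unfolding b_eq[symmetric] by (simp add: ennreal_le_iff b_nonneg)
qed

lemma b_summable: "summable (\<lambda>n. real (n + 1) * b n)"
proof (rule summable_suminf_not_top)
  have "(\<Sum>n. ennreal (real (n + 1) * b n)) = bubble_norm G"
    unfolding bubble_norm_def
  proof (rule suminf_cong)
    fix n show "ennreal (real (n + 1) * b n) = of_nat (n + 1) * sup_norm_P G n"
      unfolding b_eq[symmetric] by (simp add: ennreal_mult b_nonneg flip: ennreal_of_nat_eq_real_of_nat)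
  qed
  then show "(\<Sum>n. ennreal (real (n + 1) * b n)) \<noteq> \<top>" using bub by auto
qed (simp add: b_nonneg)

definition bubble_sum :: real where "bubble_sum = (\<Sum>n. real (n + 1) * b n)"

lemma b_sum_le: "(\<Sum>k<n. real (k + 1) * b k) \<le> bubble_sum"
  unfolding bubble_sum_def by (rule sum_le_suminf[OF b_summable]) (auto simp: b_nonneg)

lemma bubble_sum_nonneg: "bubble_sum \<ge> 0" using b_sum_le[of 0] by simp

lemma n_step_summable: assumes "x \<in> V" "y \<in> V" shows "summable (\<lambda>n. n_step n x y)"
proof (rule summable_comparison_test_ev[OF _ b_summable])
  show "\<forall>\<^sub>F n in sequentially. norm (n_step n x y) \<le> real (n + 1) * b n"
  proof (rule always_eventually, rule allI)
    fix n
    have "n_step n x y \<le> 1 * b n" using n_step_le_b[OF assms] by simp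
    also have "\<dots> \<le> real (n + 1) * b n" by (intro mult_right_mono b_nonneg) auto
    finally show "norm (n_step n x y) \<le> real (n + 1) * b n" by (simp add: n_step_nonneg)
  qed
qed

definition U :: "'v \<Rightarrow> 'v \<Rightarrow> real" where "U x y = (\<Sum>n. n_step n x y)"

lemma U_nonneg: "x \<in> V \<Longrightarrow> y \<in> V \<Longrightarrow> U x y \<ge> 0"
  unfolding U_def by (intro suminf_nonneg n_step_summable) (simp_all add: n_step_nonneg)

text \<open>Restricted to finitely many neighbours, this says that \<open>U\<close> is a
  supersolution for the walk killed outside a finite set, the situation of a wired network.\<close>

lemma U_super:
  assumes x: "x \<in> V" "y \<in> V" and F: "finite F" "F \<subseteq> V"
  shows "(\<Sum>z\<in>F. trans_pr x z * U z y) + of_bool (x = y) \<le> U x y"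
proof -
  have sm: "summable (\<lambda>n. \<Sum>z\<in>F. trans_pr x z * n_step n z y)"
    using F x by (intro summable_sum summable_mult n_step_summable) auto
  have "(\<Sum>z\<in>F. trans_pr x z * U z y) = (\<Sum>n. \<Sum>z\<in>F. trans_pr x z * n_step n z y)"
    unfolding U_def using F x
    by (subst suminf_sum) (auto intro!: summable_mult n_step_summable sum.cong suminf_mult[symmetric])
  also have "\<dots> \<le> (\<Sum>n. n_step (Suc n) x y)"
    using x F by (intro suminf_le sm step_ge) (simp_all add: summable_Suc_iff[of "\<lambda>n. n_step n x y"] n_step_summable)
  also have "\<dots> = U x y - n_step 0 x y" unfolding U_def using suminf_split_head[OF n_step_summable[OF x]] by simp
  also have "n_step 0 x y = of_bool (x = y)" by (auto simp: n_step_def pmf_return)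
  finally show ?thesis by simp
qed

lemma U_rev: assumes "x \<in> V" "y \<in> V" shows "vcond G x * U x y = vcond G y * U y x"
  unfolding U_def using assms n_step_rev[OF assms]
  by (subst (1 2) suminf_mult[symmetric]) (auto intro!: n_step_summable)

text \<open>By Chapman-Kolmogorov the sum is at most the sum of \<open>b (m + k)\<close> over all
  \<open>m\<close> and \<open>k\<close>, and a number \<open>n\<close> is such a sum in
  \<open>n + 1\<close> ways. This is where the weight in the bubble norm comes from.\<close>

lemma U_bubble:
  assumes x: "x \<in> V" and F: "finite F" "F \<subseteq> V"
  shows "(\<Sum>y\<in>F. U x y * U y x) \<le> bubble_sum"
proof (rule LIMSEQ_le_const2)
  show "(\<lambda>n. \<Sum>y\<in>F. (\<Sum>m<n. n_step m x y) * (\<Sum>m<n. n_step m y x)) \<longlonglongrightarrow> (\<Sum>y\<in>F. U x y * U y x)"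
    unfolding U_def using x F by (intro tendsto_sum tendsto_mult summable_LIMSEQ n_step_summable) auto
  show "\<exists>N. \<forall>n\<ge>N. (\<Sum>y\<in>F. (\<Sum>m<n. n_step m x y) * (\<Sum>m<n. n_step m y x)) \<le> bubble_sum"
  proof (intro exI allI impI)
    fix n
    have "(\<Sum>y\<in>F. (\<Sum>m<n. n_step m x y) * (\<Sum>m<n. n_step m y x)) = (\<Sum>y\<in>F. \<Sum>m<n. \<Sum>k<n. n_step m x y * n_step k y x)"
      by (simp add: sum_product)
    also have "\<dots> = (\<Sum>m<n. \<Sum>y\<in>F. \<Sum>k<n. n_step m x y * n_step k y x)" by (rule sum.swap)
    also have "\<dots> = (\<Sum>m<n. \<Sum>k<n. \<Sum>y\<in>F. n_step m x y * n_step k y x)" by (rule sum.cong[OF refl], rule sum.swap)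
    also have "\<dots> \<le> (\<Sum>m<n. \<Sum>k<n. b (m + k))"
      using Chapman_Kolmogorov_ge[OF F(1)] n_step_le_b[OF x x] by (intro sum_mono) (meson order_trans)
    also have "\<dots> \<le> (\<Sum>m<n. \<Sum>k<2*n. of_bool (m \<le> k) * b k)"
    proof (rule sum_mono)
      fix m assume m: "m \<in> {..<n}"
      have "(\<Sum>k<n. b (m + k)) = (\<Sum>k\<in>(+) m ` {..<n}. b k)" by (subst sum.reindex) auto
      also have "\<dots> = (\<Sum>k\<in>(+) m ` {..<n}. of_bool (m \<le> k) * b k)" by (rule sum.cong) auto
      also have "\<dots> \<le> (\<Sum>k<2*n. of_bool (m \<le> k) * b k)" using m by (intro sum_mono2) (auto simp: b_nonneg)
      finally show "(\<Sum>k<n. b (m + k)) \<le> (\<Sum>k<2*n. of_bool (m \<le> k) * b k)" .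
    qed
    also have "\<dots> = (\<Sum>k<2*n. (\<Sum>m<n. of_bool (m \<le> k)) * b k)"
      by (subst sum.swap) (simp add: sum_distrib_right)
    also have "\<dots> \<le> (\<Sum>k<2*n. real (k + 1) * b k)"
    proof (intro sum_mono mult_right_mono b_nonneg)
      fix k
      have "(\<Sum>m<n. of_bool (m \<le> k)) = real (card ({..<n} \<inter> {m. m \<le> k}))"
        by (simp add: of_bool_def sum.If_cases)
      also have "\<dots> \<le> real (card {..k})" by (intro of_nat_mono card_mono) auto
      finally show "(\<Sum>m<n. of_bool (m \<le> k)) \<le> real (k + 1)" by simp
    qed
    also have "\<dots> \<le> bubble_sum" by (rule b_sum_le)
    finally show "(\<Sum>y\<in>F. (\<Sum>m<n. n_step m x y) * (\<Sum>m<n. n_step m y x)) \<le> bubble_sum" .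
  qed
qed

definition lastv :: "'v \<Rightarrow> nat \<Rightarrow> (nat \<Rightarrow> 'v) \<Rightarrow> ennreal" where
  "lastv x r \<omega> = (SUP n\<in>{n. real (gdist G x (\<omega> n)) \<le> real r}. of_nat n)"

lemma lastv_measurable: assumes x: "x \<in> V" shows "lastv x r \<in> borel_measurable (W x)"
proof -
  \<comment> \<open>The index set depends on the trajectory. Giving the excluded times the value 0
    turns it into a supremum of countably many measurable functions.\<close>
  have "lastv x r = (\<lambda>\<omega>. SUP n. (if gdist G x (\<omega> n) \<le> r then of_nat n else 0))"
  proof
    fix \<omega>
    show "lastv x r \<omega> = (SUP n. (if gdist G x (\<omega> n) \<le> r then of_nat n else 0))"
      unfolding lastv_def
    proof (rule antisym)
      show "(SUP n\<in>{n. real (gdist G x (\<omega> n)) \<le> real r}. of_nat n) \<le> (SUP n. (if gdist G x (\<omega> n) \<le> r then of_nat n else (0::ennreal)))"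
      proof (rule SUP_least)
        fix n assume "n \<in> {n. real (gdist G x (\<omega> n)) \<le> real r}"
        then show "of_nat n \<le> (SUP n. (if gdist G x (\<omega> n) \<le> r then of_nat n else (0::ennreal)))"
          by (intro SUP_upper2[of n]) auto
      qed
      show "(SUP n. (if gdist G x (\<omega> n) \<le> r then of_nat n else (0::ennreal))) \<le> (SUP n\<in>{n. real (gdist G x (\<omega> n)) \<le> real r}. of_nat n)"
        by (rule SUP_least) (auto intro!: SUP_upper)
    qed
  qed
  moreover have "(\<lambda>\<omega>. if gdist G x (\<omega> n) \<le> r then of_nat n else (0::ennreal)) \<in> borel_measurable (W x)" for n
    using measurable_compose[OF W_coord[OF x, of n], of "\<lambda>y. if gdist G x y \<le> r then of_nat n else (0::ennreal)" borel] by simp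
  ultimately show ?thesis by (simp only:) (rule borel_measurable_SUP, auto)
qed

lemma ballistic: "\<exists>C\<ge>0. \<forall>x\<in>V. \<forall>r\<ge>1. (\<integral>\<^sup>+\<omega>. lastv x r \<omega> \<partial>W x) \<le> ennreal (C * real r)"
proof -
  from ub obtain C :: real where C: "\<And>r. r \<ge> 1 \<Longrightarrow>
       (SUP v\<in>V. \<integral>\<^sup>+\<omega>. (SUP n\<in>{n. real (gdist G v (\<omega> n)) \<le> r}. of_nat n) \<partial>random_walk G v) \<le> ennreal (C * r)"
    unfolding uniformly_ballistic_def by blast
  have "(\<integral>\<^sup>+\<omega>. lastv x r \<omega> \<partial>W x) \<le> ennreal (max C 0 * real r)" if "x \<in> V" "r \<ge> 1" for x and r :: nat
  proof -
    have "(\<integral>\<^sup>+\<omega>. lastv x r \<omega> \<partial>W x) \<le> ennreal (C * real r)"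
      using C[of "real r"] that unfolding lastv_def by (auto simp: SUP_le_iff)
    also have "\<dots> \<le> ennreal (max C 0 * real r)" by (intro ennreal_leI mult_right_mono) auto
    finally show ?thesis .
  qed
  then show ?thesis by (intro exI[of _ "max C 0"]) auto
qed

text \<open>The added 1 accounts for time zero: the number of visits to a ball is at most one more
  than the last visit time, and one is at most \<open>r\<close>. It also makes the constant
  positive.\<close>

definition C0 :: real where
  "C0 = (SOME C. C \<ge> 0 \<and> (\<forall>x\<in>V. \<forall>r\<ge>1. (\<integral>\<^sup>+\<omega>. lastv x r \<omega> \<partial>W x) \<le> ennreal (C * real r))) + 1"

lemma C0: "C0 \<ge> 1" "x \<in> V \<Longrightarrow> r \<ge> 1 \<Longrightarrow> (\<integral>\<^sup>+\<omega>. lastv x r \<omega> \<partial>W x) \<le> ennreal ((C0 - 1) * real r)"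
  using someI_ex[OF ballistic[unfolded Bex_def]] ballistic unfolding C0_def
  by (metis (mono_tags, lifting) add_diff_cancel_right' le_add_same_cancel2 someI_ex)+

text \<open>The sum is the expected number of visits to \<open>F\<close>, and all of them happen up
  to the last visit to the ball.\<close>

lemma U_ball:
  assumes x: "x \<in> V" and r: "r \<ge> 1" and F: "finite F" "F \<subseteq> {w\<in>V. gdist G x w \<le> r}"
  shows "(\<Sum>w\<in>F. U x w) \<le> C0 * real r"
proof -
  interpret prob_space "W x" by (rule W_props(1)[OF x])
  have sm: "summable (\<lambda>n. \<Sum>w\<in>F. n_step n x w)" using F x by (intro summable_sum n_step_summable) auto
  have ev: "(\<lambda>\<omega>. indicator F (\<omega> n) :: ennreal) \<in> borel_measurable (W x)" for n
    using measurable_compose[OF W_coord[OF x, of n], of "indicator F :: 'v \<Rightarrow> ennreal" borel] by simp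
  have sets: "{\<omega> \<in> space (W x). \<omega> n = w} \<in> sets (W x)" for n w using W_list_sets[OF x, of "[n]" "[w]"] by simp
  have pF: "ennreal (\<Sum>w\<in>F. n_step n x w) = (\<integral>\<^sup>+\<omega>. indicator F (\<omega> n) \<partial>W x)" for n
  proof -
    have "(\<integral>\<^sup>+\<omega>. indicator F (\<omega> n) \<partial>W x) = (\<integral>\<^sup>+\<omega>. (\<Sum>w\<in>F. indicator {\<omega> \<in> space (W x). \<omega> n = w} \<omega>) \<partial>W x)"
      by (rule nn_integral_cong) (use F in \<open>auto simp: indicator_def sum.If_cases Int_def cong: conj_cong\<close>)
    also have "\<dots> = (\<Sum>w\<in>F. emeasure (W x) {\<omega> \<in> space (W x). \<omega> n = w})"
      using sets by (subst nn_integral_sum) auto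
    also have "\<dots> = (\<Sum>w\<in>F. ennreal (n_step n x w))"
      by (rule sum.cong[OF refl]) (simp add: emeasure_eq_measure n_step_step_prob[OF x, symmetric] step_prob_def)
    finally show ?thesis by (simp add: sum_ennreal n_step_nonneg)
  qed
  have "ennreal (\<Sum>w\<in>F. U x w) = ennreal (\<Sum>n. \<Sum>w\<in>F. n_step n x w)"
    unfolding U_def using F x by (subst suminf_sum) (auto intro!: n_step_summable)
  also have "\<dots> = (\<Sum>n. ennreal (\<Sum>w\<in>F. n_step n x w))"
    by (rule suminf_ennreal2[symmetric]) (auto intro!: sum_nonneg n_step_nonneg sm)
  also have "\<dots> = (\<integral>\<^sup>+\<omega>. (\<Sum>n. indicator F (\<omega> n)) \<partial>W x)"
    unfolding pF by (rule nn_integral_suminf[symmetric]) (rule ev)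
  also have "\<dots> \<le> (\<integral>\<^sup>+\<omega>. lastv x r \<omega> + 1 \<partial>W x)"
  proof (rule nn_integral_mono)
    fix \<omega>
    have "(\<Sum>n<N. indicator F (\<omega> n)) \<le> lastv x r \<omega> + 1" for N
    proof -
      let ?S = "{n. n < N \<and> \<omega> n \<in> F}"
      have fin: "finite ?S" by simp
      have "(\<Sum>n<N. indicator F (\<omega> n)) = (of_nat (card ?S) :: ennreal)"
        by (simp add: indicator_def sum.If_cases Int_def lessThan_def)
      also have "\<dots> \<le> lastv x r \<omega> + 1"
      proof (cases "?S = {}")
        case False
        let ?m = "Max ?S"
        have m: "?m \<in> ?S" using fin False by (rule Max_in)
        have "?S \<subseteq> {..?m}" using fin by (auto intro: Max_ge)
        then have "card ?S \<le> ?m + 1" using card_mono[of "{..?m}" ?S] by simp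
        then have "(of_nat (card ?S) :: ennreal) \<le> of_nat (?m + 1)" by (rule of_nat_mono)
        also have "\<dots> = of_nat ?m + 1" by simp
        also have "of_nat ?m \<le> lastv x r \<omega>"
          unfolding lastv_def by (rule SUP_upper) (use m F in auto)
        finally show ?thesis by (simp add: add_right_mono)
      qed (simp only:, simp)
      finally show ?thesis .
    qed
    then show "(\<Sum>n. indicator F (\<omega> n)) \<le> lastv x r \<omega> + 1"
      unfolding suminf_eq_SUP by (rule SUP_least)
  qed
  also have "\<dots> = (\<integral>\<^sup>+\<omega>. lastv x r \<omega> \<partial>W x) + 1"
    using lastv_measurable[OF x, of r] by (subst nn_integral_add) (auto simp: emeasure_space_1)
  also have "\<dots> \<le> ennreal ((C0 - 1) * real r) + ennreal (real r)"
    using C0(2)[OF x r] r by (intro add_mono) (auto simp flip: ennreal_1 intro!: ennreal_leI)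
  also have "\<dots> = ennreal (C0 * real r)"
    using C0(1) mult_left_mono[OF C0(1), of "real r"] by (subst ennreal_plus[symmetric]) (auto simp: algebra_simps)
  finally show ?thesis using C0(1) by (simp add: ennreal_le_iff)
qed

text \<open>On a finite vertex set the Green function would sum to infinity. That \<open>V\<close>
  is infinite guarantees that every finite set has an edge out of it.\<close>

lemma infinite_V: "infinite V"
proof
  assume fin: "finite V"
  obtain x where x: "x \<in> V" using connected unfolding connected_net_def by auto
  have "real n \<le> (\<Sum>y\<in>V. U x y)" for n
  proof -
    have one: "(\<Sum>y\<in>V. n_step m x y) = 1" for m
      using sum_pmf_eq_1[OF fin set_Kn[OF x, of m]] by (simp add: n_step_def)
    have "real n = (\<Sum>m<n. \<Sum>y\<in>V. n_step m x y)" by (simp add: one)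
    also have "\<dots> = (\<Sum>y\<in>V. \<Sum>m<n. n_step m x y)" by (rule sum.swap)
    also have "\<dots> \<le> (\<Sum>y\<in>V. U x y)"
      unfolding U_def by (intro sum_mono sum_le_suminf n_step_summable x) (auto simp: n_step_nonneg)
    finally show ?thesis .
  qed
  then show False using reals_Archimedean2[of "\<Sum>y\<in>V. U x y"] by (meson not_le)
qed

lemma AE_steps: assumes v: "v \<in> V" shows "AE \<omega> in W v. \<omega> 0 = v \<and> (\<forall>n. trans_pr (\<omega> n) (\<omega> (Suc n)) > 0)"
proof -
  have chain_nth: "chain x l \<Longrightarrow> i < length l \<Longrightarrow> trans_pr ((x # l) ! i) (l ! i) > 0" for x l i
  proof (induction l arbitrary: x i)
    case (Cons y l)
    then show ?case by (cases i) auto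
  qed simp
  have "AE \<omega> in W v. map \<omega> [1..<Suc n] \<in> set_pmf (L n v)" for n
  proof -
    have "AE l in distr (W v) (count_space UNIV) (\<lambda>\<omega>. map \<omega> [1..<Suc n]). l \<in> set_pmf (L n v)"
      unfolding W_law[OF v] by (simp add: AE_measure_pmf_iff)
    then show ?thesis by (subst (asm) AE_distr_iff) (use W_list_measurable[OF v] in auto)
  qed
  then have "AE \<omega> in W v. \<forall>n. map \<omega> [1..<Suc n] \<in> set_pmf (L n v)" by (rule AE_all_countable[THEN iffD2, rule_format])
  then show ?thesis using W_start[OF v]
  proof eventually_elim
    case (elim \<omega>)
    have "trans_pr (\<omega> n) (\<omega> (Suc n)) > 0" for n
    proof -
      have "chain v (map \<omega> [1..<Suc (Suc n)])" using elim set_L[OF v] by blast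
      from chain_nth[OF this, of n] have "trans_pr ((v # map \<omega> [1..<Suc (Suc n)]) ! n) (map \<omega> [1..<Suc (Suc n)] ! n) > 0" by simp
      moreover have "(v # map \<omega> [1..<Suc (Suc n)]) ! n = \<omega> n" using elim by (cases n) (auto simp del: upt_Suc)
      moreover have "map \<omega> [1..<Suc (Suc n)] ! n = \<omega> (Suc n)" by (simp del: upt_Suc)
      ultimately show ?thesis by simp
    qed
    then show ?case using elim by auto
  qed
qed

text \<open>The last visit time of the ball has finite mean, so it is finite almost surely.\<close>

lemma AE_leaves: assumes v: "v \<in> V" and r: "r \<ge> 1"
  shows "AE \<omega> in W v. \<exists>n. gdist G v (\<omega> n) > r"
proof -
  have "(\<integral>\<^sup>+\<omega>. lastv v r \<omega> \<partial>W v) < \<top>"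
    using C0(2)[OF v r] by (rule le_less_trans) simp
  then have "AE \<omega> in W v. lastv v r \<omega> \<noteq> \<infinity>"
    using lastv_measurable[OF v] by (intro nn_integral_PInf_AE) auto
  then show ?thesis
  proof eventually_elim
    case (elim \<omega>)
    then obtain N :: nat where N: "lastv v r \<omega> < of_nat N"
      by (metis ennreal_Ex_less_of_nat infinity_ennreal_def less_top)
    have "gdist G v (\<omega> N) > r"
    proof (rule ccontr)
      assume "\<not> gdist G v (\<omega> N) > r"
      then have "(of_nat N :: ennreal) \<le> lastv v r \<omega>" unfolding lastv_def by (intro SUP_upper) auto
      then show False using N by simp
    qed
    then show ?case by blast
  qed
qed


section \<open>Escape from a set in the infinite network\<close>

definition avoid_pr :: "nat \<Rightarrow> 'v \<Rightarrow> 'v set \<Rightarrow> real" where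
  "avoid_pr n z S = measure_pmf.prob (L n z) {l. set l \<inter> S = {}}"

lemma avoid_pr_bounds: "avoid_pr n z S \<ge> 0" "avoid_pr n z S \<le> 1"
  unfolding avoid_pr_def by auto

lemma avoid_pr_Suc: "ennreal (avoid_pr (Suc n) z S) = (\<integral>\<^sup>+y. ennreal (of_bool (y \<notin> S) * avoid_pr n y S) \<partial>measure_pmf (K z))"
proof -
  have "ennreal (avoid_pr (Suc n) z S) = emeasure (measure_pmf (L (Suc n) z)) {l. set l \<inter> S = {}}"
    by (simp add: avoid_pr_def measure_pmf.emeasure_eq_measure)
  also have "\<dots> = (\<integral>\<^sup>+y. emeasure (measure_pmf (map_pmf ((#) y) (L n y))) {l. set l \<inter> S = {}} \<partial>measure_pmf (K z))"
    by simp
  also have "\<dots> = (\<integral>\<^sup>+y. ennreal (of_bool (y \<notin> S) * avoid_pr n y S) \<partial>measure_pmf (K z))"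
  proof (rule nn_integral_cong)
    fix y
    have "(#) y -` {l. set l \<inter> S = {}} = (if y \<in> S then {} else {l. set l \<inter> S = {}})" by auto
    then show "emeasure (measure_pmf (map_pmf ((#) y) (L n y))) {l. set l \<inter> S = {}} = ennreal (of_bool (y \<notin> S) * avoid_pr n y S)"
      by (simp add: avoid_pr_def measure_pmf.emeasure_eq_measure)
  qed
  finally show ?thesis .
qed

text \<open>A step out of the finite set \<open>F\<close> counts as a success. This matches the
  wired network, where such a step leads to the root.\<close>

lemma avoid_pr_Suc_le:
  assumes z: "z \<in> V" and F: "finite F"
  shows "avoid_pr (Suc n) z S \<le> (\<Sum>y\<in>F - S. trans_pr z y * avoid_pr n y S) + (1 - (\<Sum>y\<in>F. trans_pr z y))"
proof -
  have m: "(\<Sum>y\<in>F. trans_pr z y) = measure_pmf.prob (K z) F" using F z by (simp add: measure_measure_pmf_finite pmf_K)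
  have "ennreal (avoid_pr (Suc n) z S) \<le> (\<integral>\<^sup>+y. ennreal (of_bool (y \<notin> S) * avoid_pr n y S) * indicator F y + indicator (- F) y \<partial>measure_pmf (K z))"
    unfolding avoid_pr_Suc
  proof (rule nn_integral_mono)
    fix y
    have "of_bool (y \<notin> S) * avoid_pr n y S \<le> 1" using avoid_pr_bounds[of n y S] by (cases "y \<in> S") auto
    then show "ennreal (of_bool (y \<notin> S) * avoid_pr n y S) \<le> ennreal (of_bool (y \<notin> S) * avoid_pr n y S) * indicator F y + indicator (- F) y"
      by (cases "y \<in> F") (auto simp: ennreal_le_1)
  qed
  also have "\<dots> = (\<Sum>y\<in>F. ennreal (of_bool (y \<notin> S) * avoid_pr n y S) * indicator F y * ennreal (pmf (K z) y)) + emeasure (measure_pmf (K z)) (- F)"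
    by (subst nn_integral_add) (auto simp: nn_integral_measure_pmf_support[OF F])
  also have "(\<Sum>y\<in>F. ennreal (of_bool (y \<notin> S) * avoid_pr n y S) * indicator F y * ennreal (pmf (K z) y)) = ennreal (\<Sum>y\<in>F. of_bool (y \<notin> S) * avoid_pr n y S * trans_pr z y)"
    using z trans_pr_nonneg[OF z] by (subst sum_ennreal[symmetric]) (auto simp: pmf_K avoid_pr_bounds ennreal_mult intro!: sum.cong)
  also have "(\<Sum>y\<in>F. of_bool (y \<notin> S) * avoid_pr n y S * trans_pr z y) = (\<Sum>y\<in>F - S. trans_pr z y * avoid_pr n y S)"
    by (rule sum.mono_neutral_cong_right) (use F in auto)
  also have "emeasure (measure_pmf (K z)) (- F) = ennreal (1 - (\<Sum>y\<in>F. trans_pr z y))"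
    unfolding m measure_pmf.emeasure_eq_measure using measure_pmf.prob_compl[of F "K z"] by (simp add: Compl_eq_Diff_UNIV)
  also have "ennreal (\<Sum>y\<in>F - S. trans_pr z y * avoid_pr n y S) + ennreal (1 - (\<Sum>y\<in>F. trans_pr z y)) =
      ennreal ((\<Sum>y\<in>F - S. trans_pr z y * avoid_pr n y S) + (1 - (\<Sum>y\<in>F. trans_pr z y)))"
    by (rule ennreal_plus[symmetric]) (use trans_pr_nonneg[OF z] m in \<open>auto intro!: sum_nonneg mult_nonneg_nonneg avoid_pr_bounds\<close>)
  finally show ?thesis
    by (subst (asm) ennreal_le_iff) (use trans_pr_nonneg[OF z] m in \<open>auto intro!: add_nonneg_nonneg sum_nonneg mult_nonneg_nonneg avoid_pr_bounds\<close>)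
qed

lemma avoid_pr_dec: "z \<in> V \<Longrightarrow> avoid_pr (Suc n) z S \<le> avoid_pr n z S"
proof (induction n arbitrary: z)
  case 0
  then show ?case using avoid_pr_bounds[of 1 z S] by (simp add: avoid_pr_def)
next
  case (Suc n)
  have "ennreal (avoid_pr (Suc (Suc n)) z S) \<le> ennreal (avoid_pr (Suc n) z S)"
    unfolding avoid_pr_Suc[of "Suc n"] avoid_pr_Suc[of n]
  proof (rule nn_integral_mono_AE)
    show "AE y in measure_pmf (K z). ennreal (of_bool (y \<notin> S) * avoid_pr (Suc n) y S) \<le> ennreal (of_bool (y \<notin> S) * avoid_pr n y S)"
      unfolding AE_measure_pmf_iff using Suc.IH set_K_V[OF Suc.prems] by (auto intro!: ennreal_leI)
  qed
  then show ?case by (simp add: ennreal_le_iff avoid_pr_bounds)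
qed

definition escape_pr :: "'v set \<Rightarrow> 'v \<Rightarrow> real" where "escape_pr S z = lim (\<lambda>n. avoid_pr n z S)"

lemma escape_pr_lim: assumes z: "z \<in> V" shows "(\<lambda>n. avoid_pr n z S) \<longlonglongrightarrow> escape_pr S z"
proof -
  have "decseq (\<lambda>n. avoid_pr n z S)" by (rule decseq_SucI) (rule avoid_pr_dec[OF z])
  moreover have "Bseq (\<lambda>n. avoid_pr n z S)" by (rule BseqI'[of _ 1]) (simp add: avoid_pr_bounds abs_le_iff)
  ultimately have "convergent (\<lambda>n. avoid_pr n z S)" by (intro Bseq_monoseq_convergent decseq_imp_monoseq)
  then show ?thesis unfolding escape_pr_def by (simp add: convergent_LIMSEQ_iff)
qed

lemma escape_pr_step:
  assumes z: "z \<in> V" and F: "finite F" "F \<subseteq> V"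
  shows "escape_pr S z \<le> (\<Sum>y\<in>F - S. trans_pr z y * escape_pr S y) + (1 - (\<Sum>y\<in>F. trans_pr z y))"
proof (rule LIMSEQ_le)
  show "(\<lambda>n. avoid_pr (Suc n) z S) \<longlonglongrightarrow> escape_pr S z" using escape_pr_lim[OF z] by (rule LIMSEQ_Suc)
  show "(\<lambda>n. (\<Sum>y\<in>F - S. trans_pr z y * avoid_pr n y S) + (1 - (\<Sum>y\<in>F. trans_pr z y))) \<longlonglongrightarrow> (\<Sum>y\<in>F - S. trans_pr z y * escape_pr S y) + (1 - (\<Sum>y\<in>F. trans_pr z y))"
    using F by (intro tendsto_intros escape_pr_lim) auto
  show "\<exists>N. \<forall>n\<ge>N. avoid_pr (Suc n) z S \<le> (\<Sum>y\<in>F - S. trans_pr z y * avoid_pr n y S) + (1 - (\<Sum>y\<in>F. trans_pr z y))"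
    using avoid_pr_Suc_le[OF z F(1)] by blast
qed

definition avoid :: "'v set \<Rightarrow> (nat \<Rightarrow> 'v) set" where "avoid S = {\<omega>. \<omega> ` {0<..} \<inter> S = {}}"

lemma avoid_sets: assumes v: "v \<in> V" shows "avoid S \<inter> space (W v) \<in> sets (W v)"
proof -
  have "avoid S \<inter> space (W v) = space (W v) \<inter> (\<Inter>n\<in>{0<..}. (\<lambda>\<omega>. \<omega> n) -` (V - S) \<inter> space (W v))"
    unfolding avoid_def W_props(3)[OF v] by (auto simp: PiE_iff)
  also have "\<dots> \<in> sets (W v)"
    using measurable_sets[OF W_coord[OF v]] by (intro sets.Int sets.top sets.countable_INT') auto
  finally show ?thesis .
qed

lemma avoid_le_es: assumes v: "v \<in> V" shows "measure (W v) (avoid S \<inter> space (W v)) \<le> escape_pr S v"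
proof (rule LIMSEQ_le_const[OF escape_pr_lim[OF v]], intro exI allI impI)
  fix n
  interpret prob_space "W v" by (rule W_props(1)[OF v])
  have "measure (W v) (avoid S \<inter> space (W v)) \<le> measure (W v) ((\<lambda>\<omega>. map \<omega> [1..<Suc n]) -` {l. set l \<inter> S = {}} \<inter> space (W v))"
  proof (rule finite_measure_mono)
    show "(\<lambda>\<omega>. map \<omega> [1..<Suc n]) -` {l. set l \<inter> S = {}} \<inter> space (W v) \<in> sets (W v)"
      using W_list_measurable[OF v] by (rule measurable_sets) simp
    show "avoid S \<inter> space (W v) \<subseteq> (\<lambda>\<omega>. map \<omega> [1..<Suc n]) -` {l. set l \<inter> S = {}} \<inter> space (W v)"
    proof
      fix \<omega> assume w: "\<omega> \<in> avoid S \<inter> space (W v)"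
      have "set (map \<omega> [1..<Suc n]) \<subseteq> \<omega> ` {0<..}" by (auto simp del: upt_Suc)
      then show "\<omega> \<in> (\<lambda>\<omega>. map \<omega> [1..<Suc n]) -` {l. set l \<inter> S = {}} \<inter> space (W v)"
        using w unfolding avoid_def by blast
    qed
  qed
  also have "\<dots> = measure (distr (W v) (count_space UNIV) (\<lambda>\<omega>. map \<omega> [1..<Suc n])) {l. set l \<inter> S = {}}"
    by (rule measure_distr[symmetric]) (use W_list_measurable[OF v] in auto)
  also have "\<dots> = avoid_pr n v S" unfolding W_law[OF v] avoid_pr_def ..
  finally show "measure (W v) (avoid S \<inter> space (W v)) \<le> avoid_pr n v S" .
qed

definition apath :: "'v \<Rightarrow> nat \<Rightarrow> 'v set \<Rightarrow> nat \<Rightarrow> 'v list set" where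
  "apath v R D k = {l. l \<noteq> [] \<and> set l \<subseteq> {x\<in>D. x \<noteq> v \<and> gdist G v x \<le> 2 * R} \<and> gdist G v (last l) \<ge> R \<and> length l \<le> k}"

text \<open>The required time is the one just before the first passage above level
  \<open>j\<close>.\<close>

lemma level_crossing:
  assumes v: "v \<in> V" and Y: "Y 0 = v" "\<And>n. trans_pr (Y n) (Y (Suc n)) > 0" "\<And>n. Y n \<in> V"
    and N: "gdist G v (Y N) > j"
  shows "\<exists>m. gdist G v (Y m) = j \<and> (\<forall>i\<le>m. gdist G v (Y i) \<le> j)"
proof -
  let ?P = "\<lambda>m. gdist G v (Y m) > j"
  define m where "m = (LEAST m. ?P m)"
  have Pm: "?P m" unfolding m_def using N by (rule LeastI)
  have lt: "\<not> ?P i" if "i < m" for i using that unfolding m_def by (rule not_less_Least)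
  have "m \<noteq> 0" using Pm Y(1) gdist_refl[OF v] by (metis not_less_zero)
  then obtain m' where m': "m = Suc m'" by (cases m) auto
  have "gdist G v (Y (Suc m')) \<le> gdist G v (Y m') + gdist G (Y m') (Y (Suc m'))"
    using v Y(3) by (intro gdist_triangle)
  moreover have "gdist G (Y m') (Y (Suc m')) \<le> 1"
    using Y(2)[of m'] trans_pr_pos_iff[OF Y(3)] by (intro gdist_edge) auto
  moreover have "gdist G v (Y m') \<le> j" using lt[of m'] m' by auto
  ultimately have "gdist G v (Y m') = j" using Pm m' by auto
  moreover have "\<forall>i\<le>m'. gdist G v (Y i) \<le> j" using lt m' by (auto simp: not_less)
  ultimately show ?thesis by blast
qed

text \<open>A walk \<open>Y\<close> that leaves the ball of radius \<open>2 * R\<close> has, for every level \<open>j\<close> between \<open>R\<close> and \<open>2 * R\<close>, an initial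
  segment that ends at distance \<open>j\<close> and stays within it. These segments are distinct, so that a pair
  counted by \<open>disjoint_prob\<close> contributes \<open>R\<close> times to the sum.\<close>

lemma escape_sum:
  assumes v: "v \<in> V" and R: "R \<ge> 1" and D: "incseq D" "\<And>n. finite (D n)" "(\<Union>n. D n) = V" and q: "disjoint_prob G v > 0"
  shows "\<exists>k. disjoint_prob G v * real R / 2 \<le> (\<Sum>l\<in>apath v R (D k) k. list_pr v l * measure (W v) (avoid (insert v (set l)) \<inter> space (W v)))"
proof -
  interpret W: prob_space "W v" by (rule W_props(1)[OF v])
  interpret WW: pair_prob_space "W v" "W v" ..
  let ?PP = "W v \<Otimes>\<^sub>M W v"
  define DJ where "DJ = {p \<in> space ?PP. case p of (X, Y) \<Rightarrow> X ` {0<..} \<inter> Y ` {0<..} = {} \<and> v \<notin> X ` {0<..} \<and> v \<notin> Y ` {0<..}}"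
  have qDJ: "disjoint_prob G v = measure ?PP DJ" 
    unfolding disjoint_prob_def DJ_def by (rule arg_cong[where f="measure _"]) auto
  \<comment> \<open>\<open>measure\<close> vanishes on sets that are not measurable, so positivity
    yields measurability.\<close>
  have DJs: "DJ \<in> sets ?PP" using q measure_notin_sets unfolding qDJ by fastforce
  define Ev where "Ev l = {\<omega> \<in> space (W v). map \<omega> [1..<Suc (length l)] = l}" for l
  define Fv where "Fv l = avoid (insert v (set l)) \<inter> space (W v)" for l
  have Evs: "Ev l \<in> sets (W v)" and Fvs: "Fv l \<in> sets (W v)" for l
    unfolding Ev_def Fv_def by (rule W_list_sets[OF v], rule avoid_sets[OF v])
  have fin: "finite (apath v R (D k) k)" for k
    by (rule finite_subset[OF _ finite_lists_length_le[OF D(2)[of k], of k]]) (auto simp: apath_def)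
  have apV: "set l \<subseteq> V" if "l \<in> apath v R (D k) k" for l k using that D(3) by (auto simp: apath_def)
  have mE: "measure (W v) (Ev l) = list_pr v l" if "set l \<subseteq> V" for l
  proof -
    have "measure (W v) (Ev l) = measure (distr (W v) (count_space UNIV) (\<lambda>\<omega>. map \<omega> [1..<Suc (length l)])) {l}"
      by (subst measure_distr) (use W_list_measurable[OF v] in \<open>auto simp: Ev_def intro!: arg_cong[where f="measure _"]\<close>)
    then show ?thesis unfolding W_law[OF v] using pmf_L[OF v that] by (simp add: measure_pmf_single)
  qed
  define f where "f k p = (\<Sum>l\<in>apath v R (D k) k. indicator (Fv l \<times> Ev l) p :: ennreal)" for k and p :: "(nat \<Rightarrow> 'v) \<times> (nat \<Rightarrow> 'v)"
  have fm: "f k \<in> borel_measurable ?PP" for k unfolding f_def using Evs Fvs by (intro borel_measurable_sum) auto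
  \<comment> \<open>\<open>X\<close> and \<open>Y\<close> are independent: for each list,
    \<open>Y\<close> begins with it while \<open>X\<close> avoids it and \<open>v\<close>.\<close>
  have fint: "(\<integral>\<^sup>+p. f k p \<partial>?PP) = ennreal (\<Sum>l\<in>apath v R (D k) k. list_pr v l * measure (W v) (Fv l))" for k
  proof -
    have "(\<integral>\<^sup>+p. f k p \<partial>?PP) = (\<Sum>l\<in>apath v R (D k) k. emeasure ?PP (Fv l \<times> Ev l))"
      unfolding f_def using Evs Fvs by (subst nn_integral_sum) auto
    also have "\<dots> = (\<Sum>l\<in>apath v R (D k) k. ennreal (list_pr v l * measure (W v) (Fv l)))"
    proof (rule sum.cong[OF refl])
      fix l assume "l \<in> apath v R (D k) k"
      then have "measure (W v) (Ev l) = list_pr v l" by (rule mE[OF apV])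
      then show "emeasure ?PP (Fv l \<times> Ev l) = ennreal (list_pr v l * measure (W v) (Fv l))"
        using Evs Fvs measure_nonneg[of "W v" "Ev l"]
        by (simp add: W.emeasure_pair_measure_Times W.emeasure_eq_measure ennreal_mult mult.commute)
    qed
    also have "\<dots> = ennreal (\<Sum>l\<in>apath v R (D k) k. list_pr v l * measure (W v) (Fv l))"
    proof (rule sum_ennreal)
      fix l assume "l \<in> apath v R (D k) k"
      then have "list_pr v l \<ge> 0" using mE[OF apV] measure_nonneg by metis
      then show "0 \<le> list_pr v l * measure (W v) (Fv l)" by simp
    qed
    finally show ?thesis .
  qed
  have apmono: "apath v R (D k) k \<subseteq> apath v R (D k') k'" if "k \<le> k'" for k k'
    using that incseqD[OF D(1) that] by (auto simp: apath_def)
  have finc: "incseq f"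
  proof (rule incseq_SucI, rule le_funI)
    fix k p
    show "f k p \<le> f (Suc k) p" unfolding f_def by (rule sum_mono2[OF fin apmono]) auto
  qed
  have "AE \<omega> in W v. (\<omega> 0 = v \<and> (\<forall>n. trans_pr (\<omega> n) (\<omega> (Suc n)) > 0)) \<and> (\<exists>n. gdist G v (\<omega> n) > 2 * R)"
    using AE_steps[OF v] AE_leaves[OF v, of "2 * R"] R by (simp add: AE_conj_iff)
  then obtain N where N: "{\<omega> \<in> space (W v). \<not> ((\<omega> 0 = v \<and> (\<forall>n. trans_pr (\<omega> n) (\<omega> (Suc n)) > 0)) \<and> (\<exists>n. gdist G v (\<omega> n) > 2 * R))} \<subseteq> N"
    "emeasure (W v) N = 0" "N \<in> sets (W v)" by (rule AE_E)
  let ?N = "space (W v) \<times> N"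
  have N0: "emeasure ?PP ?N = 0" using N by (simp add: W.emeasure_pair_measure_Times)
  have Ns: "?N \<in> sets ?PP" using N by auto
  have low: "of_nat R * indicator (DJ - ?N) p \<le> (SUP k. f k p)" for p
  proof (cases "p \<in> DJ - ?N")
    case True
    obtain X Y where p: "p = (X, Y)" by (cases p)
    have XY: "X \<in> space (W v)" "Y \<in> space (W v)" "X ` {0<..} \<inter> Y ` {0<..} = {}" "v \<notin> X ` {0<..}" "v \<notin> Y ` {0<..}" "Y \<notin> N"
      using True unfolding p DJ_def by (auto simp: space_pair_measure)
    have "(Y 0 = v \<and> (\<forall>n. trans_pr (Y n) (Y (Suc n)) > 0)) \<and> (\<exists>n. gdist G v (Y n) > 2 * R)"
    proof (rule ccontr)
      assume "\<not> ?thesis"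
      then have "Y \<in> N" using XY(2) by (intro subsetD[OF N(1)]) (rule CollectI, rule conjI)
      then show False using XY(6) by contradiction
    qed
    then have Y: "Y 0 = v" "\<And>n. trans_pr (Y n) (Y (Suc n)) > 0" "\<exists>n. gdist G v (Y n) > 2 * R" by auto
    have YV: "Y n \<in> V" for n using XY(2) unfolding W_props(3)[OF v] by (simp add: PiE_iff)
    obtain n0 where n0: "gdist G v (Y n0) > 2 * R" using Y(3) by blast
    have "\<exists>m. gdist G v (Y m) = j \<and> (\<forall>i\<le>m. gdist G v (Y i) \<le> j)" if "j \<le> 2 * R" for j
    proof (rule level_crossing[where Y=Y and N=n0])
      show "v \<in> V" "Y 0 = v" by (fact v, fact Y(1))
      show "\<And>n. trans_pr (Y n) (Y (Suc n)) > 0" "\<And>n. Y n \<in> V" by (fact Y(2), fact YV)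
      show "j < gdist G v (Y n0)" using n0 that by simp
    qed
    then obtain m where m: "\<And>j. j \<le> 2 * R \<Longrightarrow> gdist G v (Y (m j)) = j \<and> (\<forall>i\<le>m j. gdist G v (Y i) \<le> j)" by metis
    define l where "l j = map Y [1..<Suc (m j)]" for j
    let ?J = "{R<..2*R}"
    define B where "B = Max (m ` ?J)"
    have mB: "m j \<le> B" if "j \<in> ?J" for j unfolding B_def using that by (intro Max_ge) auto
    have "\<forall>i\<in>{..B}. \<exists>n. Y i \<in> D n" using YV D(3) by blast
    then obtain g where g: "\<And>i. i \<le> B \<Longrightarrow> Y i \<in> D (g i)" by (metis atMost_iff)
    \<comment> \<open>A single index that bounds the lengths of all segments and whose set contains
      all their vertices.\<close>
    define k where "k = max B (Max (g ` {..B}))"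
    have Yk: "Y i \<in> D k" if "i \<le> B" for i
    proof -
      have "g i \<le> k" unfolding k_def using that by (intro max.coboundedI2 Max_ge) auto
      then show ?thesis using g[OF that] incseqD[OF D(1)] by blast
    qed
    have m0: "m j \<ge> 1" if "j \<in> ?J" for j
    proof (rule ccontr)
      assume "\<not> m j \<ge> 1"
      then have "m j = 0" by simp
      then show False using m[of j] that Y(1) gdist_refl[OF v] by auto
    qed
    have lj: "l j \<in> apath v R (D k) k" "(X, Y) \<in> Fv (l j) \<times> Ev (l j)" if j: "j \<in> ?J" for j
    proof -
      have ne: "l j \<noteq> []" using m0[OF j] by (simp add: l_def)
      have la: "last (l j) = Y (m j)" using m0[OF j] by (simp add: l_def)
      have sl: "set (l j) = Y ` {1..m j}" by (auto simp: l_def atLeastLessThanSuc_atLeastAtMost simp del: upt_Suc)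
      show "l j \<in> apath v R (D k) k" unfolding apath_def mem_Collect_eq
      proof (intro conjI)
        show "set (l j) \<subseteq> {x \<in> D k. x \<noteq> v \<and> gdist G v x \<le> 2 * R}"
        proof
          fix x assume "x \<in> set (l j)"
          then obtain i where i: "i \<in> {1..m j}" "x = Y i" unfolding sl by auto
          have "gdist G v (Y i) \<le> j" using m[of j] i j by auto
          then show "x \<in> {x \<in> D k. x \<noteq> v \<and> gdist G v x \<le> 2 * R}"
            using i j Yk[of i] mB[OF j] XY(5) by auto
        qed
        show "gdist G v (last (l j)) \<ge> R" unfolding la using m[of j] j by auto
        show "length (l j) \<le> k" using mB[OF j] unfolding k_def by (simp add: l_def max.coboundedI1)
      qed (rule ne)
      have "set (l j) \<subseteq> Y ` {0<..}" unfolding sl by auto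
      then have "X \<in> avoid (insert v (set (l j)))" unfolding avoid_def using XY(3,4) by auto
      then show "(X, Y) \<in> Fv (l j) \<times> Ev (l j)" unfolding Fv_def Ev_def using XY by (simp add: l_def)
    qed
    have inj: "inj_on l ?J"
    proof (rule inj_onI)
      fix i j assume ij: "i \<in> ?J" "j \<in> ?J" "l i = l j"
      then have "length (l i) = length (l j)" by simp
      then have "m i = m j" by (simp add: l_def del: upt_Suc)
      have ij2: "i \<le> 2 * R" "j \<le> 2 * R" using ij(1,2) by simp_all
      have "i = gdist G v (Y (m i))" using m[OF ij2(1)] by (elim conjE) (rule sym)
      also have "\<dots> = j" unfolding \<open>m i = m j\<close> using m[OF ij2(2)] by (elim conjE)
      finally show "i = j" .
    qed
    have "of_nat R = (\<Sum>j\<in>?J. indicator (Fv (l j) \<times> Ev (l j)) p :: ennreal)"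
      using lj(2) unfolding p by (simp add: indicator_def)
    also have "\<dots> = (\<Sum>l\<in>l ` ?J. indicator (Fv l \<times> Ev l) p)" by (simp add: sum.reindex[OF inj])
    also have "\<dots> \<le> f k p" unfolding f_def using lj(1) by (intro sum_mono2 fin) auto
    also have "\<dots> \<le> (SUP k. f k p)" by (rule SUP_upper) simp
    finally show ?thesis using True by simp
  qed simp
  have "ennreal (real R * disjoint_prob G v) = of_nat R * emeasure ?PP (DJ - ?N)"
  proof -
    have "emeasure ?PP (DJ - ?N) = emeasure ?PP DJ" by (rule emeasure_Diff_null_set) (use N0 Ns DJs in auto)
    then show ?thesis unfolding qDJ by (simp add: WW.emeasure_eq_measure ennreal_mult ennreal_of_nat_eq_real_of_nat)
  qed
  also have "\<dots> = (\<integral>\<^sup>+p. of_nat R * indicator (DJ - ?N) p \<partial>?PP)"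
    using DJs Ns by (subst nn_integral_cmult_indicator) auto
  also have "\<dots> \<le> (\<integral>\<^sup>+p. (SUP k. f k p) \<partial>?PP)" by (rule nn_integral_mono) (rule low)
  also have "\<dots> = (SUP k. \<integral>\<^sup>+p. f k p \<partial>?PP)" by (rule nn_integral_monotone_convergence_SUP[OF finc fm])
  finally have le: "ennreal (real R * disjoint_prob G v) \<le> (SUP k. \<integral>\<^sup>+p. f k p \<partial>?PP)" .
  \<comment> \<open>Half of the value lies strictly below the supremum, so a single \<open>k\<close>
    already exceeds it.\<close>
  have "ennreal (disjoint_prob G v * real R / 2) < ennreal (real R * disjoint_prob G v)"
    using q R by (intro ennreal_lessI) auto
  then have "ennreal (disjoint_prob G v * real R / 2) < (SUP k. \<integral>\<^sup>+p. f k p \<partial>?PP)" using le by (rule less_le_trans)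
  then obtain k where "ennreal (disjoint_prob G v * real R / 2) < (\<integral>\<^sup>+p. f k p \<partial>?PP)" unfolding less_SUP_iff by auto
  then have "disjoint_prob G v * real R / 2 < (\<Sum>l\<in>apath v R (D k) k. list_pr v l * measure (W v) (Fv l))"
    unfolding fint using q by (subst (asm) ennreal_less_iff) auto
  then show ?thesis unfolding Fv_def by (intro exI[of _ k]) simp
qed

end

section \<open>Spanning trees and successor functions\<close>

lemma is_walk_mono: "is_walk (N\<lparr>edges := S\<rparr>) u p v \<Longrightarrow> S \<subseteq> T \<Longrightarrow> is_walk (N\<lparr>edges := T\<rparr>) u p v"
proof (induction p arbitrary: u)
  case (Cons a p)
  then show ?case by (cases a) auto
qed simp

lemma is_walk_edges: "is_walk N u p v \<Longrightarrow> snd ` set p \<subseteq> edges N"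
proof (induction p arbitrary: u)
  case (Cons a p)
  then show ?case by (cases a) auto
qed simp

lemma is_path_suffix:
  "is_path N w q v \<Longrightarrow> u \<in> set (map fst q @ [v]) \<Longrightarrow> \<exists>q'. is_path N u q' v"
proof (induction q arbitrary: w)
  case Nil
  then show ?case by (intro exI[of _ "[]"]) (auto simp: is_path_def)
next
  case (Cons a q)
  obtain x e where a: "a = (x, e)" by (cases a)
  show ?case
  proof (cases "u = x")
    case True
    then show ?thesis using Cons.prems a by (intro exI[of _ "a # q"]) (auto simp: is_path_def)
  next
    case False
    obtain y where "is_walk N y q v" using Cons.prems(1) a by (auto simp: is_path_def)
    then have "is_path N y q v" using Cons.prems(1) by (auto simp: is_path_def)
    then show ?thesis using Cons.IH Cons.prems(2) False a by auto
  qed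
qed

lemma is_walk_path: "is_walk N u p v \<Longrightarrow> \<exists>q. is_path N u q v"
proof (induction p arbitrary: u)
  case Nil
  then show ?case by (intro exI[of _ "[]"]) (auto simp: is_path_def)
next
  case (Cons a p)
  obtain x e where a: "a = (x, e)" by (cases a)
  obtain w where w: "u \<in> verts N" "e \<in> edges N" "ends N e = Upair u w" "is_walk N w p v" "x = u" using Cons.prems a by auto
  obtain q where q: "is_path N w q v" using Cons.IH[OF w(4)] by blast
  show ?case
  proof (cases "u \<in> set (map fst q @ [v])")
    case True
    then show ?thesis using is_path_suffix[OF q] by blast
  next
    case False
    then have "is_path N u ((u, e) # q) v" using q w by (auto simp: is_path_def)
    then show ?thesis by blast
  qed
qed

lemma is_walk_head: "is_walk N w p v \<Longrightarrow> w \<in> set (map fst p @ [v])"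
  by (cases p) auto

lemma is_path_distinct_edges: "is_path N u p v \<Longrightarrow> distinct (map snd p)"
proof (induction p arbitrary: u)
  case (Cons a p)
  obtain x e where a: "a = (x, e)" by (cases a)
  from Cons.prems a obtain w where w: "ends N e = Upair u w" "is_walk N w p v" "x = u" by (auto simp: is_path_def)
  have p: "is_path N w p v" using Cons.prems w by (auto simp: is_path_def)
  have un: "u \<notin> set (map fst p @ [v])" using Cons.prems a w by (auto simp: is_path_def)
  have "e \<notin> snd ` set p"
  proof
    assume "e \<in> snd ` set p"
    then obtain z where z: "(z, e) \<in> set p" by auto
    then obtain p1 p2 where p12: "p = p1 @ (z, e) # p2" by (meson split_list)
    have "\<exists>y. is_walk N y p v \<Longrightarrow> \<exists>y'. ends N e = Upair z y' \<and> is_walk N y' p2 v" unfolding p12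
    proof (induction p1)
      case (Cons c p1) then show ?case by (cases c) auto
    qed auto
    then obtain y' where y': "ends N e = Upair z y'" "is_walk N y' p2 v" using w by blast
    have "z \<noteq> u" using un z by force
    then have "y' = u" using y'(1) w(1) by auto
    then have "u \<in> set (map fst p2 @ [v])" using is_walk_head[OF y'(2)] by simp
    then show False using un p12 by auto
  qed
  then show ?case using Cons.IH[OF p] a by auto
qed simp

lemma is_walk_split:
  "is_walk N u (p1 @ p2) v \<Longrightarrow> \<exists>w. is_walk N u p1 w \<and> is_walk N w p2 v"
proof (induction p1 arbitrary: u)
  case Nil
  then show ?case using is_walk_verts by fastforce
next
  case (Cons a p1)
  then show ?case by (cases a) fastforce
qed

locale tree_net =
  fixes N :: "('b, 'e) network" and r :: 'b
  assumes fin_verts: "finite (verts N)" and root: "r \<in> verts N"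
    and N_ends: "e \<in> edges N \<Longrightarrow> set_uprod (ends N e) \<subseteq> verts N"
    and N_pos: "e \<in> edges N \<Longrightarrow> cond N e > 0"
    and N_sum: "cond N summable_on edges N"
    and N_leave: "S \<subseteq> verts N - {r} \<Longrightarrow> S \<noteq> {} \<Longrightarrow> \<exists>x\<in>S. \<exists>y\<in>verts N - S. \<exists>e\<in>edges N. ends N e = Upair x y"
begin

abbreviation "A \<equiv> verts N - {r}"

definition Eb :: "'b \<Rightarrow> 'b \<Rightarrow> 'e set" where "Eb x y = {e \<in> edges N. ends N e = Upair x y}"
definition Cn :: "'b \<Rightarrow> 'b \<Rightarrow> real" where "Cn x y = (\<Sum>\<^sub>\<infinity>e\<in>Eb x y. cond N e)"

lemma sub_sum: "X \<subseteq> edges N \<Longrightarrow> cond N summable_on X"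
  using summable_on_subset_banach[OF N_sum] .

lemma Eb_sub: "Eb x y \<subseteq> edges N" unfolding Eb_def by auto

lemma infsum_pos: assumes "X \<subseteq> edges N" "X \<noteq> {}" shows "infsum (cond N) X > 0"
proof -
  obtain e where e: "e \<in> X" using assms by auto
  have "sum (cond N) {e} \<le> infsum (cond N) X"
    by (rule finite_sum_le_infsum[OF sub_sum[OF assms(1)]]) (use e assms N_pos less_imp_le in auto)
  then show ?thesis using N_pos[of e] e assms by auto
qed

lemma infsum_nn: "X \<subseteq> edges N \<Longrightarrow> infsum (cond N) X \<ge> 0"
  using infsum_pos[of X] by (cases "X = {}") auto

lemma finite_net_N: "finite_net (verts N) Cn r"
proof
  show "finite (verts N)" "r \<in> verts N" by (fact fin_verts, fact root)
  show "0 \<le> Cn x y" for x y unfolding Cn_def by (rule infsum_nn[OF Eb_sub])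
  show "Cn x y = Cn y x" for x y
  proof -
    have "Eb x y = Eb y x" unfolding Eb_def by auto
    then show ?thesis by (simp add: Cn_def)
  qed
  fix S assume "S \<subseteq> verts N - {r}" "S \<noteq> {}"
  from N_leave[OF this] obtain x y e where "x \<in> S" "y \<in> verts N - S" "e \<in> edges N" "ends N e = Upair x y" by blast
  moreover from this have "Eb x y \<noteq> {}" unfolding Eb_def by auto
  ultimately show "\<exists>x\<in>S. \<exists>y\<in>verts N - S. 0 < Cn x y" using infsum_pos[OF Eb_sub[of x y]] unfolding Cn_def by blast
qed

sublocale FN: finite_net "verts N" Cn r by (rule finite_net_N)

definition suc :: "('b \<Rightarrow> 'e) \<Rightarrow> 'b \<Rightarrow> 'b" where
  "suc \<sigma> x = (if x \<in> A then (THE y. ends N (\<sigma> x) = Upair x y) else x)"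

text \<open>A successor function forgets which of several parallel edges is used. Selections keep
  the edge, and they are in bijection with the spanning trees through their images.\<close>

definition Sel :: "('b \<Rightarrow> 'e) set" where
  "Sel = {\<sigma> \<in> PiE A (\<lambda>x. incident N x). suc \<sigma> \<in> FN.forests A}"

lemma suc_ends: assumes "\<sigma> x \<in> incident N x" "x \<in> A" shows "ends N (\<sigma> x) = Upair x (suc \<sigma> x)" "suc \<sigma> x \<in> verts N"
proof -
  obtain a b where ab: "ends N (\<sigma> x) = Upair a b" by (cases "ends N (\<sigma> x)") auto
  then have "x = a \<or> x = b" "\<sigma> x \<in> edges N" using assms by (auto simp: incident_def)
  then obtain y where y: "ends N (\<sigma> x) = Upair x y" using ab by auto
  have "(THE y'. ends N (\<sigma> x) = Upair x y') = y" using y by (intro the_equality) auto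
  then show "ends N (\<sigma> x) = Upair x (suc \<sigma> x)" unfolding suc_def using assms y by simp
  then show "suc \<sigma> x \<in> verts N" using N_ends[OF \<open>\<sigma> x \<in> edges N\<close>] by auto
qed

lemma SelD:
  assumes "\<sigma> \<in> Sel" "x \<in> A"
  shows "\<sigma> x \<in> edges N" "ends N (\<sigma> x) = Upair x (suc \<sigma> x)" "suc \<sigma> x \<in> verts N" "suc \<sigma> x \<noteq> x"
proof -
  have i: "\<sigma> x \<in> incident N x" using assms unfolding Sel_def by auto
  then show "\<sigma> x \<in> edges N" by (auto simp: incident_def)
  show "ends N (\<sigma> x) = Upair x (suc \<sigma> x)" "suc \<sigma> x \<in> verts N" using suc_ends[of \<sigma> x] i assms(2) by auto
  show "suc \<sigma> x \<noteq> x" using assms FN.forest_ne[of "suc \<sigma>" A x] unfolding Sel_def by auto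
qed

lemma Sel_forest: "\<sigma> \<in> Sel \<Longrightarrow> suc \<sigma> \<in> FN.forests A" unfolding Sel_def by simp

text \<open>The number of vertices on the path to the root. It decreases along the successor
  function and serves as the measure in inductions over a tree.\<close>

definition ht :: "('b \<Rightarrow> 'e) \<Rightarrow> 'b \<Rightarrow> nat" where "ht \<sigma> x = card (orb (suc \<sigma>) x)"

lemma orb_fin: assumes "\<sigma> \<in> Sel" "x \<in> verts N" shows "finite (orb (suc \<sigma>) x)"
  using FN.forest_orb_B[OF Sel_forest[OF assms(1)] _ assms(2)] fin_verts finite_subset by blast

lemma self_not: assumes s: "\<sigma> \<in> Sel" "x \<in> A" shows "x \<notin> orb (suc \<sigma>) (suc \<sigma> x)"
proof
  assume "x \<in> orb (suc \<sigma>) (suc \<sigma> x)"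
  then have "suc \<sigma> x = x" using FN.forest_acyclic[OF Sel_forest[OF s(1)], of "suc \<sigma> x" x] orb_step[OF orb_self, of "suc \<sigma>" x] by blast
  then show False using SelD(4)[OF s] by simp
qed

lemma ht_less: assumes s: "\<sigma> \<in> Sel" "x \<in> A" shows "ht \<sigma> (suc \<sigma> x) < ht \<sigma> x"
proof -
  have "orb (suc \<sigma>) x = insert x (orb (suc \<sigma>) (suc \<sigma> x))" by (rule orb_insert)
  then show ?thesis unfolding ht_def using self_not[OF s] orb_fin[OF s(1) SelD(3)[OF s]] by simp
qed

lemma Sel_inj: assumes s: "\<sigma> \<in> Sel" shows "inj_on \<sigma> A"
proof (rule inj_onI)
  fix x z assume xz: "x \<in> A" "z \<in> A" "\<sigma> x = \<sigma> z"
  show "x = z"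
  proof (rule ccontr)
    assume "x \<noteq> z"
    then have "suc \<sigma> x = z" "suc \<sigma> z = x"
      using SelD(2)[OF s xz(1)] SelD(2)[OF s xz(2)] xz(3) by auto
    then show False using ht_less[OF s xz(1)] ht_less[OF s xz(2)] by simp
  qed
qed

lemma Sel_path:
  assumes s: "\<sigma> \<in> Sel" and x: "x \<in> verts N"
  shows "\<exists>p. is_path (N\<lparr>edges := \<sigma> ` A\<rparr>) x p r \<and> fst ` set p = orb (suc \<sigma>) x \<inter> A \<and> (x \<in> A \<longrightarrow> (\<exists>p'. p = (x, \<sigma> x) # p'))"
  using x
proof (induction "ht \<sigma> x" arbitrary: x rule: less_induct)
  case less
  show ?case
  proof (cases "x = r")
    case True
    then have "orb (suc \<sigma>) x = {r}" using orb_fix[of "suc \<sigma>" r] by (simp add: suc_def)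
    then show ?thesis using True root by (intro exI[of _ "[]"]) (auto simp: is_path_def)
  next
    case False
    then have xA: "x \<in> A" using less.prems by auto
    let ?y = "suc \<sigma> x"
    obtain p where p: "is_path (N\<lparr>edges := \<sigma> ` A\<rparr>) ?y p r" "fst ` set p = orb (suc \<sigma>) ?y \<inter> A"
      using less.hyps[OF ht_less[OF s xA] SelD(3)[OF s xA]] by blast
    have "x \<notin> fst ` set p" using p(2) self_not[OF s xA] by auto
    then have "is_path (N\<lparr>edges := \<sigma> ` A\<rparr>) x ((x, \<sigma> x) # p) r"
      using p(1) False xA SelD(2)[OF s xA] by (auto simp: is_path_def)
    moreover have "fst ` set ((x, \<sigma> x) # p) = orb (suc \<sigma>) x \<inter> A"
      using p(2) xA orb_insert[of "suc \<sigma>" x] by auto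
    ultimately show ?thesis by blast
  qed
qed

lemma Sel_edge:
  assumes s: "\<sigma> \<in> Sel" and e: "e \<in> \<sigma> ` A" "ends N e = Upair a b"
  shows "(a \<in> A \<and> e = \<sigma> a \<and> b = suc \<sigma> a) \<or> (b \<in> A \<and> e = \<sigma> b \<and> a = suc \<sigma> b)"
proof -
  obtain z where z: "z \<in> A" "e = \<sigma> z" using e by auto
  then have "Upair z (suc \<sigma> z) = Upair a b" using SelD(2)[OF s z(1)] e(2) by simp
  then show ?thesis using z by auto
qed

text \<open>At a vertex of maximal height on the cycle, both edges of the cycle must be its own
  selected edge, because any other selected edge at it comes from a higher vertex. But the edges of
  a cycle are distinct.\<close>

lemma Sel_no_cycle: assumes s: "\<sigma> \<in> Sel" shows "\<not> is_cycle (N\<lparr>edges := \<sigma> ` A\<rparr>) u p"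
proof
  let ?N = "N\<lparr>edges := \<sigma> ` A\<rparr>"
  assume c: "is_cycle ?N u p"
  let ?Vc = "fst ` set p"
  have ne: "?Vc \<noteq> {}" using c by (auto simp: is_cycle_def)
  have "Max (ht \<sigma> ` ?Vc) \<in> ht \<sigma> ` ?Vc" using ne by (intro Max_in) auto
  then obtain m where m: "m \<in> ?Vc" "Max (ht \<sigma> ` ?Vc) = ht \<sigma> m" by auto
  have mx: "ht \<sigma> z \<le> ht \<sigma> m" if "z \<in> ?Vc" for z unfolding m(2)[symmetric] using that by (intro Max_ge) auto
  obtain e where "(m, e) \<in> set p" using m(1) by auto
  then obtain p1 p2 where p: "p = p1 @ (m, e) # p2" by (meson split_list)
  have w: "is_walk ?N u (p1 @ (m, e) # p2) u" using c p by (auto simp: is_cycle_def)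
  obtain m' where "is_walk ?N u p1 m'" "is_walk ?N m' ((m, e) # p2) u" using is_walk_split[OF w] by blast
  then have w1: "is_walk ?N u p1 m" "is_walk ?N m ((m, e) # p2) u" by auto
  obtain y where y: "e \<in> \<sigma> ` A" "ends N e = Upair m y" "is_walk ?N y p2 u" using w1(2) by auto
  have wq: "is_walk ?N y (p2 @ p1) m" by (rule is_walk_append[OF y(3) w1(1)])
  have setq: "set p = set ((m, e) # p2 @ p1)" using p by auto
  have yV: "y \<in> ?Vc"
  proof (cases "p2 @ p1 = []")
    case True then show ?thesis using wq m by simp
  next
    case False
    then obtain a q where "p2 @ p1 = a # q" by (cases "p2 @ p1") auto
    moreover from this have "fst a = y" using wq by (cases a) auto
    ultimately have "a \<in> set (p2 @ p1)" by simp
    then show ?thesis using \<open>fst a = y\<close> setq by auto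
  qed
  have em: "m \<in> A \<and> e = \<sigma> m \<and> y = suc \<sigma> m"
  proof (rule ccontr)
    assume "\<not> ?thesis"
    then have "y \<in> A" "m = suc \<sigma> y" using Sel_edge[OF s y(1,2)] by auto
    then show False using ht_less[OF s, of y] mx[OF yV] by simp
  qed
  show False
  proof (cases "p2 @ p1" rule: rev_cases)
    case Nil
    then show False using wq em SelD(4)[OF s] by auto
  next
    case (snoc q a)
    obtain z e' where a: "a = (z, e')" by (cases a)
    obtain w' where w': "is_walk ?N w' [a] m" using is_walk_split[of ?N y q "[a]" m] wq snoc by auto
    then have e': "e' \<in> \<sigma> ` A" "ends N e' = Upair z m" using a by auto
    have zV: "z \<in> ?Vc" "e' \<in> snd ` set (p2 @ p1)" using snoc a setq by force+
    have "m \<in> A \<and> e' = \<sigma> m"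
    proof (rule ccontr)
      assume "\<not> ?thesis"
      then have "z \<in> A" "m = suc \<sigma> z" using Sel_edge[OF s e'] by auto
      then show False using ht_less[OF s, of z] mx[OF zV(1)] by simp
    qed
    then have "e = e'" using em by simp
    moreover have "e \<notin> snd ` set (p2 @ p1)" using c p unfolding is_cycle_def by auto
    ultimately show False using zV by simp
  qed
qed

lemma Sel_spanning: assumes s: "\<sigma> \<in> Sel" shows "\<sigma> ` A \<in> spanning_trees N"
proof -
  let ?N = "N\<lparr>edges := \<sigma> ` A\<rparr>"
  have "\<exists>p. is_walk ?N u p v" if uv: "u \<in> verts N" "v \<in> verts N" for u v
  proof -
    obtain p q where pq: "is_walk ?N u p r" "is_walk ?N v q r"
      using Sel_path[OF s uv(1)] Sel_path[OF s uv(2)] by (auto simp: is_path_def)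
    obtain q' where "is_walk ?N r q' v" using is_walk_rev[OF pq(2)] by (elim exE conjE)
    from is_walk_append[OF pq(1) this] show ?thesis by blast
  qed
  then have "connected_net ?N" unfolding connected_net_def using root by auto
  moreover have "\<sigma> ` A \<subseteq> edges N" using SelD(1)[OF s] by auto
  ultimately show ?thesis unfolding spanning_trees_def using Sel_no_cycle[OF s] by auto
qed

lemma Sel_orient: assumes s: "\<sigma> \<in> Sel" shows "(x, e) \<in> orient_towards N r (\<sigma> ` A) \<longleftrightarrow> x \<in> A \<and> e = \<sigma> x"
proof
  let ?N = "N\<lparr>edges := \<sigma> ` A\<rparr>"
  assume "x \<in> A \<and> e = \<sigma> x"
  then show "(x, e) \<in> orient_towards N r (\<sigma> ` A)"
    using Sel_path[OF s, of x] unfolding orient_towards_def by auto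
next
  let ?N = "N\<lparr>edges := \<sigma> ` A\<rparr>"
  assume "(x, e) \<in> orient_towards N r (\<sigma> ` A)"
  then obtain p where p: "is_path ?N x ((x, e) # p) r" unfolding orient_towards_def by auto
  then obtain w where w: "x \<in> verts N" "e \<in> \<sigma> ` A" "ends N e = Upair x w" "is_walk ?N w p r" by (auto simp: is_path_def)
  have xr: "x \<noteq> r" "x \<notin> set (map fst p @ [r])" using p by (auto simp: is_path_def)
  have "\<not> (w \<in> A \<and> e = \<sigma> w \<and> x = suc \<sigma> w)"
  proof
    assume ww: "w \<in> A \<and> e = \<sigma> w \<and> x = suc \<sigma> w"
    \<comment> \<open>A walk to the root that starts at a vertex whose orbit passes through
      \<open>w\<close> can leave this part of the tree only along the edge from \<open>w\<close> to
      its successor \<open>x\<close>.\<close>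
    have "is_walk ?N a q r \<Longrightarrow> w \<in> orb (suc \<sigma>) a \<Longrightarrow> x \<in> set (map fst q @ [r])" for a q
    proof (induction q arbitrary: a)
      case Nil
      then have "a = r" by simp
      have "suc \<sigma> r = r" by (simp add: suc_def)
      then have "w = r" using Nil(2) orb_fix[of "suc \<sigma>" r] \<open>a = r\<close> by simp
      then show ?case using ww by simp
    next
      case (Cons c q)
      obtain a' e' where c: "c = (a', e')" by (cases c)
      from Cons.prems(1) c obtain y where y: "e' \<in> \<sigma> ` A" "ends N e' = Upair a y" "is_walk ?N y q r" by auto
      show ?case
      proof (cases "w \<in> orb (suc \<sigma>) y")
        case True then show ?thesis using Cons.IH[OF y(3)] by auto
      next
        case False
        have "\<not> (y \<in> A \<and> e' = \<sigma> y \<and> a = suc \<sigma> y)"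
          using False Cons.prems(2) orb_insert[of "suc \<sigma>" y] by auto
        then have "a \<in> A" "y = suc \<sigma> a" using Sel_edge[OF s y(1,2)] by auto
        then have "a = w" using False Cons.prems(2) orb_insert[of "suc \<sigma>" a] by auto
        then have "y = x" using ww \<open>y = suc \<sigma> a\<close> by simp
        then show ?thesis using is_walk_head[OF y(3)] by auto
      qed
    qed
    from this[OF w(4)] show False using xr by simp
  qed
  then show "x \<in> A \<and> e = \<sigma> x" using Sel_edge[OF s w(2,3)] by auto
qed

lemma Sel_image_inj: "inj_on (\<lambda>\<sigma>. \<sigma> ` A) Sel"
proof (rule inj_onI)
  fix \<sigma> \<tau> assume *: "\<sigma> \<in> Sel" "\<tau> \<in> Sel" "\<sigma> ` A = \<tau> ` A"
  show "\<sigma> = \<tau>"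
  proof
    fix x show "\<sigma> x = \<tau> x"
    proof (cases "x \<in> A")
      case True
      then show ?thesis using Sel_orient[OF *(1), of x "\<sigma> x"] Sel_orient[OF *(2), of x "\<sigma> x"] *(3) by auto
    next
      case False
      then show ?thesis using *(1,2) unfolding Sel_def by (auto simp: PiE_def extensional_def)
    qed
  qed
qed

text \<open>Choosing at each vertex the first edge of a shortest walk to the root gives a selection
  inside \<open>T\<close>, since the distance to the root decreases along it. A further edge of
  \<open>T\<close> would close a cycle with the path between its ends in the selected tree.\<close>

lemma spanning_Sel: assumes T: "T \<in> spanning_trees N" shows "\<exists>\<sigma>\<in>Sel. T = \<sigma> ` A"
proof -
  let ?N = "N\<lparr>edges := T\<rparr>"
  have TE: "T \<subseteq> edges N" and conn: "connected_net ?N" and nc: "\<And>u p. \<not> is_cycle ?N u p"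
    using T by (auto simp: spanning_trees_def)
  define \<delta> where "\<delta> x = (LEAST n. \<exists>p. is_walk ?N x p r \<and> length p = n)" for x
  have \<delta>le: "\<delta> x \<le> length p" if "is_walk ?N x p r" for x p
    unfolding \<delta>_def by (rule Least_le) (use that in auto)
  have \<delta>ex: "\<exists>p. is_walk ?N x p r \<and> length p = \<delta> x" if "x \<in> verts N" for x
  proof -
    have "\<exists>p. is_walk ?N x p r" using conn that root unfolding connected_net_def by auto
    then have "\<exists>n p. is_walk ?N x p r \<and> length p = n" by auto
    then show ?thesis unfolding \<delta>_def by (rule LeastI_ex)
  qed
  have "\<exists>e\<in>T. \<exists>y. ends N e = Upair x y \<and> \<delta> y < \<delta> x" if x: "x \<in> A" for x
  proof -
    obtain p where p: "is_walk ?N x p r" "length p = \<delta> x" using \<delta>ex x by blast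
    then obtain a q where aq: "p = a # q" using x by (cases p) auto
    obtain x' e where a: "a = (x', e)" by (cases a)
    from p(1) aq a obtain y where "e \<in> T" "ends N e = Upair x y" "is_walk ?N y q r" by auto
    moreover from this have "\<delta> y < \<delta> x" using \<delta>le[of y q] p aq by auto
    ultimately show ?thesis by blast
  qed
  then obtain g where g: "\<And>x. x \<in> A \<Longrightarrow> g x \<in> T \<and> (\<exists>y. ends N (g x) = Upair x y \<and> \<delta> y < \<delta> x)" by metis
  define \<sigma> where "\<sigma> = restrict g A"
  have inc: "\<sigma> x \<in> incident N x" if "x \<in> A" for x using g[OF that] TE that by (auto simp: \<sigma>_def incident_def)
  have sd: "\<delta> (suc \<sigma> x) < \<delta> x" "suc \<sigma> x \<in> verts N" if x: "x \<in> A" for x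
  proof -
    obtain y where y: "ends N (\<sigma> x) = Upair x y" "\<delta> y < \<delta> x" using g[OF x] x by (auto simp: \<sigma>_def)
    then show "\<delta> (suc \<sigma> x) < \<delta> x" using suc_ends(1)[of \<sigma> x] inc[OF x] x by auto
    show "suc \<sigma> x \<in> verts N" using suc_ends(2)[of \<sigma> x] inc[OF x] x by auto
  qed
  have "suc \<sigma> \<in> FN.forests A" unfolding FN.forests_def
  proof (intro CollectI conjI ballI allI impI)
    show "suc \<sigma> x = x" if "x \<notin> A" for x using that unfolding suc_def by (rule if_not_P)
    show "suc \<sigma> x \<in> verts N" if "x \<in> A" for x using sd(2)[OF that] .
    fix S assume S: "S \<subseteq> A" "suc \<sigma> ` S \<subseteq> S"
    show "S = {}"
    proof (rule ccontr)
      assume "S \<noteq> {}"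
      then obtain x0 where "x0 \<in> S" by auto
      then obtain x where "x \<in> S" "\<And>y. y \<in> S \<Longrightarrow> \<delta> x \<le> \<delta> y"
        using ex_has_least_nat[of "\<lambda>x. x \<in> S" x0 \<delta>] by blast
      then show False using sd(1)[of x] S by fastforce
    qed
  qed
  then have s: "\<sigma> \<in> Sel" unfolding Sel_def using inc by (auto simp: \<sigma>_def)
  have sub: "\<sigma> ` A \<subseteq> T" using g by (auto simp: \<sigma>_def)
  have "T \<subseteq> \<sigma> ` A"
  proof
    fix e assume e: "e \<in> T"
    show "e \<in> \<sigma> ` A"
    proof (rule ccontr)
      assume en: "e \<notin> \<sigma> ` A"
      obtain a b where ab: "ends N e = Upair a b" by (cases "ends N e") auto
      then have V: "a \<in> verts N" "b \<in> verts N" using N_ends[of e] TE e by auto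
      have "connected_net (N\<lparr>edges := \<sigma> ` A\<rparr>)" using Sel_spanning[OF s] by (simp add: spanning_trees_def)
      then obtain p where p: "is_walk (N\<lparr>edges := \<sigma> ` A\<rparr>) b p a" using V unfolding connected_net_def by auto
      obtain q where q: "is_path (N\<lparr>edges := \<sigma> ` A\<rparr>) b q a" using is_walk_path[OF p] by (elim exE)
      have "snd ` set q \<subseteq> \<sigma> ` A" using is_walk_edges[of _ b q a] q by (force simp: is_path_def)
      then have "distinct (map snd ((a, e) # q))" using is_path_distinct_edges[OF q] en by auto
      moreover have "is_walk ?N b q a" using q is_walk_mono[OF _ sub] by (auto simp: is_path_def)
      then have "is_walk ?N a ((a, e) # q) a" using ab e V by auto
      moreover have "distinct (map fst ((a, e) # q))" using q by (auto simp: is_path_def)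
      ultimately have "is_cycle ?N a ((a, e) # q)" by (auto simp: is_cycle_def)
      then show False using nc by blast
    qed
  qed
  then show ?thesis using s sub by blast
qed

lemma spanning_trees_eq: "spanning_trees N = (\<lambda>\<sigma>. \<sigma> ` A) ` Sel"
  using spanning_Sel Sel_spanning by blast

end

section \<open>Weights of selections and the law of the spanning tree\<close>

context tree_net
begin

text \<open>For a fixed successor function the edges are chosen independently, so the sum of
  products is a product of sums; absolute summability justifies this for infinitely many parallel
  edges. The sets \<open>E'\<close> allow the choice to be restricted to some of them.\<close>

lemma sel_has_sum:
  assumes F: "F \<subseteq> FN.forests A" and E': "\<And>x y. E' x y \<subseteq> Eb x y"
  shows "((\<lambda>\<sigma>. \<Prod>x\<in>A. cond N (\<sigma> x)) has_sum (\<Sum>f\<in>F. \<Prod>x\<in>A. infsum (cond N) (E' x (f x))))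
    {\<sigma>\<in>Sel. suc \<sigma> \<in> F \<and> (\<forall>x\<in>A. \<sigma> x \<in> E' x (suc \<sigma> x))}"
proof -
  have finA: "finite A" using fin_verts by simp
  have finF: "finite F" using F FN.finite_forests[of A] finite_subset finA by blast
  let ?P = "\<lambda>f. PiE A (\<lambda>x. E' x (f x))"
  have sucf: "suc \<sigma> = f" if f: "f \<in> F" and s: "\<sigma> \<in> ?P f" for f \<sigma>
  proof
    fix x show "suc \<sigma> x = f x"
    proof (cases "x \<in> A")
      case True
      then have e: "\<sigma> x \<in> Eb x (f x)" using s E'[of x "f x"] by (auto simp: PiE_iff)
      then have "ends N (\<sigma> x) = Upair x (f x)" "\<sigma> x \<in> incident N x" by (auto simp: Eb_def incident_def)
      then show ?thesis using suc_ends(1)[of \<sigma> x] True by auto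
    next
      case False
      moreover have "f x = x" using f F False unfolding FN.forests_def by blast
      moreover have "suc \<sigma> x = x" unfolding suc_def using False by (rule if_not_P)
      ultimately show ?thesis by simp
    qed
  qed
  have eq: "{\<sigma>\<in>Sel. suc \<sigma> \<in> F \<and> (\<forall>x\<in>A. \<sigma> x \<in> E' x (suc \<sigma> x))} = (\<Union>f\<in>F. ?P f)"
  proof (intro set_eqI iffI)
    fix \<sigma> assume *: "\<sigma> \<in> {\<sigma>\<in>Sel. suc \<sigma> \<in> F \<and> (\<forall>x\<in>A. \<sigma> x \<in> E' x (suc \<sigma> x))}"
    then have "\<sigma> \<in> extensional A" unfolding Sel_def by (auto simp: PiE_def)
    then have "\<sigma> \<in> ?P (suc \<sigma>)" using * by (simp add: PiE_iff)
    then show "\<sigma> \<in> (\<Union>f\<in>F. ?P f)" using * by blast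
  next
    fix \<sigma> assume "\<sigma> \<in> (\<Union>f\<in>F. ?P f)"
    then obtain f where f: "f \<in> F" "\<sigma> \<in> ?P f" by blast
    have "\<sigma> x \<in> E' x (f x)" if "x \<in> A" for x using f(2) that by (auto simp: PiE_iff)
    moreover have "E' x (f x) \<subseteq> incident N x" for x using E'[of x "f x"] by (auto simp: Eb_def incident_def)
    moreover have "\<sigma> \<in> extensional A" using f(2) by (simp add: PiE_def)
    ultimately have "\<sigma> \<in> PiE A (\<lambda>x. incident N x)" by (auto simp: PiE_iff)
    then show "\<sigma> \<in> {\<sigma>\<in>Sel. suc \<sigma> \<in> F \<and> (\<forall>x\<in>A. \<sigma> x \<in> E' x (suc \<sigma> x))}"
      using f F sucf[OF f] unfolding Sel_def by (auto simp: PiE_iff)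
  qed
  have each: "((\<lambda>\<sigma>. \<Prod>x\<in>A. cond N (\<sigma> x)) has_sum (\<Prod>x\<in>A. infsum (cond N) (E' x (f x)))) (?P f)" for f
  proof -
    have s: "cond N summable_on E' x (f x)" for x using sub_sum[of "E' x (f x)"] E'[of x "f x"] Eb_sub by blast
    then have a: "(\<lambda>e. norm (cond N e)) summable_on E' x (f x)" for x
      by (simp only: summable_on_iff_abs_summable_on_real[symmetric])
    have "countable {e \<in> E' x (f x). cond N e \<noteq> 0}" for x using summable_countable_real[OF s] .
    moreover have "{e \<in> E' x (f x). cond N e \<noteq> 0} = E' x (f x)" for x
      using E'[of x "f x"] Eb_sub[of x "f x"] N_pos by fastforce
    ultimately have c: "countable (E' x (f x))" for x by metis
    have "Infinite_Set_Sum.abs_summable_on (\<lambda>\<sigma>. \<Prod>x\<in>A. cond N (\<sigma> x)) (?P f)"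
      by (rule abs_summable_on_prod_PiE[OF finA c]) (rule iffD1[OF abs_summable_equivalent a])
    then have "(\<lambda>\<sigma>. \<Prod>x\<in>A. cond N (\<sigma> x)) summable_on ?P f"
      by (rule abs_summable_summable[OF iffD2[OF abs_summable_equivalent]])
    then show ?thesis using infsum_prod_PiE_abs[OF finA a] by (simp add: has_sum_iff)
  qed
  show ?thesis unfolding eq
  proof (rule sum_has_sum[where B="?P" and s="\<lambda>f. \<Prod>x\<in>A. infsum (cond N) (E' x (f x))", OF finF])
    show "((\<lambda>\<sigma>. \<Prod>x\<in>A. cond N (\<sigma> x)) has_sum (\<Prod>x\<in>A. infsum (cond N) (E' x (f x)))) (?P f)" for f
      by (rule each)
    fix f g assume fg: "f \<in> F" "g \<in> F" "f \<noteq> g"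
    show "?P f \<inter> ?P g = {}"
    proof (rule ccontr)
      assume "?P f \<inter> ?P g \<noteq> {}"
      then obtain \<sigma> where s: "\<sigma> \<in> ?P f" "\<sigma> \<in> ?P g" by auto
      have "suc \<sigma> = f" "suc \<sigma> = g" by (rule sucf[OF fg(1) s(1)], rule sucf[OF fg(2) s(2)])
      then show False using fg(3) by simp
    qed
  qed
qed

definition trees :: "(('b \<Rightarrow> 'e) \<Rightarrow> bool) \<Rightarrow> 'e set set" where
  "trees Q = {T. \<exists>\<sigma>\<in>Sel. T = \<sigma> ` A \<and> Q \<sigma>}"

lemma trees_has_sum:
  assumes "((\<lambda>\<sigma>. \<Prod>x\<in>A. cond N (\<sigma> x)) has_sum s) {\<sigma>\<in>Sel. Q \<sigma>}"
  shows "(tree_weight N has_sum s) (trees Q)"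
proof -
  have i: "inj_on (\<lambda>\<sigma>. \<sigma> ` A) {\<sigma>\<in>Sel. Q \<sigma>}" using Sel_image_inj by (rule inj_on_subset) auto
  have t: "trees Q = (\<lambda>\<sigma>. \<sigma> ` A) ` {\<sigma>\<in>Sel. Q \<sigma>}" unfolding trees_def by auto
  have "tree_weight N (\<sigma> ` A) = (\<Prod>x\<in>A. cond N (\<sigma> x))" if "\<sigma> \<in> Sel" for \<sigma>
    unfolding tree_weight_def using prod.reindex[OF Sel_inj[OF that], of "cond N"] by simp
  then have "((tree_weight N \<circ> (\<lambda>\<sigma>. \<sigma> ` A)) has_sum s) {\<sigma>\<in>Sel. Q \<sigma>}"
    using assms by (subst has_sum_cong[of _ _ "\<lambda>\<sigma>. \<Prod>x\<in>A. cond N (\<sigma> x)"]) auto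
  then show ?thesis unfolding t using has_sum_reindex[OF i] by blast
qed

lemma wt_eq: "(\<Prod>x\<in>A. infsum (cond N) (Eb x (f x))) = FN.wt A f"
  unfolding FN.wt_def Cn_def ..

lemma trees_True: "trees (\<lambda>_. True) = spanning_trees N" unfolding spanning_trees_eq trees_def by auto

lemma sel_total: "((\<lambda>\<sigma>. \<Prod>x\<in>A. cond N (\<sigma> x)) has_sum FN.Z A) {\<sigma>\<in>Sel. True}"
proof -
  have "{\<sigma>\<in>Sel. True} = {\<sigma>\<in>Sel. suc \<sigma> \<in> FN.forests A \<and> (\<forall>x\<in>A. \<sigma> x \<in> Eb x (suc \<sigma> x))}"
    using Sel_forest SelD(1,2) by (auto simp: Eb_def)
  then show ?thesis using sel_has_sum[OF subset_refl, of Eb] unfolding wt_eq FN.Z_def by simp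
qed

lemma total: "(tree_weight N has_sum FN.Z A) (spanning_trees N)"
proof -
  show ?thesis using trees_has_sum[OF sel_total] unfolding trees_True .
qed

lemma tree_weight_nonneg: "T \<in> spanning_trees N \<Longrightarrow> tree_weight N T \<ge> 0"
  unfolding tree_weight_def spanning_trees_def by (intro prod_nonneg) (auto intro: less_imp_le[OF N_pos])

lemma ZA_pos: "FN.Z A > 0" by (rule FN.Z_pos) simp

lemma UST_trees:
  assumes h: "((\<lambda>\<sigma>. \<Prod>x\<in>A. cond N (\<sigma> x)) has_sum s) {\<sigma>\<in>Sel. Q \<sigma>}"
  shows "emeasure (UST N) (trees Q) = ennreal (s / FN.Z A)"
proof -
  have sub: "trees Q \<subseteq> spanning_trees N" unfolding spanning_trees_eq trees_def by auto
  have Z: "infsum (tree_weight N) (spanning_trees N) = FN.Z A" using total by (rule infsumI)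
  have hs: "((\<lambda>T. tree_weight N T / FN.Z A) has_sum s / FN.Z A) (trees Q)"
    unfolding divide_inverse by (rule has_sum_cmult_left[OF trees_has_sum[OF h]])
  have "emeasure (UST N) (trees Q) = (\<integral>\<^sup>+T. ennreal (tree_weight N T / FN.Z A) * indicator (trees Q) T \<partial>count_space (spanning_trees N))"
    unfolding UST_def Z point_measure_def using sub by (subst emeasure_density) auto
  also have "\<dots> = (\<integral>\<^sup>+T. ennreal (tree_weight N T / FN.Z A) \<partial>count_space (trees Q))"
    using sub by (subst nn_integral_count_space_indicator[of "trees Q"])
      (auto simp: nn_integral_count_space_indicator indicator_def intro!: nn_integral_cong)
  also have "\<dots> = ennreal (s / FN.Z A)"
    by (rule nn_integral_has_sum[OF hs]) (use sub tree_weight_nonneg ZA_pos in \<open>auto intro!: divide_nonneg_nonneg\<close>)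
  finally show ?thesis .
qed

lemma space_UST: "space (UST N) = spanning_trees N" unfolding UST_def by (simp add: space_point_measure)

lemma sets_UST: "sets (UST N) = Pow (spanning_trees N)" unfolding UST_def by (simp add: sets_point_measure)

lemma prob_space_UST: "prob_space (UST N)"
proof
  from UST_trees[OF sel_total] show "emeasure (UST N) (space (UST N)) = 1"
    unfolding space_UST trees_True using ZA_pos by simp
qed

lemma UST_pr: "measure (UST N) (trees (\<lambda>\<sigma>. Q (suc \<sigma>))) = FN.pr A Q"
proof -
  let ?F = "{f \<in> FN.forests A. Q f}"
  have "{\<sigma>\<in>Sel. Q (suc \<sigma>)} = {\<sigma>\<in>Sel. suc \<sigma> \<in> ?F \<and> (\<forall>x\<in>A. \<sigma> x \<in> Eb x (suc \<sigma> x))}"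
    using Sel_forest SelD(1,2) by (auto simp: Eb_def)
  then have h: "((\<lambda>\<sigma>. \<Prod>x\<in>A. cond N (\<sigma> x)) has_sum (\<Sum>f\<in>?F. FN.wt A f)) {\<sigma>\<in>Sel. Q (suc \<sigma>)}"
    using sel_has_sum[of ?F Eb] unfolding wt_eq by simp
  have "(\<Sum>f\<in>?F. FN.wt A f) = (\<Sum>f\<in>FN.forests A. FN.wt A f * of_bool (Q f))"
    by (rule sum.mono_neutral_cong_left) (use FN.finite_forests[of A] fin_verts in auto)
  then have "(\<Sum>f\<in>?F. FN.wt A f) / FN.Z A = FN.pr A Q" unfolding FN.pr_def FN.ex_def by simp
  moreover have "FN.pr A Q \<ge> 0" by (rule FN.pr_nonneg)
  ultimately show ?thesis unfolding measure_def UST_trees[OF h] by simp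
qed

text \<open>Given that \<open>x0\<close> leads to \<open>y0\<close>, its edge is chosen among the
  parallel edges with probability proportional to conductance; the probability of the condition is
  bounded by one.\<close>

lemma UST_edge:
  assumes x0: "x0 \<in> A" and E0: "E0 \<subseteq> Eb x0 y0"
  shows "measure (UST N) (trees (\<lambda>\<sigma>. suc \<sigma> x0 = y0 \<and> \<sigma> x0 \<in> E0)) \<le> infsum (cond N) E0 / Cn x0 y0"
proof -
  let ?F = "{f \<in> FN.forests A. f x0 = y0}"
  define E' where "E' x y = (if x = x0 \<and> y = y0 then E0 else Eb x y)" for x y
  have E': "E' x y \<subseteq> Eb x y" for x y using E0 by (simp add: E'_def)
  let ?I = "infsum (cond N) E0"
  let ?s = "\<Sum>f\<in>?F. \<Prod>x\<in>A. infsum (cond N) (E' x (f x))"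
  have "{\<sigma>\<in>Sel. suc \<sigma> x0 = y0 \<and> \<sigma> x0 \<in> E0} = {\<sigma>\<in>Sel. suc \<sigma> \<in> ?F \<and> (\<forall>x\<in>A. \<sigma> x \<in> E' x (suc \<sigma> x))}"
  proof (intro set_eqI iffI)
    fix \<sigma> assume "\<sigma> \<in> {\<sigma>\<in>Sel. suc \<sigma> x0 = y0 \<and> \<sigma> x0 \<in> E0}"
    then have s: "\<sigma> \<in> Sel" "suc \<sigma> x0 = y0" "\<sigma> x0 \<in> E0" by auto
    have "\<sigma> x \<in> E' x (suc \<sigma> x)" if "x \<in> A" for x
      using SelD(1,2)[OF s(1) that] s by (auto simp: E'_def Eb_def)
    then show "\<sigma> \<in> {\<sigma>\<in>Sel. suc \<sigma> \<in> ?F \<and> (\<forall>x\<in>A. \<sigma> x \<in> E' x (suc \<sigma> x))}"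
      using s Sel_forest[OF s(1)] by simp
  next
    fix \<sigma> assume "\<sigma> \<in> {\<sigma>\<in>Sel. suc \<sigma> \<in> ?F \<and> (\<forall>x\<in>A. \<sigma> x \<in> E' x (suc \<sigma> x))}"
    then have s: "\<sigma> \<in> Sel" "suc \<sigma> x0 = y0" "\<sigma> x0 \<in> E' x0 (suc \<sigma> x0)" using x0 by auto
    then show "\<sigma> \<in> {\<sigma>\<in>Sel. suc \<sigma> x0 = y0 \<and> \<sigma> x0 \<in> E0}" by (simp add: E'_def)
  qed
  then have h: "((\<lambda>\<sigma>. \<Prod>x\<in>A. cond N (\<sigma> x)) has_sum ?s) {\<sigma>\<in>Sel. suc \<sigma> x0 = y0 \<and> \<sigma> x0 \<in> E0}"
    using sel_has_sum[of ?F E', OF _ E'] by simp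
  have finA: "finite A" using fin_verts by simp
  have I0: "?I \<ge> 0" using infsum_nn[of E0] E0 Eb_sub by blast
  have each: "(\<Prod>x\<in>A. infsum (cond N) (E' x (f x))) = FN.wt A f * (?I / Cn x0 y0)" if f: "f \<in> ?F" for f
  proof -
    have "(\<Prod>x\<in>A. infsum (cond N) (E' x (f x))) = infsum (cond N) (E' x0 (f x0)) * (\<Prod>x\<in>A-{x0}. infsum (cond N) (E' x (f x)))"
      using prod.remove[OF finA x0] by blast
    also have "\<dots> = ?I * (\<Prod>x\<in>A-{x0}. Cn x (f x))"
      using f by (intro arg_cong2[where f="(*)"] prod.cong) (auto simp: E'_def Cn_def)
    also have "\<dots> = FN.wt A f * (?I / Cn x0 y0)"
    proof (cases "Cn x0 y0 = 0")
      case True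
      then have "Eb x0 y0 = {}" using infsum_pos[OF Eb_sub[of x0 y0]] unfolding Cn_def by fastforce
      then show ?thesis using E0 by simp
    next
      case False
      have "FN.wt A f = Cn x0 y0 * (\<Prod>x\<in>A-{x0}. Cn x (f x))"
        unfolding FN.wt_def using prod.remove[OF finA x0, of "\<lambda>x. Cn x (f x)"] f by simp
      then show ?thesis using False by simp
    qed
    finally show ?thesis .
  qed
  have "?s = (\<Sum>f\<in>?F. FN.wt A f) * (?I / Cn x0 y0)"
    unfolding sum_distrib_right by (rule sum.cong[OF refl each])
  also have "\<dots> \<le> FN.Z A * (?I / Cn x0 y0)" unfolding FN.Z_def
  proof (rule mult_right_mono)
    show "(\<Sum>f\<in>?F. FN.wt A f) \<le> (\<Sum>f\<in>FN.forests A. FN.wt A f)"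
      by (rule sum_mono2) (use FN.finite_forests[of A] fin_verts FN.wt_nonneg in auto)
    show "0 \<le> ?I / Cn x0 y0" using I0 FN.C_nonneg by simp
  qed
  finally have le: "?s / FN.Z A \<le> ?I / Cn x0 y0" using ZA_pos by (simp add: pos_divide_le_eq mult.commute)
  have "?s / FN.Z A \<ge> 0" using ZA_pos has_sum_nonneg[OF h] N_pos SelD(1)
    by (intro divide_nonneg_nonneg) (auto intro!: prod_nonneg intro: less_imp_le)
  then show ?thesis unfolding measure_def UST_trees[OF h] using le by simp
qed

end

section \<open>Wired networks\<close>

lemma summable_on_finite_UN:
  fixes f :: "'a \<Rightarrow> real"
  assumes "finite I" "\<And>i. i \<in> I \<Longrightarrow> f summable_on B i"
  shows "f summable_on (\<Union>i\<in>I. B i)"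
  using assms
proof (induction I)
  case (insert i I)
  let ?X = "\<Union>j\<in>I. B j"
  have X: "f summable_on ?X" by (rule insert.IH) (rule insert.prems, simp)
  have "f summable_on B i - ?X" by (rule summable_on_subset_banach[OF insert.prems[of i]]) auto
  then have "f summable_on (B i - ?X) \<union> ?X" by (rule summable_on_Un_disjoint[OF _ X]) auto
  moreover have "(B i - ?X) \<union> ?X = (\<Union>j\<in>insert i I. B j)" by blast
  ultimately show ?case by (simp only:)
qed simp

lemma is_walk_crosses:
  "is_walk N u p v \<Longrightarrow> u \<in> S \<Longrightarrow> v \<notin> S \<Longrightarrow> \<exists>x\<in>S. \<exists>y\<in>verts N - S. \<exists>e\<in>edges N. ends N e = Upair x y"
proof (induction p arbitrary: u)
  case (Cons a p)
  obtain x e where a: "a = (x, e)" by (cases a)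
  from Cons.prems(1) a obtain w where w: "e \<in> edges N" "ends N e = Upair u w" "is_walk N w p v" by auto
  show ?case
  proof (cases "w \<in> S")
    case True then show ?thesis using Cons.IH[OF w(3)] Cons.prems(3) by simp
  next
    case False
    then show ?thesis using w Cons.prems(2) is_walk_verts[OF w(3)] by blast
  qed
qed simp

context tree_net
begin

lemma vertex_cond_eq: assumes x: "x \<in> verts N" shows "FN.vertex_cond x = vcond N x"
proof -
  have "(cond N has_sum (\<Sum>y\<in>verts N. Cn x y)) (\<Union>y\<in>verts N. Eb x y)"
    by (rule sum_has_sum[OF fin_verts]) (auto simp: Cn_def Eb_def intro!: has_sum_infsum[OF sub_sum])
  moreover have "(\<Union>y\<in>verts N. Eb x y) = incident N x"
  proof
    show "incident N x \<subseteq> (\<Union>y\<in>verts N. Eb x y)"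
    proof
      fix e assume e: "e \<in> incident N x"
      obtain a b where ab: "ends N e = Upair a b" by (cases "ends N e") auto
      then have "a \<in> verts N" "b \<in> verts N" "x = a \<or> x = b" "e \<in> edges N"
        using e N_ends[of e] by (auto simp: incident_def)
      then show "e \<in> (\<Union>y\<in>verts N. Eb x y)" using ab by (auto simp: Eb_def)
    qed
  qed (auto simp: Eb_def incident_def)
  ultimately show ?thesis unfolding FN.vertex_cond_def vcond_def by (simp add: infsumI)
qed

end

context ballistic_network
begin

definition cond_bound :: real where
  "cond_bound = (SOME M. M \<ge> 1 \<and> (\<forall>x\<in>V. inverse M \<le> vcond G x \<and> vcond G x \<le> M))"

lemma cond_bound: "cond_bound \<ge> 1" "x \<in> V \<Longrightarrow> inverse cond_bound \<le> vcond G x" "x \<in> V \<Longrightarrow> vcond G x \<le> cond_bound"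
proof -
  obtain M where M: "M > 0" "\<And>x. x \<in> V \<Longrightarrow> inverse M \<le> vcond G x \<and> vcond G x \<le> M"
    using csm unfolding controlled_stationary_measure_def by blast
  have "inverse (max M 1) \<le> vcond G x \<and> vcond G x \<le> max M 1" if "x \<in> V" for x
    using M(2)[OF that] order_trans[OF le_imp_inverse_le[of M "max M 1"], of "vcond G x"] M(1) by auto
  then have "\<exists>M. M \<ge> 1 \<and> (\<forall>x\<in>V. inverse M \<le> vcond G x \<and> vcond G x \<le> M)" by (intro exI[of _ "max M 1"]) auto
  from someI_ex[OF this] have "cond_bound \<ge> 1 \<and> (\<forall>x\<in>V. inverse cond_bound \<le> vcond G x \<and> vcond G x \<le> cond_bound)" unfolding cond_bound_def .
  then show "cond_bound \<ge> 1" "x \<in> V \<Longrightarrow> inverse cond_bound \<le> vcond G x" "x \<in> V \<Longrightarrow> vcond G x \<le> cond_bound" by blast+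
qed

text \<open>Reversing one factor turns a square of \<open>U\<close> into a product bounded by
  \<open>U_bubble\<close>, at the cost of the square of \<open>cond_bound\<close>.\<close>

definition K1 :: real where "K1 = cond_bound\<^sup>2 * bubble_sum"

lemma K1_nonneg: "K1 \<ge> 0" unfolding K1_def using bubble_sum_nonneg by simp

end

locale wired_network = ballistic_network G for G :: "('v, 'e) network" +
  fixes W :: "'v set"
  assumes finW: "finite W" and WV: "W \<subseteq> V"
begin

abbreviation "N \<equiv> wire G W"
abbreviation "\<phi> \<equiv> (\<lambda>x. if x \<in> W then Some x else None)"

lemma wire_simps: "verts N = insert None (Some ` W)" "ends N e = map_uprod \<phi> (ends G e)" "cond N = cond G"
    "edges N = {e \<in> E. map_uprod \<phi> (ends G e) \<noteq> Upair None None}"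
  unfolding wire_def by (simp_all add: Let_def)

lemma wire_edge_iff: "ends N e = Upair (Some x) (Some y) \<longleftrightarrow> x \<in> W \<and> y \<in> W \<and> ends G e = Upair x y"
  unfolding wire_simps by (cases "ends G e") auto

lemma wire_incident: assumes x: "x \<in> W" shows "incident N (Some x) = incident G x"
proof -
  have "e \<in> incident N (Some x) \<longleftrightarrow> e \<in> incident G x" for e
    using x unfolding incident_def wire_simps by (cases "ends G e") auto
  then show ?thesis by blast
qed

lemma wire_edges_sub: "edges N \<subseteq> (\<Union>x\<in>W. incident G x)"
proof
  fix e assume e: "e \<in> edges N"
  obtain a b where "ends G e = Upair a b" by (cases "ends G e") auto
  then show "e \<in> (\<Union>x\<in>W. incident G x)" using e unfolding wire_simps by (auto simp: incident_def split: if_splits)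
qed

lemma tree_net_wire: "tree_net N None"
proof
  show "finite (verts N)" "None \<in> verts N" unfolding wire_simps using finW by simp_all
  show "set_uprod (ends N e) \<subseteq> verts N" for e unfolding wire_simps by (auto simp: uprod.set_map)
  show "cond N e > 0" if "e \<in> edges N" for e using that unfolding wire_simps by (simp add: cond_pos)
  have "cond G summable_on (\<Union>x\<in>W. incident G x)"
    by (rule summable_on_finite_UN[OF finW]) (use WV vcond_finite in auto)
  then show "cond N summable_on edges N" unfolding wire_simps(3) using wire_edges_sub by (rule summable_on_subset_banach)
  fix S assume S: "S \<subseteq> verts N - {None}" "S \<noteq> {}"
  let ?S = "{x. Some x \<in> S}"
  have SW: "?S \<subseteq> W" using S unfolding wire_simps by auto
  obtain t0 where t0: "t0 \<in> S" using S(2) by auto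
  then have "t0 \<noteq> None" using subsetD[OF S(1)] by simp
  then obtain s where "t0 = Some s" by (cases t0) simp_all
  then have s: "Some s \<in> S" using t0 by simp
  \<comment> \<open>The network is infinite, so there is a vertex outside the finite set, and a walk
    to it crosses an edge out of \<open>S\<close>, possibly to the wired vertex.\<close>
  have "\<not> V \<subseteq> ?S"
  proof
    assume "V \<subseteq> ?S"
    then have "finite V" by (rule finite_subset[OF _ finite_subset[OF SW finW]])
    then show False using infinite_V by simp
  qed
  then obtain t where t: "t \<in> V" "t \<notin> ?S" by blast
  have "s \<in> V" using s SW WV by auto
  then obtain p where "is_walk G s p t" using connected t unfolding connected_net_def by blast
  from is_walk_crosses[OF this, of ?S] s t obtain x y e where
    xy: "Some x \<in> S" "y \<in> V" "Some y \<notin> S" "e \<in> E" "ends G e = Upair x y" by auto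
  then have "x \<in> W" using SW by auto
  then have "ends N e = Upair (Some x) (\<phi> y)" "e \<in> edges N" "\<phi> y \<in> verts N - S"
    using xy S unfolding wire_simps by auto
  then show "\<exists>x\<in>S. \<exists>y\<in>verts N - S. \<exists>e\<in>edges N. ends N e = Upair x y" using xy(1) by blast
qed

sublocale TN: tree_net N None by (rule tree_net_wire)

lemma TN_Eb: "x \<in> W \<Longrightarrow> y \<in> W \<Longrightarrow> TN.Eb (Some x) (Some y) = Eb x y"
  unfolding TN.Eb_def Eb_def wire_edge_iff by (auto simp: wire_simps)

lemma TN_Cn: "x \<in> W \<Longrightarrow> y \<in> W \<Longrightarrow> TN.Cn (Some x) (Some y) = pair_cond x y"
  unfolding TN.Cn_def pair_cond_def TN_Eb wire_simps ..

lemma TN_cc: assumes "x \<in> W" shows "TN.FN.vertex_cond (Some x) = vcond G x"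
proof -
  have "TN.FN.vertex_cond (Some x) = vcond N (Some x)" by (rule TN.vertex_cond_eq) (simp add: wire_simps assms)
  then show ?thesis unfolding vcond_def wire_incident[OF assms] wire_simps .
qed

lemma A_eq: "TN.A = Some ` W" unfolding wire_simps by auto

lemma sum_verts: "(\<Sum>z\<in>verts N. h z) = h None + (\<Sum>z\<in>W. h (Some z))"
  unfolding wire_simps using finW by (simp add: sum.reindex)

text \<open>Zero at the wired vertex, where the walk is killed, so that \<open>U_super\<close>
  carries over with the sum over \<open>W\<close> only.\<close>

definition U' :: "'v option \<Rightarrow> 'v option \<Rightarrow> real" where
  "U' s t = (if s \<in> Some ` V \<and> t \<in> Some ` V then U (the s) (the t) else 0)"

definition d' :: "'v option \<Rightarrow> 'v option \<Rightarrow> nat" where "d' s t = gdist G (the s) (the t)"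

lemma U'_Some: "x \<in> V \<Longrightarrow> y \<in> V \<Longrightarrow> U' (Some x) (Some y) = U x y" unfolding U'_def by simp

lemma U_rev_le: assumes xy: "x \<in> V" "y \<in> V" shows "U x y \<le> cond_bound\<^sup>2 * U y x"
proof -
  have "inverse cond_bound * U x y \<le> vcond G x * U x y" by (rule mult_right_mono[OF cond_bound(2)[OF xy(1)] U_nonneg[OF xy]])
  also have "\<dots> = vcond G y * U y x" by (rule U_rev[OF xy])
  also have "\<dots> \<le> cond_bound * U y x" by (rule mult_right_mono[OF cond_bound(3)[OF xy(2)] U_nonneg[OF xy(2,1)]])
  finally have "cond_bound * (inverse cond_bound * U x y) \<le> cond_bound * (cond_bound * U y x)" using cond_bound(1) by (intro mult_left_mono) auto
  moreover have "cond_bound * (inverse cond_bound * U x y) = U x y" using cond_bound(1) by simp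
  ultimately show ?thesis by (simp add: power2_eq_square)
qed

lemma bounded_wire: "bounded_net (verts N) TN.Cn None U' d' cond_bound C0 K1"
proof unfold_locales
  show "cond_bound \<ge> 1" "C0 \<ge> 0" "K1 \<ge> 0" using cond_bound(1) C0(1) K1_nonneg by auto
  show "U' a b \<ge> 0" for a b unfolding U'_def using U_nonneg by auto
  show "U' None b = 0" for b unfolding U'_def by auto
  fix a assume "a \<in> verts N - {None}"
  then obtain x where a: "a = Some x" and x: "x \<in> W" "x \<in> V" unfolding A_eq using WV by auto
  show "inverse cond_bound \<le> TN.FN.vertex_cond a" "TN.FN.vertex_cond a \<le> cond_bound" unfolding a TN_cc[OF x(1)] using cond_bound(2,3) x by auto
  show "d' a a = 0" unfolding a d'_def using gdist_refl x by simp
  show "(\<Sum>w\<in>{w\<in>verts N-{None}. d' a w \<le> r}. U' a w) \<le> C0 * real r" if r: "r \<ge> 1" for r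
  proof -
    have "{w\<in>verts N-{None}. d' a w \<le> r} = Some ` {w\<in>W. gdist G x w \<le> r}" unfolding A_eq a d'_def by auto
    then have "(\<Sum>w\<in>{w\<in>verts N-{None}. d' a w \<le> r}. U' a w) = (\<Sum>w\<in>{w\<in>W. gdist G x w \<le> r}. U x w)"
      unfolding a using WV x by (simp add: sum.reindex) (intro sum.cong, auto simp: U'_def)
    also have "\<dots> \<le> C0 * real r" by (rule U_ball[OF x(2) r]) (use finW WV in auto)
    finally show ?thesis .
  qed
  show "(\<Sum>y\<in>verts N-{None}. (U' a y)\<^sup>2) \<le> K1"
  proof -
    have "(\<Sum>y\<in>verts N-{None}. (U' a y)\<^sup>2) = (\<Sum>y\<in>W. (U x y)\<^sup>2)"
      unfolding A_eq a using WV x by (simp add: sum.reindex) (intro sum.cong, auto simp: U'_def)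
    also have "\<dots> \<le> (\<Sum>y\<in>W. cond_bound\<^sup>2 * (U x y * U y x))"
    proof (rule sum_mono)
      fix y assume "y \<in> W"
      then have y: "y \<in> V" using WV by auto
      have "U x y * U x y \<le> U x y * (cond_bound\<^sup>2 * U y x)" by (rule mult_left_mono[OF U_rev_le[OF x(2) y] U_nonneg[OF x(2) y]])
      then show "(U x y)\<^sup>2 \<le> cond_bound\<^sup>2 * (U x y * U y x)" by (simp add: power2_eq_square mult_ac)
    qed
    also have "\<dots> \<le> K1" unfolding K1_def sum_distrib_left[symmetric]
      by (rule mult_left_mono[OF U_bubble[OF x(2) finW WV]]) simp
    finally show ?thesis .
  qed
  fix b assume "b \<in> verts N - {None}"
  then obtain y where b: "b = Some y" and y: "y \<in> W" "y \<in> V" unfolding A_eq using WV by auto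
  show "d' a b = d' b a" unfolding a b d'_def using gdist_sym x y by simp
  show "U' a b \<le> cond_bound\<^sup>2 * U' b a" unfolding a b using x y by (simp add: U'_Some U_rev_le)
  show "d' a b \<le> 1" if "TN.Cn a b > 0"
  proof -
    have "pair_cond x y > 0" using that TN_Cn[OF x(1) y(1)] unfolding a b by simp
    then show ?thesis unfolding a b d'_def using gdist_edge pair_cond_pos_iff by simp
  qed
  show "(\<Sum>z\<in>verts N. TN.Cn a z * U' z b) + TN.FN.vertex_cond a * of_bool (a = b) \<le> TN.FN.vertex_cond a * U' a b"
  proof -
    have c: "vcond G x > 0" using vcond_pos x by simp
    have "(\<Sum>z\<in>verts N. TN.Cn a z * U' z b) = (\<Sum>z\<in>W. TN.Cn (Some x) (Some z) * U' (Some z) (Some y))"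
      unfolding sum_verts a b by (simp add: U'_def)
    also have "\<dots> = (\<Sum>z\<in>W. vcond G x * (trans_pr x z * U z y))"
      by (rule sum.cong) (use x y WV c in \<open>auto simp: TN_Cn U'_Some trans_pr_eq subset_iff\<close>)
    also have "\<dots> = vcond G x * (\<Sum>z\<in>W. trans_pr x z * U z y)" by (simp add: sum_distrib_left)
    finally have e: "(\<Sum>z\<in>verts N. TN.Cn a z * U' z b) = vcond G x * (\<Sum>z\<in>W. trans_pr x z * U z y)" .
    have "vcond G x * ((\<Sum>z\<in>W. trans_pr x z * U z y) + of_bool (x = y)) \<le> vcond G x * U x y"
      by (rule mult_left_mono[OF U_super[OF x(2) y(2) finW WV]]) (use c in simp)
    then show ?thesis unfolding e unfolding a b using x y by (simp add: TN_cc U'_Some distrib_left)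
  qed
  fix z assume "z \<in> verts N - {None}"
  then obtain w where z: "z = Some w" and w: "w \<in> W" "w \<in> V" unfolding A_eq using WV by auto
  show "d' a z \<le> d' a b + d' b z" unfolding a b z d'_def using gdist_triangle x y w by simp
qed

sublocale BN: bounded_net "verts N" TN.Cn None U' d' cond_bound C0 K1 by (rule bounded_wire)

lemma step_pr_eq: assumes "x \<in> W" "y \<in> W" shows "TN.FN.step_pr (Some x) (Some y) = trans_pr x y"
  unfolding TN.FN.step_pr_def trans_pr_eq by (simp add: TN_Cn[OF assms] TN_cc[OF assms(1)])

lemma step_pr_None: assumes x: "x \<in> W" shows "TN.FN.step_pr (Some x) None = 1 - (\<Sum>y\<in>W. trans_pr x y)"
proof -
  have c: "TN.FN.vertex_cond (Some x) > 0" using TN_cc[OF x] vcond_pos x WV by auto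
  have "TN.FN.vertex_cond (Some x) = TN.Cn (Some x) None + (\<Sum>y\<in>W. TN.Cn (Some x) (Some y))"
    unfolding TN.FN.vertex_cond_def sum_verts ..
  then have "1 = (TN.Cn (Some x) None + (\<Sum>y\<in>W. TN.Cn (Some x) (Some y))) / TN.FN.vertex_cond (Some x)" using c by simp
  also have "\<dots> = TN.FN.step_pr (Some x) None + (\<Sum>y\<in>W. TN.FN.step_pr (Some x) (Some y))"
    unfolding TN.FN.step_pr_def by (simp add: add_divide_distrib sum_divide_distrib)
  also have "(\<Sum>y\<in>W. TN.FN.step_pr (Some x) (Some y)) = (\<Sum>y\<in>W. trans_pr x y)" using x by (intro sum.cong) (auto simp: step_pr_eq)
  finally show ?thesis by simp
qed

lemma walk_pr_eq: "x \<in> W \<Longrightarrow> set l \<subseteq> W \<Longrightarrow> TN.FN.walk_pr (Some x) (map Some l) = list_pr x l"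
  by (induction l arbitrary: x) (auto simp: step_pr_eq)

text \<open>Avoiding \<open>S\<close> forever is less likely than reaching the wired vertex before
  \<open>S\<close>. By \<open>escape_pr_step\<close>, the function \<open>escape_pr S\<close>,
  extended by one at \<open>None\<close> and by zero on \<open>S\<close>, is subharmonic off
  \<open>S\<close>, and the maximum principle compares it with \<open>hit\<close>.\<close>

lemma escape_pr_le_hit:
  assumes y: "y \<in> W" "y \<notin> S"
  shows "escape_pr S y \<le> TN.FN.hit (TN.A - Some ` S) None (Some y)"
proof -
  let ?K = "TN.A - Some ` S"
  define h where "h z = TN.FN.hit ?K None z" for z
  define D where "D z = (case z of None \<Rightarrow> 1 | Some y \<Rightarrow> if y \<in> S then 0 else escape_pr S y) - h z" for z
  have KA: "?K \<subseteq> verts N - {None}" by auto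
  have h0: "h z \<ge> 0" for z unfolding h_def by (rule TN.FN.hit_nonneg)
  have "D (Some y) \<le> 0"
  proof (rule TN.FN.max_principle[OF KA, where m=0 and D=D])
    show "Some y \<in> verts N" using y by (simp add: wire_simps)
    fix z assume z: "z \<in> verts N - ?K"
    show "D z \<le> 0"
    proof (cases z)
      case None
      have "h None = 1" unfolding h_def by (subst TN.FN.hit_boundary[OF KA]) auto
      then show ?thesis unfolding None D_def by simp
    next
      case (Some w)
      then have "w \<in> S" using z by auto
      then show ?thesis unfolding Some D_def using h0[of "Some w"] by simp
    qed
  next
    fix z assume z: "z \<in> ?K"
    then obtain x where x: "z = Some x" "x \<in> W" "x \<notin> S" "x \<in> V" unfolding A_eq using WV by auto
    have c: "vcond G x > 0" using vcond_pos x by simp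
    have hz: "TN.FN.vertex_cond z * h z = (\<Sum>w\<in>verts N. TN.Cn z w * h w)"
      unfolding h_def by (rule TN.FN.hit_harmonic) (use z in auto)
    have cn: "TN.Cn z None = vcond G x * (1 - (\<Sum>y\<in>W. trans_pr x y))"
      using step_pr_None[OF x(2)] c unfolding TN.FN.step_pr_def x(1) TN_cc[OF x(2)] by (simp add: field_simps)
    have "vcond G x * escape_pr S x \<le> vcond G x * ((\<Sum>y\<in>W - S. trans_pr x y * escape_pr S y) + (1 - (\<Sum>y\<in>W. trans_pr x y)))"
      by (rule mult_left_mono[OF escape_pr_step[OF x(4) finW WV]]) (use c in simp)
    also have "\<dots> = (\<Sum>y\<in>W. TN.Cn z (Some y) * (if y \<in> S then 0 else escape_pr S y)) + TN.Cn z None"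
    proof -
      have "(\<Sum>y\<in>W. TN.Cn z (Some y) * (if y \<in> S then 0 else escape_pr S y)) = (\<Sum>y\<in>W - S. TN.Cn z (Some y) * escape_pr S y)"
        by (rule sum.mono_neutral_cong_right) (use finW in auto)
      also have "\<dots> = (\<Sum>y\<in>W - S. vcond G x * (trans_pr x y * escape_pr S y))"
        by (rule sum.cong) (use x c in \<open>auto simp: TN_Cn trans_pr_eq\<close>)
      finally show ?thesis unfolding cn by (simp add: sum_distrib_left distrib_left)
    qed
    also have "\<dots> = (\<Sum>w\<in>verts N. TN.Cn z w * (D w + h w))"
      unfolding sum_verts D_def by simp
    also have "\<dots> = (\<Sum>w\<in>verts N. TN.Cn z w * D w) + TN.FN.vertex_cond z * h z"
      unfolding hz by (simp add: distrib_left sum.distrib)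
    finally show "TN.FN.vertex_cond z * D z \<le> (\<Sum>w\<in>verts N. TN.Cn z w * D w)"
      unfolding D_def using x by (simp add: TN_cc algebra_simps)
  qed simp
  then show ?thesis unfolding D_def h_def using y by simp
qed

text \<open>The first step is split off as in \<open>esc\<close>, and a step out of \<open>W\<close>
  counts as an escape.\<close>

lemma esc_ge:
  assumes v: "v \<in> W" and S: "set l \<subseteq> W"
  shows "measure (random_walk G v) (avoid (insert v (set l)) \<inter> space (random_walk G v)) \<le> BN.esc (Some v) (set (map Some l))"
proof -
  let ?S = "insert v (set l)"
  have vV: "v \<in> V" using v WV by auto
  let ?K = "verts N - {None} - {Some v} - set (map Some l)"
  have K: "?K = TN.A - Some ` ?S" by auto
  have KA: "?K \<subseteq> verts N - {None}" by auto
  have "measure (random_walk G v) (avoid ?S \<inter> space (random_walk G v)) \<le> escape_pr ?S v" by (rule avoid_le_es[OF vV])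
  also have "\<dots> \<le> (\<Sum>y\<in>W - ?S. trans_pr v y * escape_pr ?S y) + (1 - (\<Sum>y\<in>W. trans_pr v y))" by (rule escape_pr_step[OF vV finW WV])
  also have "(\<Sum>y\<in>W - ?S. trans_pr v y * escape_pr ?S y)
      \<le> (\<Sum>y\<in>W - ?S. TN.FN.step_pr (Some v) (Some y) * (if Some y \<in> set (map Some l) then 0 else TN.FN.hit ?K None (Some y)))"
  proof (rule sum_mono)
    fix y assume y: "y \<in> W - ?S"
    have "trans_pr v y * escape_pr ?S y \<le> trans_pr v y * TN.FN.hit ?K None (Some y)"
      unfolding K by (rule mult_left_mono[OF escape_pr_le_hit trans_pr_nonneg[OF vV]]) (use y in auto)
    then show "trans_pr v y * escape_pr ?S y \<le> TN.FN.step_pr (Some v) (Some y) * (if Some y \<in> set (map Some l) then 0 else TN.FN.hit ?K None (Some y))"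
      using y v by (auto simp: step_pr_eq)
  qed
  also have "\<dots> \<le> (\<Sum>y\<in>W. TN.FN.step_pr (Some v) (Some y) * (if Some y \<in> set (map Some l) then 0 else TN.FN.hit ?K None (Some y)))"
    by (rule sum_mono2) (use finW in \<open>auto intro!: mult_nonneg_nonneg TN.FN.step_pr_nonneg TN.FN.hit_nonneg\<close>)
  also have "1 - (\<Sum>y\<in>W. trans_pr v y) = TN.FN.step_pr (Some v) None * TN.FN.hit ?K None None"
    unfolding step_pr_None[OF v] by (subst TN.FN.hit_boundary[OF KA]) auto
  finally show ?thesis unfolding BN.esc_def sum_verts by simp
qed

lemma upper_UST:
  assumes v: "v \<in> W" and r: "r \<ge> 1"
  shows "measure (UST N) (TN.trees (\<lambda>\<sigma>. \<exists>u\<in>W. Some v \<in> orb (TN.suc \<sigma>) (Some u) \<and> r \<le> gdist G u v)) \<le> 3 * BN.Dc / real r"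
proof -
  have "TN.FN.pr TN.A (\<lambda>f. \<exists>u\<in>TN.A. Some v \<in> orb f u \<and> r \<le> d' u (Some v)) \<le> 3 * BN.Dc / real r"
    by (rule BN.upper_past) (use v r A_eq in auto)
  then show ?thesis unfolding TN.UST_pr[symmetric] unfolding A_eq d'_def by simp
qed

lemma lower_UST:
  assumes v: "v \<in> W" and D: "D \<subseteq> W" and R: "R \<ge> 1"
    and m: "0 \<le> m" "m \<le> (\<Sum>l\<in>apath v R D k. list_pr v l * measure (random_walk G v) (avoid (insert v (set l)) \<inter> space (random_walk G v)))"
  defines "D' \<equiv> {x\<in>D. x \<noteq> v \<and> gdist G v x \<le> 2 * R}"
  shows "m\<^sup>2 / (4 * cond_bound ^ 10 * C0 ^ 3 * real (2 * R) ^ 3)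
    \<le> measure (UST N) (TN.trees (\<lambda>\<sigma>. \<exists>w\<in>{x\<in>D'. gdist G v x \<ge> R}. BN.arm (Some v) (Some ` D') (Some w) (TN.suc \<sigma>)))"
proof -
  let ?An = "{x\<in>D'. gdist G v x \<ge> R}"
  let ?L = "{l. l \<noteq> [] \<and> set l \<subseteq> Some ` D' \<and> last l \<in> Some ` ?An \<and> length l \<le> k}"
  have D'W: "D' \<subseteq> W" using D unfolding D'_def by auto
  have finD': "finite D'" using D'W finW finite_subset by blast
  have L: "map Some ` apath v R D k \<subseteq> ?L"
  proof
    fix l' assume "l' \<in> map Some ` apath v R D k"
    then obtain l where l: "l' = map Some l" "l \<in> apath v R D k" by auto
    then have "l \<noteq> []" "set l \<subseteq> D'" "gdist G v (last l) \<ge> R" "length l \<le> k" unfolding apath_def D'_def by auto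
    moreover from this have "last l \<in> D'" by auto
    ultimately show "l' \<in> ?L" unfolding l by (auto simp: last_map)
  qed
  have finL: "finite ?L"
    by (rule finite_subset[OF _ finite_lists_length_le[of "Some ` D'" k]]) (use finD' in auto)
  have "m \<le> (\<Sum>l\<in>apath v R D k. TN.FN.walk_pr (Some v) (map Some l) * BN.esc (Some v) (set (map Some l)))"
  proof (rule order_trans[OF m(2)], rule sum_mono)
    fix l assume "l \<in> apath v R D k"
    then have l: "set l \<subseteq> W" using D unfolding apath_def by auto
    have "list_pr v l \<ge> 0" using walk_pr_eq[OF v l] TN.FN.walk_pr_nonneg[of "Some v" "map Some l"] by simp
    then show "list_pr v l * measure (random_walk G v) (avoid (insert v (set l)) \<inter> space (random_walk G v))
      \<le> TN.FN.walk_pr (Some v) (map Some l) * BN.esc (Some v) (set (map Some l))"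
      unfolding walk_pr_eq[OF v l] by (rule mult_left_mono[OF esc_ge[OF v l]])
  qed
  also have "\<dots> = (\<Sum>l\<in>map Some ` apath v R D k. TN.FN.walk_pr (Some v) l * BN.esc (Some v) (set l))"
    by (subst sum.reindex) (auto intro!: inj_onI simp: inj_map_eq_map)
  also have "\<dots> \<le> (\<Sum>l\<in>?L. TN.FN.walk_pr (Some v) l * BN.esc (Some v) (set l))"
    by (rule sum_mono2[OF finL L])
      (auto intro!: mult_nonneg_nonneg TN.FN.walk_pr_nonneg sum_nonneg TN.FN.step_pr_nonneg TN.FN.hit_nonneg simp: BN.esc_def)
  finally have mL: "m \<le> (\<Sum>l\<in>?L. TN.FN.walk_pr (Some v) l * BN.esc (Some v) (set l))" .
  have "m\<^sup>2 / (4 * cond_bound ^ 10 * C0 ^ 3 * real (2 * R) ^ 3) \<le> TN.FN.pr TN.A (\<lambda>f. \<exists>w\<in>Some ` ?An. BN.arm (Some v) (Some ` D') w f)"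
  proof (rule BN.lower_arm[OF _ _ _ _ m(1) mL])
    show "Some v \<in> verts N - {None}" unfolding A_eq using v by simp
    have "gdist G x v \<le> 2 * R" if "x \<in> D'" for x
    proof -
      have "x \<in> V" "v \<in> V" using that D'W v WV by auto
      then show ?thesis using that gdist_sym[of x v] unfolding D'_def by simp
    qed
    then show "Some ` D' \<subseteq> {x \<in> verts N - {None} - {Some v}. d' x (Some v) \<le> 2 * R}"
      unfolding A_eq d'_def using D'W by (auto simp: D'_def)
    show "1 \<le> 2 * R" "C0 > 0" using R C0(1) by auto
  qed auto
  then show ?thesis unfolding TN.UST_pr[symmetric] by simp
qed

end

section \<open>Passage to the limit\<close>

text \<open>Increasing events: the configuration contains one of the listed paths. For a finite list
  set they depend on finitely many oriented edges.\<close>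

definition cyl :: "('v \<times> 'e) list set \<Rightarrow> ('v \<times> 'e \<Rightarrow> bool) set" where
  "cyl P = {F. \<exists>p\<in>P. set p \<subseteq> Collect F}"

lemma space_config: "space config_space = UNIV"
  by (simp add: space_PiM PiE_UNIV_domain)

lemma cyl_sets:
  fixes P :: "('v \<times> 'e) list set"
  assumes "countable P" shows "cyl P \<in> sets config_space"
proof -
  have F: "{F :: 'v \<times> 'e \<Rightarrow> bool. F a} \<in> sets config_space" for a
  proof -
    have "(\<lambda>F. F a) -` {True} \<inter> space config_space \<in> sets (config_space :: ('v \<times> 'e \<Rightarrow> bool) measure)"
      by (rule measurable_sets[OF measurable_component_singleton]) auto
    then show ?thesis by (simp add: space_config vimage_def)
  qed
  have p: "{F :: 'v \<times> 'e \<Rightarrow> bool. set p \<subseteq> Collect F} \<in> sets config_space" for p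
  proof (induction p)
    case Nil
    show ?case using sets.top[of "config_space :: ('v \<times> 'e \<Rightarrow> bool) measure"] by (simp add: space_config)
  next
    case (Cons a p)
    have "{F :: 'v \<times> 'e \<Rightarrow> bool. set (a # p) \<subseteq> Collect F} = {F. F a} \<inter> {F. set p \<subseteq> Collect F}" by auto
    then show ?case using sets.Int[OF F[of a] Cons] by (simp only:)
  qed
  have "cyl P = (\<Union>p\<in>P. {F. set p \<subseteq> Collect F})" unfolding cyl_def by auto
  then show ?thesis using sets.countable_UN'[OF assms, of "\<lambda>p. {F. set p \<subseteq> Collect F}"] p by auto
qed

text \<open>The indicator of such an event is a polynomial in finitely many coordinates, hence
  bounded and continuous.\<close>

lemma cyl_limit:
  fixes P :: "('v \<times> 'e) list set"
  assumes P: "finite P" and w: "weak_limit \<mu> M"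
    and s: "\<And>n. sets (\<mu> n) = sets config_space" "sets M = sets config_space"
  shows "(\<lambda>n. measure (\<mu> n) (cyl P)) \<longlonglongrightarrow> measure M (cyl P)"
proof -
  let ?f = "\<lambda>F :: 'v \<times> 'e \<Rightarrow> bool. 1 - (\<Prod>p\<in>P. 1 - (\<Prod>a\<in>set p. of_bool (F a))) :: real"
  have f: "?f F = indicator (cyl P) F" for F
  proof (cases "F \<in> cyl P")
    case True
    then obtain p where p: "p \<in> P" "\<forall>a\<in>set p. F a" unfolding cyl_def by auto
    then have "1 - (\<Prod>a\<in>set p. of_bool (F a)) = (0::real)" by simp
    then have "(\<Prod>p\<in>P. 1 - (\<Prod>a\<in>set p. of_bool (F a))) = (0::real)" using p(1) P by (intro prod_zero) auto
    then show ?thesis using True by simp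
  next
    case False
    have "(\<Prod>a\<in>set p. of_bool (F a)) = (0::real)" if "p \<in> P" for p
    proof -
      have "\<not> set p \<subseteq> Collect F" using False that unfolding cyl_def by simp
      then obtain a where "a \<in> set p" "\<not> F a" by (auto simp only: subset_iff mem_Collect_eq)
      then show ?thesis by (intro prod_zero) auto
    qed
    then have "(\<Prod>p\<in>P. 1 - (\<Prod>a\<in>set p. of_bool (F a))) = (1::real)"
      by (intro prod.neutral ballI) (simp only: diff_zero)
    then show ?thesis using False by simp
  qed
  have b: "continuous_on UNIV (of_bool :: bool \<Rightarrow> real)" by (simp add: continuous_on_open_vimage open_discrete)
  have "continuous_on UNIV (\<lambda>F :: 'v \<times> 'e \<Rightarrow> bool. of_bool (F a) :: real)" for a
    by (rule continuous_on_compose2[OF b]) (auto intro: continuous_on_product_coordinates)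
  then have c: "continuous_on UNIV ?f" by (intro continuous_intros)
  have "bounded (range ?f)" unfolding f by (rule boundedI[of _ 1]) (auto simp: indicator_def)
  then have "(\<lambda>n. \<integral>F. ?f F \<partial>\<mu> n) \<longlonglongrightarrow> (\<integral>F. ?f F \<partial>M)" using w c unfolding weak_limit_def by blast
  moreover have "space N = UNIV" if "sets N = sets config_space" for N :: "('v \<times> 'e \<Rightarrow> bool) measure"
    using sets_eq_imp_space_eq[OF that] space_config by simp
  ultimately show ?thesis unfolding f using s by simp
qed

context wired_network
begin

definition orientation :: "'e set \<Rightarrow> 'v \<times> 'e \<Rightarrow> bool" where
  "orientation T = (\<lambda>(x, e). (Some x, e) \<in> orient_towards N None T)"

lemma orientation_Sel: "\<sigma> \<in> TN.Sel \<Longrightarrow> orientation (\<sigma> ` TN.A) (x, e) \<longleftrightarrow> x \<in> W \<and> e = \<sigma> (Some x)"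
  unfolding orientation_def using TN.Sel_orient[of \<sigma> "Some x" e] by (auto simp: A_eq)

lemma measure_wired:
  assumes "X \<in> sets config_space"
  shows "measure (wired_UST G W) X = measure (UST N) {T \<in> spanning_trees N. orientation T \<in> X}"
proof -
  have "orientation \<in> measurable (UST N) config_space"
    unfolding UST_def by (simp add: space_config)
  then have "measure (distr (UST N) config_space orientation) X = measure (UST N) (orientation -` X \<inter> space (UST N))"
    using assms by (rule measure_distr)
  moreover have "orientation -` X \<inter> space (UST N) = {T \<in> spanning_trees N. orientation T \<in> X}" unfolding TN.space_UST by auto
  ultimately show ?thesis unfolding wired_UST_def orientation_def by simp
qed

lemma trees_sets: "TN.trees Q \<in> sets (UST N)"
  unfolding TN.sets_UST TN.trees_def TN.spanning_trees_eq by auto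

lemma walk_orb:
  assumes s: "\<sigma> \<in> TN.Sel" and v: "v \<in> W"
  shows "is_walk G u p v \<Longrightarrow> set p \<subseteq> Collect (orientation (\<sigma> ` TN.A)) \<Longrightarrow> u \<in> W \<and> Some v \<in> orb (TN.suc \<sigma>) (Some u)"
proof (induction p arbitrary: u)
  case Nil
  then show ?case using v by simp
next
  case (Cons c p)
  obtain x e where c: "c = (x, e)" by (cases c)
  from Cons.prems(1) c obtain w where w: "x = u" "ends G e = Upair u w" "is_walk G w p v" by auto
  have ih: "w \<in> W" "Some v \<in> orb (TN.suc \<sigma>) (Some w)" using Cons.IH[OF w(3)] Cons.prems(2) by auto
  have u: "u \<in> W" "e = \<sigma> (Some u)" using Cons.prems(2) orientation_Sel[OF s, of u e] c w(1) by auto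
  have uA: "Some u \<in> TN.A" unfolding A_eq using u(1) by simp
  have "Upair (Some u) (TN.suc \<sigma> (Some u)) = Upair (Some u) (Some w)"
    using TN.SelD(2)[OF s uA] wire_edge_iff[of e u w] u ih(1) w(2) by simp
  then have "TN.suc \<sigma> (Some u) = Some w" by auto
  then show ?case using u(1) ih(2) orb_insert[of "TN.suc \<sigma>" "Some u"] by simp
qed

lemma upper_cyl:
  assumes v: "v \<in> W" and r: "r \<ge> 1" and P: "countable P" "\<And>p. p \<in> P \<Longrightarrow> \<exists>u. is_path G u p v \<and> r \<le> gdist G u v"
  shows "measure (wired_UST G W) (cyl P) \<le> 3 * BN.Dc / real r"
proof -
  interpret PS: prob_space "UST N" by (rule TN.prob_space_UST)
  have "{T \<in> spanning_trees N. orientation T \<in> cyl P} \<subseteq>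
      TN.trees (\<lambda>\<sigma>. \<exists>u\<in>W. Some v \<in> orb (TN.suc \<sigma>) (Some u) \<and> r \<le> gdist G u v)"
  proof
    fix T assume T: "T \<in> {T \<in> spanning_trees N. orientation T \<in> cyl P}"
    then obtain \<sigma> where s: "\<sigma> \<in> TN.Sel" "T = \<sigma> ` TN.A" using TN.spanning_Sel[of T] by auto
    obtain p where p: "p \<in> P" "set p \<subseteq> Collect (orientation T)" using T unfolding cyl_def by auto
    obtain u where u: "is_path G u p v" "r \<le> gdist G u v" using P(2)[OF p(1)] by auto
    have "u \<in> W \<and> Some v \<in> orb (TN.suc \<sigma>) (Some u)"
      using walk_orb[OF s(1) v, of u p] u(1) p(2) s(2) by (simp add: is_path_def)
    then show "T \<in> TN.trees (\<lambda>\<sigma>. \<exists>u\<in>W. Some v \<in> orb (TN.suc \<sigma>) (Some u) \<and> r \<le> gdist G u v)"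
      unfolding TN.trees_def using s u(2) by auto
  qed
  then show ?thesis unfolding measure_wired[OF cyl_sets[OF P(1)]]
    using PS.finite_measure_mono[OF _ trees_sets] upper_UST[OF v r] by (meson order_trans)
qed

text \<open>Induction on the height of \<open>w\<close>. The last conjunct keeps the path inside the
  orbit, which makes its vertices distinct when a further step is put in front.\<close>

lemma arm_path:
  assumes s: "\<sigma> \<in> TN.Sel" and v: "v \<in> W" and D: "D \<subseteq> W"
    and E0: "\<And>x y. x \<in> D \<Longrightarrow> y \<in> insert v D \<Longrightarrow> TN.suc \<sigma> (Some x) = Some y \<Longrightarrow> \<sigma> (Some x) \<in> E0"
  shows "Some v \<in> orb (TN.suc \<sigma>) (Some w) \<Longrightarrow> orb (TN.suc \<sigma>) (Some w) \<subseteq> Some ` D \<union> orb (TN.suc \<sigma>) (Some v) \<Longrightarrow>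
    \<exists>p. is_path G w p v \<and> set p \<subseteq> Collect (orientation (\<sigma> ` TN.A)) \<and> fst ` set p \<subseteq> D \<and> snd ` set p \<subseteq> E0
      \<and> Some ` fst ` set p \<subseteq> orb (TN.suc \<sigma>) (Some w)"
proof (induction "TN.ht \<sigma> (Some w)" arbitrary: w rule: less_induct)
  case less
  let ?o = "orb (TN.suc \<sigma>)"
  show ?case
  proof (cases "w = v")
    case True
    then show ?thesis using v WV by (intro exI[of _ "[]"]) (auto simp: is_path_def)
  next
    case False
    have in_D: "y \<in> D" if "Some y \<in> ?o (Some w)" "Some v \<in> ?o (Some y)" "y \<noteq> v" for y
    proof -
      have "Some y \<notin> ?o (Some v)"
        using TN.FN.forest_acyclic[OF TN.Sel_forest[OF s], of "Some v" "Some y"] that(2,3) by auto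
      then show ?thesis using less.prems(2) that(1) by auto
    qed
    have wD: "w \<in> D" using in_D[of w] less.prems(1) False by simp
    then have wA: "Some w \<in> TN.A" unfolding A_eq using D by auto
    let ?t = "TN.suc \<sigma> (Some w)"
    have ow: "?o (Some w) = insert (Some w) (?o ?t)" by (rule orb_insert)
    then have vt: "Some v \<in> ?o ?t" using less.prems(1) False by auto
    have "?t \<noteq> None"
    proof
      assume n: "?t = None"
      have "TN.suc \<sigma> None = None" by (simp add: TN.suc_def)
      then have "?o None = {None}" using orb_fix[of "TN.suc \<sigma>" None] by simp
      then show False using vt n by simp
    qed
    then obtain y where y: "?t = Some y" by (cases ?t) simp_all
    have yv: "y \<in> insert v D" using in_D[of y] ow vt y by auto
    have "\<exists>p. is_path G y p v \<and> set p \<subseteq> Collect (orientation (\<sigma> ` TN.A)) \<and> fst ` set p \<subseteq> D \<and> snd ` set p \<subseteq> E0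
      \<and> Some ` fst ` set p \<subseteq> ?o (Some y)"
    proof (rule less.hyps)
      show "TN.ht \<sigma> (Some y) < TN.ht \<sigma> (Some w)" using TN.ht_less[OF s wA] unfolding y .
      show "Some v \<in> ?o (Some y)" using vt unfolding y .
      have "?o (Some y) \<subseteq> ?o (Some w)" using ow y by auto
      then show "?o (Some y) \<subseteq> Some ` D \<union> ?o (Some v)" using less.prems(2) by (rule subset_trans)
    qed
    then obtain p where p: "is_path G y p v" "set p \<subseteq> Collect (orientation (\<sigma> ` TN.A))" "fst ` set p \<subseteq> D" "snd ` set p \<subseteq> E0"
      "Some ` fst ` set p \<subseteq> ?o (Some y)" by (elim exE conjE)
    have "ends N (\<sigma> (Some w)) = Upair (Some w) (Some y)" using TN.SelD(2)[OF s wA] y by simp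
    then have e: "ends G (\<sigma> (Some w)) = Upair w y" using wire_edge_iff by blast
    have eE: "\<sigma> (Some w) \<in> E" using TN.SelD(1)[OF s wA] unfolding wire_simps by simp
    have nw: "Some w \<notin> ?o (Some y)" using TN.self_not[OF s wA] y by simp
    then have "w \<notin> fst ` set p" using p(5) by auto
    then have "is_path G w ((w, \<sigma> (Some w)) # p) v"
      using p(1) e eE False wD D WV by (auto simp: is_path_def)
    moreover have "orientation (\<sigma> ` TN.A) (w, \<sigma> (Some w))" using orientation_Sel[OF s] wD D by auto
    moreover have "\<sigma> (Some w) \<in> E0" using E0[OF wD yv y] .
    moreover have "Some ` fst ` set ((w, \<sigma> (Some w)) # p) \<subseteq> ?o (Some w)"
      using p(5) unfolding ow y list.set image_insert fst_conv by (intro insert_subsetI insertI1 subset_insertI2)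
    ultimately show ?thesis using p(2-4) wD by (intro exI[of _ "(w, \<sigma> (Some w)) # p"] conjI) simp_all
  qed
qed

text \<open>Infinitely many parallel edges may join two vertices. The paths are therefore restricted to a set \<open>E0\<close>
  of edges, which will be finite, and the last sum bounds the probability lost in this way.\<close>

lemma lower_cyl:
  assumes v: "v \<in> W" and D: "D \<subseteq> W" and An: "An \<subseteq> D"
    and P: "P = {p. \<exists>u\<in>An. is_path G u p v \<and> fst ` set p \<subseteq> D \<and> snd ` set p \<subseteq> E0}" "countable P"
  shows "measure (UST N) (TN.trees (\<lambda>\<sigma>. \<exists>w\<in>An. BN.arm (Some v) (Some ` D) (Some w) (TN.suc \<sigma>)))
    \<le> measure (wired_UST G W) (cyl P) + (\<Sum>(x, y)\<in>D \<times> insert v D. infsum (cond G) (Eb x y - E0) / pair_cond x y)"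
proof -
  interpret PS: prob_space "UST N" by (rule TN.prob_space_UST)
  let ?I = "D \<times> insert v D"
  let ?B = "\<lambda>(x, y). TN.trees (\<lambda>\<sigma>. TN.suc \<sigma> (Some x) = Some y \<and> \<sigma> (Some x) \<in> Eb x y - E0)"
  let ?X = "{T \<in> spanning_trees N. orientation T \<in> cyl P}"
  let ?Y = "TN.trees (\<lambda>\<sigma>. \<exists>w\<in>An. BN.arm (Some v) (Some ` D) (Some w) (TN.suc \<sigma>))"
  have finI: "finite ?I" using D finW finite_subset[OF D] by auto
  have sub: "?Y \<subseteq> ?X \<union> (\<Union>i\<in>?I. ?B i)"
  proof
    fix T assume "T \<in> ?Y"
    then obtain \<sigma> w where s: "\<sigma> \<in> TN.Sel" "T = \<sigma> ` TN.A" and w: "w \<in> An" "BN.arm (Some v) (Some ` D) (Some w) (TN.suc \<sigma>)"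
      unfolding TN.trees_def by auto
    show "T \<in> ?X \<union> (\<Union>i\<in>?I. ?B i)"
    \<comment> \<open>Either some vertex of \<open>D\<close> uses an edge outside \<open>E0\<close>
      towards \<open>insert v D\<close>, which the error sum pays for, or the whole path of
      \<open>w\<close> is one of the listed paths.\<close>
    proof (cases "\<exists>x\<in>D. \<exists>y\<in>insert v D. TN.suc \<sigma> (Some x) = Some y \<and> \<sigma> (Some x) \<notin> E0")
      case True
      then obtain x y where xy: "x \<in> D" "y \<in> insert v D" "TN.suc \<sigma> (Some x) = Some y" "\<sigma> (Some x) \<notin> E0" by auto
      have xA: "Some x \<in> TN.A" unfolding A_eq using xy(1) D by auto
      have "ends G (\<sigma> (Some x)) = Upair x y" using TN.SelD(2)[OF s(1) xA] xy(3) wire_edge_iff[of "\<sigma> (Some x)" x y] by simp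
      moreover have "\<sigma> (Some x) \<in> E" using TN.SelD(1)[OF s(1) xA] unfolding wire_simps by simp
      ultimately have "T \<in> ?B (x, y)" unfolding TN.trees_def Eb_def using xy s by auto
      then show ?thesis using xy(1,2) by blast
    next
      case False
      have "\<exists>p. is_path G w p v \<and> set p \<subseteq> Collect (orientation (\<sigma> ` TN.A)) \<and> fst ` set p \<subseteq> D \<and> snd ` set p \<subseteq> E0
          \<and> Some ` fst ` set p \<subseteq> orb (TN.suc \<sigma>) (Some w)"
        by (rule arm_path[OF s(1) v D]) (use False w(2) in \<open>auto simp: BN.arm_def\<close>)
      then have "orientation T \<in> cyl P" unfolding cyl_def P(1) using w(1) s(2) by auto
      then show ?thesis using TN.Sel_spanning[OF s(1)] s(2) by auto
    qed
  qed
  have Xs: "?X \<in> sets (UST N)" unfolding TN.sets_UST by auto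
  have Bs: "?B i \<in> sets (UST N)" for i by (cases i) (simp add: trees_sets)
  have Us: "(\<Union>i\<in>?I. ?B i) \<in> sets (UST N)" by (rule sets.finite_UN[OF finI Bs])
  have "measure (UST N) ?Y \<le> measure (UST N) (?X \<union> (\<Union>i\<in>?I. ?B i))"
    by (rule PS.finite_measure_mono[OF sub sets.Un[OF Xs Us]])
  also have "\<dots> \<le> measure (UST N) ?X + measure (UST N) (\<Union>i\<in>?I. ?B i)"
    using measure_Un_le[OF Xs Us] .
  also have "measure (UST N) (\<Union>i\<in>?I. ?B i) \<le> (\<Sum>i\<in>?I. measure (UST N) (?B i))"
    by (rule PS.finite_measure_subadditive_finite[OF finI]) (use Bs in blast)
  also have "\<dots> \<le> (\<Sum>(x, y)\<in>?I. infsum (cond G) (Eb x y - E0) / pair_cond x y)"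
  proof (rule sum_mono)
    fix i assume "i \<in> ?I"
    then obtain x y where i: "i = (x, y)" and xy: "x \<in> D" "y \<in> insert v D" by (rule SigmaE)
    have W: "x \<in> W" "y \<in> W" using xy v D by auto
    have "measure (UST N) (?B (x, y)) \<le> infsum (cond N) (Eb x y - E0) / TN.Cn (Some x) (Some y)"
      unfolding prod.case by (rule TN.UST_edge) (use W A_eq TN_Eb[OF W] in auto)
    then show "measure (UST N) (?B i) \<le> (case i of (x, y) \<Rightarrow> infsum (cond G) (Eb x y - E0) / pair_cond x y)"
      unfolding TN_Cn[OF W] wire_simps(3) i prod.case .
  qed
  finally show ?thesis unfolding measure_wired[OF cyl_sets[OF P(2)]] by simp
qed

end

section \<open>Countability of paths and the extrinsic diameter\<close>

context csm_network
begin

lemma countable_E: "countable E"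
proof -
  have "countable (incident G x)" if x: "x \<in> V" for x
  proof -
    have "countable {e \<in> incident G x. cond G e \<noteq> 0}" by (rule summable_countable_real[OF vcond_finite[OF x]])
    moreover have "{e \<in> incident G x. cond G e \<noteq> 0} = incident G x"
      using cond_pos by (force simp: incident_def)
    ultimately show ?thesis by simp
  qed
  then have "countable (\<Union>x\<in>V. incident G x)" using countable_V by simp
  moreover have "E \<subseteq> (\<Union>x\<in>V. incident G x)"
  proof
    fix e assume e: "e \<in> E"
    obtain a b where "ends G e = Upair a b" by (cases "ends G e") auto
    then show "e \<in> (\<Union>x\<in>V. incident G x)" using ends_verts[OF e] e by (auto simp: incident_def)
  qed
  ultimately show ?thesis by (rule countable_subset[rotated])
qed

lemma walk_set: "is_walk G u p v \<Longrightarrow> set p \<subseteq> V \<times> E"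
proof (induction p arbitrary: u)
  case (Cons a p)
  then show ?case by (cases a) auto
qed simp

lemma countable_paths: "countable {p. \<exists>u v. is_path G u p v}"
proof (rule countable_subset)
  show "{p. \<exists>u v. is_path G u p v} \<subseteq> lists (V \<times> E)" using walk_set by (auto simp: is_path_def)
  show "countable (lists (V \<times> E))" using countable_V countable_E by (intro countable_lists) auto
qed

lemma diam_iff:
  "ereal R \<le> diam_ext G (past G F v) \<longleftrightarrow>
    (\<exists>u w p q. is_path G u p v \<and> set p \<subseteq> F \<and> is_path G w q v \<and> set q \<subseteq> F \<and> nat \<lceil>R\<rceil> \<le> gdist G u w)"
  if R: "R \<ge> 1"
proof -
  let ?P = "past_verts G F v"
  have vp: "verts (past G F v) = ?P" unfolding past_def by simp
  have "ereal R \<le> diam_ext G (past G F v) \<longleftrightarrow> (\<exists>u\<in>?P. \<exists>w\<in>?P. nat \<lceil>R\<rceil> \<le> gdist G u w)"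
  proof
    assume "ereal R \<le> diam_ext G (past G F v)"
    \<comment> \<open>A supremum of at least \<open>R\<close> exceeds
      \<open>\<lceil>R\<rceil> - 1\<close>, and then some distance, being an integer, is at least
      \<open>\<lceil>R\<rceil>\<close>.\<close>
    moreover have "real_of_int \<lceil>R\<rceil> - 1 < R" by linarith
    ultimately have "ereal (real_of_int \<lceil>R\<rceil> - 1) < diam_ext G (past G F v)" by (metis ereal_less_eq(3) less_le_trans less_ereal.simps(1))
    then obtain u w where "u \<in> ?P" "w \<in> ?P" "ereal (real_of_int \<lceil>R\<rceil> - 1) < ereal (real (gdist G u w))"
      unfolding diam_ext_def vp less_SUP_iff by blast
    then have "real_of_int \<lceil>R\<rceil> - 1 < real (gdist G u w)" by simp
    then have "nat \<lceil>R\<rceil> \<le> gdist G u w" by linarith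
    then show "\<exists>u\<in>?P. \<exists>w\<in>?P. nat \<lceil>R\<rceil> \<le> gdist G u w" using \<open>u \<in> ?P\<close> \<open>w \<in> ?P\<close> by blast
  next
    assume "\<exists>u\<in>?P. \<exists>w\<in>?P. nat \<lceil>R\<rceil> \<le> gdist G u w"
    then obtain u w where uw: "u \<in> ?P" "w \<in> ?P" "nat \<lceil>R\<rceil> \<le> gdist G u w" by blast
    then have "R \<le> real (gdist G u w)" by linarith
    then have "ereal R \<le> ereal (real (gdist G u w))" by simp
    also have "\<dots> \<le> diam_ext G (past G F v)" unfolding diam_ext_def vp 
      by (rule SUP_upper2[OF uw(1)], rule SUP_upper[OF uw(2)])
    finally show "ereal R \<le> diam_ext G (past G F v)" .
  qed
  also have "\<dots> \<longleftrightarrow> (\<exists>u w p q. is_path G u p v \<and> set p \<subseteq> F \<and> is_path G w q v \<and> set q \<subseteq> F \<and> nat \<lceil>R\<rceil> \<le> gdist G u w)"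
    unfolding past_verts_def by blast
  finally show ?thesis .
qed

text \<open>The conductances between \<open>x\<close> and \<open>y\<close> are summable, so finitely
  many edges carry all but a small fraction of them, and larger sets carry no less.\<close>

lemma edge_tail:
  assumes "\<delta> > 0"
  shows "\<exists>F. finite F \<and> (\<forall>E0. F \<subseteq> E0 \<longrightarrow> infsum (cond G) (Eb x y - E0) / pair_cond x y \<le> \<delta>)"
proof (cases "Eb x y = {}")
  case True
  then show ?thesis using assms by (intro exI[of _ "{}"]) auto
next
  case False
  have c: "pair_cond x y > 0" using False by (simp add: pair_cond_pos_iff)
  have sub: "cond G summable_on S" if "S \<subseteq> Eb x y" for S by (rule summable_on_subset_banach[OF Eb_summable that])
  have "(cond G has_sum pair_cond x y) (Eb x y)" unfolding pair_cond_def by (rule has_sum_infsum[OF Eb_summable])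
  then have "\<forall>\<^sub>F F in finite_subsets_at_top (Eb x y). pair_cond x y - \<delta> * pair_cond x y < sum (cond G) F"
    unfolding has_sum_def by (rule order_tendstoD) (use c assms in simp)
  then obtain F where F: "finite F" "F \<subseteq> Eb x y" "pair_cond x y - \<delta> * pair_cond x y < sum (cond G) F"
    unfolding eventually_finite_subsets_at_top by blast
  have "infsum (cond G) (Eb x y - E0) / pair_cond x y \<le> \<delta>" if E0: "F \<subseteq> E0" for E0
  proof -
    have "infsum (cond G) (Eb x y - E0) \<le> infsum (cond G) (Eb x y - F)"
      by (rule infsum_mono2) (use E0 sub in \<open>auto simp: Eb_def intro: less_imp_le cond_pos\<close>)
    also have "\<dots> = infsum (cond G) (Eb x y) - infsum (cond G) F" by (rule infsum_Diff) (use sub F in auto)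
    also have "\<dots> \<le> \<delta> * pair_cond x y" using F(1,3) unfolding pair_cond_def by simp
    finally show ?thesis using c by (simp add: pos_divide_le_eq)
  qed
  then show ?thesis using F(1) by blast
qed

end

lemma eventually_exhaustion:
  assumes "exhaustion G Vn" "finite X" "X \<subseteq> verts G" shows "\<forall>\<^sub>F n in sequentially. X \<subseteq> Vn n"
proof -
  have "\<forall>\<^sub>F n in sequentially. x \<in> Vn n" if x: "x \<in> X" for x
  proof -
    have "x \<in> (\<Union>n. Vn n)" using assms x unfolding exhaustion_def by auto
    then obtain k where "x \<in> Vn k" by auto
    then have "x \<in> Vn n" if "n \<ge> k" for n using assms(1) incseqD[OF _ that, of Vn] unfolding exhaustion_def by auto
    then show ?thesis unfolding eventually_sequentially by blast
  qed
  then have "\<forall>\<^sub>F n in sequentially. \<forall>x\<in>X. x \<in> Vn n" using assms(2) by (intro eventually_ball_finite) auto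
  then show ?thesis by (rule eventually_mono) auto
qed

section \<open>The two bounds for the weak limit\<close>

context ballistic_network
begin

definition up_const :: real where "up_const = bounded_net.Dc cond_bound C0 K1"

lemma wired: "finite S \<Longrightarrow> S \<subseteq> V \<Longrightarrow> wired_network G S"
  by (intro wired_network.intro ballistic_network_axioms wired_network_axioms.intro)

lemma up_const: "up_const \<ge> 1"
proof -
  interpret wired_network G "{}" by (rule wired) auto
  show ?thesis unfolding up_const_def by (rule BN.const_bounds(3))
qed

context
  fixes M :: "('v \<times> 'e \<Rightarrow> bool) measure" and Vn :: "nat \<Rightarrow> 'v set"
  assumes M: "prob_space M" "sets M = sets config_space" and Vn: "exhaustion G Vn"
    and lim: "weak_limit (\<lambda>n. wired_UST G (Vn n)) M"
begin

interpretation PM: prob_space M by (rule M(1))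

lemma Vn: "finite (Vn n)" "Vn n \<subseteq> V" "incseq Vn" "(\<Union>n. Vn n) = V"
  using \<open>exhaustion G Vn\<close> unfolding exhaustion_def by auto

lemma limit_cyl: "finite P \<Longrightarrow> (\<lambda>n. measure (wired_UST G (Vn n)) (cyl P)) \<longlonglongrightarrow> measure M (cyl P)"
  by (rule cyl_limit[OF _ lim _ M(2)]) (auto simp: wired_UST_def)

lemma upper_finite:
  assumes v: "v \<in> V" and r: "r \<ge> 1" and P: "finite P" "P \<subseteq> {p. \<exists>u. is_path G u p v \<and> r \<le> gdist G u v}"
  shows "measure M (cyl P) \<le> 3 * up_const / real r"
proof (rule tendsto_upperbound[OF limit_cyl[OF P(1)]])
  have "\<forall>\<^sub>F n in sequentially. {v} \<subseteq> Vn n" by (rule eventually_exhaustion[OF \<open>exhaustion G Vn\<close>]) (use v in auto)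
  then show "\<forall>\<^sub>F n in sequentially. measure (wired_UST G (Vn n)) (cyl P) \<le> 3 * up_const / real r"
  proof (rule eventually_mono)
    fix n assume n: "{v} \<subseteq> Vn n"
    interpret wired_network G "Vn n" by (rule wired) (fact Vn)+
    show "measure (wired_UST G (Vn n)) (cyl P) \<le> 3 * up_const / real r"
      unfolding up_const_def by (rule upper_cyl) (use n r P countable_finite in auto)
  qed
qed simp

text \<open>The bound for finitely many paths is uniform, and the event is an increasing union of
  events given by finitely many paths.\<close>

lemma upper_all:
  assumes v: "v \<in> V" and r: "r \<ge> 1"
  shows "measure M (cyl {p. \<exists>u. is_path G u p v \<and> r \<le> gdist G u v}) \<le> 3 * up_const / real r"
proof (cases "{p. \<exists>u. is_path G u p v \<and> r \<le> gdist G u v} = {}")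
  case True
  then show ?thesis unfolding True using up_const by (simp add: cyl_def)
next
  case False
  let ?Q = "{p. \<exists>u. is_path G u p v \<and> r \<le> gdist G u v}"
  have c: "countable ?Q" by (rule countable_subset[OF _ countable_paths]) auto
  let ?B = "\<lambda>n. cyl (from_nat_into ?Q ` {..<n})"
  have "cyl ?Q = (\<Union>n. ?B n)"
  proof
    show "cyl ?Q \<subseteq> (\<Union>n. ?B n)"
    proof
      fix F assume "F \<in> cyl ?Q"
      then obtain p where p: "p \<in> ?Q" "set p \<subseteq> Collect F" unfolding cyl_def by auto
      obtain i where "from_nat_into ?Q i = p" using from_nat_into_surj[OF c p(1)] by auto
      then have "p \<in> from_nat_into ?Q ` {..<Suc i}" by auto
      then have "F \<in> ?B (Suc i)" unfolding cyl_def using p(2) by blast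
      then show "F \<in> (\<Union>n. ?B n)" by blast
    qed
    show "(\<Union>n. ?B n) \<subseteq> cyl ?Q"
      using from_nat_into[OF False] unfolding cyl_def by blast
  qed
  moreover have "(\<lambda>n. measure M (?B n)) \<longlonglongrightarrow> measure M (\<Union>n. ?B n)"
  proof (rule PM.finite_Lim_measure_incseq)
    show "range ?B \<subseteq> sets M" unfolding M(2) using cyl_sets countable_finite by blast
    show "incseq ?B" by (rule incseq_SucI) (auto simp: cyl_def lessThan_Suc)
  qed
  ultimately have "(\<lambda>n. measure M (?B n)) \<longlonglongrightarrow> measure M (cyl ?Q)" by simp
  then show ?thesis
  proof (rule LIMSEQ_le_const2)
    have "measure M (?B n) \<le> 3 * up_const / real r" for n
      by (rule upper_finite[OF v r]) (use from_nat_into[OF False] in auto)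
    then show "\<exists>N. \<forall>n\<ge>N. measure M (?B n) \<le> 3 * up_const / real r" by blast
  qed
qed

lemma lower_all:
  assumes v: "v \<in> V" and R: "R \<ge> 1" and q: "disjoint_prob G v > 0"
  shows "\<exists>P. finite P \<and> P \<subseteq> {p. \<exists>u. is_path G u p v \<and> R \<le> gdist G u v}
    \<and> (disjoint_prob G v)\<^sup>2 / (256 * cond_bound ^ 10 * C0 ^ 3 * real R) \<le> measure M (cyl P)"
proof -
  let ?q = "disjoint_prob G v"
  obtain k where k: "?q * real R / 2 \<le> (\<Sum>l\<in>apath v R (Vn k) k. list_pr v l * measure (W v) (avoid (insert v (set l)) \<inter> space (W v)))"
    using escape_sum[OF v R Vn(3) Vn(1) Vn(4) q] by blast
  define D where "D = {x\<in>Vn k. x \<noteq> v \<and> gdist G v x \<le> 2 * R}"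
  define An where "An = {x\<in>D. gdist G v x \<ge> R}"
  have finD: "finite D" unfolding D_def using Vn(1) by simp
  have DV: "D \<subseteq> V" unfolding D_def using Vn(2) by auto
  let ?I = "D \<times> insert v D"
  have finI: "finite ?I" using finD by simp
  \<comment> \<open>The bound of \<open>lower_UST\<close> for \<open>m = ?q * real R / 2\<close>.
    Half of it is kept; the other half pays for the edges outside \<open>E0\<close> and is spread
    evenly over the pairs by \<open>\<delta>\<close>.\<close>
  define L where "L = ?q\<^sup>2 / (128 * cond_bound ^ 10 * C0 ^ 3 * real R)"
  have Lpos: "L > 0" unfolding L_def using q cond_bound(1) C0(1) R by (intro divide_pos_pos mult_pos_pos zero_less_power) auto
  define \<delta> where "\<delta> = L / 2 / (real (card ?I) + 1)"
  have \<delta>: "\<delta> > 0" unfolding \<delta>_def using Lpos by simp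
  obtain Fe where Fe: "\<And>x y. finite (Fe x y)" "\<And>x y E0. Fe x y \<subseteq> E0 \<Longrightarrow> infsum (cond G) (Eb x y - E0) / pair_cond x y \<le> \<delta>"
    using edge_tail[OF \<delta>] by metis
  define E0 where "E0 = (\<Union>(x, y)\<in>?I. Fe x y)"
  have finE0: "finite E0" unfolding E0_def using finI Fe(1) by auto
  have err: "(\<Sum>(x, y)\<in>?I. infsum (cond G) (Eb x y - E0) / pair_cond x y) \<le> L / 2"
  proof -
    have "(\<Sum>(x, y)\<in>?I. infsum (cond G) (Eb x y - E0) / pair_cond x y) \<le> (\<Sum>i\<in>?I. \<delta>)"
    proof (rule sum_mono)
      fix i assume i: "i \<in> ?I"
      obtain x y where xy: "i = (x, y)" by (cases i)
      have "Fe x y \<subseteq> E0" unfolding E0_def using i xy by auto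
      then show "(case i of (x, y) \<Rightarrow> infsum (cond G) (Eb x y - E0) / pair_cond x y) \<le> \<delta>" using Fe(2) xy by simp
    qed
    also have "\<dots> = real (card ?I) * \<delta>" by simp
    also have "\<dots> \<le> (real (card ?I) + 1) * \<delta>" using \<delta> by (intro mult_right_mono) auto
    also have "\<dots> = \<delta> * (real (card ?I) + 1)" by (rule mult.commute)
    also have "\<dots> = L / 2" using \<delta>_def by (subst (asm) nonzero_eq_divide_eq) linarith+
    finally show ?thesis .
  qed
  define P where "P = {p. \<exists>u\<in>An. is_path G u p v \<and> fst ` set p \<subseteq> D \<and> snd ` set p \<subseteq> E0}"
  have finP: "finite P"
  proof (rule finite_subset)
    show "P \<subseteq> {p. set p \<subseteq> D \<times> E0 \<and> distinct p}"
    proof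
      fix p assume "p \<in> P"
      then have "fst ` set p \<subseteq> D" "snd ` set p \<subseteq> E0" "distinct (map fst p)" unfolding P_def by (auto simp: is_path_def)
      then show "p \<in> {p. set p \<subseteq> D \<times> E0 \<and> distinct p}" by (auto simp: distinct_map)
    qed
    show "finite {p. set p \<subseteq> D \<times> E0 \<and> distinct p}" by (rule finite_subset_distinct) (use finD finE0 in simp)
  qed
  have "L / 2 \<le> measure M (cyl P)"
  proof (rule tendsto_lowerbound[OF limit_cyl[OF finP]])
    have "\<forall>\<^sub>F n in sequentially. insert v (Vn k) \<subseteq> Vn n"
      by (rule eventually_exhaustion[OF \<open>exhaustion G Vn\<close>]) (use v Vn in auto)
    then show "\<forall>\<^sub>F n in sequentially. L / 2 \<le> measure (wired_UST G (Vn n)) (cyl P)"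
    proof (rule eventually_mono)
      fix n assume n: "insert v (Vn k) \<subseteq> Vn n"
      interpret WN: wired_network G "Vn n" by (rule wired) (fact Vn)+
      have vn: "v \<in> Vn n" and kn: "Vn k \<subseteq> Vn n" using n by auto
      have Dn: "D \<subseteq> Vn n" using kn unfolding D_def by auto
      have "(?q * real R / 2)\<^sup>2 / (4 * cond_bound ^ 10 * C0 ^ 3 * real (2 * R) ^ 3)
        \<le> measure (UST (wire G (Vn n))) (WN.TN.trees (\<lambda>\<sigma>. \<exists>w\<in>An. WN.BN.arm (Some v) (Some ` D) (Some w) (WN.TN.suc \<sigma>)))"
        unfolding An_def D_def by (rule WN.lower_UST[OF vn kn R _ k]) (use q in simp)
      also have "\<dots> \<le> measure (wired_UST G (Vn n)) (cyl P) + (\<Sum>(x, y)\<in>?I. infsum (cond G) (Eb x y - E0) / pair_cond x y)"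
        by (rule WN.lower_cyl[OF vn Dn _ P_def]) (use finP countable_finite in \<open>auto simp: An_def\<close>)
      also have "(?q * real R / 2)\<^sup>2 / (4 * cond_bound ^ 10 * C0 ^ 3 * real (2 * R) ^ 3) = L"
        unfolding L_def using R by (simp add: power_mult_distrib power_divide power2_eq_square power3_eq_cube)
      finally show "L / 2 \<le> measure (wired_UST G (Vn n)) (cyl P)" using err by linarith
    qed
  qed simp
  moreover have "L / 2 = ?q\<^sup>2 / (256 * cond_bound ^ 10 * C0 ^ 3 * real R)" unfolding L_def by simp
  moreover have "P \<subseteq> {p. \<exists>u. is_path G u p v \<and> R \<le> gdist G u v}"
  proof
    fix p assume "p \<in> P"
    then obtain u where u: "u \<in> An" "is_path G u p v" unfolding P_def by auto
    then have "u \<in> V" "gdist G v u \<ge> R" using DV unfolding An_def by auto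
    then show "p \<in> {p. \<exists>u. is_path G u p v \<and> R \<le> gdist G u v}" using gdist_sym[OF v, of u] u by auto
  qed
  ultimately show ?thesis using finP by auto
qed

lemma WUSF_bounds:
  assumes v: "v \<in> V" and R: "(R :: real) \<ge> 1"
  shows "inverse (512 * cond_bound ^ 10 * C0 ^ 3) * (disjoint_prob G v)\<^sup>2 * inverse R \<le> \<P>(F in M. diam_ext G (past G (Collect F) v) \<ge> ereal R)"
    and "\<P>(F in M. diam_ext G (past G (Collect F) v) \<ge> ereal R) \<le> 6 * up_const * inverse R"
proof -
  let ?R = "nat \<lceil>R\<rceil>"
  let ?Ev = "{F \<in> space M. diam_ext G (past G (Collect F) v) \<ge> ereal R}"
  let ?Q = "\<lambda>r. {p. \<exists>u. is_path G u p v \<and> r \<le> gdist G u v}"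
  have cQ: "countable (?Q r)" for r by (rule countable_subset[OF _ countable_paths]) auto
  have sp: "space M = UNIV" using sets_eq_imp_space_eq[OF M(2)] space_config by simp
  have Ev_iff: "F \<in> ?Ev \<longleftrightarrow> (\<exists>u w p q. is_path G u p v \<and> set p \<subseteq> Collect F \<and> is_path G w q v \<and> set q \<subseteq> Collect F \<and> ?R \<le> gdist G u w)" for F
    unfolding sp using diam_iff[OF R, of "Collect F" v] by simp
  have Evs: "?Ev \<in> sets M"
  proof -
    let ?PQ = "{(p, q). \<exists>u w. is_path G u p v \<and> is_path G w q v \<and> ?R \<le> gdist G u w}"
    have c: "countable ?PQ"
      by (rule countable_subset[OF _ countable_SIGMA[OF countable_paths countable_paths]]) auto
    have "?Ev = (\<Union>(p, q)\<in>?PQ. cyl {p} \<inter> cyl {q})"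
    proof (intro set_eqI)
      fix F show "F \<in> ?Ev \<longleftrightarrow> F \<in> (\<Union>(p, q)\<in>?PQ. cyl {p} \<inter> cyl {q})"
        unfolding Ev_iff cyl_def by blast
    qed
    moreover have "(\<Union>i\<in>?PQ. case i of (p, q) \<Rightarrow> cyl {p} \<inter> cyl {q}) \<in> sets M"
      by (rule sets.countable_UN'[OF c]) (auto simp: M(2) intro!: sets.Int cyl_sets)
    ultimately show ?thesis by simp
  qed
  \<comment> \<open>By the triangle inequality through \<open>v\<close>, one of two vertices at
    distance at least \<open>\<lceil>R\<rceil>\<close> from each other is at least half as far,
    rounded up, from \<open>v\<close>.\<close>
  let ?r = "(?R + 1) div 2"
  have r: "?r \<ge> 1" "R / 2 \<le> real ?r" using R by linarith+
  have "?Ev \<subseteq> cyl (?Q ?r)"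
  proof
    fix F assume "F \<in> ?Ev"
    then obtain u w p q where *: "is_path G u p v" "set p \<subseteq> Collect F" "is_path G w q v" "set q \<subseteq> Collect F" "?R \<le> gdist G u w"
      unfolding Ev_iff by blast
    have "u \<in> V" "w \<in> V" using *(1,3) is_walk_verts[of G u p v] is_walk_verts[of G w q v] by (auto simp: is_path_def)
    then have "gdist G u w \<le> gdist G u v + gdist G w v" using gdist_triangle[of u v w] gdist_sym[of w v] v by simp
    then have "?r \<le> gdist G u v \<or> ?r \<le> gdist G w v" using *(5) by linarith
    then show "F \<in> cyl (?Q ?r)" unfolding cyl_def using * by blast
  qed
  then have "measure M ?Ev \<le> measure M (cyl (?Q ?r))"
    by (rule PM.finite_measure_mono) (simp add: M(2) cyl_sets[OF cQ])
  also have "\<dots> \<le> 3 * up_const / real ?r" by (rule upper_all[OF v r(1)])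
  also have "\<dots> \<le> 3 * up_const / (R / 2)"
  proof (rule divide_left_mono[OF r(2)])
    show "0 \<le> 3 * up_const" using up_const by simp
    show "0 < real ?r * (R / 2)" by (rule mult_pos_pos) (use R r in linarith)+
  qed
  also have "\<dots> = 6 * up_const / R" using R by (simp add: field_simps)
  also have "\<dots> = 6 * up_const * inverse R" by (rule divide_inverse)
  finally show "measure M ?Ev \<le> 6 * up_const * inverse R" .
  let ?q = "disjoint_prob G v"
  show "inverse (512 * cond_bound ^ 10 * C0 ^ 3) * ?q\<^sup>2 * inverse R \<le> measure M ?Ev"
  proof (cases "?q > 0")
    case True
    \<comment> \<open>Rounding \<open>R\<close> up at most doubles it, which turns 256 into
      512.\<close>
    have R1: "?R \<ge> 1" "real ?R \<le> 2 * R" using R by linarith+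
    obtain P where P: "finite P" "P \<subseteq> ?Q ?R" "?q\<^sup>2 / (256 * cond_bound ^ 10 * C0 ^ 3 * real ?R) \<le> measure M (cyl P)"
      using lower_all[OF v R1(1) True] by blast
    have k: "256 * cond_bound ^ 10 * C0 ^ 3 > 0" using cond_bound(1) C0(1) by (intro mult_pos_pos zero_less_power) auto
    have "inverse (512 * cond_bound ^ 10 * C0 ^ 3) * ?q\<^sup>2 * inverse R = ?q\<^sup>2 / (256 * cond_bound ^ 10 * C0 ^ 3 * (2 * R))"
      using k R by (simp add: field_simps)
    also have "\<dots> \<le> ?q\<^sup>2 / (256 * cond_bound ^ 10 * C0 ^ 3 * real ?R)"
    proof (rule divide_left_mono)
      show "256 * cond_bound ^ 10 * C0 ^ 3 * real ?R \<le> 256 * cond_bound ^ 10 * C0 ^ 3 * (2 * R)"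
        by (rule mult_left_mono[OF R1(2)]) (use k in simp)
      show "0 < 256 * cond_bound ^ 10 * C0 ^ 3 * (2 * R) * (256 * cond_bound ^ 10 * C0 ^ 3 * real ?R)"
        using R R1(1) by (intro mult_pos_pos[OF mult_pos_pos[OF k] mult_pos_pos[OF k]]) auto
    qed simp
    also have "\<dots> \<le> measure M (cyl P)" by (rule P(3))
    also have "\<dots> \<le> measure M ?Ev"
    proof (rule PM.finite_measure_mono[OF _ Evs])
      show "cyl P \<subseteq> ?Ev"
      proof
        fix F assume "F \<in> cyl P"
        then obtain p where p: "p \<in> P" "set p \<subseteq> Collect F" unfolding cyl_def by auto
        then obtain u where u: "is_path G u p v" "?R \<le> gdist G u v" using P(2) by auto
        \<comment> \<open>\<open>v\<close> belongs to its own past, so a single far vertex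
          suffices.\<close>
        moreover have "is_path G v [] v" using v by (simp add: is_path_def)
        ultimately show "F \<in> ?Ev" unfolding Ev_iff using p(2)
          by (intro exI[of _ u] exI[of _ v] exI[of _ p] exI[of _ "[]"]) simp
      qed
    qed
    finally show ?thesis .
  next
    case False
    then have "?q = 0" unfolding disjoint_prob_def by (meson antisym_conv2 measure_nonneg not_less)
    then show ?thesis by simp
  qed
qed

end
end

theorem theorem1p6:
  fixes G :: "('v, 'e) network"
  assumes "network G"
    and "uniformly_ballistic G"
    and "controlled_stationary_measure G"
    and "bubble_norm G < \<infinity>"
  shows "\<exists>a A :: real. 0 < a \<and> a \<le> A \<and>
    (\<forall>M. oriented_WUSF G M \<longrightarrow>
      (\<forall>v\<in>verts G. \<forall>R::real. R \<ge> 1 \<longrightarrow>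
        a * (disjoint_prob G v)\<^sup>2 * inverse R \<le> \<P>(F in M. diam_ext G (past G (Collect F) v) \<ge> ereal R) \<and>
        \<P>(F in M. diam_ext G (past G (Collect F) v) \<ge> ereal R) \<le> A * inverse R))"
proof -
  interpret ballistic_network G
    by (intro ballistic_network.intro csm_network.intro csm_network_axioms.intro ballistic_network_axioms.intro assms)
  let ?k = "512 * cond_bound ^ 10 * C0 ^ 3"
  have "1 * 1 * 1 \<le> ?k" using cond_bound(1) C0(1) by (intro mult_mono one_le_power) auto
  then have k: "1 \<le> ?k" by (simp only: mult_1)
  then have "0 < ?k" by linarith
  then have a: "0 < inverse ?k" by (rule positive_imp_inverse_positive)
  \<comment> \<open>Both constants are compared with one, which gives the order between
    them.\<close>
  have "inverse ?k \<le> 1" using le_imp_inverse_le[OF k] by (simp only: zero_less_one inverse_1)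
  then have a': "inverse ?k \<le> 6 * up_const" using up_const by linarith
  have b: "inverse ?k * (disjoint_prob G v)\<^sup>2 * inverse R \<le> \<P>(F in M. diam_ext G (past G (Collect F) v) \<ge> ereal R) \<and>
      \<P>(F in M. diam_ext G (past G (Collect F) v) \<ge> ereal R) \<le> 6 * up_const * inverse R"
    if M: "oriented_WUSF G M" and v: "v \<in> verts G" and R: "R \<ge> 1" for M v and R :: real
  proof -
    obtain Vn where Vn: "prob_space M" "sets M = sets config_space" "exhaustion G Vn" "weak_limit (\<lambda>n. wired_UST G (Vn n)) M"
      using M unfolding oriented_WUSF_def by blast
    show ?thesis using WUSF_bounds[OF Vn v R] by (rule conjI)
  qed
  show ?thesis
    by (rule exI[of _ "inverse ?k"], rule exI[of _ "6 * up_const"]) (use a a' b in blast)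
qed

end
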